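(* Let $p_\Gamma$ be non-empty, and let the coarse level primal velocity space $\mathbf W_\Pi$ be chosen such that $\int_{\partial\Omega_i}\mathbf w_\Delta^{(i)}\cdot\mathbf n=0$ for all $\mathbf w_\Delta^{(i)}\in\mathbf W_\Delta^{(i)}$ and all $i$. Let $G=B_C\widetilde A^{-1}B_C^T$ be the FETI-DP operator on $X=Q_\Gamma\oplus\Lambda$ and let $M_D^{-1}=\mathrm{diag}\left(\tfrac1{h^2}I_{p_\Gamma},\,B_{\Delta,D}H_\Delta B_{\Delta,D}^T\right)$ be the Dirichlet preconditioner. Then there are constants $c,C>0$, independent of the mesh size $h$ and the subdomain size $H$, such that for all $x=(p_\Gamma,\lambda)\in R_{M_D^{-1}G}$ (the range of $M_D^{-1}G$), $$c\,\beta^2\langle M_Dx,x\rangle\le\langle Gx,x\rangle\le C\,\Phi_2(H/h)\,\langle M_Dx,x\rangle,$$ where $\beta$ is the inf-sup constant of the mixed finite element and $\Phi_2$ is the function in the stability bound of the jump operator $P_{D,2}$ (in the present two-dimensional setting, $\Phi_2(H/h)=C(1+\log(H/h))^2$).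
   Context: Discretization. $\Omega\subset\mathbb R^2$ is a bounded polygonal domain, triangulated into shape-regular elements of characteristic size $h$. The Stokes problem $-\Delta\mathbf u+\nabla p=\mathbf f$, $-\nabla\cdot\mathbf u=0$ in $\Omega$, $\mathbf u=0$ on $\partial\Omega$, is discretized with a space $\mathbf W\subset(H_0^1(\Omega))^2$ of continuous velocities and a pressure space $Q\subset L^2(\Omega)$ of continuous or discontinuous pressures (for example: the modified Taylor-Hood element, with piecewise linear velocity on the fine triangular mesh and continuous piecewise linear pressure on the mesh of doubled size; or piecewise linear velocity on a uniform triangular mesh with pressure constant on unions of four triangles). $A,B$ are the matrices of $a(\mathbf u,\mathbf v)=\int_\Omega\nabla\mathbf u\cdot\nabla\mathbf v$ and $b(\mathbf u,q)=-\int_\Omega(\nabla\cdot\mathbf u)q$. The same symbol denotes a finite element function and its vector of nodal values, and $\langle\cdot,\cdot\rangle$ is the inner product of vectors; for a symmetric matrix $K$, $\langle u,v\rangle_K=\langle Ku,v\rangle$. $\mathrm{Ker}(B^T)$ is the space of constant pressures, and elements of $Q/\mathrm{Ker}(B^T)$ are taken with zero average. $Z$ is the pressure mass matrix, $\|q\|_{L^2}^2=\langle q,Zq\rangle$, and $ch^2I\le Z\le Ch^2I$. The element is inf-sup stable: there is $\beta>0$ independent of $h$ with $\sup_{\mathbf w\in\mathbf W}\langle q,B\mathbf w\rangle^2/\langle\mathbf w,A\mathbf w\rangle\ge\beta^2\langle q,Zq\rangle$ for all $q\in Q/\mathrm{Ker}(B^T)$. $c,C$ denote generic positive constants independent of $h$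 and $H$. Decomposition. $\Omega$ is split into $N$ nonoverlapping polygonal subdomains $\Omega_i$ of diameter of order $H$, each a union of elements, with matching nodes on the interface $\Gamma=(\cup\partial\Omega_i)\setminus\partial\Omega$, which consists of open edges $\Gamma^{ij}$ (shared by $\Omega_i,\Omega_j$) and subdomain vertices (corners), the end points of edges. $\mathbf W=\mathbf W_I\oplus\mathbf W_\Gamma$ (subdomain interior / subdomain boundary velocities), $Q=Q_I\oplus Q_\Gamma$ with $Q_I=\bigoplus_iQ_I^{(i)}$. "$p_\Gamma$ non-empty" means: either continuous pressures are used and $Q_\Gamma$ consists of all subdomain boundary pressure degrees of freedom shared by neighboring subdomains, or discontinuous pressures are used and $Q_\Gamma$ consists of chosen subdomain pressure degrees of freedom, containing at least one from each subdomain. The partially sub-assembled interface velocity space is $\widetilde{\mathbf W}_\Gamma=\mathbf W_\Pi\oplus\mathbf W_\Delta$, $\mathbf W_\Delta=\bigoplus_i\mathbf W_\Delta^{(i)}$, where $\mathbf W_\Pi$ is the continuous coarse level primal velocity space and $\mathbf W_\Delta^{(i)}$ is spanned by the remaining interface velocity basis functions of $\Omega_i$, which vanish at the primal degrees of freedom. The divergence free boundary condition is enforced by taking $\mathbf W_\Pi$ spanned by all subdomain corner velocity nodal basis functions and, on each edge $\Gamma^{ij}$, an edge-average basis function such that $\int_{\Gamma^{ij}}\mathbf w_\Delta^{(i)}\cdot\mathbf n_{ij}=0$ for all $\mathbf w_\Delta^{(i)}\in\mathbf W_\Delta^{(i)}$ ($\mathbf n_{ij}$ a fixed normal to $\Gamma^{ij}$).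 $B_\Delta$ is the matrix with entries in $\{0,1,-1\}$ whose rows each have exactly one $1$ and one $-1$, corresponding to the same dual velocity degree of freedom on the interface taken from two neighboring subdomains, so that $B_\Delta\mathbf w_\Delta=0$ means continuity; non-redundant constraints are used, so $B_\Delta$ has full row rank. $\Lambda$ is the range of $B_\Delta$ on $\mathbf W_\Delta$. $B_{\Delta,D}$ is $B_\Delta$ with each nonzero entry, corresponding to interface node $x$, multiplied by $\delta^\dagger(x)=1/\mathcal N_x$, $\mathcal N_x$ being the number of subdomains sharing $x$; $B_{\Delta,D}^{(i)^T}:\Lambda\to\mathbf W_\Delta^{(i)}$ is the restriction of $B_{\Delta,D}^T$ to $\Omega_i$. Operators. $W=\mathbf W_I\oplus Q_I\oplus\mathbf W_\Delta\oplus\mathbf W_\Pi$, and, with all blocks computed subdomain by subdomain from $a$ and $b$ (i.e. from $\sum_i\int_{\Omega_i}\nabla\mathbf w\cdot\nabla\mathbf v$ and $-\sum_i\int_{\Omega_i}(\nabla\cdot\mathbf w)q$), $$\widetilde A=\begin{bmatrix}A_{II}&B_{II}^T&A_{I\Delta}&A_{I\Pi}\\ B_{II}&0&B_{I\Delta}&B_{I\Pi}\\ A_{\Delta I}&B_{I\Delta}^T&A_{\Delta\Delta}&A_{\Delta\Pi}\\ A_{\Pi I}&B_{I\Pi}^T&A_{\Pi\Delta}&A_{\Pi\Pi}\end{bmatrix},\qquad B_C=\begin{bmatrix}B_{\Gamma I}&0&B_{\Gamma\Delta}&B_{\Gamma\Pi}\\ 0&0&B_\Delta&0\end{bmatrix},$$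 where in the blocks $B_{II},B_{I\Delta},B_{I\Pi}$ and $B_{\Gamma I},B_{\Gamma\Delta},B_{\Gamma\Pi}$ the first subscript refers to the pressure space ($Q_I$ or $Q_\Gamma$) and the second to the velocity space. $\widetilde A$ is invertible when $p_\Gamma$ is non-empty. $I_{p_\Gamma}$ is the identity on $Q_\Gamma$. $H_\Delta:\mathbf W_\Delta\to\mathbf W_\Delta$ is the direct sum of the Schur complements $H_\Delta^{(i)}=A_{\Delta\Delta}^{(i)}-A_{\Delta I}^{(i)}(A_{II}^{(i)})^{-1}A_{I\Delta}^{(i)}$ (discrete harmonic extension on $\Omega_i$ with zero primal velocity; superscript $(i)$ denotes the subdomain $\Omega_i$ contribution). $M_D$ is the inverse of the symmetric positive definite $M_D^{-1}$. Function $\Phi_2$. $\widetilde W_0=\{w=(\mathbf w_I,p_I,\mathbf w_\Delta,\mathbf w_\Pi)\in W: B_{II}\mathbf w_I+B_{I\Delta}\mathbf w_\Delta+B_{I\Pi}\mathbf w_\Pi=0\}$; on $\widetilde W_0$ one has $\langle w,w\rangle_{\widetilde A}=\sum_i|\mathbf w^{(i)}|^2_{H^1(\Omega_i)}$, where $\mathbf w^{(i)}$ is the restriction to $\Omega_i$ of the velocity part of $w$. $P_{D,2}:W\to W$ maps $w$ to the vector whose dual velocity on $\Omega_i$ is $B_{\Delta,D}^{(i)^T}B_\Delta\mathbf w_\Delta$, whose interior velocity on $\Omega_i$ is the discrete harmonic extension $-(A_{II}^{(i)})^{-1}A_{I\Delta}^{(i)}B_{\Delta,D}^{(i)^T}B_\Delta\mathbf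 w_\Delta$, and whose other components are zero. $\Phi_2(H/h)$ is the function such that $\langle P_{D,2}w,P_{D,2}w\rangle_{\widetilde A}\le\Phi_2(H/h)\langle w,w\rangle_{\widetilde A}$ for all $w\in\widetilde W_0$; for two-dimensional problems with $\mathbf W_\Pi$ containing the subdomain corner velocities it is known that $\Phi_2(H/h)=C(1+\log(H/h))^2$. *)

theory Defs
  imports "HOL-Analysis.Analysis" "Jordan_Normal_Form.Gauss_Jordan_Elimination"
begin

text \<open>
  Notation clashes between \<open>HOL-Analysis\<close> and \<open>Jordan_Normal_Form\<close> are avoided by writing
  \<open>inner\<close> for the Euclidean inner product on the plane (and the Frobenius product of
  \<open>2 x 2\<close> matrices), and \<open>scalar_prod\<close> for the inner product of coefficient vectors.
  Coefficient vectors and assembled matrices have a varying dimension and are therefore those of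
  \<open>Jordan_Normal_Form\<close>; a finite element space is given by the list of its basis functions.
\<close>

type_synonym point = "real^2"
type_synonym rvec = "real Matrix.vec"
type_synonym rmat = "real Matrix.mat"

section \<open>Discretization data\<close>

text \<open>
  \<open>part T\<close> is the number of the subdomain containing the element \<open>T\<close>. \<open>shape x\<close> is the scalar
  nodal basis function of the velocity node \<open>x\<close>; boundary nodes carry no degree of freedom, so all
  nodes lie in the open domain, and all shape functions are extended by zero to the plane.
  \<open>pgam\<close> is the set of (positions of) pressure degrees of freedom spanning \<open>Q_Gamma\<close>.
  For the subdomain edge number \<open>e\<close>, \<open>eprim e\<close> is the primal edge-average velocity function, and
  \<open>edual e\<close> lists the remaining (dual) velocity functions of that edge, each with the interface
  node to which the degree of freedom corresponds.
\<close>

record dd =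
  mesh   :: "point set set"
  nsub   :: nat
  part   :: "point set \<Rightarrow> nat"
  vnodes :: "point list"
  shape  :: "point \<Rightarrow> point \<Rightarrow> real"
  pbasis :: "(point \<Rightarrow> real) list"
  pgam   :: "nat set"
  edges  :: "point set list"
  eprim  :: "nat \<Rightarrow> point \<Rightarrow> point"
  edual  :: "nat \<Rightarrow> (point \<times> (point \<Rightarrow> point)) list"

definition domn :: "dd \<Rightarrow> point set" where
  "domn D = interior (\<Union>(mesh D))"

definition subdom :: "dd \<Rightarrow> nat \<Rightarrow> point set" where
  "subdom D i = interior (\<Union>{T \<in> mesh D. part D T = i})"

definition iface :: "dd \<Rightarrow> point set" where
  "iface D = (\<Union>i<nsub D. frontier (subdom D i)) - frontier (domn D)"

definition corners :: "dd \<Rightarrow> point set" where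
  "corners D = (\<Union>E\<in>set (edges D). closure E - E) \<inter> iface D"

definition edge_subs :: "dd \<Rightarrow> nat \<Rightarrow> nat set" where
  "edge_subs D e = {i. i < nsub D \<and> edges D ! e \<subseteq> frontier (subdom D i)}"

text \<open>The number of subdomains sharing a point.\<close>

definition nshare :: "dd \<Rightarrow> point \<Rightarrow> nat" where
  "nshare D x = card {i. i < nsub D \<and> x \<in> closure (subdom D i)}"

definition comb :: "rvec \<Rightarrow> (point \<Rightarrow> 'b::real_vector) list \<Rightarrow> point \<Rightarrow> 'b" where
  "comb c fs = (\<lambda>y. \<Sum>k<length fs. vec_index c k *\<^sub>R (fs ! k) y)"

definition fun_basis :: "(point \<Rightarrow> point) list \<Rightarrow> (point \<Rightarrow> point) set \<Rightarrow> bool" where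
  "fun_basis fs V \<longleftrightarrow> set fs \<subseteq> V \<and>
     (\<forall>u\<in>V. \<exists>!c. c \<in> carrier_vec (length fs) \<and> u = comb c fs)"

definition nodal_funs :: "dd \<Rightarrow> point set \<Rightarrow> (point \<Rightarrow> point) list" where
  "nodal_funs D S = concat (map (\<lambda>x. map (\<lambda>k::2. \<lambda>y. shape D x y *\<^sub>R axis k 1) [1, 2])
     (filter (\<lambda>x. x \<in> S) (vnodes D)))"

definition edge_nodes :: "dd \<Rightarrow> nat \<Rightarrow> point set" where
  "edge_nodes D e = set (vnodes D) \<inter> edges D ! e"

text \<open>The span of the velocity nodal basis functions of the nodes on an open edge.\<close>

definition edge_space :: "dd \<Rightarrow> nat \<Rightarrow> (point \<Rightarrow> point) set" where
  "edge_space D e = {u. \<exists>g. u = (\<lambda>y. \<Sum>x\<in>edge_nodes D e. shape D x y *\<^sub>R g x)}"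

section \<open>Bilinear forms\<close>

text \<open>
  All finite element functions are polynomial on each element, and the velocities are continuous.
  Hence the classical derivative exists off the null set of element boundaries and is the weak one.
  The completed measure \<open>lebesgue\<close> makes the values on that null set irrelevant.
\<close>

definition a_int :: "point set \<Rightarrow> (point \<Rightarrow> point) \<Rightarrow> (point \<Rightarrow> point) \<Rightarrow> real" where
  "a_int S u v = (LINT y:S|lebesgue. inner (jacobian u (at y)) (jacobian v (at y)))"

definition b_int :: "point set \<Rightarrow> (point \<Rightarrow> point) \<Rightarrow> (point \<Rightarrow> real) \<Rightarrow> real" where
  "b_int S u q = - (LINT y:S|lebesgue. trace (jacobian u (at y)) * q y)"

definition a_mat :: "point set \<Rightarrow> (point \<Rightarrow> point) list \<Rightarrow> (point \<Rightarrow> point) list \<Rightarrow> rmat" where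
  "a_mat S us vs = mat (length us) (length vs) (\<lambda>(r, c). a_int S (us ! r) (vs ! c))"

definition b_mat :: "point set \<Rightarrow> (point \<Rightarrow> real) list \<Rightarrow> (point \<Rightarrow> point) list \<Rightarrow> rmat" where
  "b_mat S qs us = mat (length qs) (length us) (\<lambda>(r, c). b_int S (us ! c) (qs ! r))"

definition mass_mat :: "dd \<Rightarrow> rmat" where
  "mass_mat D = mat (length (pbasis D)) (length (pbasis D))
     (\<lambda>(r, c). LINT y:domn D|lebesgue. (pbasis D ! r) y * (pbasis D ! c) y)"

text \<open>
  A velocity of the partially sub-assembled space is a family \<open>u\<close>, where \<open>u i\<close> represents it on
  the subdomain number \<open>i\<close>.
\<close>

definition asm_a :: "dd \<Rightarrow> (nat \<Rightarrow> point \<Rightarrow> point) list \<Rightarrow> (nat \<Rightarrow> point \<Rightarrow> point) list \<Rightarrow> rmat" where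
  "asm_a D us vs = mat (length us) (length vs)
     (\<lambda>(r, c). \<Sum>i<nsub D. a_int (subdom D i) ((us ! r) i) ((vs ! c) i))"

definition asm_b :: "dd \<Rightarrow> (point \<Rightarrow> real) list \<Rightarrow> (nat \<Rightarrow> point \<Rightarrow> point) list \<Rightarrow> rmat" where
  "asm_b D qs us = mat (length qs) (length us)
     (\<lambda>(r, c). \<Sum>i<nsub D. b_int (subdom D i) ((us ! c) i) (qs ! r))"

section \<open>Standing assumptions\<close>

definition mesh_ok :: "real \<Rightarrow> real \<Rightarrow> dd \<Rightarrow> bool" where
  "mesh_ok \<sigma> h D \<longleftrightarrow>
     triangulation (mesh D) \<and> mesh D \<noteq> {} \<and> (\<forall>T\<in>mesh D. 2 simplex T) \<and> connected (domn D) \<and>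
     (\<forall>T\<in>mesh D. (\<exists>z. ball z (\<sigma> * h) \<subseteq> T) \<and> diameter T \<le> h / \<sigma>)"

definition velocity_ok :: "dd \<Rightarrow> bool" where
  "velocity_ok D \<longleftrightarrow>
     distinct (vnodes D) \<and> set (vnodes D) \<subseteq> domn D \<and>
     (\<forall>x\<in>set (vnodes D).
        continuous_on UNIV (shape D x) \<and>
        (\<forall>y. y \<notin> domn D \<longrightarrow> shape D x y = 0) \<and>
        (\<forall>y\<in>set (vnodes D). shape D x y = (if y = x then 1 else 0)) \<and>
        (\<forall>T\<in>mesh D. \<exists>p. real_polynomial_function p \<and> (\<forall>y\<in>T. shape D x y = p y)) \<and>
        (\<forall>T\<in>mesh D. x \<notin> T \<longrightarrow> (\<forall>y\<in>T. shape D x y = 0)))"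

text \<open>
  The pressure degrees of freedom are nodal values, so the constant one has all coefficients one.
  A pressure space of dimension one would consist of the constants only, and the inf-sup
  condition would be void.
\<close>

definition pressure_ok :: "real \<Rightarrow> real \<Rightarrow> real \<Rightarrow> dd \<Rightarrow> bool" where
  "pressure_ok c\<^sub>Z C\<^sub>Z h D \<longleftrightarrow>
     2 \<le> length (pbasis D) \<and>
     (\<forall>q\<in>set (pbasis D). \<forall>T\<in>mesh D.
        \<exists>p. real_polynomial_function p \<and> (\<forall>y\<in>interior T. q y = p y)) \<and>
     (\<forall>T\<in>mesh D. \<forall>y\<in>interior T. (\<Sum>k<length (pbasis D). (pbasis D ! k) y) = 1) \<and>
     (\<forall>v\<in>carrier_vec (length (pbasis D)).
        c\<^sub>Z * h\<^sup>2 * scalar_prod v v \<le> scalar_prod v (mass_mat D *\<^sub>v v) \<and>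
        scalar_prod v (mass_mat D *\<^sub>v v) \<le> C\<^sub>Z * h\<^sup>2 * scalar_prod v v)"

text \<open>
  A subdomain edge is an open arc, possibly a broken line, and the interface is the disjoint union
  of the edges and of the corners. The primal function of an edge together with the dual ones is a
  basis of the span of the nodal basis functions of the edge; an edge without nodes carries
  neither.
\<close>

definition decomposition_ok :: "real \<Rightarrow> real \<Rightarrow> dd \<Rightarrow> bool" where
  "decomposition_ok \<sigma> H D \<longleftrightarrow>
     (\<forall>T\<in>mesh D. part D T < nsub D) \<and>
     (\<forall>i<nsub D. (\<exists>T\<in>mesh D. part D T = i) \<and> connected (subdom D i) \<and>
        \<sigma> * H \<le> diameter (subdom D i) \<and> diameter (subdom D i) \<le> H / \<sigma>) \<and>
     (\<forall>E\<in>set (edges D). \<exists>g. arc g \<and> E = path_image g - {pathstart g, pathfinish g}) \<and>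
     (\<forall>e<length (edges D). \<forall>e'<length (edges D). e \<noteq> e' \<longrightarrow> edges D ! e \<inter> edges D ! e' = {}) \<and>
     corners D \<inter> \<Union>(set (edges D)) = {} \<and>
     iface D = \<Union>(set (edges D)) \<union> corners D \<and>
     corners D \<subseteq> set (vnodes D) \<and>
     (\<forall>e<length (edges D).
        card (edge_subs D e) = 2 \<and>
        (\<forall>x\<in>edges D ! e. \<forall>i<nsub D. x \<in> closure (subdom D i) \<longrightarrow> i \<in> edge_subs D e) \<and>
        (\<forall>(x, u)\<in>set (edual D e). x \<in> edge_nodes D e) \<and>
        (if edge_nodes D e = {} then edual D e = []
         else fun_basis (eprim D e # map snd (edual D e)) (edge_space D e)))"

definition fetidp_setting :: "real \<Rightarrow> real \<Rightarrow> real \<Rightarrow> real \<Rightarrow> real \<Rightarrow> dd \<Rightarrow> bool" where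
  "fetidp_setting \<sigma> c\<^sub>Z C\<^sub>Z h H D \<longleftrightarrow> 0 < h \<and> h \<le> H \<and> mesh_ok \<sigma> h D \<and> velocity_ok D \<and>
     pressure_ok c\<^sub>Z C\<^sub>Z h D \<and> decomposition_ok \<sigma> H D"

text \<open>
  In the supremum the vector \<open>w = 0\<close> only contributes the value \<open>0 / 0 = 0\<close>, which is
  harmless since all quotients are nonnegative.
\<close>

definition inf_sup_stable :: "real \<Rightarrow> dd \<Rightarrow> bool" where
  "inf_sup_stable \<beta> D \<longleftrightarrow> 0 < \<beta> \<and>
     (let W = nodal_funs D UNIV; A = a_mat (domn D) W W; B = b_mat (domn D) (pbasis D) W in
      \<forall>q\<in>carrier_vec (length (pbasis D)).
        (LINT y:domn D|lebesgue. comb q (pbasis D) y) = 0 \<longrightarrow>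
        (SUP w\<in>carrier_vec (length W). (scalar_prod q (B *\<^sub>v w))\<^sup>2 / scalar_prod w (A *\<^sub>v w))
          \<ge> \<beta>\<^sup>2 * scalar_prod q (mass_mat D *\<^sub>v q))"

text \<open>A pressure degree of freedom belongs to a subdomain if its basis function is nonzero there.\<close>

definition pres_on :: "dd \<Rightarrow> nat \<Rightarrow> nat \<Rightarrow> bool" where
  "pres_on D k i \<longleftrightarrow>
     (\<exists>T\<in>mesh D. part D T = i \<and> (\<exists>y\<in>interior T. (pbasis D ! k) y \<noteq> 0))"

definition p_gamma_nonempty :: "dd \<Rightarrow> bool" where
  "p_gamma_nonempty D \<longleftrightarrow>
     ((\<forall>q\<in>set (pbasis D). continuous_on (closure (domn D)) q) \<and>
      pgam D = {k. k < length (pbasis D) \<and> (\<exists>i j. i \<noteq> j \<and> pres_on D k i \<and> pres_on D k j)} \<and>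
      pgam D \<noteq> {}) \<or>
     ((\<forall>k<length (pbasis D). \<exists>!i. pres_on D k i) \<and>
      pgam D \<subseteq> {..<length (pbasis D)} \<and>
      (\<forall>i<nsub D. \<exists>k\<in>pgam D. pres_on D k i))"

section \<open>Basis functions of the spaces\<close>

definition pI :: "dd \<Rightarrow> (point \<Rightarrow> real) list" where
  "pI D = map (\<lambda>k. pbasis D ! k) (filter (\<lambda>k. k \<notin> pgam D) [0..<length (pbasis D)])"

definition pG :: "dd \<Rightarrow> (point \<Rightarrow> real) list" where
  "pG D = map (\<lambda>k. pbasis D ! k) (filter (\<lambda>k. k \<in> pgam D) [0..<length (pbasis D)])"

text \<open>
  \<open>(e, m)\<close> stands for the \<open>m\<close>-th dual velocity degree of freedom of the edge number \<open>e\<close>, and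
  \<open>(i, e, m)\<close> for its copy in the subdomain number \<open>i\<close>.
\<close>

definition dual_loc :: "dd \<Rightarrow> nat \<Rightarrow> (nat \<times> nat) list" where
  "dual_loc D i = [(e, m). e \<leftarrow> [0..<length (edges D)], i \<in> edge_subs D e,
                           m \<leftarrow> [0..<length (edual D e)]]"

definition dual_idx :: "dd \<Rightarrow> (nat \<times> nat \<times> nat) list" where
  "dual_idx D = concat (map (\<lambda>i. map (\<lambda>(e, m). (i, e, m)) (dual_loc D i)) [0..<nsub D])"

definition mult_idx :: "dd \<Rightarrow> (nat \<times> nat) list" where
  "mult_idx D = [(e, m). e \<leftarrow> [0..<length (edges D)], m \<leftarrow> [0..<length (edual D e)]]"

definition dual_fun :: "dd \<Rightarrow> nat \<times> nat \<Rightarrow> point \<Rightarrow> point" where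
  "dual_fun D = (\<lambda>(e, m). snd (edual D e ! m))"

definition velI_loc :: "dd \<Rightarrow> nat \<Rightarrow> (point \<Rightarrow> point) list" where
  "velI_loc D i = nodal_funs D (subdom D i)"

definition velD_loc :: "dd \<Rightarrow> nat \<Rightarrow> (point \<Rightarrow> point) list" where
  "velD_loc D i = map (dual_fun D) (dual_loc D i)"

definition velI :: "dd \<Rightarrow> (nat \<Rightarrow> point \<Rightarrow> point) list" where
  "velI D = map (\<lambda>f i. f) (concat (map (velI_loc D) [0..<nsub D]))"

definition velD :: "dd \<Rightarrow> (nat \<Rightarrow> point \<Rightarrow> point) list" where
  "velD D = map (\<lambda>(i, em) j. if j = i then dual_fun D em else (\<lambda>_. 0)) (dual_idx D)"

definition velP :: "dd \<Rightarrow> (nat \<Rightarrow> point \<Rightarrow> point) list" where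
  "velP D = map (\<lambda>f i. f) (nodal_funs D (corners D) @
     map (eprim D) (filter (\<lambda>e. edge_nodes D e \<noteq> {}) [0..<length (edges D)]))"

abbreviation "nI D \<equiv> length (velI D)"
abbreviation "nQ D \<equiv> length (pI D)"
abbreviation "nD D \<equiv> length (velD D)"
abbreviation "nP D \<equiv> length (velP D)"
abbreviation "nG D \<equiv> length (pG D)"
abbreviation "nL D \<equiv> length (mult_idx D)"

section \<open>Flux over the subdomain boundaries\<close>

text \<open>
  The integral of the outward normal component of \<open>w\<close> over the side \<open>S\<close> of the triangle \<open>T\<close>;
  it does not depend on the order in which the end points of \<open>S\<close> are chosen.
\<close>

definition side_flux :: "(point \<Rightarrow> point) \<Rightarrow> point set \<Rightarrow> point set \<Rightarrow> real" where
  "side_flux w T S =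
     (let (a, b) = (SOME ab. S = closed_segment (fst ab) (snd ab));
          n = (THE n. norm n = 1 \<and> inner n (b - a) = 0 \<and> (\<forall>y\<in>T. inner n (y - a) \<le> 0))
      in dist a b * integral {0..1} (\<lambda>t. inner (w (linepath a b t)) n))"

definition sub_flux :: "dd \<Rightarrow> nat \<Rightarrow> (point \<Rightarrow> point) \<Rightarrow> real" where
  "sub_flux D i w = (\<Sum>(T, S)\<in>{(T, S). T \<in> mesh D \<and> part D T = i \<and> S facet_of T \<and>
     S \<subseteq> frontier (subdom D i)}. side_flux w T S)"

definition dual_zero_flux :: "dd \<Rightarrow> bool" where
  "dual_zero_flux D \<longleftrightarrow> (\<forall>i<nsub D. \<forall>c\<in>carrier_vec (length (velD_loc D i)).
     sub_flux D i (comb c (velD_loc D i)) = 0)"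

section \<open>Operators\<close>

definition inv_mat :: "rmat \<Rightarrow> rmat" where
  "inv_mat A = the (mat_inverse A)"

definition A_tilde :: "dd \<Rightarrow> rmat" where
  "A_tilde D =
     (let I = velI D; E = velD D; P = velP D; Q = pI D in
      four_block_mat
        (four_block_mat (asm_a D I I) (transpose_mat (asm_b D Q I))
                        (asm_b D Q I) (0\<^sub>m (nQ D) (nQ D)))
        (four_block_mat (asm_a D I E) (asm_a D I P)
                        (asm_b D Q E) (asm_b D Q P))
        (four_block_mat (asm_a D E I) (transpose_mat (asm_b D Q E))
                        (asm_a D P I) (transpose_mat (asm_b D Q P)))
        (four_block_mat (asm_a D E E) (asm_a D E P)
                        (asm_a D P E) (asm_a D P P)))"

text \<open>In each row of \<open>B_Delta\<close> the entry \<open>1\<close> is put in the subdomain of smaller number.\<close>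

definition B_Delta :: "dd \<Rightarrow> rmat" where
  "B_Delta D = mat (nL D) (nD D)
     (\<lambda>(r, c). case dual_idx D ! c of (i, em) \<Rightarrow>
        if mult_idx D ! r = em then (if i = Min (edge_subs D (fst em)) then 1 else - 1) else 0)"

definition B_Delta_D :: "dd \<Rightarrow> rmat" where
  "B_Delta_D D = mat (nL D) (nD D)
     (\<lambda>(r, c). case mult_idx D ! r of (e, m) \<Rightarrow>
        (1 / real (nshare D (fst (edual D e ! m)))) * index_mat (B_Delta D) (r, c))"

definition B_C :: "dd \<Rightarrow> rmat" where
  "B_C D = four_block_mat
     (four_block_mat (asm_b D (pG D) (velI D)) (0\<^sub>m (nG D) (nQ D))
                     (0\<^sub>m (nL D) (nI D)) (0\<^sub>m (nL D) (nQ D)))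
     (four_block_mat (asm_b D (pG D) (velD D)) (asm_b D (pG D) (velP D))
                     (B_Delta D) (0\<^sub>m (nL D) (nP D)))
     (0\<^sub>m 0 (nI D + nQ D)) (0\<^sub>m 0 (nD D + nP D))"

definition G_op :: "dd \<Rightarrow> rmat" where
  "G_op D = B_C D * inv_mat (A_tilde D) * transpose_mat (B_C D)"

text \<open>The (negative) matrix of the discrete harmonic extension on one subdomain.\<close>

definition harm_loc :: "dd \<Rightarrow> nat \<Rightarrow> rmat" where
  "harm_loc D i = inv_mat (a_mat (subdom D i) (velI_loc D i) (velI_loc D i)) *
     a_mat (subdom D i) (velI_loc D i) (velD_loc D i)"

definition H_loc :: "dd \<Rightarrow> nat \<Rightarrow> rmat" where
  "H_loc D i = a_mat (subdom D i) (velD_loc D i) (velD_loc D i) -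
     a_mat (subdom D i) (velD_loc D i) (velI_loc D i) * harm_loc D i"

definition H_Delta :: "dd \<Rightarrow> rmat" where
  "H_Delta D = diag_block_mat (map (H_loc D) [0..<nsub D])"

definition M_D_inv :: "real \<Rightarrow> dd \<Rightarrow> rmat" where
  "M_D_inv h D = four_block_mat
     ((1 / h\<^sup>2) \<cdot>\<^sub>m 1\<^sub>m (nG D)) (0\<^sub>m (nG D) (nL D))
     (0\<^sub>m (nL D) (nG D)) (B_Delta_D D * H_Delta D * transpose_mat (B_Delta_D D))"

definition M_D :: "real \<Rightarrow> dd \<Rightarrow> rmat" where
  "M_D h D = inv_mat (M_D_inv h D)"

definition mat_range :: "rmat \<Rightarrow> rvec set" where
  "mat_range A = {A *\<^sub>v y | y. y \<in> carrier_vec (dim_col A)}"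

section \<open>Stability of the jump operator\<close>

definition block_vec :: "rvec \<Rightarrow> rvec \<Rightarrow> rvec \<Rightarrow> rvec \<Rightarrow> rvec" where
  "block_vec wI p wD wP = (wI @\<^sub>v p) @\<^sub>v (wD @\<^sub>v wP)"

text \<open>The jump operator, as a function of the dual part of its argument, the only one it uses.\<close>

definition P_D2 :: "dd \<Rightarrow> rvec \<Rightarrow> rvec" where
  "P_D2 D wD =
     (let v = transpose_mat (B_Delta_D D) *\<^sub>v (B_Delta D *\<^sub>v wD) in
      block_vec (- (diag_block_mat (map (harm_loc D) [0..<nsub D]) *\<^sub>v v))
        (0\<^sub>v (nQ D)) v (0\<^sub>v (nP D)))"

definition jump_stable :: "real \<Rightarrow> dd \<Rightarrow> bool" where
  "jump_stable \<phi> D \<longleftrightarrow>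
     (\<forall>wI\<in>carrier_vec (nI D). \<forall>p\<in>carrier_vec (nQ D).
      \<forall>wD\<in>carrier_vec (nD D). \<forall>wP\<in>carrier_vec (nP D).
        asm_b D (pI D) (velI D) *\<^sub>v wI + asm_b D (pI D) (velD D) *\<^sub>v wD +
          asm_b D (pI D) (velP D) *\<^sub>v wP = 0\<^sub>v (nQ D) \<longrightarrow>
        scalar_prod (A_tilde D *\<^sub>v P_D2 D wD) (P_D2 D wD) \<le>
          \<phi> * scalar_prod (A_tilde D *\<^sub>v block_vec wI p wD wP) (block_vec wI p wD wP))"

end

theory Submission
  imports Defs "Jordan_Normal_Form.Determinant"
begin

text \<open>
  Write \<open>A\<close> for \<open>A_tilde\<close> and \<open>B\<close> for \<open>B_C\<close>. For a multiplier \<open>x\<close> let \<open>w = A\<^sup>-\<^sup>1 B\<^sup>T x\<close>. Then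
  \<open>\<langle>G x, x\<rangle> = \<langle>A w, w\<rangle>\<close>. Although \<open>A\<close> is indefinite, \<open>w\<close> satisfies the divergence constraints for
  \<open>Q_I\<close> (\<open>solution_div_free\<close>), and on the space \<open>div_free\<close> of such vectors the form of \<open>A\<close> is the broken
  energy of the velocity. So \<open>G\<close> is a dual norm of the constraints \<open>B v\<close>, and comparing it with \<open>M_D\<close>
  amounts to comparing the energy of \<open>v\<close> with the form of \<open>M_D\<^sup>-\<^sup>1\<close> at \<open>B v\<close>. This reduction is
  \<open>dual_operator_bounds\<close>; it leaves two estimates.

  Upper bound (\<open>constraint_bound\<close>): \<open>\<langle>M_D\<^sup>-\<^sup>1 B v, B v\<rangle> \<le> (2 C\<^sub>Z + \<Phi>\<^sub>2) \<langle>A v, v\<rangle>\<close> on \<open>div_free\<close>. The pressure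
  part follows from \<open>|tr J|\<^sup>2 \<le> 2 |J|\<^sup>2\<close> and the upper bound for the mass matrix. The jump part is the energy
  of the image of \<open>v\<close> under \<open>P_D2\<close>, because the Schur complement \<open>H_Delta\<close> measures the energy of discrete harmonic
  extensions (\<open>harmonic_energy\<close>), and the stability of the jump operator applies.

  Lower bound (\<open>constraint_lifting\<close>): every value \<open>B v\<close> with \<open>v\<close> in \<open>div_free\<close> is also the value of some
  \<open>w\<close> in \<open>div_free\<close> with \<open>\<beta>\<^sup>2 \<langle>A w, w\<rangle> \<le> (12 + 4 / c\<^sub>Z) \<langle>M_D\<^sup>-\<^sup>1 B v, B v\<rangle>\<close>. It is a sum \<open>w = w1 + w2\<close>. The
  scaled dual velocity with its discrete harmonic extension, \<open>w1\<close>, has the right jump, as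
  \<open>B_Delta B_Delta_D\<^sup>T\<close> is the identity (\<open>B_Delta_right_inverse\<close>), and its energy is the jump part of
  \<open>\<langle>M_D\<^sup>-\<^sup>1 B v, B v\<rangle>\<close>. The remaining defect in the pressure constraints is removed by a continuous
  velocity \<open>w2\<close>, which does not change the jump and is bounded by the inf-sup condition
  (\<open>inf_sup_right_inverse\<close>). A continuous velocity can only remove a defect of mean value zero, and
  that the defect is of this kind is what the flux condition on the dual velocities is for
  (\<open>mean_divergence_family\<close>), by the divergence theorem on a subdomain. That theorem
  (\<open>divergence_region\<close>) is proved on a triangle by transformation to a reference triangle, and extended
  to a union of elements by cancellation of the fluxes through the inner sides.

  Both bounds require \<open>A\<close>, the interior blocks \<open>A_II\<close> and \<open>M_D\<^sup>-\<^sup>1\<close> to be invertible. All three follow from the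
  definiteness of the broken energy (\<open>energy_zero_imp_zero\<close>): a velocity without energy is constant on
  each subdomain, the constants agree because every edge ends at a corner or at the boundary of the
  domain, and they vanish at the boundary. For \<open>A\<close> the pressures remain; the inf-sup condition leaves
  only the constant one, which is excluded by \<open>p\<^sub>\<Gamma>\<close> being nonempty (\<open>A_tilde_trivial_kernel\<close>).
\<close>

section \<open>Symmetric matrices and dual operators\<close>

abbreviation ip :: "rvec \<Rightarrow> rvec \<Rightarrow> real" where "ip \<equiv> scalar_prod"

definition trivial_kernel :: "nat \<Rightarrow> rmat \<Rightarrow> bool" where
  "trivial_kernel n A \<longleftrightarrow> A \<in> carrier_mat n n \<and>
     (\<forall>v\<in>carrier_vec n. A *\<^sub>v v = 0\<^sub>v n \<longrightarrow> v = 0\<^sub>v n)"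

text \<open>
  A square matrix with trivial kernel has a nonzero determinant, hence is a unit of the matrix ring,
  and then Gauss-Jordan elimination, on which \<open>inv_mat\<close> rests, does return an inverse.
\<close>

lemma inv_mat_props:
  fixes A :: rmat
  assumes ker: "trivial_kernel n A"
  shows "inv_mat A \<in> carrier_mat n n" "A * inv_mat A = 1\<^sub>m n" "inv_mat A * A = 1\<^sub>m n"
proof -
  have A: "A \<in> carrier_mat n n" using ker by (simp add: trivial_kernel_def)
  have "Determinant.det A \<noteq> 0" using det_0_iff_vec_prod_zero_field[OF A] ker by (auto simp: trivial_kernel_def)
  then have "A \<in> Units (ring_mat TYPE(real) n ())" by (rule det_non_zero_imp_unit[OF A])
  then obtain B where B: "mat_inverse A = Some B" using mat_inverse(1)[OF A] by fastforce
  from mat_inverse(2)[OF A B] B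
  show "inv_mat A \<in> carrier_mat n n" "A * inv_mat A = 1\<^sub>m n" "inv_mat A * A = 1\<^sub>m n"
    by (auto simp: inv_mat_def)
qed

lemma inv_mat_apply:
  fixes A :: rmat
  assumes ker: "trivial_kernel n A"
    and v: "v \<in> carrier_vec n"
  shows "A *\<^sub>v (inv_mat A *\<^sub>v v) = v" "inv_mat A *\<^sub>v (A *\<^sub>v v) = v" "inv_mat A *\<^sub>v v \<in> carrier_vec n"
proof -
  have A: "A \<in> carrier_mat n n" using ker by (simp add: trivial_kernel_def)
  note I = inv_mat_props[OF ker]
  have "A *\<^sub>v (inv_mat A *\<^sub>v v) = (A * inv_mat A) *\<^sub>v v" using assoc_mult_mat_vec[OF A I(1) v] by simp
  then show "A *\<^sub>v (inv_mat A *\<^sub>v v) = v" using I v by simp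
  have "inv_mat A *\<^sub>v (A *\<^sub>v v) = (inv_mat A * A) *\<^sub>v v" using assoc_mult_mat_vec[OF I(1) A v] by simp
  then show "inv_mat A *\<^sub>v (A *\<^sub>v v) = v" using I v by simp
  show "inv_mat A *\<^sub>v v \<in> carrier_vec n" using I(1) v by simp
qed

text \<open>
  All Cauchy-Schwarz inequalities below come from this one. The case \<open>c = 0\<close> is included because a
  semidefinite form may vanish on nonzero vectors.
\<close>

lemma quadratic_nonneg_imp_discriminant:
  fixes a b c :: real
  assumes q: "\<And>t. 0 \<le> a + 2 * t * b + t\<^sup>2 * c" and c: "0 \<le> c"
  shows "b\<^sup>2 \<le> a * c"
proof (cases "c = 0")
  case True
  have "b = 0"
  proof (rule ccontr)
    assume "b \<noteq> 0"
    with q[of "-(a + 1) / (2 * b)"] True show False by (simp add: field_simps)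
  qed
  with True show ?thesis by simp
next
  case False
  with c have "c > 0" by simp
  have "0 \<le> a - b\<^sup>2 / c" using q[of "- b / c"] \<open>c > 0\<close> by (simp add: field_simps power2_eq_square)
  with \<open>c > 0\<close> show ?thesis by (simp add: field_simps)
qed

definition symm :: "nat \<Rightarrow> rmat \<Rightarrow> bool" where
  "symm n A \<longleftrightarrow> A \<in> carrier_mat n n \<and> transpose_mat A = A"

lemma symm_ip:
  assumes "symm n A" "u \<in> carrier_vec n" "v \<in> carrier_vec n"
  shows "ip u (A *\<^sub>v v) = ip v (A *\<^sub>v u)"
proof -
  have A: "A \<in> carrier_mat n n" using assms by (simp add: symm_def)
  have "ip u (A *\<^sub>v v) = ip (transpose_mat A *\<^sub>v u) v"
    using transpose_vec_mult_scalar[OF A assms(3,2)] by simp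
  also have "\<dots> = ip v (A *\<^sub>v u)"
    using assms A by (simp add: symm_def comm_scalar_prod[of _ n])
  finally show ?thesis .
qed

lemma quadratic_form_add:
  assumes A: "symm n A" and u: "u \<in> carrier_vec n" and v: "v \<in> carrier_vec n"
  shows "ip (u + t \<cdot>\<^sub>v v) (A *\<^sub>v (u + t \<cdot>\<^sub>v v)) =
    ip u (A *\<^sub>v u) + 2 * t * ip u (A *\<^sub>v v) + t\<^sup>2 * ip v (A *\<^sub>v v)"
proof -
  have Ac: "A \<in> carrier_mat n n" using A by (simp add: symm_def)
  have "A *\<^sub>v (u + t \<cdot>\<^sub>v v) = A *\<^sub>v u + t \<cdot>\<^sub>v (A *\<^sub>v v)"
    using Ac u v by (simp add: mult_add_distrib_mat_vec[OF Ac] mult_mat_vec[OF Ac])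
  moreover have "ip v (A *\<^sub>v u) = ip u (A *\<^sub>v v)" using symm_ip[OF A u v] by simp
  ultimately show ?thesis
    using Ac u v
    by (simp add: add_scalar_prod_distrib[of _ n] scalar_prod_add_distrib[of _ n] power2_eq_square algebra_simps)
qed

text \<open>
  The matrix of a saddle point problem is indefinite, but it is positive semidefinite on the
  divergence free vectors; hence the restriction to a subspace.
\<close>

lemma Cauchy_Schwarz_on_subspace:
  assumes A: "symm n A" and W: "W \<subseteq> carrier_vec n"
    and lin: "\<And>u v t. u \<in> W \<Longrightarrow> v \<in> W \<Longrightarrow> u + t \<cdot>\<^sub>v v \<in> W"
    and psd: "\<And>v. v \<in> W \<Longrightarrow> 0 \<le> ip v (A *\<^sub>v v)"
    and u: "u \<in> W" and v: "v \<in> W"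
  shows "(ip u (A *\<^sub>v v))\<^sup>2 \<le> ip u (A *\<^sub>v u) * ip v (A *\<^sub>v v)"
proof (rule quadratic_nonneg_imp_discriminant)
  fix t :: real
  show "0 \<le> ip u (A *\<^sub>v u) + 2 * t * ip u (A *\<^sub>v v) + t\<^sup>2 * ip v (A *\<^sub>v v)"
    using psd[OF lin[OF u v, of t]] quadratic_form_add[OF A subsetD[OF W u] subsetD[OF W v], of t] by simp
qed (use psd v in blast)

definition pos_def :: "nat \<Rightarrow> rmat \<Rightarrow> bool" where
  "pos_def n A \<longleftrightarrow> symm n A \<and> (\<forall>v\<in>carrier_vec n. v \<noteq> 0\<^sub>v n \<longrightarrow> 0 < ip v (A *\<^sub>v v))"

lemma pos_def_nonneg: "pos_def n A \<Longrightarrow> v \<in> carrier_vec n \<Longrightarrow> 0 \<le> ip v (A *\<^sub>v v)"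
  unfolding pos_def_def symm_def by (cases "v = 0\<^sub>v n") (auto simp: less_imp_le)

lemma pos_def_ker:
  assumes "pos_def n A" "v \<in> carrier_vec n" "A *\<^sub>v v = 0\<^sub>v n"
  shows "v = 0\<^sub>v n"
proof (rule ccontr)
  assume "v \<noteq> 0\<^sub>v n"
  then have "0 < ip v (A *\<^sub>v v)" using assms by (auto simp: pos_def_def)
  with assms show False by simp
qed

lemma pos_def_trivial_kernel: "pos_def n A \<Longrightarrow> trivial_kernel n A"
  using pos_def_ker unfolding trivial_kernel_def pos_def_def symm_def by blast

lemma Cauchy_Schwarz_pos_def:
  assumes A: "pos_def n A" and u: "u \<in> carrier_vec n" and v: "v \<in> carrier_vec n"
  shows "(ip u (A *\<^sub>v v))\<^sup>2 \<le> ip u (A *\<^sub>v u) * ip v (A *\<^sub>v v)"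
  using A by (intro Cauchy_Schwarz_on_subspace[where W = "carrier_vec n" and n = n])
    (auto simp: u v pos_def_nonneg pos_def_def)

lemma pos_def_one: "pos_def n (1\<^sub>m n)"
  unfolding pos_def_def symm_def
proof (intro conjI ballI impI)
  fix v :: rvec assume v: "v \<in> carrier_vec n" "v \<noteq> 0\<^sub>v n"
  then obtain i where i: "i < n" "v $ i \<noteq> 0" by (metis carrier_vecD eq_vecI index_zero_vec(1,2))
  have "ip v v = (\<Sum>i<n. v $ i * v $ i)" using v by (simp add: scalar_prod_def lessThan_atLeast0)
  also have "0 < \<dots>" by (rule sum_pos2[of _ i]) (use i in \<open>auto simp: zero_less_mult_iff\<close>)
  finally show "0 < ip v (1\<^sub>m n *\<^sub>v v)" using v by simp
qed auto

lemma Cauchy_Schwarz_ip: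
  assumes "u \<in> carrier_vec n" "v \<in> carrier_vec n" shows "(ip u v)\<^sup>2 \<le> ip u u * ip v v"
  using Cauchy_Schwarz_pos_def[OF pos_def_one assms] assms by simp

lemma ip_nonneg: "0 \<le> ip v (v :: rvec)"
  unfolding scalar_prod_def by (intro sum_nonneg) simp

lemma square_le_mult_imp:
  fixes e K a :: real
  assumes "e\<^sup>2 \<le> K * e * a" "0 \<le> e" "0 \<le> K" "0 \<le> a"
  shows "e \<le> K * a"
proof (cases "e = 0")
  case False
  with assms have "e * e \<le> e * (K * a)" by (simp add: power2_eq_square algebra_simps)
  with False assms(2) show ?thesis by (simp add: mult_le_cancel_left)
qed (use assms in simp)

text \<open>
  With \<open>w = A\<^sup>-\<^sup>1 B\<^sup>T x\<close> one has \<open>\<langle>G x, x\<rangle> = \<langle>A w, w\<rangle>\<close> and \<open>\<langle>B v, x\<rangle> = \<langle>A v, w\<rangle>\<close> for all \<open>v\<close>, so that the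
  form of \<open>G\<close> is the square of a seminorm dual to the energy on \<open>W\<close>. With \<open>M = N\<^sup>-\<^sup>1\<close>, the upper bound is the Cauchy-Schwarz
  inequality in the form of \<open>N\<close>:
  \<open>\<langle>G x, x\<rangle>\<^sup>2 = \<langle>B w, N (M x)\<rangle>\<^sup>2 \<le> \<langle>B w, N (B w)\<rangle> \<langle>M x, x\<rangle> \<le> K \<langle>G x, x\<rangle> \<langle>M x, x\<rangle>\<close>.
  The lower bound is the Cauchy-Schwarz inequality in the form of \<open>A\<close>: if \<open>x\<close> is in the range of
  \<open>N G\<close>, then \<open>M x\<close> is in the range of \<open>G\<close> and equals \<open>B w'\<close> for some \<open>w'\<close> of small energy, whence
  \<open>\<langle>M x, x\<rangle>\<^sup>2 = \<langle>B w', x\<rangle>\<^sup>2 = \<langle>A w', w\<rangle>\<^sup>2 \<le> \<langle>A w', w'\<rangle> \<langle>G x, x\<rangle>\<close>.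
\<close>

lemma dual_operator_bounds:
  fixes A B N :: rmat
  assumes A: "symm n A" and ker: "trivial_kernel n A"
    and B: "B \<in> carrier_mat m n" and N: "pos_def m N"
    and W: "W \<subseteq> carrier_vec n"
    and lin: "\<And>u v t. u \<in> W \<Longrightarrow> v \<in> W \<Longrightarrow> u + t \<cdot>\<^sub>v v \<in> W"
    and psd: "\<And>v. v \<in> W \<Longrightarrow> 0 \<le> ip v (A *\<^sub>v v)"
    and sol: "\<And>w x. w \<in> carrier_vec n \<Longrightarrow> x \<in> carrier_vec m \<Longrightarrow>
      A *\<^sub>v w = transpose_mat B *\<^sub>v x \<Longrightarrow> w \<in> W"
    and K: "0 \<le> K" and c: "0 \<le> c"
    and upper: "\<And>v. v \<in> W \<Longrightarrow> ip (B *\<^sub>v v) (N *\<^sub>v (B *\<^sub>v v)) \<le> K * ip v (A *\<^sub>v v)"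
    and lower: "\<And>v. v \<in> W \<Longrightarrow> \<exists>w\<in>W. B *\<^sub>v w = B *\<^sub>v v \<and>
      c * ip w (A *\<^sub>v w) \<le> ip (B *\<^sub>v v) (N *\<^sub>v (B *\<^sub>v v))"
    and x: "x \<in> mat_range (N * (B * inv_mat A * transpose_mat B))"
  shows "c * ip (inv_mat N *\<^sub>v x) x \<le> ip (B * inv_mat A * transpose_mat B *\<^sub>v x) x"
    and "ip (B * inv_mat A * transpose_mat B *\<^sub>v x) x \<le> K * ip (inv_mat N *\<^sub>v x) x"
proof -
  have Ac: "A \<in> carrier_mat n n" using A by (simp add: symm_def)
  have Nc: "N \<in> carrier_mat m m" using N by (simp add: pos_def_def symm_def)
  note Ai = inv_mat_props[OF ker] inv_mat_apply[OF ker]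
  note Ni = inv_mat_props[OF pos_def_trivial_kernel[OF N]] inv_mat_apply[OF pos_def_trivial_kernel[OF N]]
  define G where "G = B * inv_mat A * transpose_mat B"
  have Gc: "G \<in> carrier_mat m m" using B Ai(1) by (simp add: G_def)
  define s where "s y = inv_mat A *\<^sub>v (transpose_mat B *\<^sub>v y)" for y
  have s: "s y \<in> W" "s y \<in> carrier_vec n" "A *\<^sub>v s y = transpose_mat B *\<^sub>v y" "G *\<^sub>v y = B *\<^sub>v s y"
    if y: "y \<in> carrier_vec m" for y
  proof -
    have By: "transpose_mat B *\<^sub>v y \<in> carrier_vec n" using B y by simp
    show c: "s y \<in> carrier_vec n" and e: "A *\<^sub>v s y = transpose_mat B *\<^sub>v y"
      using Ai(4,6)[OF By] by (simp_all add: s_def)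
    show "s y \<in> W" by (rule sol[OF c y e])
    have "G *\<^sub>v y = (B * inv_mat A) *\<^sub>v (transpose_mat B *\<^sub>v y)"
      unfolding G_def using B Ai(1) y by (intro assoc_mult_mat_vec[of _ m n _ m]) auto
    also have "\<dots> = B *\<^sub>v s y"
      unfolding s_def using B Ai(1) By by (intro assoc_mult_mat_vec[of _ m n _ n]) auto
    finally show "G *\<^sub>v y = B *\<^sub>v s y" .
  qed
  have test: "ip (B *\<^sub>v v) y = ip v (A *\<^sub>v s y)" if "v \<in> W" "y \<in> carrier_vec m" for v y
  proof -
    have v: "v \<in> carrier_vec n" using that W by auto
    have "ip (B *\<^sub>v v) y = ip y (B *\<^sub>v v)" using B v that by (intro comm_scalar_prod[of _ m]) auto
    also have "\<dots> = ip (transpose_mat B *\<^sub>v y) v" using transpose_vec_mult_scalar[OF B v that(2)] by simp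
    also have "\<dots> = ip v (A *\<^sub>v s y)" using B v that s(3)[OF that(2)]
      by (simp add: comm_scalar_prod[of _ n])
    finally show ?thesis .
  qed
  obtain z where "z \<in> carrier_vec (dim_col (N * G))" "x = (N * G) *\<^sub>v z"
    using x[folded G_def, unfolded mat_range_def mem_Collect_eq] by blast
  then have z: "z \<in> carrier_vec m" and xz: "x = N *\<^sub>v (G *\<^sub>v z)"
    using assoc_mult_mat_vec[OF Nc Gc, of z] Gc by (simp_all del: assoc_mult_mat_vec)
  have xc: "x \<in> carrier_vec m" using xz Nc Gc z by auto
  define y where "y = inv_mat N *\<^sub>v x"
  have y: "y \<in> carrier_vec m" "N *\<^sub>v y = x" using Ni(4,6)[OF xc] by (simp_all add: y_def)
  define w where "w = s x"
  have w: "w \<in> W" "w \<in> carrier_vec n" using s[OF xc] by (auto simp: w_def)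
  define E where "E = ip w (A *\<^sub>v w)"
  have GE: "ip (G *\<^sub>v x) x = E" using s(4)[OF xc] test[OF w(1) xc] by (simp add: E_def w_def)
  have E0: "0 \<le> E" using psd[OF w(1)] by (simp add: E_def)
  have CS: "(ip v (A *\<^sub>v w))\<^sup>2 \<le> ip v (A *\<^sub>v v) * E" if "v \<in> W" for v
    unfolding E_def by (rule Cauchy_Schwarz_on_subspace[OF A W lin psd that w(1)])
  have Myx: "ip y x = ip y (N *\<^sub>v y)" using y by simp
  have M0: "0 \<le> ip y x" using pos_def_nonneg[OF N y(1)] Myx by simp
  have Bw: "B *\<^sub>v w \<in> carrier_vec m" using B w by auto
  have "E\<^sup>2 = (ip (B *\<^sub>v w) (N *\<^sub>v y))\<^sup>2"
    using test[OF w(1) xc] y by (simp add: E_def w_def)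
  also have "\<dots> \<le> ip (B *\<^sub>v w) (N *\<^sub>v (B *\<^sub>v w)) * ip y (N *\<^sub>v y)"
    by (rule Cauchy_Schwarz_pos_def[OF N Bw y(1)])
  also have "\<dots> \<le> K * E * ip y x"
    using upper[OF w(1)] M0 by (auto simp: E_def Myx intro!: mult_right_mono)
  finally show "ip (B * inv_mat A * transpose_mat B *\<^sub>v x) x \<le> K * ip (inv_mat N *\<^sub>v x) x"
    unfolding GE[unfolded G_def] y_def[symmetric] by (rule square_le_mult_imp[OF _ E0 K M0])
  have yG: "y = G *\<^sub>v z"
    unfolding y_def xz using Ni(5)[of "G *\<^sub>v z"] Gc z by simp
  obtain w' where w': "w' \<in> W" "B *\<^sub>v w' = y" "c * ip w' (A *\<^sub>v w') \<le> ip y (N *\<^sub>v y)"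
    using lower[OF s(1)[OF z]] s(4)[OF z] yG by auto
  have "(ip y x)\<^sup>2 = (ip w' (A *\<^sub>v w))\<^sup>2" using test[OF w'(1) xc] w'(2) by (simp add: w_def)
  also have "\<dots> \<le> ip w' (A *\<^sub>v w') * E" by (rule CS[OF w'(1)])
  finally have *: "(ip y x)\<^sup>2 \<le> ip w' (A *\<^sub>v w') * E" .
  have "(c * ip y x)\<^sup>2 = c\<^sup>2 * (ip y x)\<^sup>2" by (simp add: power_mult_distrib)
  also have "\<dots> \<le> c\<^sup>2 * (ip w' (A *\<^sub>v w') * E)" using * by (intro mult_left_mono) auto
  also have "\<dots> = (c * ip w' (A *\<^sub>v w')) * (c * E)" by (simp add: power2_eq_square algebra_simps)
  also have "\<dots> \<le> ip y x * (c * E)" using w'(3) Myx c E0 by (intro mult_right_mono) auto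
  finally have "(c * ip y x)\<^sup>2 \<le> 1 * (c * ip y x) * E" by (simp add: algebra_simps)
  then have "c * ip y x \<le> 1 * E" by (rule square_le_mult_imp) (use M0 c E0 in auto)
  then show "c * ip (inv_mat N *\<^sub>v x) x \<le> ip (B * inv_mat A * transpose_mat B *\<^sub>v x) x"
    unfolding GE[unfolded G_def] y_def[symmetric] by simp
qed

section \<open>The inf-sup condition for matrices\<close>

text \<open>
  The supremum of the inf-sup condition is attained at \<open>A\<^sup>-\<^sup>1 B\<^sup>T q\<close>, where it is the quadratic form of
  the Schur complement \<open>B A\<^sup>-\<^sup>1 B\<^sup>T\<close>.
\<close>

lemma inf_sup_le_Schur:
  fixes A B :: rmat
  assumes A: "pos_def n A" and B: "B \<in> carrier_mat m n"
    and q: "q \<in> carrier_vec m"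
    and w0: "w0 \<in> carrier_vec n" "A *\<^sub>v w0 = transpose_mat B *\<^sub>v q"
  shows "(SUP w\<in>carrier_vec n. (ip q (B *\<^sub>v w))\<^sup>2 / ip w (A *\<^sub>v w)) \<le> ip w0 (A *\<^sub>v w0)"
proof (rule cSUP_least)
  show "carrier_vec n \<noteq> ({} :: rvec set)" using w0 by auto
  fix w :: rvec assume w: "w \<in> carrier_vec n"
  have As: "symm n A" using A by (simp add: pos_def_def)
  have "ip q (B *\<^sub>v w) = ip (transpose_mat B *\<^sub>v q) w"
    using transpose_vec_mult_scalar[OF B w q] by simp
  also have "\<dots> = ip w (A *\<^sub>v w0)"
    unfolding w0(2)[symmetric] using w0(1) w As by (intro comm_scalar_prod[of _ n]) (auto simp: symm_def)
  finally have "(ip q (B *\<^sub>v w))\<^sup>2 \<le> ip w (A *\<^sub>v w) * ip w0 (A *\<^sub>v w0)"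
    using Cauchy_Schwarz_pos_def[OF A w w0(1)] by simp
  then show "(ip q (B *\<^sub>v w))\<^sup>2 / ip w (A *\<^sub>v w) \<le> ip w0 (A *\<^sub>v w0)"
    using pos_def_nonneg[OF A w] pos_def_nonneg[OF A w0(1)]
    by (cases "ip w (A *\<^sub>v w) = 0") (auto simp: field_simps)
qed

text \<open>
  The solution of least energy is \<open>w = A\<^sup>-\<^sup>1 B\<^sup>T q\<close> with \<open>q\<close> solving the Schur complement equation
  \<open>B A\<^sup>-\<^sup>1 B\<^sup>T q = r\<close>. Its energy is \<open>a = \<langle>q, r\<rangle>\<close>, and \<open>a\<^sup>2 \<le> R \<langle>q, Z q\<rangle> \<le> R a / \<beta>\<^sup>2\<close> by the bound on \<open>r\<close>
  and the inf-sup condition. The vector \<open>e\<close> stands for the constant pressures.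
\<close>

lemma inf_sup_right_inverse:
  fixes A B Z :: rmat
  assumes A: "pos_def n A" and B: "B \<in> carrier_mat m n" and Z: "pos_def m Z"
    and e: "e \<in> carrier_vec m" "e \<noteq> 0\<^sub>v m" "transpose_mat B *\<^sub>v e = 0\<^sub>v n"
    and \<beta>: "0 < \<beta>"
    and inf_sup: "\<And>q. q \<in> carrier_vec m \<Longrightarrow> ip (Z *\<^sub>v e) q = 0 \<Longrightarrow>
      \<beta>\<^sup>2 * ip q (Z *\<^sub>v q) \<le> (SUP w\<in>carrier_vec n. (ip q (B *\<^sub>v w))\<^sup>2 / ip w (A *\<^sub>v w))"
    and r: "r \<in> carrier_vec m" "ip e r = 0"
    and R: "0 \<le> R" "\<And>q. q \<in> carrier_vec m \<Longrightarrow> (ip q r)\<^sup>2 \<le> R * ip q (Z *\<^sub>v q)"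
  shows "\<exists>w\<in>carrier_vec n. B *\<^sub>v w = r \<and> \<beta>\<^sup>2 * ip w (A *\<^sub>v w) \<le> R"
proof -
  have As: "symm n A" and Ac: "A \<in> carrier_mat n n" using A by (auto simp: pos_def_def symm_def)
  have Zs: "symm m Z" and Zc: "Z \<in> carrier_mat m m" using Z by (auto simp: pos_def_def symm_def)
  note Ai = inv_mat_props[OF pos_def_trivial_kernel[OF A]] inv_mat_apply[OF pos_def_trivial_kernel[OF A]]
  define s where "s q = inv_mat A *\<^sub>v (transpose_mat B *\<^sub>v q)" for q
  define k where "k = Z *\<^sub>v e"
  have kc: "k \<in> carrier_vec m" using Zc e by (simp add: k_def)
  have s: "s q \<in> carrier_vec n" "A *\<^sub>v s q = transpose_mat B *\<^sub>v q" if "q \<in> carrier_vec m" for q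
    using Ai(4,6)[of "transpose_mat B *\<^sub>v q"] B that by (simp_all add: s_def)
  have form: "ip q (B *\<^sub>v v) = ip v (A *\<^sub>v s q)" if "q \<in> carrier_vec m" "v \<in> carrier_vec n" for q v
  proof -
    have "ip q (B *\<^sub>v v) = ip (transpose_mat B *\<^sub>v q) v"
      using transpose_vec_mult_scalar[OF B that(2,1)] by simp
    also have "\<dots> = ip v (A *\<^sub>v s q)" using s[OF that(1)] that B by (simp add: comm_scalar_prod[of _ n])
    finally show ?thesis .
  qed
  \<comment> \<open>The Schur complement has the kernel spanned by \<open>e\<close>; adding the square of the mean value
    makes it definite without changing it on the vectors of mean value zero.\<close>
  define S where "S = B * inv_mat A * transpose_mat B + mat m m (\<lambda>(i, j). k $ i * k $ j)"
  have Sc: "S \<in> carrier_mat m m" using B Ai(1) by (simp add: S_def)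
  have Sv: "S *\<^sub>v q = B *\<^sub>v s q + ip k q \<cdot>\<^sub>v k" if q: "q \<in> carrier_vec m" for q
  proof -
    have Bq: "transpose_mat B *\<^sub>v q \<in> carrier_vec n" using B q by simp
    have "S *\<^sub>v q = B * inv_mat A * transpose_mat B *\<^sub>v q + mat m m (\<lambda>(i, j). k $ i * k $ j) *\<^sub>v q"
      unfolding S_def using B Ai(1) q by (intro add_mult_distrib_mat_vec[of _ m m]) auto
    also have "B * inv_mat A * transpose_mat B *\<^sub>v q = (B * inv_mat A) *\<^sub>v (transpose_mat B *\<^sub>v q)"
      using B Ai(1) q by (intro assoc_mult_mat_vec[of _ m n _ m]) auto
    also have "\<dots> = B *\<^sub>v s q"
      unfolding s_def using B Ai(1) Bq by (intro assoc_mult_mat_vec[of _ m n _ n]) auto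
    also have "mat m m (\<lambda>(i, j). k $ i * k $ j) *\<^sub>v q = ip k q \<cdot>\<^sub>v k"
      using q kc by (intro eq_vecI) (auto simp: scalar_prod_def sum_distrib_left mult.assoc
          sum_distrib_right intro!: sum.cong)
    finally show ?thesis .
  qed
  have qSq: "ip q (S *\<^sub>v q) = ip (s q) (A *\<^sub>v s q) + (ip k q)\<^sup>2" if q: "q \<in> carrier_vec m" for q
    using q kc B s[OF q] form[OF q s(1)[OF q]]
    by (simp add: Sv scalar_prod_add_distrib[of _ m] power2_eq_square comm_scalar_prod[of q m k])
  have Sinf: "\<beta>\<^sup>2 * ip q (Z *\<^sub>v q) \<le> ip (s q) (A *\<^sub>v s q)"
    if "q \<in> carrier_vec m" "ip k q = 0" for q
    using inf_sup[of q] inf_sup_le_Schur[OF A B that(1) s[OF that(1)]] that by (simp add: k_def)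
  have kerS: "q = 0\<^sub>v m" if q: "q \<in> carrier_vec m" and "S *\<^sub>v q = 0\<^sub>v m" for q
  proof (rule ccontr)
    assume "q \<noteq> 0\<^sub>v m"
    then have "0 < ip q (Z *\<^sub>v q)" using Z q by (auto simp: pos_def_def)
    moreover have "ip (s q) (A *\<^sub>v s q) + (ip k q)\<^sup>2 = 0" using qSq[OF q] that by simp
    then have "ip k q = 0" "ip (s q) (A *\<^sub>v s q) = 0"
      using pos_def_nonneg[OF A s(1)[OF q]] by (auto simp: add_nonneg_eq_0_iff)
    ultimately show False using Sinf[OF q] \<beta> by (auto simp: mult_le_0_iff)
  qed
  define q where "q = inv_mat S *\<^sub>v r"
  have q: "q \<in> carrier_vec m" "S *\<^sub>v q = r"
    using inv_mat_apply[of m S r] Sc kerS r(1) by (auto simp: q_def trivial_kernel_def)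
  have "ip e r = ip e (B *\<^sub>v s q) + ip k q * ip e k"
    unfolding q(2)[symmetric] Sv[OF q(1)] using kc B e s(1)[OF q(1)]
    by (simp add: scalar_prod_add_distrib[of _ m])
  moreover have "ip e (B *\<^sub>v s q) = 0"
    using form[OF e(1) s(1)[OF q(1)]] s(2)[OF e(1)] e(3) s(1)[OF q(1)] by simp
  moreover have "0 < ip e k" using Z e by (auto simp: pos_def_def k_def)
  ultimately have k0: "ip k q = 0" using r by simp
  define w where "w = s q"
  have w: "w \<in> carrier_vec n" using s[OF q(1)] by (simp add: w_def)
  have Bw: "B *\<^sub>v w = r"
    using Sv[OF q(1)] k0 q B w kc by (intro eq_vecI) (auto simp: w_def)
  define a where "a = ip w (A *\<^sub>v w)"
  have "a = ip q r" using form[OF q(1) w] Bw by (simp add: a_def w_def)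
  then have "\<beta>\<^sup>2 * a\<^sup>2 \<le> \<beta>\<^sup>2 * (R * ip q (Z *\<^sub>v q))" using R(2)[OF q(1)] by (simp add: mult_left_mono)
  also have "\<dots> \<le> R * a" using mult_left_mono[OF Sinf[OF q(1) k0] R(1)]
    by (simp add: a_def w_def algebra_simps)
  finally have "\<beta>\<^sup>2 * a\<^sup>2 \<le> R * a" .
  moreover have "0 \<le> a" using pos_def_nonneg[OF A w] by (simp add: a_def)
  ultimately have "\<beta>\<^sup>2 * a \<le> R"
    using R(1) by (cases "a = 0") (auto simp: power2_eq_square mult.assoc[symmetric])
  with w Bw show ?thesis by (auto simp: a_def)
qed

text \<open>
  Continuity of the divergence bounds the inf-sup constant from above, as soon as there is a nonzero
  pressure of mean value zero. This absorbs, in the lower spectral bound, terms that do not carry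
  the factor \<open>\<beta>\<^sup>2\<close>.
\<close>

lemma inf_sup_constant_le:
  fixes A B Z :: rmat
  assumes Z: "pos_def m Z" and m: "2 \<le> m" and k: "k \<in> carrier_vec m"
    and A: "pos_def n A"
    and inf_sup: "\<And>q. q \<in> carrier_vec m \<Longrightarrow> ip k q = 0 \<Longrightarrow>
      \<beta>\<^sup>2 * ip q (Z *\<^sub>v q) \<le> (SUP w\<in>carrier_vec n. (ip q (B *\<^sub>v w))\<^sup>2 / ip w (A *\<^sub>v w))"
    and K: "0 \<le> K"  "\<And>q w. q \<in> carrier_vec m \<Longrightarrow> w \<in> carrier_vec n \<Longrightarrow>
      (ip q (B *\<^sub>v w))\<^sup>2 \<le> K * ip w (A *\<^sub>v w) * ip q (Z *\<^sub>v q)"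
  shows "\<beta>\<^sup>2 \<le> K"
proof -
  \<comment> \<open>In dimension at least two some nonzero vector is orthogonal to \<open>k\<close>.\<close>
  define q where "q = (if k $ 0 = 0 then unit_vec m 0 else
     (k $ 1) \<cdot>\<^sub>v unit_vec m 0 - (k $ 0) \<cdot>\<^sub>v unit_vec m 1)"
  have q: "q \<in> carrier_vec m" by (simp add: q_def)
  have "ip k q = 0"
    using m k by (auto simp: q_def scalar_prod_minus_distrib[of _ m])
  have "q \<noteq> 0\<^sub>v m"
  proof
    assume "q = 0\<^sub>v m"
    then have "q $ 0 = 0" "q $ 1 = 0" using m by auto
    then show False using m k by (auto simp: q_def split: if_splits)
  qed
  then have Z0: "0 < ip q (Z *\<^sub>v q)" using Z q by (auto simp: pos_def_def)
  have "(SUP w\<in>carrier_vec n. (ip q (B *\<^sub>v w))\<^sup>2 / ip w (A *\<^sub>v w)) \<le> K * ip q (Z *\<^sub>v q)"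
  proof (rule cSUP_least)
    show "carrier_vec n \<noteq> ({} :: rvec set)" using zero_carrier_vec by blast
    fix w :: rvec assume w: "w \<in> carrier_vec n"
    show "(ip q (B *\<^sub>v w))\<^sup>2 / ip w (A *\<^sub>v w) \<le> K * ip q (Z *\<^sub>v q)"
      using K(1) K(2)[OF q w] pos_def_nonneg[OF A w] Z0
      by (cases "ip w (A *\<^sub>v w) = 0") (auto simp: field_simps)
  qed
  then have "\<beta>\<^sup>2 * ip q (Z *\<^sub>v q) \<le> K * ip q (Z *\<^sub>v q)" using inf_sup[OF q \<open>ip k q = 0\<close>] by linarith
  with Z0 show ?thesis by simp
qed

text \<open>From here on the dollar sign selects the coordinates of a point of the plane.\<close>

no_notation vec_index (infixl \<open>$\<close> 100)

section \<open>The divergence theorem on a triangle\<close>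

definition cross2 :: "point \<Rightarrow> point \<Rightarrow> real" where
  "cross2 u v = u $ 1 * v $ 2 - u $ 2 * v $ 1"

text \<open>
  The flux of \<open>w\<close> through the segment from \<open>a\<close> to \<open>b\<close>, counted positive from the left to the right of
  the direction of travel. The tangent \<open>b - a\<close> is not normalized, so no length factor is needed.
\<close>

definition edge_int :: "(point \<Rightarrow> point) \<Rightarrow> point \<Rightarrow> point \<Rightarrow> real" where
  "edge_int w a b = integral {0..1} (\<lambda>t. cross2 (w (linepath a b t)) (b - a))"

definition tri2 :: "(real \<times> real) set" where
  "tri2 = {(s, t). 0 \<le> s \<and> 0 \<le> t \<and> s + t \<le> 1}"

definition pt :: "real \<times> real \<Rightarrow> point" where
  "pt z = fst z *\<^sub>R axis 1 1 + snd z *\<^sub>R axis 2 1"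

lemma pt_nth [simp]: "pt z $ 1 = fst z" "pt z $ 2 = snd z"
  by (simp_all add: pt_def axis_def)

lemma point_eqI: "x $ 1 = y $ 1 \<Longrightarrow> x $ 2 = y $ 2 \<Longrightarrow> x = (y :: point)"
  by (simp add: Finite_Cartesian_Product.vec_eq_iff forall_2)

lemma point_expand: "(x :: point) = x $ 1 *\<^sub>R axis 1 1 + x $ 2 *\<^sub>R axis 2 1"
  by (rule point_eqI) (simp_all add: axis_def)

lemma Basis_point: "(Basis :: point set) = {axis 1 1, axis 2 1}"
  by (auto simp: Basis_vec_def UNIV_2)

lemma axis_12 [simp]: "axis 1 1 \<noteq> (axis 2 1 :: point)"
  by (simp add: axis_eq_axis)

text \<open>
  Fubini's theorem is about product measures; this identification of the measure on \<open>real^2\<close> makes it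
  available there.
\<close>

lemma lborel_point_eq: "(lborel :: point measure) = distr (lborel \<Otimes>\<^sub>M lborel) borel pt"
proof (rule lborel_eqI)
  have m: "pt \<in> borel_measurable borel"
    unfolding pt_def by (intro borel_measurable_continuous_onI continuous_intros)
  then have m': "pt \<in> measurable (lborel \<Otimes>\<^sub>M lborel) borel"
    by (simp add: lborel_prod)
  fix l u :: point
  assume le: "\<And>b. b \<in> Basis \<Longrightarrow> inner l b \<le> inner u b"
  have le': "l $ 1 \<le> u $ 1" "l $ 2 \<le> u $ 2"
    using le[of "axis 1 1"] le[of "axis 2 1"] by (auto simp: Basis_point inner_axis)
  have "pt -` box l u = {l $ 1 <..< u $ 1} \<times> {l $ 2 <..< u $ 2}"
    by (auto simp: mem_box Basis_point inner_axis)
  then have "emeasure (distr (lborel \<Otimes>\<^sub>M lborel) borel pt) (box l u)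
      = emeasure (lborel \<Otimes>\<^sub>M lborel) ({l $ 1 <..< u $ 1} \<times> {l $ 2 <..< u $ 2})"
    using m' by (subst emeasure_distr) (auto simp: space_pair_measure)
  also have "\<dots> = ennreal ((u $ 1 - l $ 1) * (u $ 2 - l $ 2))"
    using le' by (subst lborel.emeasure_pair_measure_Times) (auto simp: ennreal_mult)
  also have "(u $ 1 - l $ 1) * (u $ 2 - l $ 2) = (\<Prod>b\<in>Basis. inner (u - l) b)"
    by (simp add: Basis_point inner_axis)
  finally show "emeasure (distr (lborel \<Otimes>\<^sub>M lborel) borel pt) (box l u) = (\<Prod>b\<in>Basis. inner (u - l) b)" .
qed simp

lemma compact_tri2: "compact tri2"
proof -
  have "tri2 = cbox (0, 0) (1, 1) \<inter> {z. fst z + snd z \<le> 1}"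
    by (auto simp: tri2_def cbox_Pair_eq)
  moreover have "closed {z :: real \<times> real. fst z + snd z \<le> 1}"
    by (intro closed_Collect_le continuous_intros)
  ultimately show ?thesis using compact_Int_closed[OF compact_cbox] by metis
qed

lemma integrable_tri2:
  fixes f :: "real \<times> real \<Rightarrow> real"
  assumes "continuous_on UNIV f"
  shows "integrable (lborel \<Otimes>\<^sub>M lborel) (\<lambda>z. indicator tri2 z * f z)"
  using borel_integrable_compact[OF compact_tri2 continuous_on_subset[OF assms]]
  by (simp add: lborel_prod)

lemma set_integrable_lebesgue_compact:
  fixes f :: "'a::euclidean_space \<Rightarrow> real"
  assumes "compact S" "continuous_on S f"
  shows "set_integrable lebesgue S f"
proof -
  have "integrable lborel (\<lambda>x. indicator S x *\<^sub>R f x)" by (rule borel_integrable_compact[OF assms])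
  then show ?thesis
    unfolding set_integrable_def by (subst integrable_completion) (auto intro: borel_measurable_integrable)
qed

text \<open>
  Fubini's theorem followed by the fundamental theorem of calculus on each vertical section of the
  reference triangle.
\<close>

lemma tri2_FTC_snd:
  fixes f :: "real \<times> real \<Rightarrow> real"
  assumes f: "continuous_on UNIV f" and der: "\<And>s t. ((\<lambda>t. \<psi> s t) has_real_derivative f (s, t)) (at t)"
  shows "(LINT z|(lborel \<Otimes>\<^sub>M lborel). indicator tri2 z * f z)
    = (LINT s|lborel. indicator {0..1} s * (\<psi> s (1 - s) - \<psi> s 0))"
proof -
  have "(LINT z|(lborel \<Otimes>\<^sub>M lborel). indicator tri2 z * f z)
      = (LINT s|lborel. LINT t|lborel. indicator tri2 (s, t) * f (s, t))"
    using lborel_pair.integral_fst'[OF integrable_tri2[OF f]] by simp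
  also have "\<dots> = (LINT s|lborel. indicator {0..1} s * (\<psi> s (1 - s) - \<psi> s 0))"
  proof (rule Bochner_Integration.integral_cong)
    fix s :: real
    show "(LINT t|lborel. indicator tri2 (s, t) * f (s, t)) = indicator {0..1} s * (\<psi> s (1 - s) - \<psi> s 0)"
    proof (cases "0 \<le> s \<and> s \<le> 1")
      case True
      have cs: "continuous_on {0..1 - s} (\<lambda>t. f (s, t))"
        by (rule continuous_on_compose2[OF f]) (auto intro!: continuous_intros)
      have "(LINT t|lborel. indicator {0..1 - s} t *\<^sub>R f (s, t)) = \<psi> s (1 - s) - \<psi> s 0"
        using True by (intro integral_FTC_Icc[OF _ _ cs])
          (auto intro!: has_vector_derivative_at_within der[unfolded has_real_derivative_iff_has_vector_derivative])
      moreover have "indicator tri2 (s, t) = (indicator {0..1 - s} t :: real)" for t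
        using True by (auto simp: tri2_def indicator_def)
      ultimately show ?thesis using True by (simp add: indicator_def)
    next
      case False
      then have "indicator tri2 (s, t) = (0 :: real)" for t by (auto simp: tri2_def indicator_def)
      then show ?thesis using False by (auto simp: indicator_def)
    qed
  qed simp
  finally show ?thesis .
qed

lemma tri2_FTC_fst:
  fixes f :: "real \<times> real \<Rightarrow> real"
  assumes f: "continuous_on UNIV f" and der: "\<And>s t. ((\<lambda>s. \<phi> s t) has_real_derivative f (s, t)) (at s)"
  shows "(LINT z|(lborel \<Otimes>\<^sub>M lborel). indicator tri2 z * f z)
    = (LINT t|lborel. indicator {0..1} t * (\<phi> (1 - t) t - \<phi> 0 t))"
proof -
  have f': "continuous_on UNIV (\<lambda>(x, y). f (y, x))"
    unfolding case_prod_beta by (rule continuous_on_compose2[OF f]) (auto intro!: continuous_intros)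
  have "(LINT z|(lborel \<Otimes>\<^sub>M lborel). indicator tri2 z * f z)
      = (LINT (x, y)|(lborel \<Otimes>\<^sub>M lborel). indicator tri2 (y, x) * f (y, x))"
    using lborel_pair.integral_product_swap[of "\<lambda>z. indicator tri2 z * f z"] integrable_tri2[OF f] by auto
  also have "\<dots> = (LINT z|(lborel \<Otimes>\<^sub>M lborel). indicator tri2 z * (\<lambda>(x, y). f (y, x)) z)"
    by (intro Bochner_Integration.integral_cong) (auto simp: tri2_def indicator_def)
  also have "\<dots> = (LINT t|lborel. indicator {0..1} t * (\<phi> (1 - t) t - \<phi> 0 t))"
    by (rule tri2_FTC_snd[OF f', of "\<lambda>t s. \<phi> s t"]) (use der in auto)
  finally show ?thesis .
qed

text \<open>
  The trace is the derivative of the determinant at the identity in the direction of \<open>L\<close>.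
  It turns a divergence into derivatives along the two edge vectors of a triangle.
\<close>

lemma linear_trace_cross2:
  fixes L :: "point \<Rightarrow> point"
  assumes "linear L"
  shows "cross2 (L e) f + cross2 e (L f) = trace (matrix L) * cross2 e f"
proof -
  define p where "p = L (axis 1 1)"
  define q where "q = L (axis 2 1)"
  have L: "L x = x $ 1 *\<^sub>R p + x $ 2 *\<^sub>R q" for x
    by (subst point_expand[of x]) (simp add: linear_add[OF assms] linear_scale[OF assms] p_def q_def)
  have "trace (matrix L) = p $ 1 + q $ 2"
    by (simp add: trace_def matrix_def sum_2 p_def q_def)
  then show ?thesis by (simp add: cross2_def L algebra_simps)
qed

lemma integral_flip_unit:
  fixes f :: "real \<Rightarrow> real"
  shows "integral {0..1} (\<lambda>t. f (1 - t)) = integral {0..1} f"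
proof -
  have "integral {0..1} (\<lambda>t. f (1 - t)) = integral {-1..0} (\<lambda>t. f (t + 1))"
    using Henstock_Kurzweil_Integration.integral_reflect_real[of 0 "-1" "\<lambda>t. f (1 + t)"] by (simp add: add.commute)
  then show ?thesis using integral_shift_real_ivl[of 0 1 1 f] by simp
qed

lemma edge_int_flip: "edge_int w b a = - edge_int w a b"
proof -
  have "cross2 (w (linepath b a t)) (a - b) = - cross2 (w (linepath a b (1 - t))) (b - a)" for t
    by (simp add: linepath_def algebra_simps cross2_def)
  then show ?thesis
    unfolding edge_int_def using integral_flip_unit[of "\<lambda>t. cross2 (w (linepath a b t)) (b - a)"] by simp
qed

text \<open>
  The derivative is carried along as \<open>p'\<close>, with continuity stated for each direction: this is the form
  in which Fubini's theorem and the fundamental theorem of calculus make use of it.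
\<close>

definition C1_map :: "(point \<Rightarrow> point) \<Rightarrow> (point \<Rightarrow> point \<Rightarrow> point) \<Rightarrow> bool" where
  "C1_map p p' \<longleftrightarrow> (\<forall>y. (p has_derivative p' y) (at y)) \<and> (\<forall>v. continuous_on UNIV (\<lambda>y. p' y v))"

lemma C1_map_linear: "C1_map p p' \<Longrightarrow> linear (p' y)"
  unfolding C1_map_def by (meson has_derivative_linear)

lemma C1_map_continuous: "C1_map p p' \<Longrightarrow> continuous_on S p"
  unfolding C1_map_def by (meson continuous_at_imp_continuous_on has_derivative_continuous)

lemma trace_matrix_point: "trace (matrix L) = L (axis 1 1) $ 1 + L (axis 2 1) $ (2::2)"
  by (simp add: trace_def matrix_def sum_2)

lemma continuous_on_trace:
  assumes "C1_map p p'"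
  shows "continuous_on S (\<lambda>y. trace (matrix (p' y)))"
  using assms unfolding C1_map_def trace_matrix_point
  by (intro continuous_intros) (auto intro: continuous_on_subset)

lemma cross2_bilinear:
  "cross2 (u + v) w = cross2 u w + cross2 v w" "cross2 w (u + v) = cross2 w u + cross2 w v"
  "cross2 (u - v) w = cross2 u w - cross2 v w" "cross2 w (u - v) = cross2 w u - cross2 w v"
  "cross2 (r *\<^sub>R u) w = r * cross2 u w" "cross2 w (r *\<^sub>R u) = r * cross2 w u" "cross2 u u = 0"
  "cross2 (- u) w = - cross2 u w" "cross2 w (- u) = - cross2 w u"
  by (simp_all add: cross2_def algebra_simps)

lemma cross2_skew: "cross2 u v = - cross2 v u"
  by (simp add: cross2_def)

text \<open>
  The affine map from the reference triangle has the Jacobian determinant \<open>cross2 e f\<close>, with the edge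
  vectors \<open>e = b - a\<close> and \<open>f = c - a\<close>. By \<open>linear_trace_cross2\<close> this determinant times the divergence
  is the sum of an \<open>s\<close>-derivative and a \<open>t\<close>-derivative in the reference coordinates (the Piola
  transformation). Each is integrated by \<open>tri2_FTC_fst\<close> and \<open>tri2_FTC_snd\<close>; on the hypotenuse the two
  boundary terms add up to the flux through the side from \<open>b\<close> to \<open>c\<close>.
\<close>

lemma divergence_triangle:
  assumes p: "C1_map p p'" and D: "cross2 (b - a) (c - a) \<noteq> 0"
  shows "integral (convex hull {a, b, c}) (\<lambda>x. trace (matrix (p' x)))
    = sgn (cross2 (b - a) (c - a)) * (edge_int p a b + edge_int p b c + edge_int p c a)"
proof -
  define e f where "e = b - a" and "f = c - a"
  define D where "D = cross2 e f"
  define \<gamma> where "\<gamma> z = a + fst z *\<^sub>R e + snd z *\<^sub>R f" for z :: "real \<times> real"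
  define g where "g x = a + x $ 1 *\<^sub>R e + x $ 2 *\<^sub>R f" for x :: point
  define g' where "g' x = x $ 1 *\<^sub>R e + x $ 2 *\<^sub>R f" for x :: point
  define F where "F x = trace (matrix (p' x))" for x
  have D0: "D \<noteq> 0" using assms by (simp add: D_def e_def f_def)
  have Fc: "continuous_on S F" for S unfolding F_def by (rule continuous_on_trace[OF p])
  have \<gamma>c: "continuous_on S \<gamma>" for S unfolding \<gamma>_def by (intro continuous_intros)
  have der: "(g has_derivative g') (at x within S)" for x S
    unfolding g_def g'_def
    by (auto intro!: derivative_eq_intros bounded_linear.has_derivative[OF bounded_linear_vec_nth])
  have det: "Determinants.det (matrix g') = D"
    by (simp add: det_2 matrix_def g'_def D_def cross2_def axis_def)
  have inj: "inj_on g S" for S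
  proof (rule inj_onI)
    fix x y assume "g x = g y"
    then have "(x $ 1 - y $ 1) *\<^sub>R e + (x $ 2 - y $ 2) *\<^sub>R f = 0" (is "?z = 0")
      by (simp add: g_def algebra_simps)
    then have "cross2 ?z f = 0" "cross2 e ?z = 0" by (simp_all add: cross2_def)
    then have "(x $ 1 - y $ 1) * D = 0" "(x $ 2 - y $ 2) * D = 0"
      by (simp_all add: cross2_bilinear D_def)
    with D0 show "x = y" by (intro point_eqI) auto
  qed
  define T2 where "T2 = pt ` tri2"
  have T2: "T2 = {x. 0 \<le> x $ 1 \<and> 0 \<le> x $ 2 \<and> x $ 1 + x $ 2 \<le> 1}"
  proof -
    have "x = pt (x $ 1, x $ 2)" for x by (rule point_eqI) auto
    then show ?thesis by (force simp: T2_def tri2_def)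
  qed
  have T: "convex hull {a, b, c} = g ` T2"
  proof -
    have "g ` T2 = \<gamma> ` tri2" by (auto simp: T2_def g_def \<gamma>_def image_image)
    also have "\<gamma> ` tri2 = {a + u *\<^sub>R (b - a) + v *\<^sub>R (c - a) |u v. 0 \<le> u \<and> 0 \<le> v \<and> u + v \<le> 1}"
      unfolding \<gamma>_def e_def f_def tri2_def image_def by fastforce
    finally show ?thesis by (simp add: convex_hull_3_alt)
  qed
  have ptc: "continuous_on S pt" for S unfolding pt_def by (intro continuous_intros)
  have "compact T2" unfolding T2_def by (intro compact_continuous_image compact_tri2 ptc)
  have gc: "continuous_on S g" for S unfolding g_def by (intro continuous_intros)
  have T2l: "T2 \<in> sets lebesgue" using \<open>compact T2\<close> by (simp add: lmeasurable_compact fmeasurableD)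
  have cT: "compact (convex hull {a, b, c})" by (simp add: finite_imp_compact_convex_hull)
  \<comment> \<open>The change of variables is for vector-valued functions; a real function is one with a single
    component.\<close>
  define V where "V x = F x *\<^sub>R (axis 1 1 :: real^1)" for x
  have Fi: "F absolutely_integrable_on (g ` T2)"
    unfolding T[symmetric] by (intro set_integrable_lebesgue_compact cT Fc)
  then have "V absolutely_integrable_on (g ` T2) \<and> integral (g ` T2) V = integral (g ` T2) V"
    unfolding V_def by (auto intro!: set_integrable_scaleR_left)
  then have "integral T2 (\<lambda>x. \<bar>D\<bar> *\<^sub>R V (g x)) = integral (g ` T2) V"
    using has_absolute_integral_change_of_variables[OF T2l der inj, of V "integral (g ` T2) V"] det by auto
  moreover have J1: "(\<lambda>x. \<bar>D\<bar> *\<^sub>R F (g x)) absolutely_integrable_on T2"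
    by (intro set_integrable_lebesgue_compact \<open>compact T2\<close> continuous_intros continuous_on_compose2[OF Fc gc]) auto
  moreover have "integral T2 (\<lambda>x. \<bar>D\<bar> *\<^sub>R V (g x)) = integral T2 (\<lambda>x. (\<bar>D\<bar> *\<^sub>R F (g x)) *\<^sub>R axis 1 1)"
    by (simp add: V_def)
  moreover have "\<dots> = integral T2 (\<lambda>x. \<bar>D\<bar> *\<^sub>R F (g x)) *\<^sub>R axis 1 1"
    by (rule integral_unique[OF has_integral_scaleR_left[OF integrable_integral[OF set_lebesgue_integral_eq_integral(1)[OF J1]]]])
  moreover have "integral (g ` T2) V = integral (g ` T2) F *\<^sub>R axis 1 1"
    unfolding V_def by (rule integral_unique[OF has_integral_scaleR_left[OF integrable_integral[OF set_lebesgue_integral_eq_integral(1)[OF Fi]]]])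
  ultimately have J: "(\<lambda>x. \<bar>D\<bar> *\<^sub>R F (g x)) absolutely_integrable_on T2"
    "integral T2 (\<lambda>x. \<bar>D\<bar> *\<^sub>R F (g x)) = integral (g ` T2) F"
    by (simp_all add: axis_eq_axis)
  have "integral T2 (\<lambda>x. \<bar>D\<bar> *\<^sub>R F (g x)) = (LINT x:T2|lebesgue. \<bar>D\<bar> *\<^sub>R F (g x))"
    by (rule sym[OF set_lebesgue_integral_eq_integral(2)[OF J(1)]])
  also have "\<dots> = (LINT x|lebesgue. indicator T2 x * (\<bar>D\<bar> * F (g x)))"
    unfolding set_lebesgue_integral_def real_scaleR_def ..
  also have "\<dots> = (LINT x|lborel. indicator T2 x * (\<bar>D\<bar> * F (g x)))"
  proof (rule integral_completion)
    have [measurable]: "T2 \<in> sets borel" using \<open>compact T2\<close> by (simp add: borel_compact)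
    have "continuous_on UNIV (\<lambda>x. F (g x))" by (rule continuous_on_compose2[OF Fc gc]) auto
    then have [measurable]: "(\<lambda>x. F (g x)) \<in> borel_measurable borel" by (rule borel_measurable_continuous_onI)
    show "(\<lambda>x. indicator T2 x * (\<bar>D\<bar> * F (g x))) \<in> borel_measurable lborel" by measurable
  qed
  also have "\<dots> = (LINT z|(lborel \<Otimes>\<^sub>M lborel). indicator T2 (pt z) * (\<bar>D\<bar> * F (g (pt z))))"
  proof (subst lborel_point_eq, rule integral_distr)
    show "pt \<in> measurable (lborel \<Otimes>\<^sub>M lborel) borel"
      using borel_measurable_continuous_onI[OF ptc] by (simp add: lborel_prod)
    have [measurable]: "T2 \<in> sets borel" using \<open>compact T2\<close> by (simp add: borel_compact)
    have "continuous_on UNIV (\<lambda>x. F (g x))" by (rule continuous_on_compose2[OF Fc gc]) auto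
    then have [measurable]: "(\<lambda>x. F (g x)) \<in> borel_measurable borel" by (rule borel_measurable_continuous_onI)
    show "(\<lambda>x. indicator T2 x * (\<bar>D\<bar> * F (g x))) \<in> borel_measurable borel" by measurable
  qed
  also have "\<dots> = (LINT z|(lborel \<Otimes>\<^sub>M lborel). indicator tri2 z * (\<bar>D\<bar> * F (\<gamma> z)))"
  proof (rule Bochner_Integration.integral_cong)
    fix z show "indicator T2 (pt z) * (\<bar>D\<bar> * F (g (pt z))) = indicator tri2 z * (\<bar>D\<bar> * F (\<gamma> z))"
      by (cases z) (auto simp: T2 tri2_def indicator_def g_def \<gamma>_def)
  qed simp
  also have "\<dots> = sgn D * (LINT z|(lborel \<Otimes>\<^sub>M lborel). indicator tri2 z * (D * F (\<gamma> z)))"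
  proof -
    have "indicator tri2 z * (\<bar>D\<bar> * F (\<gamma> z)) = sgn D * (indicator tri2 z * (D * F (\<gamma> z)))" for z
      using D0 by (simp add: abs_sgn)
    then show ?thesis by (simp only: integral_mult_right_zero)
  qed
  finally have 1: "integral (convex hull {a, b, c}) F
    = sgn D * (LINT z|(lborel \<Otimes>\<^sub>M lborel). indicator tri2 z * (D * F (\<gamma> z)))"
    using J T by simp
  \<comment> \<open>The two parts of the divergence are derivatives with respect to the reference coordinates.\<close>
  define P where "P z = cross2 (p' (\<gamma> z) e) f" for z
  define Q where "Q z = cross2 e (p' (\<gamma> z) f)" for z
  have split: "D * F (\<gamma> z) = P z + Q z" for z
    using linear_trace_cross2[OF C1_map_linear[OF p], of "\<gamma> z" e f] by (simp add: P_def Q_def F_def D_def)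
  have p'c: "continuous_on UNIV (\<lambda>z. p' (\<gamma> z) v)" for v
    using p unfolding C1_map_def by (auto intro!: continuous_on_compose2[OF _ \<gamma>c])
  have Pc: "continuous_on UNIV P" and Qc: "continuous_on UNIV Q"
    unfolding P_def Q_def cross2_def by (intro continuous_intros p'c)+
  have pd: "(p has_derivative p' y) (at y)" for y using p by (simp add: C1_map_def)
  have ds: "((\<lambda>s. p (\<gamma> (s, t))) has_derivative (\<lambda>h. h *\<^sub>R p' (\<gamma> (s, t)) e)) (at s)" for s t
  proof -
    have "((\<lambda>s. \<gamma> (s, t)) has_derivative (\<lambda>h. h *\<^sub>R e)) (at s)"
      unfolding \<gamma>_def by (auto intro!: derivative_eq_intros)
    from has_derivative_compose[OF this pd] show ?thesis
      by (simp add: linear_scale[OF C1_map_linear[OF p]])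
  qed
  have dt: "((\<lambda>t. p (\<gamma> (s, t))) has_derivative (\<lambda>h. h *\<^sub>R p' (\<gamma> (s, t)) f)) (at t)" for s t
  proof -
    have "((\<lambda>t. \<gamma> (s, t)) has_derivative (\<lambda>h. h *\<^sub>R f)) (at t)"
      unfolding \<gamma>_def by (auto intro!: derivative_eq_intros)
    from has_derivative_compose[OF this pd] show ?thesis
      by (simp add: linear_scale[OF C1_map_linear[OF p]])
  qed
  have comp: "((\<lambda>s. u s $ i) has_real_derivative d $ i) (at s)"
    if "(u has_derivative (\<lambda>h. h *\<^sub>R d)) (at s)" for u :: "real \<Rightarrow> point" and d s i
    using bounded_linear.has_derivative[OF bounded_linear_vec_nth that, of i]
    by (simp add: has_field_derivative_def mult_commute_abs)
  have dP: "((\<lambda>s. cross2 (p (\<gamma> (s, t))) f) has_real_derivative P (s, t)) (at s)" for s t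
    unfolding cross2_def P_def
    by (auto intro!: derivative_eq_intros comp[OF ds])
  have dQ: "((\<lambda>t. cross2 e (p (\<gamma> (s, t)))) has_real_derivative Q (s, t)) (at t)" for s t
    unfolding cross2_def Q_def
    by (auto intro!: derivative_eq_intros comp[OF dt])
  have pc: "continuous_on S p" for S by (rule C1_map_continuous[OF p])
  have lin: "integral {0..1} h = (LINT t|lborel. indicator {0..1} t * h t)" and
    integr: "h integrable_on {0..1}"
    if "continuous_on UNIV h" for h :: "real \<Rightarrow> real"
  proof -
    have "set_integrable lborel {0..1} h"
      unfolding set_integrable_def using borel_integrable_compact[of "{0..1::real}" h] that
      by (auto intro: continuous_on_subset)
    from set_borel_integral_eq_integral[OF this]
    show "integral {0..1} h = (LINT t|lborel. indicator {0..1} t * h t)" "h integrable_on {0..1}"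
      by (auto simp: set_lebesgue_integral_def)
  qed
  have lc: "continuous_on UNIV (\<lambda>t. cross2 (p (linepath x y t)) v)" for x y v
    unfolding cross2_def by (intro continuous_intros continuous_on_compose2[OF pc]) auto
  \<comment> \<open>The integrands of the fluxes through the three sides.\<close>
  define A where "A t = cross2 (p (linepath b c t)) (c - b)" for t
  define B where "B t = cross2 (p (linepath c a (1 - t))) (a - c)" for t
  define C where "C t = cross2 (p (linepath a b t)) (b - a)" for t
  have int1: "(LINT z|(lborel \<Otimes>\<^sub>M lborel). indicator tri2 z * P z)
     = integral {0..1} (\<lambda>t. cross2 (p (linepath b c t)) f + B t)"
  proof -
    have eq: "cross2 (p (\<gamma> (1 - t, t))) f - cross2 (p (\<gamma> (0, t))) f = cross2 (p (linepath b c t)) f + B t" for t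
    proof -
      have "\<gamma> (1 - t, t) = linepath b c t" "\<gamma> (0, t) = linepath c a (1 - t)"
        by (simp_all add: \<gamma>_def linepath_def e_def f_def algebra_simps)
      then show ?thesis by (simp add: B_def f_def cross2_bilinear)
    qed
    have "continuous_on UNIV (\<lambda>t. cross2 (p (linepath b c t)) f + B t)"
      unfolding B_def by (intro continuous_intros lc continuous_on_compose2[OF lc]) auto
    from lin[OF this] show ?thesis unfolding tri2_FTC_fst[OF Pc dP] eq by simp
  qed
  have int2: "(LINT z|(lborel \<Otimes>\<^sub>M lborel). indicator tri2 z * Q z)
     = integral {0..1} (\<lambda>t. cross2 e (p (linepath b c (1 - t))) + C t)"
  proof -
    have eq: "cross2 e (p (\<gamma> (t, 1 - t))) - cross2 e (p (\<gamma> (t, 0))) = cross2 e (p (linepath b c (1 - t))) + C t" for t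
    proof -
      have "\<gamma> (t, 1 - t) = linepath b c (1 - t)" "\<gamma> (t, 0) = linepath a b t"
        by (simp_all add: \<gamma>_def linepath_def e_def f_def algebra_simps)
      then show ?thesis using cross2_skew[of "p (linepath a b t)" "b - a"] by (simp add: C_def e_def)
    qed
    have "continuous_on UNIV (\<lambda>t. cross2 e (p (linepath b c (1 - t))) + C t)"
      unfolding C_def cross2_skew[of e] by (intro continuous_intros lc continuous_on_compose2[OF lc]) auto
    from lin[OF this] show ?thesis unfolding tri2_FTC_snd[OF Qc dQ] eq by simp
  qed
  have i1: "(\<lambda>t. cross2 (p (linepath x y t)) v) integrable_on {0..1}" for x y v
    by (rule integr[OF lc])
  have "continuous_on UNIV (\<lambda>t. cross2 (p (linepath x y (1 - t))) v)" for x y v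
    by (rule continuous_on_compose2[OF lc]) (auto intro!: continuous_intros)
  then have i2: "(\<lambda>t. cross2 (p (linepath x y (1 - t))) v) integrable_on {0..1}" for x y v
    by (rule integr)
  have I1: "integral {0..1} (\<lambda>t. cross2 (p (linepath b c t)) f + B t)
     = integral {0..1} (\<lambda>t. cross2 (p (linepath b c t)) f) + edge_int p c a"
    using integral_flip_unit[of "\<lambda>t. cross2 (p (linepath c a t)) (a - c)"]
    unfolding B_def edge_int_def by (subst integral_add[OF i1 i2]) simp
  have I2: "integral {0..1} (\<lambda>t. cross2 e (p (linepath b c (1 - t))) + C t)
     = edge_int p a b - integral {0..1} (\<lambda>t. cross2 (p (linepath b c t)) e)"
    using integral_flip_unit[of "\<lambda>t. cross2 (p (linepath b c t)) e"]
    unfolding C_def edge_int_def cross2_skew[of e]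
    by (subst integral_add[OF integrable_neg[OF i2] i1]) simp
  have I3: "integral {0..1} (\<lambda>t. cross2 (p (linepath b c t)) f) - integral {0..1} (\<lambda>t. cross2 (p (linepath b c t)) e)
     = edge_int p b c"
    unfolding edge_int_def integral_diff[OF i1 i1, symmetric]
    by (simp add: e_def f_def cross2_bilinear)
  have "(LINT z|(lborel \<Otimes>\<^sub>M lborel). indicator tri2 z * (D * F (\<gamma> z)))
     = (LINT z|(lborel \<Otimes>\<^sub>M lborel). indicator tri2 z * P z + indicator tri2 z * Q z)"
    by (simp add: split distrib_left)
  also have "\<dots> = (LINT z|(lborel \<Otimes>\<^sub>M lborel). indicator tri2 z * P z) + (LINT z|(lborel \<Otimes>\<^sub>M lborel). indicator tri2 z * Q z)"
    by (intro Bochner_Integration.integral_add integrable_tri2 Pc Qc)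
  also have "\<dots> = edge_int p a b + edge_int p b c + edge_int p c a"
    using int1 int2 I1 I2 I3 by simp
  finally show ?thesis using 1 by (simp add: F_def[abs_def] D_def e_def f_def)
qed

section \<open>Flux through the sides of a triangulation\<close>

lemma orthogonal_plane_coordinates:
  fixes n1 n2 e1 e2 :: real
  assumes "n1 * e1 + n2 * e2 = 0"
  shows "n1 * (e1 * e1 + e2 * e2) = (n1 * e2 - n2 * e1) * e2"
    "n2 * (e1 * e1 + e2 * e2) = - (n1 * e2 - n2 * e1) * e1"
proof -
  have "n1 * e1 = - (n2 * e2)" using assms by simp
  then have "(n1 * e1) * e1 = - (n2 * e2) * e1" "(n1 * e1) * e2 = - (n2 * e2) * e2" by simp_all
  then show "n1 * (e1 * e1 + e2 * e2) = (n1 * e2 - n2 * e1) * e2"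
    "n2 * (e1 * e1 + e2 * e2) = - (n1 * e2 - n2 * e1) * e1"
    by (simp_all add: algebra_simps)
qed

lemma parallel_plane_coordinates:
  fixes e1 e2 f1 f2 :: real
  assumes "e1 * f2 - e2 * f1 = 0"
  shows "f1 * (e1 * e1 + e2 * e2) = (e1 * f1 + e2 * f2) * e1"
    "f2 * (e1 * e1 + e2 * e2) = (e1 * f1 + e2 * f2) * e2"
proof -
  have "e1 * f2 = e2 * f1" using assms by simp
  then have eq: "f1 * e2 * e2 = e2 * f2 * e1" "f2 * e1 * e1 = e1 * f1 * e2"
    by (metis mult.assoc mult.commute)+
  show "f1 * (e1 * e1 + e2 * e2) = (e1 * f1 + e2 * f2) * e1"
    using eq(1) by (simp only: distrib_left distrib_right mult.assoc[symmetric]) (simp only: mult.commute[of f1 e1])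
  show "f2 * (e1 * e1 + e2 * e2) = (e1 * f1 + e2 * f2) * e2"
    using eq(2) by (simp only: distrib_left distrib_right mult.assoc[symmetric]) (simp only: mult.commute[of f2 e2])
qed

lemma Cramer_plane_coordinates:
  fixes e1 e2 f1 f2 g1 g2 :: real
  shows "(e1 * g2 - e2 * g1) * f1 = (f1 * g2 - f2 * g1) * e1 + (e1 * f2 - e2 * f1) * g1"
    "(e1 * g2 - e2 * g1) * f2 = (f1 * g2 - f2 * g1) * e2 + (e1 * f2 - e2 * f1) * g2"
  by (simp_all add: algebra_simps)

text \<open>
  The normal vector that occurs in \<open>side_flux\<close>, for given end points of the side.
\<close>

definition outer_normal :: "point \<Rightarrow> point \<Rightarrow> point set \<Rightarrow> point" where
  "outer_normal a b T = (THE n. norm n = 1 \<and> inner n (b - a) = 0 \<and> (\<forall>y\<in>T. inner n (y - a) \<le> 0))"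

lemma inner_point: "inner x y = x $ 1 * y $ 1 + x $ 2 * (y :: point) $ 2"
  by (simp add: inner_vec_def sum_2)

text \<open>
  The unit vectors orthogonal to \<open>b - a\<close> are the two rotations of it by a right angle, scaled; the
  position of \<open>c\<close>, that is, the orientation of the triangle, decides between them.
\<close>

lemma outer_normal_eq:
  assumes D: "cross2 (b - a) (c - a) \<noteq> 0"
  defines "\<mu> \<equiv> sgn (cross2 (b - a) (c - a)) / norm (b - a)"
  shows "outer_normal a b (convex hull {a, b, c}) = \<mu> *\<^sub>R pt ((b - a) $ 2, - (b - a) $ 1)"
proof -
  define e f where "e = b - a" and "f = c - a"
  define D where "D = cross2 e f"
  define r where "r = pt (e $ 2, - e $ 1)"
  have D0: "D \<noteq> 0" using D by (simp add: D_def e_def f_def)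
  then have e0: "e \<noteq> 0" by (auto simp: D_def cross2_def)
  have re: "inner r v = - cross2 e v" for v by (simp add: r_def inner_point cross2_def)
  have nr: "norm r = norm e" by (simp add: norm_eq_sqrt_inner inner_point r_def)
  have \<mu>: "\<mu> = sgn D / norm e" by (simp add: \<mu>_def D_def e_def f_def)
  show ?thesis
    unfolding outer_normal_def e_def[symmetric] r_def[symmetric]
  proof (rule the_equality, intro conjI ballI)
    show "norm (\<mu> *\<^sub>R r) = 1" using D0 e0 by (simp add: nr \<mu> abs_sgn_eq)
    show "inner (\<mu> *\<^sub>R r) e = 0" by (simp add: re cross2_bilinear)
    fix y assume "y \<in> convex hull {a, b, c}"
    then obtain u v where y: "y = a + u *\<^sub>R e + v *\<^sub>R f" "0 \<le> v"
      unfolding convex_hull_3_alt e_def f_def by blast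
    then have "y - a = u *\<^sub>R e + v *\<^sub>R f" by simp
    then have "inner (\<mu> *\<^sub>R r) (y - a) = - (\<mu> * (v * D))" by (simp add: re cross2_bilinear D_def)
    moreover have "0 \<le> \<mu> * D" by (simp add: \<mu> sgn_mult_self_eq zero_le_divide_iff sgn_if)
    then have "0 \<le> \<mu> * D * v" using y(2) by (rule mult_nonneg_nonneg)
    ultimately show "inner (\<mu> *\<^sub>R r) (y - a) \<le> 0" by (simp add: algebra_simps)
  next
    fix n assume n: "norm n = 1 \<and> inner n e = 0 \<and> (\<forall>y\<in>convex hull {a, b, c}. inner n (y - a) \<le> 0)"
    define k where "k = cross2 n e / (norm e)\<^sup>2"
    have ee: "(norm e)\<^sup>2 = e $ 1 * e $ 1 + e $ 2 * e $ 2" by (simp add: power2_norm_eq_inner inner_point)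
    have ne: "n $ 1 * e $ 1 + n $ 2 * e $ 2 = 0" using n by (simp add: inner_point)
    have e2: "e $ 1 * e $ 1 + e $ 2 * e $ 2 \<noteq> 0" using e0 ee by (metis norm_eq_zero power_not_zero)
    have "n $ 1 * (e $ 1 * e $ 1 + e $ 2 * e $ 2) = cross2 n e * e $ 2"
      "n $ 2 * (e $ 1 * e $ 1 + e $ 2 * e $ 2) = - cross2 n e * e $ 1"
      unfolding cross2_def by (rule orthogonal_plane_coordinates[OF ne])+
    then have nk: "n = k *\<^sub>R r"
      using e2 by (intro point_eqI) (simp_all add: k_def ee r_def field_simps)
    have "c \<in> convex hull {a, b, c}" by (simp add: hull_inc)
    then have "inner n f \<le> 0" using n by (auto simp: f_def)
    then have kD: "0 \<le> k * D" by (simp add: nk re D_def)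
    have "\<bar>k\<bar> * norm e = 1" using n by (simp add: nk nr)
    then have "\<bar>k\<bar> = 1 / norm e" using e0 by (simp add: field_simps)
    then have "k = \<mu>" using kD D0 \<mu> by (auto simp: sgn_if abs_if zero_le_mult_iff split: if_splits)
    with nk show "n = \<mu> *\<^sub>R r" by simp
  qed
qed

lemma side_flux_eq_oriented:
  assumes D: "cross2 (b - a) (c - a) \<noteq> 0"
  shows "dist a b * integral {0..1} (\<lambda>t. inner (w (linepath a b t)) (outer_normal a b (convex hull {a, b, c})))
     = sgn (cross2 (b - a) (c - a)) * edge_int w a b"
proof -
  have ab: "norm (b - a) \<noteq> 0" using D by (auto simp: cross2_def)
  have eq: "inner v (r *\<^sub>R pt (e $ 2, - e $ 1)) = r * cross2 v e" for v e r
    by (simp add: inner_point cross2_def algebra_simps)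
  show ?thesis
    using ab unfolding outer_normal_eq[OF D] eq by (simp add: edge_int_def dist_norm norm_minus_commute)
qed

text \<open>
  Exchanging the end points changes the sign of both \<open>edge_int\<close> and the orientation, so the value is
  the same for either choice of the end points of the side.
\<close>

lemma side_flux_eq:
  assumes D: "cross2 (b - a) (c - a) \<noteq> 0"
  shows "side_flux w (convex hull {a, b, c}) (closed_segment a b)
     = sgn (cross2 (b - a) (c - a)) * edge_int w a b"
proof -
  let ?P = "\<lambda>ab. closed_segment a b = closed_segment (fst ab) (snd ab)"
  obtain a' b' where ab': "(SOME ab. ?P ab) = (a', b')" by force
  have "?P (SOME ab. ?P ab)" by (rule someI[of ?P "(a, b)"]) simp
  then have "?P (a', b')" unfolding ab' .
  then have "{a, b} = {a', b'}" by simp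
  then consider "a' = a" "b' = b" | "a' = b" "b' = a" by (auto simp: doubleton_eq_iff)
  then have "dist a' b' * integral {0..1} (\<lambda>t. inner (w (linepath a' b' t)) (outer_normal a' b' (convex hull {a, b, c})))
     = sgn (cross2 (b - a) (c - a)) * edge_int w a b"
  proof cases
    case 1 then show ?thesis using side_flux_eq_oriented[OF D] by simp
  next
    case 2
    have flip: "cross2 (a - b) (c - b) = - cross2 (b - a) (c - a)" by (simp add: cross2_def algebra_simps)
    then have D': "cross2 (a - b) (c - b) \<noteq> 0" using D by simp
    have "{a, b, c} = {b, a, c}" by auto
    with side_flux_eq_oriented[OF D', of w] show ?thesis
      unfolding 2 by (simp add: flip edge_int_flip[of w a b] sgn_minus)
  qed
  then show ?thesis unfolding side_flux_def ab' Let_def prod.case outer_normal_def .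
qed

definition triangle_of :: "point \<Rightarrow> point \<Rightarrow> point \<Rightarrow> point set \<Rightarrow> bool" where
  "triangle_of a b c T \<longleftrightarrow> T = convex hull {a, b, c} \<and> cross2 (b - a) (c - a) \<noteq> 0"

lemma triangle_of_rotate: "triangle_of a b c T \<Longrightarrow> triangle_of b c a T"
proof -
  have "{a, b, c} = {b, c, a}" by auto
  then show "triangle_of a b c T \<Longrightarrow> triangle_of b c a T"
    by (simp add: triangle_of_def cross2_def algebra_simps)
qed

lemma triangle_of_swap: "triangle_of a b c T \<Longrightarrow> triangle_of b a c T"
proof -
  have "{a, b, c} = {b, a, c}" by auto
  then show "triangle_of a b c T \<Longrightarrow> triangle_of b a c T"
    by (simp add: triangle_of_def cross2_def algebra_simps)
qed

lemma triangle_of_distinct: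
  assumes "triangle_of a b c T" shows "a \<noteq> b" "b \<noteq> c" "a \<noteq> c" "card {a, b, c} = 3"
proof -
  show d: "a \<noteq> b" "b \<noteq> c" "a \<noteq> c"
    using assms by (auto simp: triangle_of_def cross2_def)
  show "card {a, b, c} = 3" using d by simp
qed

lemma triangle_of_independent:
  assumes "triangle_of a b c T" shows "\<not> affine_dependent {a, b, c}"
proof
  assume "affine_dependent {a, b, c}"
  then have "collinear {a, b, c}"
    using triangle_of_distinct[OF assms] by (simp add: collinear_3_eq_affine_dependent)
  moreover have "{a, b, c} = {b, a, c}" by auto
  ultimately have "collinear {0, b - a, c - a}" using collinear_3[of b a c] by simp
  then consider "b - a = 0" | "c - a = 0" | k where "c - a = k *\<^sub>R (b - a)"
    by (auto simp: collinear_lemma)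
  then have "cross2 (b - a) (c - a) = 0"
  proof cases
    case (3 k)
    then show ?thesis by (simp only: cross2_bilinear(6,7) mult_zero_right)
  qed (simp_all add: cross2_def)
  with assms show False by (simp add: triangle_of_def)
qed

lemma simplex_triangle_of:
  assumes "2 simplex T"
  obtains a b c where "triangle_of a b c T"
proof -
  obtain C where C: "\<not> affine_dependent C" "card C = 3" "T = convex hull C"
    using assms unfolding simplex_def by force
  then obtain a b c where abc: "C = {a, b, c}" "a \<noteq> b" "a \<noteq> c" "b \<noteq> c"
    by (metis card_3_iff)
  have "cross2 (b - a) (c - a) \<noteq> 0"
  proof
    assume z: "cross2 (b - a) (c - a) = 0"
    define e f where "e = b - a" and "f = c - a"
    have e0: "inner e e \<noteq> 0" using abc by (simp add: e_def)
    have "f = (inner e f / inner e e) *\<^sub>R e"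
    proof (rule point_eqI)
      have "f $ 1 * inner e e = inner e f * e $ 1" "f $ 2 * inner e e = inner e f * e $ 2"
        using parallel_plane_coordinates[OF z[folded e_def f_def, unfolded cross2_def]] by (simp_all add: inner_point)
      then show "f $ 1 = ((inner e f / inner e e) *\<^sub>R e) $ 1" "f $ 2 = ((inner e f / inner e e) *\<^sub>R e) $ 2"
        using e0 by (simp_all add: field_simps)
    qed
    then have "c = a + (inner e f / inner e e) *\<^sub>R (b - a)" by (simp add: e_def f_def algebra_simps)
    then have "c \<in> affine hull {a, b}" unfolding affine_hull_2_alt by blast
    moreover have "C - {c} = {a, b}" using abc by auto
    ultimately have "affine_dependent C" unfolding affine_dependent_def abc(1) by auto
    with C show False by simp
  qed
  then show thesis using that[of a b c] C abc by (simp add: triangle_of_def)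
qed

lemma triangle_convex: "triangle_of a b c T \<Longrightarrow> convex T"
  and triangle_compact: "triangle_of a b c T \<Longrightarrow> compact T"
  by (auto simp: triangle_of_def finite_imp_compact_convex_hull)

lemma interior_triangle:
  assumes "triangle_of a b c T"
  shows "interior T = {u *\<^sub>R a + v *\<^sub>R b + w *\<^sub>R c |u v w. 0 < u \<and> 0 < v \<and> 0 < w \<and> u + v + w = 1}" (is "_ = ?R")
proof -
  note d = triangle_of_distinct[OF assms]
  have "interior T = {y. \<exists>u. (\<forall>x\<in>{a, b, c}. 0 < u x) \<and> sum u {a, b, c} = 1 \<and> (\<Sum>x\<in>{a, b, c}. u x *\<^sub>R x) = y}"
    using interior_convex_hull_explicit_minimal[OF triangle_of_independent[OF assms]] d assms
    by (simp add: triangle_of_def del: sum.insert)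
  also have "\<dots> = ?R"
  proof (intro subset_antisym subsetI)
    fix y assume "y \<in> {y. \<exists>u. (\<forall>x\<in>{a, b, c}. 0 < u x) \<and> sum u {a, b, c} = 1 \<and> (\<Sum>x\<in>{a, b, c}. u x *\<^sub>R x) = y}"
    then obtain u where "0 < u a" "0 < u b" "0 < u c" "u a + (u b + u c) = 1" "u a *\<^sub>R a + (u b *\<^sub>R b + u c *\<^sub>R c) = y"
      using d by auto
    then have "y = u a *\<^sub>R a + u b *\<^sub>R b + u c *\<^sub>R c \<and> 0 < u a \<and> 0 < u b \<and> 0 < u c \<and> u a + u b + u c = 1"
      by (simp add: add.assoc)
    then show "y \<in> ?R" by blast
  next
    fix y assume "y \<in> ?R"
    then obtain u v w where "y = u *\<^sub>R a + v *\<^sub>R b + w *\<^sub>R c" "0 < u" "0 < v" "0 < w" "u + v + w = 1" by blast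
    then show "y \<in> {y. \<exists>u. (\<forall>x\<in>{a, b, c}. 0 < u x) \<and> sum u {a, b, c} = 1 \<and> (\<Sum>x\<in>{a, b, c}. u x *\<^sub>R x) = y}"
      using d by (intro CollectI exI[of _ "\<lambda>x. if x = a then u else if x = b then v else w"]) auto
  qed
  finally show ?thesis .
qed

lemma interior_triangleI:
  assumes "triangle_of a b c T" "0 < u" "0 < v" "0 < w" "u + v + w = 1" "y = u *\<^sub>R a + v *\<^sub>R b + w *\<^sub>R c"
  shows "y \<in> interior T"
  unfolding interior_triangle[OF assms(1)] using assms(2-) by blast

lemma interior_triangle_nonempty: "triangle_of a b c T \<Longrightarrow> interior T \<noteq> {}"
  using interior_triangleI[of a b c T "1/3" "1/3" "1/3"] by auto

lemma closure_interior_triangle: "triangle_of a b c T \<Longrightarrow> closure (interior T) = T"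
  by (metis convex_closure_interior interior_triangle_nonempty triangle_convex triangle_compact
      compact_imp_closed closure_closed)

lemma facet_of_triangle:
  assumes "triangle_of a b c T"
  shows "S facet_of T \<longleftrightarrow> S \<in> {closed_segment a b, closed_segment b c, closed_segment c a}"
proof -
  note d = triangle_of_distinct[OF assms]
  have eqs: "{a, b, c} - {a} = {b, c}" "{a, b, c} - {b} = {c, a}" "{a, b, c} - {c} = {a, b}"
    using d by auto
  have "S facet_of T \<longleftrightarrow> S \<noteq> {} \<and> (\<exists>u\<in>{a, b, c}. S = convex hull ({a, b, c} - {u}))"
    using facet_of_convex_hull_affine_independent[OF triangle_of_independent[OF assms], of S] assms
    unfolding triangle_of_def by blast
  also have "\<dots> \<longleftrightarrow> S \<noteq> {} \<and> (S = closed_segment b c \<or> S = closed_segment c a \<or> S = closed_segment a b)"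
    by (simp only: ball_simps bex_simps eqs segment_convex_hull simp_thms)
  also have "\<dots> \<longleftrightarrow> S \<in> {closed_segment a b, closed_segment b c, closed_segment c a}"
    using ends_in_segment by (simp only: insert_iff empty_iff) blast
  finally show ?thesis .
qed

lemma facet_representation:
  assumes T: "triangle_of a b c T" and S: "S facet_of T"
  obtains x y z where "triangle_of x y z T" "S = closed_segment x y"
proof -
  note T2 = triangle_of_rotate[OF T]
  note T3 = triangle_of_rotate[OF T2]
  consider "S = closed_segment a b" | "S = closed_segment b c" | "S = closed_segment c a"
    using S facet_of_triangle[OF T] by (simp only: insert_iff empty_iff) blast
  then show thesis using that[OF T] that[OF T2] that[OF T3] by cases
qed

lemma facet_representation_ends:
  assumes "triangle_of a b c T" "closed_segment x y facet_of T"
  obtains z where "triangle_of x y z T"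
proof -
  obtain x' y' z' where t: "triangle_of x' y' z' T" "closed_segment x y = closed_segment x' y'"
    using facet_representation[OF assms] by metis
  then have "{x, y} = {x', y'}" by simp
  then have "triangle_of x y z' T" using t triangle_of_swap by (auto simp: doubleton_eq_iff)
  then show thesis by (rule that)
qed

lemma divergence_triangle_facets:
  assumes T: "triangle_of a b c T" and p: "C1_map p p'"
  shows "integral T (\<lambda>x. trace (matrix (p' x))) = (\<Sum>S | S facet_of T. side_flux p T S)"
proof -
  note d = triangle_of_distinct[OF T]
  have "{S. S facet_of T} = {closed_segment a b, closed_segment b c, closed_segment c a}"
    using facet_of_triangle[OF T] by blast
  moreover have "closed_segment a b \<noteq> closed_segment b c" "closed_segment a b \<noteq> closed_segment c a"
    "closed_segment b c \<noteq> closed_segment c a"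
    using d by (auto simp: doubleton_eq_iff)
  ultimately have "(\<Sum>S | S facet_of T. side_flux p T S) =
    side_flux p T (closed_segment a b) + side_flux p T (closed_segment b c) + side_flux p T (closed_segment c a)"
    by simp
  moreover have fl: "side_flux p T (closed_segment x y) = sgn (cross2 (y - x) (z - x)) * edge_int p x y"
    if "triangle_of x y z T" for x y z
    using that side_flux_eq by (auto simp: triangle_of_def)
  moreover have cyc: "cross2 (c - b) (a - b) = cross2 (b - a) (c - a)" "cross2 (a - c) (b - c) = cross2 (b - a) (c - a)"
    by (simp_all add: cross2_def algebra_simps)
  ultimately have "(\<Sum>S | S facet_of T. side_flux p T S)
    = sgn (cross2 (b - a) (c - a)) * (edge_int p a b + edge_int p b c + edge_int p c a)"
    unfolding fl[OF T] fl[OF triangle_of_rotate[OF T]] fl[OF triangle_of_rotate[OF triangle_of_rotate[OF T]]]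
    by (simp add: distrib_left)
  moreover have "T = convex hull {a, b, c}" "cross2 (b - a) (c - a) \<noteq> 0" using T by (auto simp: triangle_of_def)
  ultimately show ?thesis using divergence_triangle[OF p, of b a c] by simp
qed

definition tri_mesh :: "point set set \<Rightarrow> bool" where
  "tri_mesh M \<longleftrightarrow> finite M \<and> (\<forall>T\<in>M. 2 simplex T) \<and> (\<forall>T\<in>M. \<forall>T'\<in>M. (T \<inter> T') face_of T)"

lemma tri_mesh_subset: "tri_mesh M \<Longrightarrow> N \<subseteq> M \<Longrightarrow> tri_mesh N"
  unfolding tri_mesh_def by (auto intro: finite_subset)

lemma tri_mesh_triangle:
  assumes "tri_mesh M" "T \<in> M"
  obtains a b c where "triangle_of a b c T"
  using assms simplex_triangle_of unfolding tri_mesh_def by blast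

lemma tri_mesh_face:
  assumes "tri_mesh M" "T \<in> M" "T' \<in> M"
  shows "(T \<inter> T') face_of T" "(T \<inter> T') face_of T'"
  using assms unfolding tri_mesh_def by (auto simp: Int_commute[of T])

lemma tri_mesh_closed: "tri_mesh M \<Longrightarrow> T \<in> M \<Longrightarrow> closed T"
  using tri_mesh_triangle triangle_compact compact_imp_closed by metis

lemma triangle_face_meets_interior:
  assumes "triangle_of a b c T" "F face_of T" "x \<in> F" "x \<in> interior T"
  shows "F = T"
proof -
  have "rel_interior T = interior T"
    using interior_triangle_nonempty[OF assms(1)] by (rule rel_interior_nonempty_interior)
  then have "T \<subseteq> F" using assms by (intro subset_of_face_of[OF assms(2)]) auto
  with face_of_imp_subset[OF assms(2)] show ?thesis by auto
qed

lemma tri_mesh_interior_Int: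
  assumes "tri_mesh M" "T \<in> M" "T' \<in> M" "x \<in> interior T" "x \<in> T'"
  shows "T = T'"
proof -
  obtain a b c where T: "triangle_of a b c T" by (rule tri_mesh_triangle[OF assms(1,2)])
  obtain a' b' c' where T': "triangle_of a' b' c' T'" by (rule tri_mesh_triangle[OF assms(1,3)])
  have TT: "T \<inter> T' = T"
    using triangle_face_meets_interior[OF T tri_mesh_face(1)[OF assms(1-3)], of x] assms interior_subset by auto
  then have "interior T \<subseteq> interior T'" by (intro interior_mono) auto
  then have "T \<inter> T' = T'"
    using triangle_face_meets_interior[OF T' tri_mesh_face(2)[OF assms(1-3)], of x] assms interior_subset by auto
  with TT show ?thesis by auto
qed

text \<open>
  Start at the midpoint of the common side and move by a small \<open>\<epsilon>\<close> towards \<open>c\<close>. If \<open>c\<close> and \<open>c'\<close> lie on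
  the same side of the line through \<open>a\<close> and \<open>b\<close>, all barycentric coordinates are positive in both
  triangles.
\<close>

lemma same_side_triangles_overlap:
  assumes T: "triangle_of a b c T" and T': "triangle_of a b c' T'"
    and side: "0 < cross2 (b - a) (c - a) * cross2 (b - a) (c' - a)"
  shows "\<exists>y. y \<in> interior T \<and> y \<in> T'"
proof -
  define D D' where "D = cross2 (b - a) (c - a)" and "D' = cross2 (b - a) (c' - a)"
  have D: "D \<noteq> 0" "D' \<noteq> 0" using side by (auto simp: D_def D'_def)
  define \<gamma> where "\<gamma> = D / D'"
  have \<gamma>: "0 < \<gamma>" using side D by (simp add: \<gamma>_def D_def[symmetric] D'_def[symmetric] zero_less_divide_iff zero_less_mult_iff)
  \<comment> \<open>Barycentric coordinates of \<open>c\<close> in the second triangle.\<close>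
  define \<beta> where "\<beta> = cross2 (c - a) (c' - a) / D'"
  have c: "c = a + \<beta> *\<^sub>R (b - a) + \<gamma> *\<^sub>R (c' - a)"
  proof (rule point_eqI)
    have eq: "D' * (c - a) $ 1 = cross2 (c - a) (c' - a) * (b - a) $ 1 + D * (c' - a) $ 1"
      "D' * (c - a) $ 2 = cross2 (c - a) (c' - a) * (b - a) $ 2 + D * (c' - a) $ 2"
      unfolding D_def D'_def cross2_def by (rule Cramer_plane_coordinates)+
    have "\<beta> * (b - a) $ i + \<gamma> * (c' - a) $ i
      = (cross2 (c - a) (c' - a) * (b - a) $ i + D * (c' - a) $ i) / D'" for i
      by (simp add: \<beta>_def \<gamma>_def add_divide_distrib)
    from this[of 1] this[of 2] have "\<beta> * (b - a) $ 1 + \<gamma> * (c' - a) $ 1 = (c - a) $ 1" "\<beta> * (b - a) $ 2 + \<gamma> * (c' - a) $ 2 = (c - a) $ 2"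
      unfolding eq[symmetric] using D(2) by (simp_all del: vector_minus_component)
    then show "c $ 1 = (a + \<beta> *\<^sub>R (b - a) + \<gamma> *\<^sub>R (c' - a)) $ 1" "c $ 2 = (a + \<beta> *\<^sub>R (b - a) + \<gamma> *\<^sub>R (c' - a)) $ 2"
      by simp_all
  qed
  define \<epsilon> where "\<epsilon> = 1 / (4 * (1 + \<bar>\<beta>\<bar> + \<gamma>))"
  have den: "0 < 1 + \<bar>\<beta>\<bar> + \<gamma>" using \<gamma> by linarith
  have "\<epsilon> * (1 + \<bar>\<beta>\<bar> + \<gamma>) = 1 / 4" using den by (simp add: \<epsilon>_def)
  then have e4: "\<epsilon> + \<epsilon> * \<bar>\<beta>\<bar> + \<epsilon> * \<gamma> = 1 / 4" by (simp add: algebra_simps)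
  have \<epsilon>: "0 < \<epsilon>" using den by (simp add: \<epsilon>_def)
  have b1: "- (\<epsilon> * \<bar>\<beta>\<bar>) \<le> \<epsilon> * \<beta>" "\<epsilon> * \<beta> \<le> \<epsilon> * \<bar>\<beta>\<bar>"
    using mult_left_mono[of "- \<bar>\<beta>\<bar>" \<beta> \<epsilon>] mult_left_mono[of \<beta> "\<bar>\<beta>\<bar>" \<epsilon>] \<epsilon> by auto
  have g0: "0 < \<epsilon> * \<gamma>" using \<epsilon> \<gamma> by simp
  have b0: "0 \<le> \<epsilon> * \<bar>\<beta>\<bar>" using \<epsilon> by simp
  define y where "y = (1/2 - \<epsilon>) *\<^sub>R a + (1/2) *\<^sub>R b + \<epsilon> *\<^sub>R c"
  have "y \<in> interior T"
  proof (rule interior_triangleI[OF T])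
    show "0 < 1/2 - \<epsilon>" using e4 b0 g0 by linarith
  qed (use \<epsilon> in \<open>simp_all add: y_def\<close>)
  moreover have "y \<in> interior T'"
  proof (rule interior_triangleI[OF T'])
    show "0 < 1/2 - \<epsilon> * \<beta> - \<epsilon> * \<gamma>" using e4 b0 b1 g0 \<epsilon> by linarith
    show "0 < 1/2 + \<epsilon> * \<beta>" using e4 b0 b1 g0 \<epsilon> by linarith
    show "0 < \<epsilon> * \<gamma>" by (rule g0)
    show "y = (1/2 - \<epsilon> * \<beta> - \<epsilon> * \<gamma>) *\<^sub>R a + (1/2 + \<epsilon> * \<beta>) *\<^sub>R b + (\<epsilon> * \<gamma>) *\<^sub>R c'"
      unfolding y_def by (subst c) (simp add: algebra_simps)
  qed simp
  ultimately show ?thesis using interior_subset by auto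
qed

lemma tri_mesh_opposite_sides:
  assumes M: "tri_mesh M" "T \<in> M" "T' \<in> M" "T \<noteq> T'"
    and T: "triangle_of a b c T" and T': "triangle_of a b c' T'"
  shows "cross2 (b - a) (c - a) * cross2 (b - a) (c' - a) < 0"
proof (rule ccontr)
  assume "\<not> ?thesis"
  then have "0 < cross2 (b - a) (c - a) * cross2 (b - a) (c' - a)"
    using T T' by (auto simp: triangle_of_def not_less less_le)
  with same_side_triangles_overlap[OF T T'] tri_mesh_interior_Int[OF M(1-3)] M(4) show False by blast
qed

text \<open>
  Two elements with a common side lie on opposite sides of it, so they have opposite orientations
  when their vertices are listed starting with the end points of that side.
\<close>

lemma tri_mesh_flux_cancel:
  assumes M: "tri_mesh M" "T \<in> M" "T' \<in> M" "T \<noteq> T'" and S: "S facet_of T" "S facet_of T'"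
  shows "side_flux w T' S = - side_flux w T S"
proof -
  obtain a0 b0 c0 where "triangle_of a0 b0 c0 T" by (rule tri_mesh_triangle[OF M(1,2)])
  then obtain a b c where T: "triangle_of a b c T" "S = closed_segment a b"
    using facet_representation[OF _ S(1)] by metis
  obtain a0 b0 c0 where "triangle_of a0 b0 c0 T'" by (rule tri_mesh_triangle[OF M(1,3)])
  then obtain c' where T': "triangle_of a b c' T'"
    using facet_representation_ends[of _ _ _ T' a b] S(2) T(2) by metis
  have "sgn (cross2 (b - a) (c' - a)) = - sgn (cross2 (b - a) (c - a))"
    using tri_mesh_opposite_sides[OF M T(1) T'] by (auto simp: sgn_if mult_less_0_iff)
  moreover have "side_flux w T S = sgn (cross2 (b - a) (c - a)) * edge_int w a b"
    "side_flux w T' S = sgn (cross2 (b - a) (c' - a)) * edge_int w a b"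
    using T T' side_flux_eq by (auto simp: triangle_of_def)
  ultimately show ?thesis by simp
qed

text \<open>
  A line has only two sides: among three triangles with a common side two would overlap.
\<close>

lemma tri_mesh_facet_unique:
  assumes M: "tri_mesh M" "T \<in> M" "T1 \<in> M" "T2 \<in> M" "T1 \<noteq> T" "T2 \<noteq> T"
    and S: "S facet_of T" "S facet_of T1" "S facet_of T2"
  shows "T1 = T2"
proof (rule ccontr)
  assume ne: "T1 \<noteq> T2"
  obtain a0 b0 c0 where "triangle_of a0 b0 c0 T" by (rule tri_mesh_triangle[OF M(1,2)])
  then obtain a b c where T: "triangle_of a b c T" "S = closed_segment a b"
    using facet_representation[OF _ S(1)] by metis
  obtain a1 b1 c1 where "triangle_of a1 b1 c1 T1" by (rule tri_mesh_triangle[OF M(1,3)])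
  then obtain d1 where T1: "triangle_of a b d1 T1"
    using facet_representation_ends[of _ _ _ T1 a b] S(2) T(2) by metis
  obtain a2 b2 c2 where "triangle_of a2 b2 c2 T2" by (rule tri_mesh_triangle[OF M(1,4)])
  then obtain d2 where T2: "triangle_of a b d2 T2"
    using facet_representation_ends[of _ _ _ T2 a b] S(3) T(2) by metis
  show False
    using tri_mesh_opposite_sides[OF M(1,2,3) M(5)[symmetric] T(1) T1]
      tri_mesh_opposite_sides[OF M(1,2,4) M(6)[symmetric] T(1) T2]
      tri_mesh_opposite_sides[OF M(1,3,4) ne T1 T2]
    by (auto simp: mult_less_0_iff)
qed

lemma triangle_subset_closure_interior_Union:
  assumes "tri_mesh M" "T \<in> M"
  shows "T \<subseteq> closure (interior (\<Union>M))"
proof -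
  obtain a b c where "triangle_of a b c T" by (rule tri_mesh_triangle[OF assms])
  then have "T = closure (interior T)" by (simp add: closure_interior_triangle)
  also have "\<dots> \<subseteq> closure (interior (\<Union>M))" using assms(2) by (intro closure_mono interior_mono) auto
  finally show ?thesis .
qed

text \<open>
  A side that is not contained in the boundary has a relatively interior point \<open>y\<close> with a
  neighbourhood covered by the mesh. Beyond the side the covering must be by other triangles, and by
  closedness one of them contains \<open>y\<close>. Its intersection with \<open>T\<close> is a proper face of \<open>T\<close> meeting the
  relative interior of the side, hence is the side itself.
\<close>

lemma tri_mesh_facet_neighbour:
  assumes M: "tri_mesh M" "T \<in> M" and S: "S facet_of T" and nb: "\<not> S \<subseteq> frontier (interior (\<Union>M))"
  shows "\<exists>T'\<in>M. T' \<noteq> T \<and> S facet_of T'"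
proof -
  obtain a0 b0 c0 where "triangle_of a0 b0 c0 T" by (rule tri_mesh_triangle[OF M])
  then obtain a b c where T: "triangle_of a b c T" and Sab: "S = closed_segment a b"
    using facet_representation[OF _ S] by metis
  define U where "U = interior (\<Union>M)"
  have "open U" by (simp add: U_def)
  have ST: "S \<subseteq> T" using S facet_of_imp_subset by blast
  obtain y0 where "y0 \<in> S" "y0 \<notin> frontier U" using nb by (auto simp: U_def)
  moreover have "y0 \<in> closure U" using ST \<open>y0 \<in> S\<close> triangle_subset_closure_interior_Union[OF M] by (auto simp: U_def)
  ultimately have y0: "y0 \<in> S" "y0 \<in> U" using \<open>open U\<close> by (auto simp: frontier_def interior_open)
  have ab: "a \<noteq> b" using triangle_of_distinct[OF T] by simp
  have "closure (open_segment a b) = closed_segment a b" using ab by (simp add: closure_open_segment)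
  then have "U \<inter> open_segment a b \<noteq> {}"
    using y0 Sab open_Int_closure_eq_empty[OF \<open>open U\<close>, of "open_segment a b"] by auto
  then obtain y where y: "y \<in> U" "y \<in> open_segment a b" by auto
  obtain t where t: "0 < t" "t < 1" "y = (1 - t) *\<^sub>R a + t *\<^sub>R b" using y(2) by (auto simp: in_segment)
  \<comment> \<open>Points close to \<open>y\<close> on the other side of the line through \<open>a\<close> and \<open>b\<close> lie in other triangles.\<close>
  define D where "D = cross2 (b - a) (c - a)"
  have D0: "D \<noteq> 0" using T by (simp add: triangle_of_def D_def)
  define z where "z s = y - s *\<^sub>R (c - a)" for s :: real
  have znT: "z s \<notin> T" if "0 < s" for s
  proof
    assume "z s \<in> T"
    then have "z s \<in> convex hull {a, b, c}" using T by (simp add: triangle_of_def)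
    then obtain u v where "z s = a + u *\<^sub>R (b - a) + v *\<^sub>R (c - a)" "0 \<le> v"
      unfolding convex_hull_3_alt by blast
    moreover have "z s = a + t *\<^sub>R (b - a) - s *\<^sub>R (c - a)" by (simp add: z_def t algebra_simps)
    ultimately have "t *\<^sub>R (b - a) - s *\<^sub>R (c - a) = u *\<^sub>R (b - a) + v *\<^sub>R (c - a)"
      by (simp add: add.assoc diff_eq_eq)
    then have "cross2 (b - a) (t *\<^sub>R (b - a) - s *\<^sub>R (c - a)) = cross2 (b - a) (u *\<^sub>R (b - a) + v *\<^sub>R (c - a))" by simp
    moreover have "cross2 e (t *\<^sub>R e - s *\<^sub>R f) = - s * cross2 e f" "cross2 e (u *\<^sub>R e + v *\<^sub>R f) = v * cross2 e f"
      for e f by (simp_all add: cross2_def algebra_simps)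
    ultimately have "- s * D = v * D" unfolding D_def by metis
    then have "- s = v" using D0 mult_right_cancel by metis
    with that \<open>0 \<le> v\<close> show False by simp
  qed
  have zlim: "(z \<longlongrightarrow> y) (at_right 0)"
    unfolding z_def by (auto intro!: tendsto_eq_intros)
  have "\<forall>\<^sub>F s in at_right 0. z s \<in> U" using topological_tendstoD[OF zlim \<open>open U\<close> y(1)] .
  moreover have "\<forall>\<^sub>F s in at_right (0::real). 0 < s" by (simp add: eventually_at_right_less)
  ultimately have ev: "\<forall>\<^sub>F s in at_right 0. z s \<in> \<Union>(M - {T})"
  proof eventually_elim
    fix s :: real assume "z s \<in> U" "0 < s"
    moreover have "U \<subseteq> \<Union>M" by (simp add: U_def interior_subset)
    ultimately show "z s \<in> \<Union>(M - {T})" using znT[of s] by blast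
  qed
  have "closed (\<Union>(M - {T}))"
    using M tri_mesh_closed by (intro closed_Union) (auto simp: tri_mesh_def)
  then have "y \<in> \<Union>(M - {T})"
    by (rule Lim_in_closed_set[OF _ ev _ zlim]) simp
  then obtain T' where T': "T' \<in> M" "T' \<noteq> T" "y \<in> T'" by auto
  have "S face_of T" using S by (simp add: facet_of_def)
  have I: "(T \<inter> T') face_of T" "(T \<inter> T') face_of T'" using tri_mesh_face[OF M T'(1)] .
  obtain a1 b1 c1 where T1: "triangle_of a1 b1 c1 T'" by (rule tri_mesh_triangle[OF M(1) T'(1)])
  have aff: "aff_dim T = 2" "aff_dim T' = 2"
    using interior_triangle_nonempty[OF T] interior_triangle_nonempty[OF T1] by (simp_all add: aff_dim_nonempty_interior)
  have "S \<subseteq> T \<inter> T'"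
  proof (rule subset_of_face_of[OF I(1) ST])
    have "y \<in> rel_interior S" using y(2) ab by (simp add: Sab rel_interior_closed_segment)
    moreover have "y \<in> T \<inter> T'" using y(2) ST T'(3) Sab by (auto simp: open_segment_def)
    ultimately show "T \<inter> T' \<inter> rel_interior S \<noteq> {}" by auto
  qed
  have SI: "S face_of (T \<inter> T')" by (rule face_of_subset[OF \<open>S face_of T\<close> \<open>S \<subseteq> T \<inter> T'\<close>]) auto
  have neT: "T \<inter> T' \<noteq> T"
  proof
    assume "T \<inter> T' = T"
    then have "T \<subseteq> T'" by auto
    obtain x where "x \<in> interior T" using interior_triangle_nonempty[OF T] by auto
    then have "T = T'" using tri_mesh_interior_Int[OF M T'(1)] \<open>T \<subseteq> T'\<close> interior_subset by blast
    with T'(2) show False by simp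
  qed
  have "aff_dim (T \<inter> T') < aff_dim T" by (rule face_of_aff_dim_lt[OF triangle_convex[OF T] I(1) neT])
  moreover have "aff_dim S = 1" using S aff by (simp add: facet_of_def)
  ultimately have "\<not> aff_dim S < aff_dim (T \<inter> T')" using aff by simp
  then have "S = T \<inter> T'"
    using face_of_aff_dim_lt[OF _ SI] face_of_imp_convex[OF I(1)] triangle_convex[OF T] by blast
  then have "S facet_of T'" using I(2) \<open>aff_dim S = 1\<close> aff y0 by (auto simp: facet_of_def)
  with T' show ?thesis by blast
qed

lemma finite_facets:
  assumes "tri_mesh M" "T \<in> M" shows "finite {S. S facet_of T}"
proof -
  obtain a b c where "triangle_of a b c T" by (rule tri_mesh_triangle[OF assms])
  from facet_of_triangle[OF this]
  have "{S. S facet_of T} \<subseteq> {closed_segment a b, closed_segment b c, closed_segment c a}" by blast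
  then show ?thesis by (rule finite_subset) simp
qed

text \<open>
  Passing from a triangle to its neighbour across a side is an involution on the pairs (triangle,
  side) off the boundary, and it changes the sign of the flux. So these pairs contribute their own
  negative, that is, nothing.
\<close>

lemma flux_sum_over_boundary:
  assumes M: "tri_mesh M"
  shows "(\<Sum>T\<in>M. \<Sum>S | S facet_of T. side_flux w T S)
    = (\<Sum>(T, S)\<in>{(T, S). T \<in> M \<and> S facet_of T \<and> S \<subseteq> frontier (interior (\<Union>M))}. side_flux w T S)"
proof -
  define A where "A = (SIGMA T:M. {S. S facet_of T})"
  define B where "B = {(T, S). T \<in> M \<and> S facet_of T \<and> S \<subseteq> frontier (interior (\<Union>M))}"
  have fin: "finite A" unfolding A_def using M finite_facets[OF M]
    by (intro finite_SigmaI) (auto simp: tri_mesh_def)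
  have BA: "B \<subseteq> A" by (auto simp: A_def B_def)
  \<comment> \<open>The neighbour of \<open>T\<close> across \<open>S\<close>.\<close>
  define other where "other T S = (THE T'. T' \<in> M \<and> T' \<noteq> T \<and> S facet_of T')" for T S
  have other: "other T S \<in> M" "other T S \<noteq> T" "S facet_of other T S" "other (other T S) S = T"
    if TS: "(T, S) \<in> A - B" for T S
  proof -
    have T: "T \<in> M" "S facet_of T" "\<not> S \<subseteq> frontier (interior (\<Union>M))" using TS by (auto simp: A_def B_def)
    obtain T' where T': "T' \<in> M" "T' \<noteq> T" "S facet_of T'" using tri_mesh_facet_neighbour[OF M T] by blast
    have "other T S = T'" unfolding other_def
      using T T' tri_mesh_facet_unique[OF M T(1)] by (intro the_equality) auto
    moreover have "other T' S = T" unfolding other_def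
      using T T' tri_mesh_facet_unique[OF M T'(1)] by (intro the_equality) auto
    ultimately show "other T S \<in> M" "other T S \<noteq> T" "S facet_of other T S" "other (other T S) S = T"
      using T T' by auto
  qed
  define \<sigma> where "\<sigma> = (\<lambda>(T, S). (other T S, S))"
  have \<sigma>: "\<sigma> x \<in> A - B" "\<sigma> (\<sigma> x) = x"
    "(case \<sigma> x of (T, S) \<Rightarrow> - side_flux w T S) = (case x of (T, S) \<Rightarrow> side_flux w T S)"
    if x: "x \<in> A - B" for x
  proof -
    obtain T S where TS: "x = (T, S)" by (cases x)
    note o = other[of T S, OF x[unfolded TS]]
    show "\<sigma> (\<sigma> x) = x" using o by (simp add: TS \<sigma>_def)
    show "\<sigma> x \<in> A - B" using o x unfolding TS \<sigma>_def A_def B_def by simp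
    have "side_flux w (other T S) S = - side_flux w T S"
      using o x by (intro tri_mesh_flux_cancel[OF M]) (auto simp: TS A_def)
    then show "(case \<sigma> x of (T, S) \<Rightarrow> - side_flux w T S) = (case x of (T, S) \<Rightarrow> side_flux w T S)"
      by (simp add: TS \<sigma>_def)
  qed
  have "(\<Sum>(T, S)\<in>A - B. side_flux w T S) = (\<Sum>(T, S)\<in>A - B. - side_flux w T S)"
    by (rule sum.reindex_bij_witness[where i = \<sigma> and j = \<sigma>]) (fact \<sigma>)+
  then have "(\<Sum>(T, S)\<in>A - B. side_flux w T S) = 0"
    by (simp add: sum_negf case_prod_unfold)
  then have "(\<Sum>(T, S)\<in>A. side_flux w T S) = (\<Sum>(T, S)\<in>B. side_flux w T S)"
    using sum.subset_diff[OF BA fin, of "\<lambda>(T, S). side_flux w T S"] by simp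
  moreover have "(\<Sum>T\<in>M. \<Sum>S | S facet_of T. side_flux w T S) = (\<Sum>(T, S)\<in>A. side_flux w T S)"
    unfolding A_def using M finite_facets[OF M] by (intro sum.Sigma) (auto simp: tri_mesh_def)
  ultimately show ?thesis by (simp add: B_def)
qed

section \<open>Piecewise smooth functions and the bilinear forms\<close>

text \<open>
  Pressures may jump across the sides, so only the values inside the elements matter. A continuous
  representative on the whole plane, hence on the compact element, makes integrability automatic.
\<close>

definition pwc :: "point set set \<Rightarrow> (point \<Rightarrow> real) \<Rightarrow> bool" where
  "pwc M f \<longleftrightarrow> (\<forall>T\<in>M. \<exists>g. continuous_on UNIV g \<and> (\<forall>y\<in>interior T. f y = g y))"

text \<open>
  In contrast to \<open>pwc\<close> the representative must agree on the closed element, because the values on the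
  sides enter the fluxes.
\<close>

definition pc1 :: "point set set \<Rightarrow> (point \<Rightarrow> point) \<Rightarrow> bool" where
  "pc1 M u \<longleftrightarrow> (\<forall>T\<in>M. \<exists>p p'. C1_map p p' \<and> (\<forall>y\<in>T. u y = p y))"

text \<open>
  Both the domain and its subdomains are of this form.
\<close>

definition region :: "point set set \<Rightarrow> point set" where
  "region M = interior (\<Union>M)"

abbreviation jac :: "(point \<Rightarrow> point) \<Rightarrow> point \<Rightarrow> real^2^2" where
  "jac u y \<equiv> jacobian u (at y)"

lemma pwc_subset: "pwc M f \<Longrightarrow> N \<subseteq> M \<Longrightarrow> pwc N f"
  unfolding pwc_def by blast

lemma pc1_subset: "pc1 M u \<Longrightarrow> N \<subseteq> M \<Longrightarrow> pc1 N u"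
  unfolding pc1_def by blast

lemma pwc_const: "pwc M (\<lambda>_. c)"
  unfolding pwc_def by (auto intro!: exI[of _ "\<lambda>_. c"])

lemma pwc_add:
  assumes "pwc M f" "pwc M g" shows "pwc M (\<lambda>y. f y + g y)"
  unfolding pwc_def
proof
  fix T assume "T \<in> M"
  with assms obtain p q where "continuous_on UNIV p" "\<forall>y\<in>interior T. f y = p y"
    "continuous_on UNIV q" "\<forall>y\<in>interior T. g y = q y" unfolding pwc_def by metis
  then show "\<exists>h. continuous_on UNIV h \<and> (\<forall>y\<in>interior T. f y + g y = h y)"
    by (intro exI[of _ "\<lambda>y. p y + q y"]) (auto intro: continuous_intros)
qed

lemma pwc_mult:
  assumes "pwc M f" "pwc M g" shows "pwc M (\<lambda>y. f y * g y)"
  unfolding pwc_def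
proof
  fix T assume "T \<in> M"
  with assms obtain p q where "continuous_on UNIV p" "\<forall>y\<in>interior T. f y = p y"
    "continuous_on UNIV q" "\<forall>y\<in>interior T. g y = q y" unfolding pwc_def by metis
  then show "\<exists>h. continuous_on UNIV h \<and> (\<forall>y\<in>interior T. f y * g y = h y)"
    by (intro exI[of _ "\<lambda>y. p y * q y"]) (auto intro: continuous_intros)
qed

lemma pwc_cmult: "pwc M f \<Longrightarrow> pwc M (\<lambda>y. c * f y)"
  by (rule pwc_mult[OF pwc_const])

lemma pwc_sum:
  fixes n :: nat
  shows "(\<And>k. k < n \<Longrightarrow> pwc M (f k)) \<Longrightarrow> pwc M (\<lambda>y. \<Sum>k<n. f k y)"
  by (induction n) (simp_all add: pwc_const pwc_add)

text \<open>
  The part of the region outside the open elements consists of points on the sides, and the boundary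
  of a convex set is a null set. Integrals may therefore be computed element by element.
\<close>

lemma negligible_region_diff:
  assumes M: "tri_mesh M"
  shows "negligible (region M - (\<Union>T\<in>M. interior T))"
proof -
  have "negligible (\<Union>T\<in>M. frontier T)"
  proof (rule negligible_Union)
    show "finite ((\<lambda>T. frontier T) ` M)" using M by (simp add: tri_mesh_def)
    fix F assume "F \<in> (\<lambda>T. frontier T) ` M"
    then show "negligible F"
      using tri_mesh_triangle[OF M] triangle_convex negligible_convex_frontier by (metis imageE)
  qed
  moreover have "region M - (\<Union>T\<in>M. interior T) \<subseteq> (\<Union>T\<in>M. frontier T)"
  proof
    fix y assume y: "y \<in> region M - (\<Union>T\<in>M. interior T)"
    then obtain T where "T \<in> M" "y \<in> T" using interior_subset[of "\<Union>M"] by (auto simp: region_def)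
    then show "y \<in> (\<Union>T\<in>M. frontier T)" using y closure_subset by (auto simp: frontier_def)
  qed
  ultimately show ?thesis by (rule negligible_subset)
qed

lemma interior_subset_region: "T \<in> M \<Longrightarrow> interior T \<subseteq> region M"
  unfolding region_def by (intro interior_mono) auto

lemma region_mono: "N \<subseteq> M \<Longrightarrow> region N \<subseteq> region M"
  unfolding region_def by (intro interior_mono) auto

lemma open_region: "open (region M)"
  by (simp add: region_def)

lemma pwc_set_integrable_interior:
  assumes M: "tri_mesh M" and f: "pwc M f" and T: "T \<in> M"
  shows "set_integrable lebesgue (interior T) f"
proof -
  obtain a b c where abc: "triangle_of a b c T" by (rule tri_mesh_triangle[OF M T])
  obtain g where g: "continuous_on UNIV g" "\<forall>y\<in>interior T. f y = g y" using f T by (auto simp: pwc_def)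
  have "set_integrable lebesgue T g"
    by (intro set_integrable_lebesgue_compact triangle_compact[OF abc]) (rule continuous_on_subset[OF g(1)], simp)
  then have "set_integrable lebesgue (interior T) g"
    by (rule set_integrable_subset) (auto simp: interior_subset)
  then show ?thesis using g(2) by (subst set_integrable_cong[OF refl refl, of _ _ g]) auto
qed

lemma pwc_integral:
  assumes M: "tri_mesh M" and f: "pwc M f"
  shows "set_integrable lebesgue (region M) f"
    and "(LINT y:region M|lebesgue. f y) = (\<Sum>T\<in>M. LINT y:interior T|lebesgue. f y)"
proof -
  define U where "U = (\<Union>T\<in>M. interior T)"
  have fin: "finite M" using M by (simp add: tri_mesh_def)
  note I = pwc_set_integrable_interior[OF M f]
  have fU: "set_integrable lebesgue U f" unfolding U_def
    by (rule set_integrable_UN[OF fin]) (auto intro: I)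
  have UR: "U \<subseteq> region M" unfolding U_def using interior_subset_region by blast
  have neg: "negligible ((U - region M) \<union> (region M - U))"
    using negligible_region_diff[OF M] UR by (simp add: U_def[symmetric] Diff_eq_empty_iff[THEN iffD2])
  have neg': "negligible {x \<in> U - region M. f x \<noteq> 0}" "negligible {x \<in> region M - U. f x \<noteq> 0}"
    by (rule negligible_subset[OF neg], blast)+
  show R: "set_integrable lebesgue (region M) f"
    using fU absolutely_integrable_spike_set_eq[OF neg'] by blast
  have "(LINT y:region M|lebesgue. f y) = integral (region M) f"
    by (rule set_lebesgue_integral_eq_integral(2)[OF R])
  also have "\<dots> = integral U f" by (rule integral_spike_set[OF neg'(2) neg'(1)])
  also have "\<dots> = (\<Sum>T\<in>M. integral (interior T) f)" unfolding U_def
  proof (rule integral_unique, rule has_integral_UN[OF fin])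
    show "(f has_integral integral (interior T) f) (interior T)" if "T \<in> M" for T
      using set_lebesgue_integral_eq_integral(1)[OF I[OF that]] by (rule integrable_integral)
    have "interior T \<inter> interior T' = {}" if "T \<in> M" "T' \<in> M" "T \<noteq> T'" for T T'
      using tri_mesh_interior_Int[OF M that(1,2)] that(3) interior_subset by blast
    then show "pairwise (\<lambda>T T'. negligible (interior T \<inter> interior T')) M"
      by (auto simp: pairwise_def)
  qed
  also have "\<dots> = (\<Sum>T\<in>M. LINT y:interior T|lebesgue. f y)"
    by (rule sum.cong[OF refl]) (rule set_lebesgue_integral_eq_integral(2)[OF I, symmetric])
  finally show "(LINT y:region M|lebesgue. f y) = (\<Sum>T\<in>M. LINT y:interior T|lebesgue. f y)" .
qed

lemma pwc_integral_cong:
  assumes M: "tri_mesh M" and f: "pwc M f" and eq: "\<And>T y. T \<in> M \<Longrightarrow> y \<in> interior T \<Longrightarrow> f y = g y"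
  shows "(LINT y:region M|lebesgue. f y) = (LINT y:region M|lebesgue. g y)"
proof -
  have g: "pwc M g" using f eq unfolding pwc_def by metis
  show ?thesis unfolding pwc_integral(2)[OF M f] pwc_integral(2)[OF M g]
    by (intro sum.cong refl set_lebesgue_integral_cong) (auto simp: eq)
qed

lemma pwc_integral_add:
  assumes M: "tri_mesh M" and f: "pwc M f" and g: "pwc M g"
  shows "(LINT y:region M|lebesgue. f y + c * g y) = (LINT y:region M|lebesgue. f y) + c * (LINT y:region M|lebesgue. g y)"
  using set_integral_add(2)[OF pwc_integral(1)[OF M f] pwc_integral(1)[OF M pwc_cmult[OF g, of c]]] by simp

lemma pwc_integral_sum:
  fixes n :: nat
  assumes M: "tri_mesh M" and f: "\<And>k. k < n \<Longrightarrow> pwc M (f k)"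
  shows "(LINT y:region M|lebesgue. \<Sum>k<n. c k * f k y) = (\<Sum>k<n. c k * (LINT y:region M|lebesgue. f k y))"
  using f
proof (induction n)
  case (Suc n)
  have "pwc M (\<lambda>y. \<Sum>k<n. c k * f k y)" using Suc.prems by (intro pwc_sum pwc_cmult) auto
  then show ?case using Suc pwc_integral_add[OF M, of "\<lambda>y. \<Sum>k<n. c k * f k y" "f n" "c n"] by simp
qed (simp add: set_lebesgue_integral_def)

lemma pwc_integral_partition:
  assumes M: "tri_mesh M" and f: "pwc M f" and part: "\<And>T. T \<in> M \<Longrightarrow> \<pi> T < (n::nat)"
  shows "(LINT y:region M|lebesgue. f y) = (\<Sum>i<n. LINT y:region {T \<in> M. \<pi> T = i}|lebesgue. f y)"
proof -
  have "(\<Sum>i<n. LINT y:region {T \<in> M. \<pi> T = i}|lebesgue. f y)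
     = (\<Sum>i<n. \<Sum>T\<in>{T \<in> M. \<pi> T = i}. LINT y:interior T|lebesgue. f y)"
    by (intro sum.cong refl pwc_integral(2) tri_mesh_subset[OF M] pwc_subset[OF f]) auto
  also have "\<dots> = (\<Sum>T\<in>M. LINT y:interior T|lebesgue. f y)"
    using part M by (intro sum.group) (auto simp: tri_mesh_def)
  finally show ?thesis using pwc_integral(2)[OF M f] by simp
qed

lemma jac_on_triangle:
  assumes "\<forall>y\<in>T. u y = p y" "C1_map p p'" "y \<in> interior T"
  shows "(u has_derivative p' y) (at y)" "jac u y = matrix (p' y)"
proof -
  have "(p has_derivative p' y) (at y)" using assms(2) by (simp add: C1_map_def)
  then show d: "(u has_derivative p' y) (at y)"
    by (rule has_derivative_transform_within_open[OF _ open_interior assms(3)])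
      (use assms(1) interior_subset[of T] in auto)
  then show "jac u y = matrix (p' y)" by (simp add: jacobian_def frechet_derivative_at[symmetric])
qed

lemma pc1_obtain:
  assumes "pc1 M u" "T \<in> M"
  obtains p p' where "C1_map p p'" "\<forall>y\<in>T. u y = p y"
    "\<And>y. y \<in> interior T \<Longrightarrow> (u has_derivative p' y) (at y)" "\<And>y. y \<in> interior T \<Longrightarrow> jac u y = matrix (p' y)"
proof -
  obtain p p' where p: "C1_map p p'" "\<forall>y\<in>T. u y = p y" using assms unfolding pc1_def by blast
  show thesis by (rule that[OF p jac_on_triangle[OF p(2,1)]])
qed

lemma C1_map_add_scaled:
  assumes "C1_map p p'" "C1_map q q'"
  shows "C1_map (\<lambda>y. p y + c *\<^sub>R q y) (\<lambda>y v. p' y v + c *\<^sub>R q' y v)"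
  using assms unfolding C1_map_def
  by (auto intro!: continuous_intros has_derivative_add has_derivative_scaleR_right)

lemma pc1_zero: "pc1 M (\<lambda>_. 0)"
proof -
  have "C1_map (\<lambda>_. 0) (\<lambda>_ _. 0)" by (simp add: C1_map_def)
  then show ?thesis unfolding pc1_def by blast
qed

lemma pc1_add_scaled:
  assumes "pc1 M u" "pc1 M v" shows "pc1 M (\<lambda>y. u y + c *\<^sub>R v y)"
  unfolding pc1_def
proof
  fix T assume T: "T \<in> M"
  obtain p p' where p: "C1_map p p'" "\<forall>y\<in>T. u y = p y" using assms(1) T unfolding pc1_def by blast
  obtain q q' where q: "C1_map q q'" "\<forall>y\<in>T. v y = q y" using assms(2) T unfolding pc1_def by blast
  have "\<forall>y\<in>T. u y + c *\<^sub>R v y = p y + c *\<^sub>R q y" using p(2) q(2) by simp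
  with C1_map_add_scaled[OF p(1) q(1), of c]
  show "\<exists>r r'. C1_map r r' \<and> (\<forall>y\<in>T. u y + c *\<^sub>R v y = r y)" by blast
qed

lemma pc1_add: "pc1 M u \<Longrightarrow> pc1 M v \<Longrightarrow> pc1 M (\<lambda>y. u y + v y)"
  using pc1_add_scaled[of M u v 1] by simp

lemma pc1_scale: "pc1 M u \<Longrightarrow> pc1 M (\<lambda>y. c *\<^sub>R u y)"
  using pc1_add_scaled[OF pc1_zero, of M u c] by simp

lemma pc1_sum:
  assumes "finite A" "\<And>k. k \<in> A \<Longrightarrow> pc1 M (f k)"
  shows "pc1 M (\<lambda>y. \<Sum>k\<in>A. f k y)"
  using assms by (induction A rule: finite_induct) (simp_all add: pc1_zero pc1_add)

lemma jac_add_scaled: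
  assumes "pc1 M u" "pc1 M v" "T \<in> M" "y \<in> interior T"
  shows "jac (\<lambda>y. u y + c *\<^sub>R v y) y = jac u y + c *\<^sub>R jac v y"
proof -
  obtain p p' where p: "C1_map p p'" "(u has_derivative p' y) (at y)" "jac u y = matrix (p' y)"
    using pc1_obtain[OF assms(1,3)] assms(4) by metis
  obtain q q' where q: "C1_map q q'" "(v has_derivative q' y) (at y)" "jac v y = matrix (q' y)"
    using pc1_obtain[OF assms(2,3)] assms(4) by metis
  have "((\<lambda>y. u y + c *\<^sub>R v y) has_derivative (\<lambda>h. p' y h + c *\<^sub>R q' y h)) (at y)"
    by (intro has_derivative_add has_derivative_scaleR_right p q)
  then have "jac (\<lambda>y. u y + c *\<^sub>R v y) y = matrix (\<lambda>h. p' y h + c *\<^sub>R q' y h)"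
    by (simp add: jacobian_def frechet_derivative_at[symmetric])
  also have "\<dots> = matrix (p' y) + c *\<^sub>R matrix (q' y)"
    by (simp add: matrix_def Finite_Cartesian_Product.vec_eq_iff)
  finally show ?thesis using p q by simp
qed

lemma jac_zero: "jac (\<lambda>_. 0) y = 0"
proof -
  have "((\<lambda>_. 0 :: point) has_derivative (\<lambda>_. 0)) (at y)" by simp
  then show ?thesis by (simp add: jacobian_def frechet_derivative_at[symmetric] matrix_def
        Finite_Cartesian_Product.vec_eq_iff)
qed

lemma jac_cong_open:
  assumes "open S" "y \<in> S" "\<And>z. z \<in> S \<Longrightarrow> u z = v z"
  shows "jac u y = jac v y"
proof -
  have "(u has_derivative f') (at y) \<longleftrightarrow> (v has_derivative f') (at y)" for f'
    using has_derivative_transform_within_open[OF _ assms(1,2), of u f' UNIV v]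
      has_derivative_transform_within_open[OF _ assms(1,2), of v f' UNIV u] assms(3) by metis
  then show ?thesis by (simp add: jacobian_def frechet_derivative_def)
qed

lemma pwc_inner_jac:
  assumes "pc1 M u" "pc1 M v" shows "pwc M (\<lambda>y. inner (jac u y) (jac v y))"
  unfolding pwc_def
proof
  fix T assume T: "T \<in> M"
  obtain p p' where p: "C1_map p p'" "\<And>y. y \<in> interior T \<Longrightarrow> jac u y = matrix (p' y)"
    using pc1_obtain[OF assms(1) T] by metis
  obtain q q' where q: "C1_map q q'" "\<And>y. y \<in> interior T \<Longrightarrow> jac v y = matrix (q' y)"
    using pc1_obtain[OF assms(2) T] by metis
  have "continuous_on UNIV (\<lambda>y. inner (matrix (p' y)) (matrix (q' y)))"
    using p(1) q(1) unfolding inner_vec_def sum_2 matrix_def C1_map_def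
    by (simp del: inner_real_def) (intro continuous_intros; simp)
  then show "\<exists>g. continuous_on UNIV g \<and> (\<forall>y\<in>interior T. inner (jac u y) (jac v y) = g y)"
    using p(2) q(2) by auto
qed

lemma pwc_trace_jac:
  assumes "pc1 M u" shows "pwc M (\<lambda>y. trace (jac u y))"
  unfolding pwc_def
proof
  fix T assume T: "T \<in> M"
  obtain p p' where p: "C1_map p p'" "\<And>y. y \<in> interior T \<Longrightarrow> jac u y = matrix (p' y)"
    using pc1_obtain[OF assms(1) T] by metis
  then show "\<exists>g. continuous_on UNIV g \<and> (\<forall>y\<in>interior T. trace (jac u y) = g y)"
    using continuous_on_trace[OF p(1)] by auto
qed

lemma a_int_sym: "a_int S u v = a_int S v u"
  by (simp add: a_int_def inner_commute)

lemma a_int_add_scaled: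
  assumes M: "tri_mesh M" and u: "pc1 M u" "pc1 M v" "pc1 M w"
  shows "a_int (region M) (\<lambda>y. u y + c *\<^sub>R v y) w = a_int (region M) u w + c * a_int (region M) v w"
proof -
  have "a_int (region M) (\<lambda>y. u y + c *\<^sub>R v y) w
     = (LINT y:region M|lebesgue. inner (jac u y) (jac w y) + c * inner (jac v y) (jac w y))"
    unfolding a_int_def
    by (intro pwc_integral_cong[OF M] pwc_inner_jac pc1_add_scaled u)
      (simp add: jac_add_scaled[OF u(1,2)] inner_add_left)
  also have "\<dots> = a_int (region M) u w + c * a_int (region M) v w"
    unfolding a_int_def by (intro pwc_integral_add[OF M] pwc_inner_jac u)
  finally show ?thesis .
qed

lemma a_int_zero: "a_int S (\<lambda>_. 0) w = 0"
  by (simp add: a_int_def jac_zero set_lebesgue_integral_def)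

lemma a_int_sum:
  fixes n :: nat
  assumes M: "tri_mesh M" and w: "pc1 M w" and f: "\<And>k. k < n \<Longrightarrow> pc1 M (f k)"
  shows "a_int (region M) (\<lambda>y. \<Sum>k<n. c k *\<^sub>R f k y) w = (\<Sum>k<n. c k * a_int (region M) (f k) w)"
  using f
proof (induction n)
  case (Suc n)
  have "pc1 M (\<lambda>y. \<Sum>k<n. c k *\<^sub>R f k y)" using Suc.prems by (intro pc1_sum pc1_scale) auto
  then show ?case using Suc a_int_add_scaled[OF M _ _ w, of "\<lambda>y. \<Sum>k<n. c k *\<^sub>R f k y" "f n" "c n"] by simp
qed (simp add: a_int_zero)

lemma b_int_add_scaled:
  assumes M: "tri_mesh M" and u: "pc1 M u" "pc1 M v" and q: "pwc M q"
  shows "b_int (region M) (\<lambda>y. u y + c *\<^sub>R v y) q = b_int (region M) u q + c * b_int (region M) v q"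
proof -
  have "(LINT y:region M|lebesgue. trace (jac (\<lambda>y. u y + c *\<^sub>R v y) y) * q y)
     = (LINT y:region M|lebesgue. trace (jac u y) * q y + c * (trace (jac v y) * q y))"
    by (intro pwc_integral_cong[OF M] pwc_mult pwc_trace_jac pc1_add_scaled u q)
      (simp add: jac_add_scaled[OF u(1,2)] trace_def sum.distrib sum_distrib_left[symmetric] algebra_simps)
  also have "\<dots> = (LINT y:region M|lebesgue. trace (jac u y) * q y) + c * (LINT y:region M|lebesgue. trace (jac v y) * q y)"
    by (intro pwc_integral_add[OF M] pwc_mult pwc_trace_jac u q)
  finally show ?thesis unfolding b_int_def by simp
qed

lemma b_int_zero: "b_int S (\<lambda>_. 0) q = 0"
  by (simp add: b_int_def jac_zero set_lebesgue_integral_def trace_def)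

lemma b_int_zero_right: "b_int S u (\<lambda>_. 0) = 0"
  by (simp add: b_int_def set_lebesgue_integral_def)

lemma b_int_sum:
  fixes n :: nat
  assumes M: "tri_mesh M" and q: "pwc M q" and f: "\<And>k. k < n \<Longrightarrow> pc1 M (f k)"
  shows "b_int (region M) (\<lambda>y. \<Sum>k<n. c k *\<^sub>R f k y) q = (\<Sum>k<n. c k * b_int (region M) (f k) q)"
  using f
proof (induction n)
  case (Suc n)
  have "pc1 M (\<lambda>y. \<Sum>k<n. c k *\<^sub>R f k y)" using Suc.prems by (intro pc1_sum pc1_scale) auto
  then show ?case using Suc b_int_add_scaled[OF M _ _ q, of "\<lambda>y. \<Sum>k<n. c k *\<^sub>R f k y" "f n" "c n"] by simp
qed (simp add: b_int_zero)

lemma b_int_add_scaled_right: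
  assumes M: "tri_mesh M" and u: "pc1 M u" and q: "pwc M q" "pwc M r"
  shows "b_int (region M) u (\<lambda>y. q y + c * r y) = b_int (region M) u q + c * b_int (region M) u r"
proof -
  have "(LINT y:region M|lebesgue. trace (jac u y) * (q y + c * r y))
     = (LINT y:region M|lebesgue. trace (jac u y) * q y + c * (trace (jac u y) * r y))"
    by (simp add: algebra_simps)
  also have "\<dots> = (LINT y:region M|lebesgue. trace (jac u y) * q y) + c * (LINT y:region M|lebesgue. trace (jac u y) * r y)"
    by (intro pwc_integral_add[OF M] pwc_mult pwc_trace_jac u q)
  finally show ?thesis unfolding b_int_def by simp
qed

lemma b_int_sum_right:
  fixes n :: nat
  assumes M: "tri_mesh M" and u: "pc1 M u" and q: "\<And>k. k < n \<Longrightarrow> pwc M (q k)"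
  shows "b_int (region M) u (\<lambda>y. \<Sum>k<n. c k * q k y) = (\<Sum>k<n. c k * b_int (region M) u (q k))"
  using q
proof (induction n)
  case (Suc n)
  have "pwc M (\<lambda>y. \<Sum>k<n. c k * q k y)" using Suc.prems by (intro pwc_sum pwc_cmult) auto
  then show ?case using Suc b_int_add_scaled_right[OF M u, of "\<lambda>y. \<Sum>k<n. c k * q k y" "q n" "c n"] by simp
qed (simp add: b_int_zero_right)

lemma a_int_zero_on:
  assumes "open S" "\<And>y. y \<in> S \<Longrightarrow> u y = 0" shows "a_int S u v = 0"
proof -
  have "jac u y = 0" if "y \<in> S" for y
    using jac_cong_open[OF assms(1) that, of u "\<lambda>_. 0"] assms(2) by (simp add: jac_zero)
  then have "(\<lambda>y. indicat_real S y *\<^sub>R inner (jac u y) (jac v y)) = (\<lambda>y. 0)"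
    by (auto simp: indicator_def)
  then show ?thesis by (simp add: a_int_def set_lebesgue_integral_def)
qed

lemma a_int_cong:
  assumes "open S" "\<And>y. y \<in> S \<Longrightarrow> u y = u' y" "\<And>y. y \<in> S \<Longrightarrow> v y = v' y"
  shows "a_int S u v = a_int S u' v'"
proof -
  have "jac u y = jac u' y" "jac v y = jac v' y" if "y \<in> S" for y
    using jac_cong_open[OF assms(1) that] assms(2,3) by blast+
  then have "(\<lambda>y. indicat_real S y *\<^sub>R inner (jac u y) (jac v y)) = (\<lambda>y. indicat_real S y *\<^sub>R inner (jac u' y) (jac v' y))"
    by (auto simp: indicator_def)
  then show ?thesis by (simp add: a_int_def set_lebesgue_integral_def)
qed

lemma b_int_cong:
  assumes "open S" "\<And>y. y \<in> S \<Longrightarrow> u y = u' y"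
  shows "b_int S u q = b_int S u' q"
proof -
  have "jac u y = jac u' y" if "y \<in> S" for y
    using jac_cong_open[OF assms(1) that] assms(2) by blast
  then have "(\<lambda>y. indicat_real S y *\<^sub>R (trace (jac u y) * q y)) = (\<lambda>y. indicat_real S y *\<^sub>R (trace (jac u' y) * q y))"
    by (auto simp: indicator_def)
  then show ?thesis by (simp add: b_int_def set_lebesgue_integral_def)
qed

text \<open>
  The constant in \<open>\<parallel>div u\<parallel>\<^sup>2 \<le> 2 \<parallel>grad u\<parallel>\<^sup>2\<close>: the divergence is the inner product of the gradient with the
  identity matrix, whose squared Frobenius norm is the dimension.
\<close>

lemma trace_le_Frobenius: "(trace J)\<^sup>2 \<le> 2 * inner J (J :: real^2^2)"
proof -
  have "2 * inner J J - (trace J)\<^sup>2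
    = (J $ 1 $ 1 - J $ 2 $ 2)\<^sup>2 + 2 * (J $ 1 $ 2)\<^sup>2 + 2 * (J $ 2 $ 1)\<^sup>2"
    by (simp add: inner_vec_def sum_2 trace_def power2_eq_square algebra_simps)
  also have "0 \<le> \<dots>" by simp
  finally show ?thesis by simp
qed

lemma a_int_nonneg: "0 \<le> a_int S u u"
  unfolding a_int_def set_lebesgue_integral_def by (intro Bochner_Integration.integral_nonneg) simp

text \<open>
  The integrand is \<open>(2 |J|\<^sup>2 - (tr J)\<^sup>2) + (tr J - t q)\<^sup>2\<close>. In this form, as a polynomial in \<open>t\<close>, the
  estimates of several subdomains can be added before passing to the discriminant.
\<close>

lemma divergence_quadratic_nonneg:
  assumes M: "tri_mesh M" and u: "pc1 M u" and q: "pwc M q"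
  shows "0 \<le> 2 * a_int (region M) u u + 2 * t * b_int (region M) u q
    + t\<^sup>2 * (LINT y:region M|lebesgue. q y * q y)"
proof -
  define f g h where "f y = inner (jac u y) (jac u y)" and "g y = trace (jac u y) * q y" and "h y = q y * q y" for y
  have pw: "pwc M f" "pwc M g" "pwc M h"
    unfolding f_def g_def h_def by (intro pwc_inner_jac pwc_mult pwc_trace_jac u q)+
  have "0 \<le> (LINT y:region M|lebesgue. (2 * f y + (- 2 * t) * g y) + t\<^sup>2 * h y)"
    unfolding set_lebesgue_integral_def
  proof (intro Bochner_Integration.integral_nonneg)
    fix y
    have "2 * f y + (- 2 * t) * g y + t\<^sup>2 * h y = (2 * f y - (trace (jac u y))\<^sup>2) + (trace (jac u y) - t * q y)\<^sup>2"
      by (simp add: g_def h_def power2_eq_square algebra_simps)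
    moreover have "0 \<le> 2 * f y - (trace (jac u y))\<^sup>2" using trace_le_Frobenius by (simp add: f_def)
    moreover have "0 \<le> (trace (jac u y) - t * q y)\<^sup>2" by simp
    ultimately have "0 \<le> 2 * f y + (- 2 * t) * g y + t\<^sup>2 * h y" by linarith
    then show "0 \<le> indicator (region M) y *\<^sub>R (2 * f y + (- 2 * t) * g y + t\<^sup>2 * h y)" by simp
  qed
  also have "\<dots> = (LINT y:region M|lebesgue. 2 * f y + (- 2 * t) * g y) + t\<^sup>2 * (LINT y:region M|lebesgue. h y)"
    by (intro pwc_integral_add[OF M] pwc_add pwc_cmult pw)
  also have "(LINT y:region M|lebesgue. 2 * f y + (- 2 * t) * g y)
     = (LINT y:region M|lebesgue. 2 * f y) + (- 2 * t) * (LINT y:region M|lebesgue. g y)"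
    by (intro pwc_integral_add[OF M] pwc_cmult pw)
  finally show ?thesis unfolding a_int_def b_int_def by (simp add: f_def g_def h_def)
qed

text \<open>
  A continuous function that vanishes almost everywhere on an open set vanishes on it, since a
  nonempty open set is not a null set.
\<close>

lemma pwc_zero_of_integral_zero:
  assumes M: "tri_mesh M" and f: "pwc M f" and nn: "\<And>y. 0 \<le> f y"
    and z: "(LINT y:region M|lebesgue. f y) = 0" and T: "T \<in> M" "y \<in> interior T"
  shows "f y = 0"
proof (rule ccontr)
  assume fy: "f y \<noteq> 0"
  obtain g where g: "continuous_on UNIV g" "\<forall>y\<in>interior T. f y = g y" using f T by (auto simp: pwc_def)
  have "AE x in lebesgue. indicator (region M) x *\<^sub>R f x = 0"
    using pwc_integral(1)[OF M f] z nn unfolding set_integrable_def set_lebesgue_integral_def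
    by (subst integral_nonneg_eq_0_iff_AE[symmetric]) (auto intro!: AE_I2)
  then have ae: "AE x in lebesgue. x \<notin> {x \<in> interior T. g x \<noteq> 0}"
    using g(2) interior_subset_region[OF T(1)] by (auto elim!: eventually_mono simp: indicator_def split: if_splits)
  have op: "open {x \<in> interior T. g x \<noteq> 0}"
  proof -
    have "open (interior T \<inter> g -` (- {0}))"
      using g(1) by (intro open_Int open_interior open_vimage) (auto simp: continuous_on_eq_continuous_at)
    then show ?thesis by (simp add: vimage_def Int_def)
  qed
  then have "{x \<in> interior T. g x \<noteq> 0} \<in> sets lebesgue" by (simp add: borel_open)
  from AE_iff_null_sets[OF this] ae have "{x \<in> interior T. g x \<noteq> 0} \<in> null_sets lebesgue" by blast
  then have "negligible {x \<in> interior T. g x \<noteq> 0}" by (simp add: negligible_iff_null_sets)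
  with open_not_negligible[OF op] have "{x \<in> interior T. g x \<noteq> 0} = {}" by blast
  with fy g(2) T(2) show False by auto
qed

text \<open>
  The gradient vanishes inside each element, so there are only finitely many values, and a connected
  set has no continuous image with finitely many points other than a single one.
\<close>

lemma zero_energy_imp_constant:
  assumes M: "tri_mesh M" and u: "pc1 M u" and cont: "continuous_on UNIV u"
    and con: "connected (region M)" and z: "a_int (region M) u u = 0"
  shows "\<exists>c. \<forall>y\<in>closure (region M). u y = c"
proof -
  have const: "\<exists>c. \<forall>y\<in>T. u y = c" if T: "T \<in> M" for T
  proof -
    obtain a b c where abc: "triangle_of a b c T" by (rule tri_mesh_triangle[OF M T])
    obtain p p' where p: "C1_map p p'" "\<And>y. y \<in> interior T \<Longrightarrow> (u has_derivative p' y) (at y)"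
      "\<And>y. y \<in> interior T \<Longrightarrow> jac u y = matrix (p' y)"
      using pc1_obtain[OF u T] by metis
    have d0: "(u has_derivative (\<lambda>_. 0)) (at y within interior T)" if y: "y \<in> interior T" for y
    proof -
      have "inner (jac u y) (jac u y) = 0"
        by (rule pwc_zero_of_integral_zero[OF M pwc_inner_jac[OF u u] _ z[unfolded a_int_def] T y]) simp
      then have "matrix (p' y) = 0" using p(3)[OF y] by simp
      then have "p' y v = 0" for v
        using matrix_vector_mul(2)[OF C1_map_linear[OF p(1)], of y] by (metis matrix_vector_mult_0)
      then have "p' y = (\<lambda>_. 0)" by auto
      with p(2)[OF y] show ?thesis by (simp add: has_derivative_at_withinI)
    qed
    obtain c where c: "\<And>y. y \<in> interior T \<Longrightarrow> u y = c"
      using has_derivative_zero_constant[OF convex_interior[OF triangle_convex[OF abc]] d0] by metis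
    have "closed {y. u y = c}" by (rule continuous_closed_preimage_constant[OF cont, simplified])
    then have "closure (interior T) \<subseteq> {y. u y = c}" using c by (intro closure_minimal) auto
    then show ?thesis using closure_interior_triangle[OF abc] by (intro exI[of _ c]) auto
  qed
  then obtain k where k: "\<And>T y. T \<in> M \<Longrightarrow> y \<in> T \<Longrightarrow> u y = k T" by metis
  have "u ` region M \<subseteq> k ` M" using k interior_subset[of "\<Union>M"] by (force simp: region_def)
  moreover have "finite M" using M by (simp add: tri_mesh_def)
  ultimately have "finite (u ` region M)" by (meson finite_imageI finite_subset)
  moreover have "connected (u ` region M)"
    by (rule connected_continuous_image[OF continuous_on_subset[OF cont subset_UNIV] con])
  ultimately have "u ` region M = {} \<or> (\<exists>c. u ` region M = {c})" using connected_finite_iff_sing by blast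
  then obtain c where c: "\<And>y. y \<in> region M \<Longrightarrow> u y = c" by blast
  have "closed {y. u y = c}" by (rule continuous_closed_preimage_constant[OF cont, simplified])
  then have "closure (region M) \<subseteq> {y. u y = c}" using c by (intro closure_minimal) auto
  then show ?thesis by (intro exI[of _ c]) auto
qed

text \<open>
  The divergence theorem on each triangle, summed up; by \<open>flux_sum_over_boundary\<close> only the sides on the
  boundary of the region remain.
\<close>

lemma divergence_region:
  assumes M: "tri_mesh M" and u: "pc1 M u"
  shows "(LINT y:region M|lebesgue. trace (jac u y)) =
    (\<Sum>(T, S)\<in>{(T, S). T \<in> M \<and> S facet_of T \<and> S \<subseteq> frontier (region M)}. side_flux u T S)"
proof -
  have "(LINT y:interior T|lebesgue. trace (jac u y)) = (\<Sum>S | S facet_of T. side_flux u T S)" if T: "T \<in> M" for T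
  proof -
    obtain a b c where abc: "triangle_of a b c T" by (rule tri_mesh_triangle[OF M T])
    obtain p p' where p: "C1_map p p'" "\<forall>y\<in>T. u y = p y"
      "\<And>y. y \<in> interior T \<Longrightarrow> jac u y = matrix (p' y)"
      using pc1_obtain[OF u T] by metis
    have "(LINT y:interior T|lebesgue. trace (jac u y)) = integral (interior T) (\<lambda>y. trace (jac u y))"
      by (rule set_lebesgue_integral_eq_integral(2)[OF pwc_set_integrable_interior[OF M pwc_trace_jac[OF u] T]])
    also have "\<dots> = integral (interior T) (\<lambda>y. trace (matrix (p' y)))"
      by (rule Henstock_Kurzweil_Integration.integral_cong) (simp add: p(3))
    also have "\<dots> = integral T (\<lambda>y. trace (matrix (p' y)))"
    proof (rule integral_spike_set)
      have "negligible (frontier T)" by (rule negligible_convex_frontier[OF triangle_convex[OF abc]])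
      moreover have "T - interior T \<subseteq> frontier T" using closure_subset by (auto simp: frontier_def)
      ultimately have "negligible (T - interior T)" by (rule negligible_subset)
      then show "negligible {x \<in> T - interior T. trace (matrix (p' x)) \<noteq> 0}" by (rule negligible_subset) auto
      have "{x \<in> interior T - T. trace (matrix (p' x)) \<noteq> 0} = {}" using interior_subset by auto
      then show "negligible {x \<in> interior T - T. trace (matrix (p' x)) \<noteq> 0}" by (metis negligible_empty)
    qed
    also have "\<dots> = (\<Sum>S | S facet_of T. side_flux p T S)"
      by (rule divergence_triangle_facets[OF abc p(1)])
    also have "\<dots> = (\<Sum>S | S facet_of T. side_flux u T S)"
    proof (rule sum.cong[OF refl])
      fix S assume "S \<in> {S. S facet_of T}"
      then have S: "S facet_of T" by simp
      obtain x y z where t: "triangle_of x y z T" "S = closed_segment x y"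
        using facet_representation[OF abc S] by metis
      have "edge_int p x y = edge_int u x y" unfolding edge_int_def
      proof (rule Henstock_Kurzweil_Integration.integral_cong)
        fix s :: real assume "s \<in> {0..1}"
        then have "linepath x y s \<in> S" by (auto simp: t(2) linepath_in_path)
        then have "linepath x y s \<in> T" using facet_of_imp_subset[OF S] by auto
        then show "cross2 (p (linepath x y s)) (y - x) = cross2 (u (linepath x y s)) (y - x)" using p(2) by simp
      qed
      then show "side_flux p T S = side_flux u T S"
        using t side_flux_eq by (auto simp: triangle_of_def)
    qed
    finally show ?thesis .
  qed
  then have "(LINT y:region M|lebesgue. trace (jac u y)) = (\<Sum>T\<in>M. \<Sum>S | S facet_of T. side_flux u T S)"
    unfolding pwc_integral(2)[OF M pwc_trace_jac[OF u]] by (rule sum.cong[OF refl])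
  then show ?thesis unfolding flux_sum_over_boundary[OF M] region_def .
qed

lemma side_flux_zero:
  assumes "\<And>y. y \<in> S \<Longrightarrow> w y = 0" "triangle_of a b c T" "S facet_of T"
  shows "side_flux w T S = 0"
proof -
  obtain x y z where t: "triangle_of x y z T" "S = closed_segment x y"
    using facet_representation[OF assms(2,3)] by metis
  have "edge_int w x y = integral {0..1} (\<lambda>s :: real. 0 :: real)" unfolding edge_int_def
  proof (rule Henstock_Kurzweil_Integration.integral_cong)
    fix s :: real assume "s \<in> {0..1}"
    then have "linepath x y s \<in> S" by (auto simp: t(2) linepath_in_path)
    then show "cross2 (w (linepath x y s)) (y - x) = 0" using assms(1) by (simp add: cross2_def)
  qed
  then show ?thesis using t side_flux_eq[of y x z w] by (auto simp: triangle_of_def)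
qed

lemma divergence_region_zero_boundary:
  assumes M: "tri_mesh M" and u: "pc1 M u" and z: "\<And>y. y \<in> frontier (region M) \<Longrightarrow> u y = 0"
  shows "(LINT y:region M|lebesgue. trace (jac u y)) = 0"
  unfolding divergence_region[OF M u]
proof (rule sum.neutral, clarify)
  fix T S assume TS: "T \<in> M" "S facet_of T" "S \<subseteq> frontier (region M)"
  obtain a b c where abc: "triangle_of a b c T" by (rule tri_mesh_triangle[OF M TS(1)])
  show "side_flux u T S = 0" by (rule side_flux_zero[OF _ abc TS(2)]) (use z TS(3) in auto)
qed

lemma real_polynomial_function_C1:
  assumes "real_polynomial_function (f :: point \<Rightarrow> real)"
  shows "\<exists>f'. (\<forall>x. (f has_derivative f' x) (at x)) \<and> (\<forall>v. continuous_on UNIV (\<lambda>x. f' x v))"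
  using assms
proof (induction f rule: real_polynomial_function.induct)
  case (linear f)
  then show ?case
    by (intro exI[of _ "\<lambda>_. f"]) (auto intro: bounded_linear_imp_has_derivative)
next
  case (const c)
  show ?case by (intro exI[of _ "\<lambda>_ _. 0"]) auto
next
  case (add f g)
  then obtain f' g' where "\<forall>x. (f has_derivative f' x) (at x)" "\<forall>v. continuous_on UNIV (\<lambda>x. f' x v)"
    "\<forall>x. (g has_derivative g' x) (at x)" "\<forall>v. continuous_on UNIV (\<lambda>x. g' x v)" by blast
  then show ?case
    by (intro exI[of _ "\<lambda>x v. f' x v + g' x v"]) (auto intro!: has_derivative_add continuous_intros)
next
  case (mult f g)
  then obtain f' g' where fg: "\<forall>x. (f has_derivative f' x) (at x)" "\<forall>v. continuous_on UNIV (\<lambda>x. f' x v)"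
    "\<forall>x. (g has_derivative g' x) (at x)" "\<forall>v. continuous_on UNIV (\<lambda>x. g' x v)" by blast
  moreover have "continuous_on UNIV f" "continuous_on UNIV g"
    using fg by (meson continuous_at_imp_continuous_on has_derivative_continuous)+
  ultimately show ?case
    by (intro exI[of _ "\<lambda>x v. f x * g' x v + f' x v * g x"]) (auto intro!: has_derivative_mult continuous_intros)
qed

lemma real_polynomial_function_continuous:
  assumes "real_polynomial_function (f :: point \<Rightarrow> real)" shows "continuous_on UNIV f"
  using real_polynomial_function_C1[OF assms]
  by (meson continuous_at_imp_continuous_on has_derivative_continuous)

text \<open>From here on the dollar sign selects the entries of a coefficient vector.\<close>

unbundle no vec_syntax
notation vec_index (infixl \<open>$\<close> 100)

section \<open>Coefficients labelled by distinct lists\<close>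

lemma sum_nth_distinct:
  assumes "distinct xs" shows "(\<Sum>k<length xs. G (xs ! k)) = (\<Sum>x\<in>set xs. G x)"
  by (rule sum.reindex_bij_betw[OF bij_betw_nth[OF assms refl refl]])

text \<open>
  Coefficient vectors are indexed by positions in lists of basis functions, while the mathematics
  speaks of nodes, edges and subdomains. As the labels in a list are distinct, coefficients may be
  regarded as a function of the label, and sums over positions become sums over sets.
\<close>

lemma labelled_coefficients:
  assumes "distinct xs" shows "\<exists>d. \<forall>k<length xs. c k = d (xs ! k)"
proof (intro exI allI impI)
  fix k assume k: "k < length xs"
  have "(THE j. j < length xs \<and> xs ! j = xs ! k) = k"
    using assms k by (intro the_equality) (auto simp: nth_eq_iff_index_eq)
  then show "c k = (\<lambda>x. c (THE j. j < length xs \<and> xs ! j = x)) (xs ! k)" by simp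
qed

definition fam :: "rvec \<Rightarrow> (nat \<Rightarrow> point \<Rightarrow> point) list \<Rightarrow> nat \<Rightarrow> point \<Rightarrow> point" where
  "fam c fs i = (\<lambda>y. \<Sum>k<length fs. (c $ k) *\<^sub>R (fs ! k) i y)"

lemma fam_map: "fam c (map (\<lambda>f i. f) fs) i = comb c fs"
  by (simp add: fam_def comb_def)

section \<open>Geometry of the decomposition\<close>

definition sub_mesh :: "dd \<Rightarrow> nat \<Rightarrow> point set set" where
  "sub_mesh D i = {T \<in> mesh D. part D T = i}"

lemma subdom_region: "subdom D i = region (sub_mesh D i)"
  by (simp add: subdom_def region_def sub_mesh_def)

lemma domn_region: "domn D = region (mesh D)"
  by (simp add: domn_def region_def)

text \<open>
  The class of functions in which the velocities are handled: it contains all velocity basis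
  functions, is closed under linear combinations, and is small enough for the divergence theorem and
  for \<open>zero_energy_imp_constant\<close>.
\<close>

definition vfun :: "dd \<Rightarrow> (point \<Rightarrow> point) \<Rightarrow> bool" where
  "vfun D u \<longleftrightarrow> continuous_on UNIV u \<and> pc1 (mesh D) u \<and> (\<forall>y. y \<notin> domn D \<longrightarrow> u y = 0)"

lemma vfun_zero: "vfun D (\<lambda>_. 0)"
  by (simp add: vfun_def pc1_zero)

lemma vfun_add: "vfun D u \<Longrightarrow> vfun D v \<Longrightarrow> vfun D (\<lambda>y. u y + v y)"
  unfolding vfun_def by (auto intro!: continuous_intros pc1_add)

lemma vfun_scale: "vfun D u \<Longrightarrow> vfun D (\<lambda>y. c *\<^sub>R u y)"
  unfolding vfun_def by (auto intro!: continuous_intros pc1_scale)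

lemma vfun_sum: "finite A \<Longrightarrow> (\<And>k. k \<in> A \<Longrightarrow> vfun D (f k)) \<Longrightarrow> vfun D (\<lambda>y. \<Sum>k\<in>A. f k y)"
  by (induction A rule: finite_induct) (simp_all add: vfun_zero vfun_add)

lemma vfun_comb: "(\<And>f. f \<in> set fs \<Longrightarrow> vfun D f) \<Longrightarrow> vfun D (comb c fs)"
  unfolding comb_def by (intro vfun_sum vfun_scale) auto

lemma vfun_fam: "(\<And>f. f \<in> set fs \<Longrightarrow> vfun D (f i)) \<Longrightarrow> vfun D (fam c fs i)"
  unfolding fam_def by (intro vfun_sum vfun_scale) auto

text \<open>
  A neighbourhood of \<open>y\<close> is covered by the elements of \<open>N\<close>, and it meets the interior of every element
  that contains \<open>y\<close>. As elements do not overlap, that element is in \<open>N\<close>.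
\<close>

lemma region_contains_triangles:
  assumes M: "tri_mesh M" and N: "N \<subseteq> M" and y: "y \<in> region N" "T \<in> M" "y \<in> T"
  shows "T \<in> N"
proof -
  obtain a b c where abc: "triangle_of a b c T" by (rule tri_mesh_triangle[OF M y(2)])
  have "y \<in> closure (interior T)" using closure_interior_triangle[OF abc] y(3) by simp
  then have "region N \<inter> interior T \<noteq> {}"
    using y(1) open_Int_closure_eq_empty[OF open_region, of N "interior T"] by blast
  then obtain z where z: "z \<in> region N" "z \<in> interior T" by auto
  then obtain T' where "T' \<in> N" "z \<in> T'" using interior_subset[of "\<Union>N"] by (auto simp: region_def)
  then show ?thesis using tri_mesh_interior_Int[OF M y(2), of T' z] z N by auto
qed

lemma closure_region:
  assumes M: "tri_mesh M" shows "closure (region M) = \<Union>M"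
proof
  have "closed (\<Union>M)" using M tri_mesh_closed by (intro closed_Union) (auto simp: tri_mesh_def)
  then show "closure (region M) \<subseteq> \<Union>M" unfolding region_def by (intro closure_minimal interior_subset)
  show "\<Union>M \<subseteq> closure (region M)"
    using triangle_subset_closure_interior_Union[OF M] unfolding region_def by blast
qed

text \<open>
  Through its end points a subdomain edge is tied to a corner or to the boundary, where the value of
  a velocity is known.
\<close>

lemma arc_end_in_closure:
  assumes "arc g"
  shows "pathstart g \<in> closure (path_image g - {pathstart g, pathfinish g})"
proof -
  have c: "continuous_on (closure {0<..<1}) g" using assms by (simp add: arc_def path_def)
  have "g ` {0<..<1} \<subseteq> path_image g - {pathstart g, pathfinish g}"
    using assms by (force simp: arc_def path_image_def pathstart_def pathfinish_def inj_on_def)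
  then have "g ` closure {0<..<1} \<subseteq> closure (path_image g - {pathstart g, pathfinish g})"
    using closure_subset[of "path_image g - {pathstart g, pathfinish g}"]
    by (intro image_closure_subset[OF c]) auto
  then show ?thesis by (auto simp: pathstart_def)
qed

locale decomposed_mesh =
  fixes D :: dd and \<sigma> c\<^sub>Z C\<^sub>Z h H :: real
  assumes setting: "fetidp_setting \<sigma> c\<^sub>Z C\<^sub>Z h H D"
begin

abbreviation "nodes \<equiv> set (vnodes D)"
abbreviation "nE \<equiv> length (edges D)"

lemma mesh_tri: "tri_mesh (mesh D)"
  using setting unfolding fetidp_setting_def mesh_ok_def tri_mesh_def triangulation_def by auto

lemma sub_mesh_tri: "tri_mesh (sub_mesh D i)"
  by (rule tri_mesh_subset[OF mesh_tri]) (auto simp: sub_mesh_def)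

lemma sub_mesh_subset: "sub_mesh D i \<subseteq> mesh D"
  by (auto simp: sub_mesh_def)

lemma vel: "velocity_ok D" and pre: "pressure_ok c\<^sub>Z C\<^sub>Z h D" and dec: "decomposition_ok \<sigma> H D"
  and mok: "mesh_ok \<sigma> h D" and h0: "0 < h" and hH: "h \<le> H"
  using setting by (auto simp: fetidp_setting_def)

lemma part_less: "T \<in> mesh D \<Longrightarrow> part D T < nsub D"
  using dec by (simp add: decomposition_ok_def)

lemma open_subdom: "open (subdom D i)" and open_domn: "open (domn D)"
  by (simp_all add: subdom_def domn_def)

lemma closure_subdom: "closure (subdom D i) = \<Union>(sub_mesh D i)"
  unfolding subdom_region by (rule closure_region[OF sub_mesh_tri])

lemma subdom_triangle: "y \<in> subdom D i \<Longrightarrow> T \<in> mesh D \<Longrightarrow> y \<in> T \<Longrightarrow> part D T = i"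
  using region_contains_triangles[OF mesh_tri sub_mesh_subset, of y i T]
  by (auto simp: subdom_region sub_mesh_def)

lemma subdom_closure_disjoint: "y \<in> subdom D i \<Longrightarrow> y \<in> closure (subdom D j) \<Longrightarrow> j = i"
  unfolding closure_subdom using subdom_triangle by (auto simp: sub_mesh_def)

lemma domn_covered:
  assumes "y \<in> domn D" obtains i where "i < nsub D" "y \<in> closure (subdom D i)"
proof -
  obtain T where "T \<in> mesh D" "y \<in> T" using assms interior_subset unfolding domn_def by blast
  then show thesis using that[of "part D T"] part_less unfolding closure_subdom by (auto simp: sub_mesh_def)
qed

lemma mesh_covered: "\<Union>(mesh D) = (\<Union>i<nsub D. closure (subdom D i))"
  unfolding closure_subdom using part_less by (auto simp: sub_mesh_def)

lemma closure_domn: "closure (domn D) = (\<Union>i<nsub D. closure (subdom D i))"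
  unfolding domn_region closure_region[OF mesh_tri] by (rule mesh_covered)

lemma iface_not_subdom: "y \<in> iface D \<Longrightarrow> y \<notin> subdom D i"
proof
  assume "y \<in> iface D" and y: "y \<in> subdom D i"
  then obtain j where j: "y \<in> frontier (subdom D j)" by (auto simp: iface_def)
  then have "y \<in> closure (subdom D j)" by (simp add: frontier_def)
  then have "j = i" by (rule subdom_closure_disjoint[OF y])
  with j y show False using open_subdom[of i] by (simp add: frontier_def interior_open)
qed

lemma frontier_subdom: "frontier (subdom D i) = closure (subdom D i) - subdom D i"
  using open_subdom by (simp add: frontier_def interior_open)

lemma domn_iface: "y \<in> domn D \<Longrightarrow> i < nsub D \<Longrightarrow> y \<in> closure (subdom D i) \<Longrightarrow> y \<notin> subdom D i \<Longrightarrow> y \<in> iface D"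
  using open_domn by (auto simp: iface_def frontier_subdom frontier_def[of "domn D"] interior_open)

text \<open>
  Otherwise a neighbourhood of \<open>y\<close> would be covered by the elements of the subdomain \<open>i\<close> alone, and \<open>y\<close>
  would be one of its interior points.
\<close>

lemma frontier_subdom_neighbour:
  assumes "y \<in> domn D" "y \<in> frontier (subdom D i)"
  obtains j where "j < nsub D" "j \<noteq> i" "y \<in> closure (subdom D j)"
proof -
  define K where "K = (\<Union>j\<in>{..<nsub D} - {i}. closure (subdom D j))"
  have "y \<in> K"
  proof (rule ccontr)
    assume "y \<notin> K"
    have "closed K" unfolding K_def by (intro closed_UN) auto
    then have "open (domn D - K)" using open_domn by (rule open_Diff[rotated])
    moreover have "domn D - K \<subseteq> \<Union>(sub_mesh D i)"
    proof
      fix z assume z: "z \<in> domn D - K"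
      then obtain j where "j < nsub D" "z \<in> closure (subdom D j)" using domn_covered by blast
      with z have "j = i" by (auto simp: K_def)
      with \<open>z \<in> closure (subdom D j)\<close> show "z \<in> \<Union>(sub_mesh D i)" by (simp add: closure_subdom)
    qed
    ultimately have "domn D - K \<subseteq> subdom D i" unfolding subdom_region region_def by (rule interior_maximal[rotated])
    with assms \<open>y \<notin> K\<close> show False by (auto simp: frontier_subdom)
  qed
  then show thesis using that by (auto simp: K_def)
qed

subsection \<open>Shape functions\<close>

lemma
  assumes x: "x \<in> nodes"
  shows shape_cont: "continuous_on UNIV (shape D x)"
    and shape_outside: "y \<notin> domn D \<Longrightarrow> shape D x y = 0"
    and shape_node: "z \<in> nodes \<Longrightarrow> shape D x z = (if z = x then 1 else 0)"
    and shape_poly: "T \<in> mesh D \<Longrightarrow> \<exists>p. real_polynomial_function p \<and> (\<forall>y\<in>T. shape D x y = p y)"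
    and shape_away: "T \<in> mesh D \<Longrightarrow> x \<notin> T \<Longrightarrow> y \<in> T \<Longrightarrow> shape D x y = 0"
    and node_domn: "x \<in> domn D"
  using vel x unfolding velocity_ok_def by auto

lemma shape_away_subdom: "x \<in> nodes \<Longrightarrow> x \<notin> closure (subdom D i) \<Longrightarrow> y \<in> closure (subdom D i) \<Longrightarrow> shape D x y = 0"
  unfolding closure_subdom using shape_away by (auto simp: sub_mesh_def)

text \<open>
  A shape function vanishes on the elements that do not contain its node. A boundary point of the
  subdomain belongs either to the boundary of the domain or to a second subdomain, all of whose
  elements miss the node.
\<close>

lemma shape_interior_support:
  assumes x: "x \<in> nodes" "x \<in> subdom D i" and y: "y \<notin> subdom D i"
  shows "shape D x y = 0"
proof (cases "y \<in> domn D")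
  case True
  then obtain j where j: "j < nsub D" "y \<in> closure (subdom D j)" using domn_covered by blast
  show ?thesis
  proof (cases "j = i")
    case False
    then have "x \<notin> closure (subdom D j)" using subdom_closure_disjoint[OF x(2)] by blast
    then show ?thesis using shape_away_subdom x j by blast
  next
    case True
    with j y have "y \<in> frontier (subdom D i)" by (simp add: frontier_subdom)
    then obtain k where k: "k \<noteq> i" "y \<in> closure (subdom D k)"
      using frontier_subdom_neighbour \<open>y \<in> domn D\<close> by metis
    then have "x \<notin> closure (subdom D k)" using subdom_closure_disjoint[OF x(2)] by blast
    then show ?thesis using shape_away_subdom x k by blast
  qed
qed (use shape_outside x in blast)

lemma vfun_shape:
  assumes x: "x \<in> nodes" shows "vfun D (\<lambda>y. shape D x y *\<^sub>R g)"
  unfolding vfun_def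
proof (intro conjI allI impI)
  show "continuous_on UNIV (\<lambda>y. shape D x y *\<^sub>R g)" using shape_cont[OF x] by (intro continuous_intros)
  show "shape D x y *\<^sub>R g = 0" if "y \<notin> domn D" for y using shape_outside[OF x that] by simp
  show "pc1 (mesh D) (\<lambda>y. shape D x y *\<^sub>R g)" unfolding pc1_def
  proof
    fix T assume "T \<in> mesh D"
    then obtain p where p: "real_polynomial_function p" "\<forall>y\<in>T. shape D x y = p y" using shape_poly[OF x] by blast
    obtain p' where "\<forall>y. (p has_derivative p' y) (at y)" "\<forall>v. continuous_on UNIV (\<lambda>y. p' y v)"
      using real_polynomial_function_C1[OF p(1)] by blast
    then have "C1_map (\<lambda>y. p y *\<^sub>R g) (\<lambda>y v. p' y v *\<^sub>R g)"
      unfolding C1_map_def by (auto intro!: has_derivative_scaleR_left continuous_intros)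
    then show "\<exists>q q'. C1_map q q' \<and> (\<forall>y\<in>T. shape D x y *\<^sub>R g = q y)"
      using p(2) by (intro exI[of _ "\<lambda>y. p y *\<^sub>R g"]) auto
  qed
qed

definition nodal_sum :: "point set \<Rightarrow> (point \<Rightarrow> point) \<Rightarrow> point \<Rightarrow> point" where
  "nodal_sum X g = (\<lambda>y. \<Sum>x\<in>X. shape D x y *\<^sub>R g x)"

lemma vfun_nodal_sum: "X \<subseteq> nodes \<Longrightarrow> vfun D (nodal_sum X g)"
  unfolding nodal_sum_def by (intro vfun_sum vfun_shape) (auto intro: finite_subset)

lemma nodal_sum_node:
  assumes "X \<subseteq> nodes" "z \<in> nodes"
  shows "nodal_sum X g z = (if z \<in> X then g z else 0)"
proof -
  have "nodal_sum X g z = (\<Sum>x\<in>X. if x = z then g x else 0)"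
    unfolding nodal_sum_def using assms by (intro sum.cong) (auto simp: shape_node)
  then show ?thesis using finite_subset[OF assms(1)] by simp
qed

lemma edge_nodes_nodes: "edge_nodes D e \<subseteq> nodes"
  by (simp add: edge_nodes_def)

lemma edge_space_nodal_sum: "edge_space D e = range (nodal_sum (edge_nodes D e))"
  by (auto simp: edge_space_def nodal_sum_def)

lemma edge_space_zero:
  assumes "v \<in> edge_space D e" "\<And>x. x \<in> edge_nodes D e \<Longrightarrow> v x = 0" shows "v = (\<lambda>_. 0)"
proof -
  obtain g where v: "v = nodal_sum (edge_nodes D e) g" using assms(1) by (auto simp: edge_space_nodal_sum)
  have "g x = 0" if "x \<in> edge_nodes D e" for x
    using assms(2)[OF that] nodal_sum_node[OF edge_nodes_nodes, of x e g] that edge_nodes_nodes by (auto simp: v)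
  then show ?thesis by (simp add: v nodal_sum_def)
qed

lemma
  shows edges_disjoint: "e < nE \<Longrightarrow> e' < nE \<Longrightarrow> e \<noteq> e' \<Longrightarrow> edges D ! e \<inter> edges D ! e' = {}"
    and corners_not_edges: "corners D \<inter> \<Union>(set (edges D)) = {}"
    and iface_eq: "iface D = \<Union>(set (edges D)) \<union> corners D"
    and corners_nodes: "corners D \<subseteq> nodes"
    and edge_subs_card: "e < nE \<Longrightarrow> card (edge_subs D e) = 2"
    and edge_subs_only: "e < nE \<Longrightarrow> x \<in> edges D ! e \<Longrightarrow> i < nsub D \<Longrightarrow> x \<in> closure (subdom D i) \<Longrightarrow> i \<in> edge_subs D e"
    and edual_node: "e < nE \<Longrightarrow> (x, u) \<in> set (edual D e) \<Longrightarrow> x \<in> edge_nodes D e"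
    and no_edual: "e < nE \<Longrightarrow> edge_nodes D e = {} \<Longrightarrow> edual D e = []"
    and edge_basis: "e < nE \<Longrightarrow> edge_nodes D e \<noteq> {} \<Longrightarrow> fun_basis (eprim D e # map snd (edual D e)) (edge_space D e)"
    and edge_arc: "E \<in> set (edges D) \<Longrightarrow> \<exists>g. arc g \<and> E = path_image g - {pathstart g, pathfinish g}"
    and connected_subdom: "i < nsub D \<Longrightarrow> connected (subdom D i)"
  using dec unfolding decomposition_ok_def by (auto split: if_splits)

lemma edge_iface: "e < nE \<Longrightarrow> edges D ! e \<subseteq> iface D"
  using iface_eq nth_mem[of e "edges D"] by auto

lemma edge_subs_closure: "i \<in> edge_subs D e \<Longrightarrow> closure (edges D ! e) \<subseteq> closure (subdom D i)"
proof -
  assume "i \<in> edge_subs D e"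
  then have "edges D ! e \<subseteq> frontier (subdom D i)" by (simp add: edge_subs_def)
  then have "closure (edges D ! e) \<subseteq> frontier (subdom D i)" by (intro closure_minimal) auto
  then show ?thesis by (auto simp: frontier_def)
qed

lemma eprim_edge_space: "e < nE \<Longrightarrow> edge_nodes D e \<noteq> {} \<Longrightarrow> eprim D e \<in> edge_space D e"
  using edge_basis by (force simp: fun_basis_def)

lemma edual_edge_space: "e < nE \<Longrightarrow> m < length (edual D e) \<Longrightarrow> dual_fun D (e, m) \<in> edge_space D e"
proof -
  assume e: "e < nE" and m: "m < length (edual D e)"
  then have "edge_nodes D e \<noteq> {}" using no_edual by auto
  from edge_basis[OF e this] m show ?thesis by (auto simp: fun_basis_def dual_fun_def)
qed

lemma vfun_edge_space: "v \<in> edge_space D e \<Longrightarrow> vfun D v"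
  using vfun_nodal_sum[OF edge_nodes_nodes] by (auto simp: edge_space_nodal_sum)

lemma edge_space_node: "v \<in> edge_space D e \<Longrightarrow> z \<in> nodes \<Longrightarrow> z \<notin> edge_nodes D e \<Longrightarrow> v z = 0"
  using nodal_sum_node[OF edge_nodes_nodes] by (auto simp: edge_space_nodal_sum)

lemma edge_space_away:
  assumes v: "v \<in> edge_space D e" and e: "e < nE" and i: "i < nsub D" "i \<notin> edge_subs D e"
    and y: "y \<in> closure (subdom D i)"
  shows "v y = 0"
proof -
  have "shape D x y = 0" if "x \<in> edge_nodes D e" for x
  proof (rule shape_away_subdom[OF _ _ y])
    show "x \<in> nodes" using that edge_nodes_nodes by blast
    show "x \<notin> closure (subdom D i)" using edge_subs_only[OF e _ i(1)] i(2) that by (auto simp: edge_nodes_def)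
  qed
  with v show ?thesis by (auto simp: edge_space_nodal_sum nodal_sum_def)
qed

text \<open>
  The end point is a limit of interface points, so it is on the interface, hence a corner, or on the
  boundary of the domain.
\<close>

lemma edge_end_point:
  assumes e: "e < nE"
  obtains z where "z \<in> closure (edges D ! e)" "z \<in> corners D \<or> z \<notin> domn D"
proof -
  obtain g where g: "arc g" "edges D ! e = path_image g - {pathstart g, pathfinish g}"
    using edge_arc[of "edges D ! e"] e by auto
  define z where "z = pathstart g"
  have z: "z \<in> closure (edges D ! e)" "z \<notin> edges D ! e" using arc_end_in_closure[OF g(1)] by (auto simp: z_def g(2))
  have "edges D ! e \<subseteq> (\<Union>i<nsub D. frontier (subdom D i))" using edge_iface[OF e] by (auto simp: iface_def)
  moreover have "closed (\<Union>i<nsub D. frontier (subdom D i))" by (intro closed_UN) auto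
  ultimately have "z \<in> (\<Union>i<nsub D. frontier (subdom D i))" using z closure_minimal by blast
  then have "z \<in> iface D \<or> z \<in> frontier (domn D)" by (auto simp: iface_def)
  moreover have "z \<in> corners D" if "z \<in> iface D" using that z e nth_mem unfolding corners_def by blast
  moreover have "z \<notin> domn D" if "z \<in> frontier (domn D)" using that open_domn by (simp add: frontier_def interior_open)
  ultimately show thesis using z that by blast
qed

lemma node_cases:
  assumes "x \<in> nodes"
  obtains (interior) i where "i < nsub D" "x \<in> subdom D i" | (corner) "x \<in> corners D"
    | (edge) e where "e < nE" "x \<in> edge_nodes D e"
proof -
  obtain i where i: "i < nsub D" "x \<in> closure (subdom D i)" using domn_covered node_domn assms by blast
  show thesis
  proof (cases "x \<in> subdom D i")
    case False
    then have "x \<in> iface D" using domn_iface node_domn assms i by blast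
    then show thesis using corner edge assms unfolding iface_eq edge_nodes_def by (auto simp: in_set_conv_nth)
  qed (use interior i in blast)
qed

definition inodes :: "point set" where "inodes = {x \<in> nodes. \<exists>i<nsub D. x \<in> subdom D i}"

lemma inodes_not_iface: "x \<in> inodes \<Longrightarrow> x \<notin> iface D"
  using iface_not_subdom by (auto simp: inodes_def)

lemma corner_iface: "x \<in> corners D \<Longrightarrow> x \<in> iface D"
  by (simp add: iface_eq)

lemma edge_node_iface: "e < nE \<Longrightarrow> x \<in> edge_nodes D e \<Longrightarrow> x \<in> iface D"
  using edge_iface by (auto simp: edge_nodes_def)

lemma edge_node_not_corner: "e < nE \<Longrightarrow> x \<in> edge_nodes D e \<Longrightarrow> x \<notin> corners D"
  using corners_not_edges nth_mem[of e "edges D"] unfolding edge_nodes_def by blast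

text \<open>
  Every node is inside exactly one subdomain, or a corner, or on exactly one edge.
\<close>

lemma nodal_sum_split:
  "nodal_sum nodes g y = nodal_sum inodes g y + nodal_sum (corners D) g y + (\<Sum>e<nE. nodal_sum (edge_nodes D e) g y)"
proof -
  have N: "nodes = inodes \<union> corners D \<union> (\<Union>e<nE. edge_nodes D e)"
  proof (intro subset_antisym subsetI)
    fix x assume x: "x \<in> nodes"
    then show "x \<in> inodes \<union> corners D \<union> (\<Union>e<nE. edge_nodes D e)"
      by (rule node_cases) (use x in \<open>auto simp: inodes_def\<close>)
  qed (use corners_nodes edge_nodes_nodes in \<open>auto simp: inodes_def\<close>)
  have fin: "finite inodes" "finite (corners D)" "\<And>e. finite (edge_nodes D e)"
    using corners_nodes edge_nodes_nodes by (auto simp: inodes_def intro: finite_subset)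
  have d1: "inodes \<inter> corners D = {}" using inodes_not_iface corner_iface by blast
  have d2: "(inodes \<union> corners D) \<inter> (\<Union>e<nE. edge_nodes D e) = {}"
    using inodes_not_iface edge_node_iface edge_node_not_corner by blast
  have "(\<Sum>x\<in>(\<Union>e<nE. edge_nodes D e). shape D x y *\<^sub>R g x) = (\<Sum>e<nE. nodal_sum (edge_nodes D e) g y)"
    unfolding nodal_sum_def using edges_disjoint fin by (intro sum.UNION_disjoint) (auto simp: edge_nodes_def)
  then show ?thesis
    unfolding nodal_sum_def N using fin d1 d2 by (simp add: sum.union_disjoint nodal_sum_def)
qed

end

section \<open>Velocity families of the partially assembled space\<close>

lemma distinct_concat_map:
  assumes "distinct xs" "\<And>x. x \<in> set xs \<Longrightarrow> distinct (f x)"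
    "\<And>x y. x \<in> set xs \<Longrightarrow> y \<in> set xs \<Longrightarrow> x \<noteq> y \<Longrightarrow> set (f x) \<inter> set (f y) = {}"
  shows "distinct (concat (map f xs))"
  using assms
proof (induction xs)
  case (Cons a xs)
  have "set (f a) \<inter> (\<Union>x\<in>set xs. set (f x)) = {}" using Cons.prems(1) Cons.prems(3)[of a] by fastforce
  with Cons show ?case by auto
qed simp

lemma comb_labelled:
  assumes "distinct idx"
  shows "\<exists>d. (\<forall>k<length idx. c $ k = d (idx ! k)) \<and> comb c (map F idx) = (\<lambda>y. \<Sum>x\<in>set idx. d x *\<^sub>R F x y)"
proof -
  obtain d where d: "\<forall>k<length idx. c $ k = d (idx ! k)"
    using labelled_coefficients[OF assms, of "\<lambda>k. c $ k"] by blast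
  have "comb c (map F idx) = (\<lambda>y. \<Sum>k<length idx. d (idx ! k) *\<^sub>R F (idx ! k) y)"
    unfolding comb_def by (rule ext) (simp add: d)
  also have "\<dots> = (\<lambda>y. \<Sum>x\<in>set idx. d x *\<^sub>R F x y)"
    by (rule ext) (rule sum_nth_distinct[OF assms])
  finally show ?thesis using d by blast
qed

lemma comb_vec_labelled:
  assumes "distinct idx"
  shows "comb (Matrix.vec (length idx) (\<lambda>k. d (idx ! k))) (map F idx) = (\<lambda>y. \<Sum>x\<in>set idx. d x *\<^sub>R F x y)"
proof -
  have "comb (Matrix.vec (length idx) (\<lambda>k. d (idx ! k))) (map F idx) = (\<lambda>y. \<Sum>k<length idx. d (idx ! k) *\<^sub>R F (idx ! k) y)"
    unfolding comb_def by (rule ext) simp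
  also have "\<dots> = (\<lambda>y. \<Sum>x\<in>set idx. d x *\<^sub>R F x y)"
    by (rule ext) (rule sum_nth_distinct[OF assms])
  finally show ?thesis .
qed

lemma sum_lessThan_append:
  fixes f :: "nat \<Rightarrow> 'a :: comm_monoid_add"
  shows "(\<Sum>k<a + b. f k) = (\<Sum>k<a. f k) + (\<Sum>k<b. f (a + k))"
  by (induction b) (simp_all add: add.assoc)

lemma comb_append:
  "comb c (xs @ ys) y = comb (Matrix.vec (length xs) (\<lambda>k. c $ k)) xs y
     + comb (Matrix.vec (length ys) (\<lambda>k. c $ (length xs + k))) ys y"
proof -
  have "comb c (xs @ ys) y = (\<Sum>k<length xs + length ys. c $ k *\<^sub>R ((xs @ ys) ! k) y)" by (simp add: comb_def)
  also have "\<dots> = (\<Sum>k<length xs. c $ k *\<^sub>R ((xs @ ys) ! k) y) + (\<Sum>k<length ys. c $ (length xs + k) *\<^sub>R ((xs @ ys) ! (length xs + k)) y)"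
    by (rule sum_lessThan_append)
  finally show ?thesis by (simp add: comb_def nth_append)
qed

lemma comb_cong: "(\<And>k. k < length fs \<Longrightarrow> c $ k = d $ k) \<Longrightarrow> comb c fs = comb d fs"
  by (simp add: comb_def)

text \<open>
  The labels of the nodal basis functions: a node together with a component.
\<close>

definition node_labels :: "point list \<Rightarrow> (point \<times> 2) list" where
  "node_labels xs = concat (map (\<lambda>x. [(x, 1), (x, 2)]) xs)"

definition nodal_fun :: "dd \<Rightarrow> point \<times> 2 \<Rightarrow> point \<Rightarrow> point" where
  "nodal_fun D = (\<lambda>(x, k) y. shape D x y *\<^sub>R axis k 1)"

lemma nodal_funs_eq: "nodal_funs D S = map (nodal_fun D) (node_labels (filter (\<lambda>x. x \<in> S) (vnodes D)))"
  by (simp add: nodal_funs_def node_labels_def nodal_fun_def map_concat comp_def)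

lemma distinct_node_labels: "distinct xs \<Longrightarrow> distinct (node_labels xs)"
  unfolding node_labels_def by (rule distinct_concat_map) auto

lemma set_node_labels: "set (node_labels xs) = set xs \<times> UNIV"
  unfolding node_labels_def UNIV_2 by auto

lemma dual_loc_eq: "dual_loc D i = concat (map (\<lambda>e. if i \<in> edge_subs D e then map (Pair e) [0..<length (edual D e)] else []) [0..<length (edges D)])"
  unfolding dual_loc_def by (rule arg_cong[of _ _ concat]) (simp cong: map_cong)

lemma set_dual_loc: "set (dual_loc D i) = {(e, m). e < length (edges D) \<and> i \<in> edge_subs D e \<and> m < length (edual D e)}"
  unfolding dual_loc_eq by (auto split: if_splits)

lemma distinct_dual_loc: "distinct (dual_loc D i)"
  unfolding dual_loc_eq by (rule distinct_concat_map) (auto simp: distinct_map inj_on_def split: if_splits)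

lemma set_dual_idx: "set (dual_idx D) = {(i, e, m). i < nsub D \<and> e < length (edges D) \<and> i \<in> edge_subs D e \<and> m < length (edual D e)}"
  unfolding dual_idx_def by (force simp: set_dual_loc)

lemma distinct_dual_idx: "distinct (dual_idx D)"
  unfolding dual_idx_def
  by (rule distinct_concat_map) (auto simp: distinct_map distinct_dual_loc inj_on_def)

lemma mult_idx_eq: "mult_idx D = concat (map (\<lambda>e. map (Pair e) [0..<length (edual D e)]) [0..<length (edges D)])"
  unfolding mult_idx_def by (rule arg_cong[of _ _ concat]) (simp cong: map_cong)

lemma set_mult_idx: "set (mult_idx D) = {(e, m). e < length (edges D) \<and> m < length (edual D e)}"
  unfolding mult_idx_eq by auto

lemma distinct_mult_idx: "distinct (mult_idx D)"
  unfolding mult_idx_eq by (rule distinct_concat_map) (auto simp: distinct_map inj_on_def)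

lemma edge_subs_less: "i \<in> edge_subs D e \<Longrightarrow> i < nsub D"
  by (simp add: edge_subs_def)

lemma length_velD: "length (velD D) = length (dual_idx D)"
  by (simp add: velD_def)

definition jump_sign :: "dd \<Rightarrow> nat \<Rightarrow> nat \<Rightarrow> real" where
  "jump_sign D e i = (if i = Min (edge_subs D e) then 1 else - 1)"

lemma B_Delta_carrier: "B_Delta D \<in> carrier_mat (nL D) (nD D)"
  and B_Delta_D_carrier: "B_Delta_D D \<in> carrier_mat (nL D) (nD D)"
  by (simp_all add: B_Delta_def B_Delta_D_def)

definition dual_sum :: "dd \<Rightarrow> (nat \<Rightarrow> nat \<Rightarrow> nat \<Rightarrow> real) \<Rightarrow> nat \<Rightarrow> point \<Rightarrow> point" where
  "dual_sum D d i = (\<lambda>y. \<Sum>e | e < length (edges D) \<and> i \<in> edge_subs D e. \<Sum>m<length (edual D e). d i e m *\<^sub>R dual_fun D (e, m) y)"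

lemma sum_dual_loc:
  "(\<Sum>x\<in>set (dual_loc D i). (case x of (e, m) \<Rightarrow> d i e m) *\<^sub>R dual_fun D x y) = dual_sum D d i y"
proof -
  have "set (dual_loc D i) = Sigma {e. e < length (edges D) \<and> i \<in> edge_subs D e} (\<lambda>e. {..<length (edual D e)})"
    by (auto simp: set_dual_loc)
  then show ?thesis by (simp add: dual_sum_def sum.Sigma case_prod_unfold)
qed

lemma fam_velD:
  assumes c: "\<forall>k<length (dual_idx D). c $ k = (case dual_idx D ! k of (j, e, m) \<Rightarrow> d j e m)" and i: "i < nsub D"
  shows "fam c (velD D) i = dual_sum D d i"
proof
  fix y
  define G where "G = (\<lambda>(j, e, m). d j e m *\<^sub>R (if i = j then dual_fun D (e, m) else (\<lambda>_. 0)) y)"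
  have "fam c (velD D) i y = (\<Sum>k<length (dual_idx D). G (dual_idx D ! k))"
    unfolding fam_def velD_def G_def by (auto intro!: sum.cong simp: c split: prod.splits)
  also have "\<dots> = (\<Sum>x\<in>set (dual_idx D). G x)" by (rule sum_nth_distinct[OF distinct_dual_idx])
  also have "\<dots> = (\<Sum>x\<in>Pair i ` set (dual_loc D i). G x)"
    by (rule sum.mono_neutral_right[OF finite_set]) (auto simp: set_dual_idx set_dual_loc G_def i)
  also have "\<dots> = (\<Sum>x\<in>set (dual_loc D i). (case x of (e, m) \<Rightarrow> d i e m) *\<^sub>R dual_fun D x y)"
    by (subst sum.reindex) (auto simp: inj_on_def G_def intro!: sum.cong split: prod.splits)
  also have "\<dots> = dual_sum D d i y" by (rule sum_dual_loc)
  finally show "fam c (velD D) i y = dual_sum D d i y" .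
qed

lemma comb_velD_loc:
  "comb (Matrix.vec (length (dual_loc D i)) (\<lambda>k. case dual_loc D i ! k of (e, m) \<Rightarrow> d i e m)) (velD_loc D i) = dual_sum D d i"
  unfolding velD_loc_def
  using comb_vec_labelled[OF distinct_dual_loc, of D i "\<lambda>(e, m). d i e m" "dual_fun D"] sum_dual_loc[of d i D] by auto

context decomposed_mesh
begin

text \<open>
  The coefficients of a combination of nodal basis functions are the components of its nodal values,
  so vanishing nodal values force vanishing coefficients.
\<close>

lemma nodal_list_coefficients:
  assumes xs: "distinct xs"
  shows "\<exists>g. comb c (map (nodal_fun D) (node_labels xs)) = nodal_sum (set xs) g \<and>
    ((\<forall>x\<in>set xs. g x = 0) \<longrightarrow> (\<forall>k<length (node_labels xs). c $ k = 0))"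
proof -
  obtain d where d: "\<forall>k<length (node_labels xs). c $ k = d (node_labels xs ! k)"
    and c: "comb c (map (nodal_fun D) (node_labels xs)) = (\<lambda>y. \<Sum>x\<in>set (node_labels xs). d x *\<^sub>R nodal_fun D x y)"
    using comb_labelled[OF distinct_node_labels[OF xs]] by blast
  define g where "g x = (\<Sum>k\<in>UNIV. d (x, k) *\<^sub>R (axis k 1 :: point))" for x
  show ?thesis
  proof (intro exI[of _ g] conjI impI)
    have "(\<Sum>x\<in>set (node_labels xs). d x *\<^sub>R nodal_fun D x y) = nodal_sum (set xs) g y" for y
      unfolding set_node_labels nodal_sum_def g_def sum.cartesian_product[symmetric]
      by (simp add: nodal_fun_def scaleR_sum_right case_prod_unfold sum.cartesian_product' mult.commute)
    then show "comb c (map (nodal_fun D) (node_labels xs)) = nodal_sum (set xs) g" unfolding c by auto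
    assume g0: "\<forall>x\<in>set xs. g x = 0"
    show "\<forall>k<length (node_labels xs). c $ k = 0"
    proof (intro allI impI)
      fix k assume k: "k < length (node_labels xs)"
      obtain x j where xj: "node_labels xs ! k = (x, j)" by (cases "node_labels xs ! k") auto
      have "x \<in> set xs" using nth_mem[OF k] by (simp add: xj set_node_labels)
      then have "vec_nth (g x) j = 0" using g0 by simp
      moreover have "vec_nth (g x) j = d (x, j)"
        by (simp add: g_def sum_component axis_def if_distrib[of "\<lambda>t. _ * t"] cong: if_cong)
      ultimately show "c $ k = 0" using d k xj by simp
    qed
  qed
qed

lemma nodal_list_coefficients_exist:
  assumes xs: "distinct xs"
  shows "\<exists>c\<in>carrier_vec (length (node_labels xs)).
    comb c (map (nodal_fun D) (node_labels xs)) = nodal_sum (set xs) g"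
proof -
  define d where "d = (\<lambda>(x, j). vec_nth (g x) j)"
  have "(\<Sum>x\<in>set (node_labels xs). d x *\<^sub>R nodal_fun D x y) = nodal_sum (set xs) g y" for y
  proof -
    have "g x = (\<Sum>k\<in>UNIV. d (x, k) *\<^sub>R (axis k 1 :: point))" for x
      unfolding d_def using basis_expansion[of "g x"] by (simp add: scalar_mult_eq_scaleR)
    then show ?thesis unfolding set_node_labels nodal_sum_def
      by (simp add: nodal_fun_def scaleR_sum_right case_prod_unfold sum.cartesian_product' mult.commute)
  qed
  then show ?thesis
    using comb_vec_labelled[OF distinct_node_labels[OF xs], of d "nodal_fun D"]
    by (intro bexI[of _ "Matrix.vec (length (node_labels xs)) (\<lambda>k. d (node_labels xs ! k))"]) auto
qed

text \<open>
  The nodes behind \<open>velI\<close>, in the order of that list: subdomain by subdomain.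
\<close>

definition ilist :: "point list" where
  "ilist = concat (map (\<lambda>i. filter (\<lambda>x. x \<in> subdom D i) (vnodes D)) [0..<nsub D])"

definition clist :: "point list" where "clist = filter (\<lambda>x. x \<in> corners D) (vnodes D)"

definition elist :: "nat list" where "elist = filter (\<lambda>e. edge_nodes D e \<noteq> {}) [0..<nE]"

lemma distinct_vnodes: "distinct (vnodes D)"
  using vel by (simp add: velocity_ok_def)

lemma distinct_ilist: "distinct ilist"
  unfolding ilist_def
proof (rule distinct_concat_map)
  fix i j :: nat assume "i \<noteq> j"
  then show "set (filter (\<lambda>x. x \<in> subdom D i) (vnodes D)) \<inter> set (filter (\<lambda>x. x \<in> subdom D j) (vnodes D)) = {}"
    using subdom_closure_disjoint closure_subset by fastforce
qed (simp_all add: distinct_vnodes)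

lemma set_ilist: "set ilist = inodes"
  by (auto simp: ilist_def inodes_def)

lemma set_clist: "set clist = corners D" and distinct_clist: "distinct clist"
  using corners_nodes distinct_vnodes by (auto simp: clist_def)

lemma set_elist: "set elist = {e. e < nE \<and> edge_nodes D e \<noteq> {}}" and distinct_elist: "distinct elist"
  by (auto simp: elist_def)

lemma concat_node_labels:
  "concat (map (\<lambda>i. map F (node_labels (g i))) is) = map F (node_labels (concat (map g is)))"
  by (induction "is") (simp_all add: node_labels_def)

lemma velI_eq: "velI D = map (\<lambda>f i. f) (map (nodal_fun D) (node_labels ilist))"
  unfolding velI_def ilist_def concat_node_labels[symmetric] velI_loc_def[abs_def] nodal_funs_eq ..

lemma velP_eq: "velP D = map (\<lambda>f i. f) (map (nodal_fun D) (node_labels clist) @ map (eprim D) elist)"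
  by (simp add: velP_def nodal_funs_eq clist_def elist_def)

definition vel_family :: "rvec \<Rightarrow> rvec \<Rightarrow> rvec \<Rightarrow> nat \<Rightarrow> point \<Rightarrow> point" where
  "vel_family wI wD wP i = (\<lambda>y. fam wI (velI D) i y + fam wD (velD D) i y + fam wP (velP D) i y)"

text \<open>
  The velocity families \<open>vel_family\<close> again, given by nodal values and labelled coefficients instead of
  coefficient vectors. In this form values at nodes can be read off.
\<close>

definition coeff_family :: "(point \<Rightarrow> point) \<Rightarrow> (nat \<Rightarrow> nat \<Rightarrow> nat \<Rightarrow> real) \<Rightarrow> (point \<Rightarrow> point) \<Rightarrow> (nat \<Rightarrow> real) \<Rightarrow> nat \<Rightarrow> point \<Rightarrow> point" where
  "coeff_family gI d gC pe i = (\<lambda>y. nodal_sum inodes gI y + dual_sum D d i y +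
     (nodal_sum (corners D) gC y + (\<Sum>e\<in>set elist. pe e *\<^sub>R eprim D e y)))"

lemma dual_coefficients:
  "\<exists>d. \<forall>k<length (dual_idx D). (c :: rvec) $ k = (case dual_idx D ! k of (j, e, m) \<Rightarrow> d j e m)"
proof -
  obtain d where d: "\<forall>k<length (dual_idx D). c $ k = d (dual_idx D ! k)"
    using labelled_coefficients[OF distinct_dual_idx, of D "\<lambda>k. c $ k"] by blast
  then show ?thesis by (intro exI[of _ "\<lambda>j e m. d (j, e, m)"]) (auto split: prod.splits)
qed

text \<open>
  The three implications at the end say that no coefficient is lost on the way to the labelled form;
  they are what turns the vanishing of a velocity into the vanishing of its coefficient vectors.
\<close>

lemma vel_family_coefficients:
  assumes wI: "wI \<in> carrier_vec (nI D)" and wD: "wD \<in> carrier_vec (nD D)" and wP: "wP \<in> carrier_vec (nP D)"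
  shows "\<exists>gI d gC pe. (\<forall>i<nsub D. vel_family wI wD wP i = coeff_family gI d gC pe i) \<and>
    (\<forall>i. fam wI (velI D) i = nodal_sum inodes gI) \<and>
    (\<forall>i<nsub D. fam wD (velD D) i = dual_sum D d i) \<and>
    ((\<forall>x\<in>inodes. gI x = 0) \<longrightarrow> wI = 0\<^sub>v (nI D)) \<and>
    ((\<forall>i e m. e < nE \<and> i \<in> edge_subs D e \<and> m < length (edual D e) \<longrightarrow> d i e m = 0) \<longrightarrow> wD = 0\<^sub>v (nD D)) \<and>
    ((\<forall>x\<in>corners D. gC x = 0) \<and> (\<forall>e\<in>set elist. pe e = 0) \<longrightarrow> wP = 0\<^sub>v (nP D))"
proof -
  obtain gI where gI: "comb wI (map (nodal_fun D) (node_labels ilist)) = nodal_sum (set ilist) gI"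
    "(\<forall>x\<in>set ilist. gI x = 0) \<longrightarrow> (\<forall>k<length (node_labels ilist). wI $ k = 0)"
    using nodal_list_coefficients[OF distinct_ilist, of wI] by blast
  obtain d where d: "\<forall>k<length (dual_idx D). wD $ k = (case dual_idx D ! k of (j, e, m) \<Rightarrow> d j e m)"
    using dual_coefficients by blast
  define a where "a = length (node_labels clist)"
  define b where "b = length elist"
  define cC where "cC = Matrix.vec a (\<lambda>k. wP $ k)"
  define cE where "cE = Matrix.vec b (\<lambda>k. wP $ (a + k))"
  obtain gC where gC: "comb cC (map (nodal_fun D) (node_labels clist)) = nodal_sum (set clist) gC"
    "(\<forall>x\<in>set clist. gC x = 0) \<longrightarrow> (\<forall>k<length (node_labels clist). cC $ k = 0)"
    using nodal_list_coefficients[OF distinct_clist, of cC] by blast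
  obtain pe where pe: "\<forall>k<length elist. cE $ k = pe (elist ! k)"
    "comb cE (map (eprim D) elist) = (\<lambda>y. \<Sum>e\<in>set elist. pe e *\<^sub>R eprim D e y)"
    using comb_labelled[OF distinct_elist, of cE "eprim D"] by blast
  have I: "fam wI (velI D) i = nodal_sum inodes gI" for i
    unfolding velI_eq fam_map gI(1) set_ilist ..
  have Dd: "fam wD (velD D) i = dual_sum D d i" if "i < nsub D" for i
    by (rule fam_velD[OF d that])
  have P: "fam wP (velP D) i = (\<lambda>y. nodal_sum (corners D) gC y + (\<Sum>e\<in>set elist. pe e *\<^sub>R eprim D e y))" for i
  proof
    fix y
    have "fam wP (velP D) i y = comb cC (map (nodal_fun D) (node_labels clist)) y + comb cE (map (eprim D) elist) y"
      unfolding velP_eq fam_map comb_append by (simp add: cC_def cE_def a_def b_def)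
    then show "fam wP (velP D) i y = nodal_sum (corners D) gC y + (\<Sum>e\<in>set elist. pe e *\<^sub>R eprim D e y)"
      unfolding gC(1) pe(2) set_clist .
  qed
  show ?thesis
  proof (intro exI conjI allI impI)
    show "vel_family wI wD wP i = coeff_family gI d gC pe i" if "i < nsub D" for i
      unfolding vel_family_def coeff_family_def I Dd[OF that] P ..
    show "fam wI (velI D) i = nodal_sum inodes gI" for i by (rule I)
    show "fam wD (velD D) i = dual_sum D d i" if "i < nsub D" for i by (rule Dd[OF that])
    show "wI = 0\<^sub>v (nI D)" if "\<forall>x\<in>inodes. gI x = 0"
      using gI(2) that wI unfolding set_ilist by (intro eq_vecI) (auto simp: velI_eq)
    show "wD = 0\<^sub>v (nD D)"
      if z: "\<forall>i e m. e < nE \<and> i \<in> edge_subs D e \<and> m < length (edual D e) \<longrightarrow> d i e m = 0"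
    proof (rule eq_vecI)
      fix k assume "k < dim_vec (0\<^sub>v (nD D))"
      then have k: "k < length (dual_idx D)" by (simp add: length_velD)
      from nth_mem[OF k] d[rule_format, OF k] z show "wD $ k = 0\<^sub>v (nD D) $ k"
        using k by (auto simp: set_dual_idx length_velD split: prod.splits)
    qed (use wD in auto)
    assume "(\<forall>x\<in>corners D. gC x = 0) \<and> (\<forall>e\<in>set elist. pe e = 0)"
    then have c0: "\<forall>x\<in>corners D. gC x = 0" and e0: "\<forall>e\<in>set elist. pe e = 0" by auto
    show "wP = 0\<^sub>v (nP D)"
    proof (rule eq_vecI)
      fix k assume "k < dim_vec (0\<^sub>v (nP D))"
      then have k: "k < a + b" by (simp add: velP_eq a_def b_def)
      have "wP $ k = 0"
      proof (cases "k < a")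
        case True
        then have "wP $ k = cC $ k" by (simp add: cC_def)
        then show ?thesis using gC(2) c0 True by (simp add: set_clist a_def)
      next
        case False
        with k have "k - a < b" by simp
        then have "wP $ k = cE $ (k - a)" using False by (simp add: cE_def)
        then show ?thesis using pe(1) e0 \<open>k - a < b\<close> by (simp add: b_def)
      qed
      then show "wP $ k = 0\<^sub>v (nP D) $ k" using k by (simp add: velP_eq a_def b_def)
    qed (use wP in auto)
  qed
qed

lemma vel_family_coefficients_exist:
  "\<exists>wI\<in>carrier_vec (nI D). \<exists>wD\<in>carrier_vec (nD D). \<exists>wP\<in>carrier_vec (nP D).
    (\<forall>i<nsub D. vel_family wI wD wP i = coeff_family gI d gC pe i) \<and>
    (\<forall>k<length (dual_idx D). wD $ k = (case dual_idx D ! k of (j, e, m) \<Rightarrow> d j e m))"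
proof -
  obtain wI where wI: "wI \<in> carrier_vec (length (node_labels ilist))"
    "comb wI (map (nodal_fun D) (node_labels ilist)) = nodal_sum (set ilist) gI"
    using nodal_list_coefficients_exist[OF distinct_ilist] by blast
  obtain cC where cC: "cC \<in> carrier_vec (length (node_labels clist))"
    "comb cC (map (nodal_fun D) (node_labels clist)) = nodal_sum (set clist) gC"
    using nodal_list_coefficients_exist[OF distinct_clist] by blast
  define cE where "cE = Matrix.vec (length elist) (\<lambda>k. pe (elist ! k))"
  define wP where "wP = cC @\<^sub>v cE"
  define wD where "wD = Matrix.vec (length (dual_idx D)) (\<lambda>k. case dual_idx D ! k of (j, e, m) \<Rightarrow> d j e m)"
  have wD: "\<forall>k<length (dual_idx D). wD $ k = (case dual_idx D ! k of (j, e, m) \<Rightarrow> d j e m)"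
    by (simp add: wD_def)
  have P: "fam wP (velP D) i y = nodal_sum (corners D) gC y + (\<Sum>e\<in>set elist. pe e *\<^sub>R eprim D e y)" for i y
  proof -
    have 1: "comb (Matrix.vec (length (map (nodal_fun D) (node_labels clist))) (\<lambda>k. wP $ k)) (map (nodal_fun D) (node_labels clist))
      = comb cC (map (nodal_fun D) (node_labels clist))"
      using cC(1) by (intro comb_cong) (simp add: wP_def cE_def)
    have 2: "comb (Matrix.vec (length (map (eprim D) elist)) (\<lambda>k. wP $ (length (map (nodal_fun D) (node_labels clist)) + k))) (map (eprim D) elist)
      = comb cE (map (eprim D) elist)"
      using cC(1) by (intro comb_cong) (simp add: wP_def cE_def)
    show ?thesis unfolding velP_eq fam_map comb_append 1 2 cC set_clist
      unfolding cE_def comb_vec_labelled[OF distinct_elist] ..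
  qed
  show ?thesis
  proof (rule bexI[of _ wI], rule bexI[of _ wD], rule bexI[of _ wP], intro conjI allI impI)
    show "wI \<in> carrier_vec (nI D)" using wI by (simp add: velI_eq)
    show "wD \<in> carrier_vec (nD D)" by (simp add: wD_def length_velD)
    show "wP \<in> carrier_vec (nP D)" using cC by (auto simp: wP_def cE_def velP_eq)
    show "vel_family wI wD wP i = coeff_family gI d gC pe i" if "i < nsub D" for i
      unfolding vel_family_def coeff_family_def fam_velD[OF wD that] P
      unfolding velI_eq fam_map wI set_ilist ..
    show "wD $ k = (case dual_idx D ! k of (j, e, m) \<Rightarrow> d j e m)" if "k < length (dual_idx D)" for k
      using wD that by blast
  qed
qed

lemma inodes_nodes: "inodes \<subseteq> nodes"
  by (auto simp: inodes_def)

lemma vfun_dual_sum: "vfun D (dual_sum D d i)"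
  unfolding dual_sum_def
  by (intro vfun_sum vfun_scale) (auto intro: vfun_edge_space edual_edge_space)

lemma vfun_eprim: "e \<in> set elist \<Longrightarrow> vfun D (eprim D e)"
  by (rule vfun_edge_space[OF eprim_edge_space]) (auto simp: set_elist)

lemma vfun_primal_sum: "vfun D (\<lambda>y. \<Sum>e\<in>set elist. pe e *\<^sub>R eprim D e y)"
  by (intro vfun_sum vfun_scale vfun_eprim) auto

lemma vfun_coeff_family: "vfun D (coeff_family gI d gC pe i)"
  unfolding coeff_family_def
  by (intro vfun_add vfun_nodal_sum vfun_dual_sum vfun_primal_sum inodes_nodes corners_nodes)

lemma vfun_basis:
  "f \<in> set (velI D) \<Longrightarrow> vfun D (f i)" "f \<in> set (velD D) \<Longrightarrow> vfun D (f i)" "f \<in> set (velP D) \<Longrightarrow> vfun D (f i)"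
proof -
  have n: "vfun D (nodal_fun D l)" if "l \<in> set (node_labels xs)" "set xs \<subseteq> nodes" for l xs
    using that vfun_shape by (auto simp: nodal_fun_def set_node_labels split: prod.splits)
  show "f \<in> set (velI D) \<Longrightarrow> vfun D (f i)" using n[of _ ilist] inodes_nodes by (auto simp: velI_eq set_ilist)
  show "f \<in> set (velP D) \<Longrightarrow> vfun D (f i)" using n[of _ clist] corners_nodes
    by (auto simp: velP_eq set_clist intro: vfun_eprim)
  show "f \<in> set (velD D) \<Longrightarrow> vfun D (f i)"
    unfolding velD_def using vfun_edge_space[OF edual_edge_space]
    by (auto simp: set_dual_idx vfun_zero)
qed

lemma vfun_vel_family: "vfun D (vel_family wI wD wP i)"
  unfolding vel_family_def by (intro vfun_add vfun_fam vfun_basis)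

lemma dual_sum_node:
  assumes "z \<in> nodes" "\<And>e. e < nE \<Longrightarrow> z \<notin> edge_nodes D e"
  shows "dual_sum D d i z = 0"
  unfolding dual_sum_def using edge_space_node[OF edual_edge_space assms(1)] assms(2)
  by (intro sum.neutral) auto

lemma primal_sum_node:
  assumes "z \<in> nodes" "\<And>e. e < nE \<Longrightarrow> z \<notin> edge_nodes D e"
  shows "(\<Sum>e\<in>set elist. pe e *\<^sub>R eprim D e z) = 0"
  using edge_space_node[OF eprim_edge_space assms(1)] assms(2)
  by (intro sum.neutral) (auto simp: set_elist)

lemma coeff_family_corner: "z \<in> corners D \<Longrightarrow> coeff_family gI d gC pe i z = gC z"
proof -
  assume z: "z \<in> corners D"
  then have n: "z \<in> nodes" "z \<notin> inodes" using corners_nodes inodes_not_iface corner_iface by auto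
  have e: "e < nE \<Longrightarrow> z \<notin> edge_nodes D e" for e using edge_node_not_corner z by blast
  show ?thesis unfolding coeff_family_def
    by (simp add: dual_sum_node[OF n(1) e] primal_sum_node[OF n(1) e] nodal_sum_node[OF inodes_nodes n(1)]
        nodal_sum_node[OF corners_nodes n(1)] z n(2))
qed

lemma coeff_family_inode: "z \<in> inodes \<Longrightarrow> coeff_family gI d gC pe i z = gI z"
proof -
  assume z: "z \<in> inodes"
  then have n: "z \<in> nodes" "z \<notin> corners D" using inodes_nodes inodes_not_iface corner_iface by auto
  have e: "e < nE \<Longrightarrow> z \<notin> edge_nodes D e" for e using edge_node_iface inodes_not_iface z by blast
  show ?thesis unfolding coeff_family_def
    by (simp add: dual_sum_node[OF n(1) e] primal_sum_node[OF n(1) e] nodal_sum_node[OF inodes_nodes n(1)]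
        nodal_sum_node[OF corners_nodes n(1)] z n(2))
qed

text \<open>
  At a node of an edge all contributions vanish except those of that edge, so that the values on the
  nodes of an edge determine its primal coefficient and its dual coefficients on the subdomain \<open>i\<close>.
\<close>

lemma coeff_family_edge_node:
  assumes e: "e < nE" "i \<in> edge_subs D e" and z: "z \<in> edge_nodes D e"
  shows "coeff_family gI d gC pe i z = pe e *\<^sub>R eprim D e z + (\<Sum>m<length (edual D e). d i e m *\<^sub>R dual_fun D (e, m) z)"
proof -
  have n: "z \<in> nodes" "z \<notin> inodes" "z \<notin> corners D"
    using edge_nodes_nodes z inodes_not_iface edge_node_iface[OF e(1)] edge_node_not_corner[OF e(1)] by auto
  have other: "z \<notin> edge_nodes D e'" if "e' < nE" "e' \<noteq> e" for e'
    using edges_disjoint[OF e(1) that(1)] that(2) z by (auto simp: edge_nodes_def)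
  have "dual_sum D d i z = (\<Sum>e'\<in>{e}. \<Sum>m<length (edual D e'). d i e' m *\<^sub>R dual_fun D (e', m) z)"
    unfolding dual_sum_def using e edge_space_node[OF edual_edge_space n(1)] other
    by (intro sum.mono_neutral_right) (auto intro!: sum.neutral)
  moreover have "(\<Sum>e'\<in>set elist. pe e' *\<^sub>R eprim D e' z) = (\<Sum>e'\<in>{e}. pe e' *\<^sub>R eprim D e' z)"
    using e z edge_space_node[OF eprim_edge_space n(1)] other
    by (intro sum.mono_neutral_right) (auto simp: set_elist)
  ultimately show ?thesis unfolding coeff_family_def
    by (simp add: nodal_sum_node[OF inodes_nodes n(1)] nodal_sum_node[OF corners_nodes n(1)] n)
qed

subsection \<open>Definiteness of the broken energy\<close>

lemma subdom_nonempty: "i < nsub D \<Longrightarrow> subdom D i \<noteq> {}"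
proof -
  assume "i < nsub D"
  then obtain T where T: "T \<in> mesh D" "part D T = i" using dec by (auto simp: decomposition_ok_def)
  then have "interior T \<subseteq> subdom D i" unfolding subdom_region by (intro interior_subset_region) (simp add: sub_mesh_def)
  moreover obtain a b c where "triangle_of a b c T" by (rule tri_mesh_triangle[OF mesh_tri T(1)])
  ultimately show ?thesis using interior_triangle_nonempty by blast
qed

lemma subdom_domn: "subdom D i \<subseteq> domn D"
  unfolding subdom_region domn_region by (intro region_mono sub_mesh_subset)

text \<open>
  Two subdomains that meet inside the domain share a corner or an edge, and an edge has an end point
  that is a corner, where all branches agree, or on the boundary of the domain, where they vanish. So
  neighbouring constants are equal. The closed union of the subdomains with constant zero and that of
  the others then cover the connected domain without meeting in it, and the first one is not empty
  because the domain is bounded and some subdomain touches its boundary.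
\<close>

lemma glued_constants_zero:
  assumes const: "\<And>i y. i < nsub D \<Longrightarrow> y \<in> closure (subdom D i) \<Longrightarrow> u i y = (k i :: point)"
    and corner: "\<And>i z. i < nsub D \<Longrightarrow> z \<in> corners D \<Longrightarrow> u i z = gC z"
    and outside: "\<And>i y. i < nsub D \<Longrightarrow> y \<notin> domn D \<Longrightarrow> u i y = 0"
    and i: "i < nsub D"
  shows "k i = 0"
proof (rule ccontr)
  assume ki: "k i \<noteq> 0"
  \<comment> \<open>Subdomains that meet inside the domain carry the same constant.\<close>
  have match: "k i = k j"
    if "i < nsub D" "j < nsub D" "y \<in> domn D" "y \<in> closure (subdom D i)" "y \<in> closure (subdom D j)" for i j y
  proof (cases "i = j")
    case False
    then have "y \<notin> subdom D i" using subdom_closure_disjoint that by blast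
    then have "y \<in> iface D" using domn_iface that by blast
    then consider "y \<in> corners D" | e where "e < nE" "y \<in> edges D ! e"
      unfolding iface_eq by (auto simp: in_set_conv_nth)
    then show ?thesis
    proof cases
      case 1
      then show ?thesis using const that corner by metis
    next
      case (2 e)
      have s: "i \<in> edge_subs D e" "j \<in> edge_subs D e" using edge_subs_only[OF 2] that by auto
      obtain z where z: "z \<in> closure (edges D ! e)" "z \<in> corners D \<or> z \<notin> domn D"
        by (rule edge_end_point[OF 2(1)])
      then have "z \<in> closure (subdom D i)" "z \<in> closure (subdom D j)" using edge_subs_closure s by auto
      then show ?thesis using z(2) const that corner outside by metis
    qed
  qed simp
  define A where "A = (\<Union>j\<in>{j. j < nsub D \<and> k j = 0}. closure (subdom D j))"
  define B where "B = (\<Union>j\<in>{j. j < nsub D \<and> k j \<noteq> 0}. closure (subdom D j))"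
  have cl: "closed A" "closed B" unfolding A_def B_def by (intro closed_UN; simp)+
  have cov: "domn D \<subseteq> A \<union> B" using domn_covered unfolding A_def B_def by blast
  have "y \<notin> A \<inter> B \<inter> domn D" for y
  proof
    assume y: "y \<in> A \<inter> B \<inter> domn D"
    then obtain i j where "i < nsub D" "k i = 0" "y \<in> closure (subdom D i)"
      "j < nsub D" "k j \<noteq> 0" "y \<in> closure (subdom D j)" unfolding A_def B_def by blast
    with match[of i j y] y show False by simp
  qed
  then have dis: "A \<inter> B \<inter> domn D = {}" by blast
  have "B \<inter> domn D \<noteq> {}"
    using subdom_nonempty[OF i] subdom_domn[of i] closure_subset[of "subdom D i"] i ki unfolding B_def by blast
  moreover have "A \<inter> domn D \<noteq> {}"
  proof -
    have "bounded (domn D)"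
    proof (rule bounded_subset)
      show "bounded (\<Union>(mesh D))"
      proof (rule bounded_Union)
        show "finite (mesh D)" using mesh_tri by (simp add: tri_mesh_def)
        show "\<forall>T\<in>mesh D. bounded T"
          using tri_mesh_triangle[OF mesh_tri] triangle_compact compact_imp_bounded by metis
      qed
      show "domn D \<subseteq> \<Union>(mesh D)" unfolding domn_def by (rule interior_subset)
    qed
    then have "domn D \<noteq> UNIV" using not_bounded_UNIV by metis
    moreover have "domn D \<noteq> {}" using subdom_nonempty[OF i] subdom_domn[of i] by blast
    ultimately obtain z where z: "z \<in> frontier (domn D)" using frontier_not_empty by blast
    then have "z \<in> closure (domn D)" "z \<notin> domn D" using open_domn by (auto simp: frontier_def interior_open)
    then obtain j where j: "j < nsub D" "z \<in> closure (subdom D j)" by (auto simp: closure_domn)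
    then have "k j = 0" using const outside \<open>z \<notin> domn D\<close> by metis
    then show ?thesis
      using subdom_nonempty[OF j(1)] subdom_domn[of j] closure_subset[of "subdom D j"] j(1) unfolding A_def by blast
  qed
  ultimately have "\<exists>A B. closed A \<and> closed B \<and> domn D \<subseteq> A \<union> B \<and> A \<inter> B \<inter> domn D = {} \<and> A \<inter> domn D \<noteq> {} \<and> B \<inter> domn D \<noteq> {}"
    using cl cov dis by (intro exI[of _ A] exI[of _ B]) simp
  moreover have "connected (domn D)" using mok by (simp add: mesh_ok_def)
  ultimately show False unfolding connected_closed by simp
qed

definition energy :: "(nat \<Rightarrow> point \<Rightarrow> point) \<Rightarrow> (nat \<Rightarrow> point \<Rightarrow> point) \<Rightarrow> real" where
  "energy u v = (\<Sum>i<nsub D. a_int (subdom D i) (u i) (v i))"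

lemma energy_nonneg: "0 \<le> energy u u"
  unfolding energy_def by (intro sum_nonneg a_int_nonneg)

lemma vfun_pc1: "vfun D u \<Longrightarrow> pc1 (sub_mesh D i) u"
  unfolding vfun_def using pc1_subset sub_mesh_subset by blast

lemma energy_zero_imp_vanish:
  assumes z: "energy (coeff_family gI d gC pe) (coeff_family gI d gC pe) = 0"
    and i: "i < nsub D" and y: "y \<in> closure (subdom D i)"
  shows "coeff_family gI d gC pe i y = 0"
proof -
  let ?u = "coeff_family gI d gC pe"
  have "a_int (subdom D i) (?u i) (?u i) = 0" if "i < nsub D" for i
    using z that unfolding energy_def by (subst (asm) sum_nonneg_eq_0_iff) (auto simp: a_int_nonneg)
  then have "\<exists>c. \<forall>y\<in>closure (subdom D i). ?u i y = c" if "i < nsub D" for i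
    using connected_subdom[OF that] that vfun_coeff_family[of gI d gC pe i]
    unfolding subdom_region
    by (intro zero_energy_imp_constant sub_mesh_tri vfun_pc1) (auto simp: vfun_def)
  then obtain k where k: "\<And>i y. i < nsub D \<Longrightarrow> y \<in> closure (subdom D i) \<Longrightarrow> ?u i y = k i" by metis
  have "k i = 0"
  proof (rule glued_constants_zero[OF k _ _ i])
    show "?u i z = gC z" if "z \<in> corners D" for i z by (rule coeff_family_corner[OF that])
    show "?u i y = 0" if "y \<notin> domn D" for i y using vfun_coeff_family that by (auto simp: vfun_def)
  qed
  with k[OF i y] show ?thesis by simp
qed

text \<open>
  A velocity without energy is constant on each subdomain, hence zero by \<open>glued_constants_zero\<close>. The
  values at the nodes give the interior and the corner coefficients; on each edge the primal function
  and the dual ones form a basis of the edge space, so their coefficients vanish as well.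
\<close>

lemma energy_zero_imp_zero:
  assumes w: "wI \<in> carrier_vec (nI D)" "wD \<in> carrier_vec (nD D)" "wP \<in> carrier_vec (nP D)"
    and z: "energy (vel_family wI wD wP) (vel_family wI wD wP) = 0"
  shows "wI = 0\<^sub>v (nI D) \<and> wD = 0\<^sub>v (nD D) \<and> wP = 0\<^sub>v (nP D)"
proof -
  obtain gI d gC pe where c: "\<forall>i<nsub D. vel_family wI wD wP i = coeff_family gI d gC pe i"
    "(\<forall>x\<in>inodes. gI x = 0) \<longrightarrow> wI = 0\<^sub>v (nI D)"
    "(\<forall>i e m. e < nE \<and> i \<in> edge_subs D e \<and> m < length (edual D e) \<longrightarrow> d i e m = 0) \<longrightarrow> wD = 0\<^sub>v (nD D)"
    "(\<forall>x\<in>corners D. gC x = 0) \<and> (\<forall>e\<in>set elist. pe e = 0) \<longrightarrow> wP = 0\<^sub>v (nP D)"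
    using vel_family_coefficients[OF w] by (elim exE conjE) (rule that)
  have "energy (coeff_family gI d gC pe) (coeff_family gI d gC pe) = 0" using z c(1) by (simp add: energy_def)
  note v = energy_zero_imp_vanish[OF this]
  have I0: "gI x = 0" if x: "x \<in> inodes" for x
  proof -
    obtain i where i: "i < nsub D" "x \<in> subdom D i" using x by (auto simp: inodes_def)
    then have "x \<in> closure (subdom D i)" using closure_subset by blast
    from v[OF i(1) this] coeff_family_inode[OF x, of gI d gC pe i] show ?thesis by simp
  qed
  have C0: "gC x = 0" if x: "x \<in> corners D" for x
  proof -
    obtain i where "i < nsub D" "x \<in> closure (subdom D i)" using corner_iface[OF x] by (auto simp: iface_def frontier_def)
    from v[OF this] coeff_family_corner[OF x, of gI d gC pe i] show ?thesis by simp
  qed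
  have E0: "pe e = 0 \<and> (\<forall>m<length (edual D e). d i e m = 0)"
    if e: "e < nE" "edge_nodes D e \<noteq> {}" and i: "i \<in> edge_subs D e" for e i
  proof -
    define fs where "fs = eprim D e # map snd (edual D e)"
    define n where "n = length (edual D e)"
    define c where "c = Matrix.vec (Suc n) (\<lambda>k. case k of 0 \<Rightarrow> pe e | Suc m \<Rightarrow> d i e m)"
    have len: "length fs = Suc n" by (simp add: fs_def n_def)
    have cfs: "comb c fs y = pe e *\<^sub>R eprim D e y + (\<Sum>m<length (edual D e). d i e m *\<^sub>R dual_fun D (e, m) y)" for y
      unfolding comb_def len sum.lessThan_Suc_shift by (simp add: c_def fs_def n_def dual_fun_def)
    have es: "comb c fs \<in> edge_space D e"
    proof -
      have "fs ! k \<in> edge_space D e" if "k < length fs" for k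
        using edge_basis[OF e] nth_mem[OF that] by (auto simp: fun_basis_def fs_def)
      then have "\<exists>g. fs ! k = nodal_sum (edge_nodes D e) g" if "k < length fs" for k
        using that by (auto simp: edge_space_nodal_sum)
      then obtain g where g: "\<And>k. k < length fs \<Longrightarrow> fs ! k = nodal_sum (edge_nodes D e) (g k)" by metis
      have "comb c fs = nodal_sum (edge_nodes D e) (\<lambda>x. \<Sum>k<length fs. c $ k *\<^sub>R g k x)"
        unfolding comb_def by (rule ext)
          (simp add: g nodal_sum_def scaleR_sum_right sum.swap[of _ "{..<length fs}"] mult.commute)
      then show ?thesis by (simp add: edge_space_nodal_sum)
    qed
    have "comb c fs = (\<lambda>_. 0)"
    proof (rule edge_space_zero[OF es])
      fix x assume x: "x \<in> edge_nodes D e"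
      have "x \<in> closure (subdom D i)"
        using edge_subs_closure[OF i] closure_subset x by (auto simp: edge_nodes_def)
      then show "comb c fs x = 0"
        using v[OF edge_subs_less[OF i], of x] coeff_family_edge_node[OF e(1) i x, of gI d gC pe] cfs by simp
    qed
    moreover have "comb (0\<^sub>v (Suc n)) fs = (\<lambda>_. 0)" by (simp add: comb_def len)
    moreover have "\<exists>!c. c \<in> carrier_vec (length fs) \<and> (\<lambda>_. 0) = comb c fs"
    proof -
      have "(\<lambda>_. 0) \<in> edge_space D e" by (auto simp: edge_space_nodal_sum nodal_sum_def intro!: image_eqI[of _ _ "\<lambda>_. 0"])
      then show ?thesis using edge_basis[OF e] by (auto simp: fun_basis_def fs_def)
    qed
    moreover have "c \<in> carrier_vec (length fs)" "0\<^sub>v (Suc n) \<in> carrier_vec (length fs)" by (auto simp: c_def len)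
    ultimately have "c = 0\<^sub>v (Suc n)" by metis
    then have "c $ k = 0" if "k < Suc n" for k using that by simp
    from this[of 0] this[of "Suc m" for m] show ?thesis by (auto simp: c_def n_def)
  qed
  have "\<forall>i e m. e < nE \<and> i \<in> edge_subs D e \<and> m < length (edual D e) \<longrightarrow> d i e m = 0"
    using E0 no_edual by fastforce
  moreover have "\<forall>e\<in>set elist. pe e = 0"
  proof
    fix e assume "e \<in> set elist"
    then have e: "e < nE" "edge_nodes D e \<noteq> {}" by (auto simp: set_elist)
    then obtain i where "i \<in> edge_subs D e" using edge_subs_card[OF e(1)] by fastforce
    then show "pe e = 0" using E0[OF e] by blast
  qed
  ultimately show ?thesis using c(2-4) I0 C0 by blast
qed

subsection \<open>Vanishing of the mean divergence\<close>

text \<open>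
  Velocities that are continuous across the interface have the same form on the domain as in the
  partially assembled space.
\<close>

lemma a_int_partition:
  assumes "vfun D u" "vfun D v"
  shows "a_int (domn D) u v = (\<Sum>i<nsub D. a_int (subdom D i) u v)"
  unfolding a_int_def domn_region subdom_region sub_mesh_def
  by (intro pwc_integral_partition[OF mesh_tri] pwc_inner_jac part_less) (use assms in \<open>simp_all add: vfun_def\<close>)

lemma b_int_partition:
  assumes "vfun D u" "pwc (mesh D) q"
  shows "b_int (domn D) u q = (\<Sum>i<nsub D. b_int (subdom D i) u q)"
proof -
  have "(LINT y:domn D|lebesgue. trace (jac u y) * q y) = (\<Sum>i<nsub D. LINT y:subdom D i|lebesgue. trace (jac u y) * q y)"
    unfolding domn_region subdom_region sub_mesh_def
    by (intro pwc_integral_partition[OF mesh_tri] pwc_mult pwc_trace_jac part_less) (use assms in \<open>simp_all add: vfun_def\<close>)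
  then show ?thesis by (simp add: b_int_def sum_negf)
qed

lemma b_int_add:
  assumes "vfun D u" "vfun D v" "pwc (mesh D) q"
  shows "b_int (subdom D i) (\<lambda>y. u y + v y) q = b_int (subdom D i) u q + b_int (subdom D i) v q"
  using b_int_add_scaled[OF sub_mesh_tri vfun_pc1[OF assms(1)] vfun_pc1[OF assms(2)] pwc_subset[OF assms(3) sub_mesh_subset], of i 1]
  by (simp add: subdom_region)

lemma mean_divergence_domain:
  assumes "vfun D u" shows "b_int (domn D) u (\<lambda>_. 1) = 0"
proof -
  have "u y = 0" if "y \<in> frontier (region (mesh D))" for y
    using that assms open_domn unfolding vfun_def domn_region[symmetric] by (auto simp: frontier_def interior_open)
  with divergence_region_zero_boundary[OF mesh_tri, of u] assms show ?thesis
    by (simp add: b_int_def domn_region vfun_def)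
qed

text \<open>
  Every interior function, of whichever subdomain, vanishes on the boundary of the subdomain \<open>i\<close>.
\<close>

lemma mean_divergence_interior:
  assumes i: "i < nsub D" shows "b_int (subdom D i) (nodal_sum inodes g) (\<lambda>_. 1) = 0"
proof -
  have "nodal_sum inodes g y = 0" if y: "y \<in> frontier (subdom D i)" for y
    unfolding nodal_sum_def
  proof (rule sum.neutral, rule ballI)
    fix x assume "x \<in> inodes"
    then obtain j where j: "x \<in> nodes" "x \<in> subdom D j" by (auto simp: inodes_def)
    have "y \<notin> subdom D j" using y subdom_closure_disjoint[of y j i] by (auto simp: frontier_subdom)
    then show "shape D x y *\<^sub>R g x = 0" using shape_interior_support[OF j] by simp
  qed
  with divergence_region_zero_boundary[OF sub_mesh_tri, of i "nodal_sum inodes g"]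
    vfun_pc1[OF vfun_nodal_sum[OF inodes_nodes]] show ?thesis
    by (simp add: b_int_def subdom_region)
qed

text \<open>
  This is where the choice of the primal space enters: by the divergence theorem the mean divergence
  on a subdomain is the flux through its boundary.
\<close>

lemma mean_divergence_dual:
  assumes i: "i < nsub D" and z: "dual_zero_flux D" shows "b_int (subdom D i) (dual_sum D d i) (\<lambda>_. 1) = 0"
proof -
  define c where "c = Matrix.vec (length (dual_loc D i)) (\<lambda>k. case dual_loc D i ! k of (e, m) \<Rightarrow> d i e m)"
  have "c \<in> carrier_vec (length (velD_loc D i))" by (simp add: c_def velD_loc_def)
  then have "sub_flux D i (dual_sum D d i) = 0"
    using z i comb_velD_loc[of D i d] unfolding dual_zero_flux_def c_def by metis
  moreover have "{(T, S). T \<in> mesh D \<and> part D T = i \<and> S facet_of T \<and> S \<subseteq> frontier (subdom D i)}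
    = {(T, S). T \<in> sub_mesh D i \<and> S facet_of T \<and> S \<subseteq> frontier (region (sub_mesh D i))}"
    by (auto simp: sub_mesh_def subdom_region)
  ultimately have "(LINT y:subdom D i|lebesgue. trace (jac (dual_sum D d i) y)) = 0"
    unfolding subdom_region divergence_region[OF sub_mesh_tri vfun_pc1[OF vfun_dual_sum]] sub_flux_def by simp
  then show ?thesis by (simp add: b_int_def)
qed

text \<open>
  Interior and dual parts have mean divergence zero on every subdomain. The primal part is continuous
  across the interface and vanishes on the boundary of the domain, so its mean divergence over the
  whole domain is zero.
\<close>

lemma mean_divergence_family:
  assumes z: "dual_zero_flux D"
    and w: "wI \<in> carrier_vec (nI D)" "wD \<in> carrier_vec (nD D)" "wP \<in> carrier_vec (nP D)"
  shows "(\<Sum>i<nsub D. b_int (subdom D i) (vel_family wI wD wP i) (\<lambda>_. 1)) = 0"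
proof -
  obtain gI d gC pe where c: "\<forall>i<nsub D. vel_family wI wD wP i = coeff_family gI d gC pe i"
    using vel_family_coefficients[OF w] by (elim exE conjE) (rule that)
  define P where "P y = nodal_sum (corners D) gC y + (\<Sum>e\<in>set elist. pe e *\<^sub>R eprim D e y)" for y
  have vP: "vfun D P" unfolding P_def by (intro vfun_add vfun_nodal_sum vfun_primal_sum corners_nodes)
  have vI: "vfun D (nodal_sum inodes gI)" by (rule vfun_nodal_sum[OF inodes_nodes])
  have "b_int (subdom D i) (vel_family wI wD wP i) (\<lambda>_. 1) = b_int (subdom D i) P (\<lambda>_. 1)" if i: "i < nsub D" for i
  proof -
    have "vel_family wI wD wP i = (\<lambda>y. (nodal_sum inodes gI y + dual_sum D d i y) + P y)"
      using c i by (simp add: coeff_family_def P_def)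
    then show ?thesis
      using vI vP vfun_dual_sum[of d i] mean_divergence_interior[OF i] mean_divergence_dual[OF i z]
      by (simp add: b_int_add pwc_const vfun_add)
  qed
  then have "(\<Sum>i<nsub D. b_int (subdom D i) (vel_family wI wD wP i) (\<lambda>_. 1)) = (\<Sum>i<nsub D. b_int (subdom D i) P (\<lambda>_. 1))"
    by simp
  also have "\<dots> = b_int (domn D) P (\<lambda>_. 1)" by (rule b_int_partition[OF vP pwc_const, symmetric])
  finally show ?thesis using mean_divergence_domain[OF vP] by simp
qed

subsection \<open>The jump matrices\<close>

lemma B_Delta_mult:
  assumes c: "\<forall>k<length (dual_idx D). c $ k = (case dual_idx D ! k of (j, e, m) \<Rightarrow> d j e m)"
    and cc: "c \<in> carrier_vec (nD D)" and r: "r < nL D" "mult_idx D ! r = (e, m)"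
  shows "(B_Delta D *\<^sub>v c) $ r = (\<Sum>i\<in>edge_subs D e. jump_sign D e i * d i e m)"
proof -
  have em: "e < nE" "m < length (edual D e)" using nth_mem[OF r(1)] r(2) by (auto simp: set_mult_idx)
  define G where "G = (\<lambda>(j, e', m'). (if (e, m) = (e', m') then jump_sign D e' j else 0) * d j e' m')"
  have "(B_Delta D *\<^sub>v c) $ r = (\<Sum>k<length (dual_idx D). index_mat (B_Delta D) (r, k) * c $ k)"
    using r cc B_Delta_carrier[of D]
    by (auto simp: scalar_prod_def length_velD lessThan_atLeast0 intro!: sum.cong)
  also have "\<dots> = (\<Sum>k<length (dual_idx D). G (dual_idx D ! k))"
    using r by (auto intro!: sum.cong simp: G_def B_Delta_def length_velD c jump_sign_def split: prod.splits)
  also have "\<dots> = (\<Sum>x\<in>set (dual_idx D). G x)" by (rule sum_nth_distinct[OF distinct_dual_idx])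
  also have "\<dots> = (\<Sum>x\<in>(\<lambda>i. (i, e, m)) ` edge_subs D e. G x)"
    using em by (intro sum.mono_neutral_right[OF finite_set]) (auto simp: set_dual_idx G_def edge_subs_less)
  also have "\<dots> = (\<Sum>i\<in>edge_subs D e. jump_sign D e i * d i e m)"
    by (subst sum.reindex) (auto simp: inj_on_def G_def)
  finally show ?thesis .
qed

lemma edge_subs_pair:
  assumes "e < nE"
  obtains i j where "edge_subs D e = {i, j}" "i \<noteq> j" "jump_sign D e i = 1" "jump_sign D e j = - 1"
proof -
  obtain i j where ij: "edge_subs D e = {i, j}" "i \<noteq> j" using edge_subs_card[OF assms] by (auto simp: card_2_iff)
  show thesis
  proof (cases "i < j")
    case True
    then show thesis using that[of i j] ij by (simp add: jump_sign_def)
  next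
    case False
    then show thesis using that[of j i] ij by (auto simp: jump_sign_def)
  qed
qed

lemma nshare_edge_node:
  assumes e: "e < nE" and x: "x \<in> edge_nodes D e" shows "nshare D x = 2"
proof -
  have "x \<in> closure (subdom D i)" if "i \<in> edge_subs D e" for i
    using edge_subs_closure[OF that] closure_subset x by (auto simp: edge_nodes_def)
  then have "{i. i < nsub D \<and> x \<in> closure (subdom D i)} = edge_subs D e"
    using edge_subs_only[OF e, of x] x edge_subs_less by (auto simp: edge_nodes_def)
  then show ?thesis using edge_subs_card[OF e] by (simp add: nshare_def)
qed

text \<open>
  The factor \<open>1 / 2\<close> is \<open>1 / nshare\<close>: a node on an open edge is shared by exactly two subdomains.
\<close>

lemma B_Delta_D_transpose_mult:
  assumes l: "\<forall>r<nL D. l $ r = lam (mult_idx D ! r)" and lc: "l \<in> carrier_vec (nL D)"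
    and k: "k < length (dual_idx D)" "dual_idx D ! k = (i, e, m)"
  shows "(transpose_mat (B_Delta_D D) *\<^sub>v l) $ k = 1 / 2 * jump_sign D e i * lam (e, m)"
proof -
  have em: "e < nE" "m < length (edual D e)" "(e, m) \<in> set (mult_idx D)"
    using nth_mem[OF k(1)] k(2) by (auto simp: set_dual_idx set_mult_idx)
  define G where "G = (\<lambda>x. if x = (e, m) then 1 / 2 * jump_sign D e i * lam (e, m) else 0)"
  have "fst (edual D e ! m) \<in> edge_nodes D e"
    using edual_node[OF em(1), of "fst (edual D e ! m)" "snd (edual D e ! m)"] nth_mem[OF em(2)] by simp
  then have ns: "nshare D (fst (edual D e ! m)) = 2" by (rule nshare_edge_node[OF em(1)])
  have "(transpose_mat (B_Delta_D D) *\<^sub>v l) $ k = (\<Sum>r<nL D. index_mat (B_Delta_D D) (r, k) * l $ r)"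
    using k lc B_Delta_D_carrier[of D]
    by (auto simp: scalar_prod_def length_velD lessThan_atLeast0 intro!: sum.cong)
  also have "\<dots> = (\<Sum>r<length (mult_idx D). G (mult_idx D ! r))"
    using k l ns
    by (auto intro!: sum.cong simp: G_def B_Delta_D_def B_Delta_def length_velD jump_sign_def split: prod.splits)
  also have "\<dots> = (\<Sum>x\<in>set (mult_idx D). G x)" by (rule sum_nth_distinct[OF distinct_mult_idx])
  also have "\<dots> = 1 / 2 * jump_sign D e i * lam (e, m)" unfolding G_def using em(3) by simp
  finally show ?thesis .
qed

text \<open>
  Each of the two subdomains of an edge receives half of the prescribed jump, with opposite signs, and
  the jump of that is the whole again. This also shows that \<open>B_Delta\<close> has full row rank.
\<close>

lemma B_Delta_right_inverse:
  assumes l: "l \<in> carrier_vec (nL D)"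
  shows "B_Delta D *\<^sub>v (transpose_mat (B_Delta_D D) *\<^sub>v l) = l"
proof (rule eq_vecI)
  obtain lam where lam: "\<forall>r<nL D. l $ r = lam (mult_idx D ! r)"
    using labelled_coefficients[OF distinct_mult_idx, of D "\<lambda>r. l $ r"] by blast
  have c: "\<forall>k<length (dual_idx D). (transpose_mat (B_Delta_D D) *\<^sub>v l) $ k
     = (case dual_idx D ! k of (i, e, m) \<Rightarrow> 1 / 2 * jump_sign D e i * lam (e, m))"
    using B_Delta_D_transpose_mult[OF lam l] by (auto split: prod.splits)
  fix r assume "r < dim_vec l"
  then have r: "r < nL D" using l by simp
  obtain e m where em: "mult_idx D ! r = (e, m)" by force
  then have "e < nE" using nth_mem[OF r] by (auto simp: set_mult_idx)
  then obtain i j where ij: "edge_subs D e = {i, j}" "i \<noteq> j" "jump_sign D e i = 1" "jump_sign D e j = - 1"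
    by (rule edge_subs_pair)
  have "transpose_mat (B_Delta_D D) *\<^sub>v l \<in> carrier_vec (nD D)" using B_Delta_D_carrier[of D] l by (intro mult_mat_vec_carrier) auto
  from B_Delta_mult[OF c this r em] ij lam r em
  show "(B_Delta D *\<^sub>v (transpose_mat (B_Delta_D D) *\<^sub>v l)) $ r = l $ r" by simp
qed (use l B_Delta_carrier[of D] in auto)

subsection \<open>Continuous velocities in the partially assembled space\<close>

text \<open>
  A continuous velocity is a member of the partially assembled space: on each edge it is expanded in
  the basis of the edge space, and both copies of a dual coefficient get the same value, so that there
  is no jump. Functions of edges that do not belong to a subdomain vanish there.
\<close>

lemma nodal_embedding:
  obtains wI wD wP where "wI \<in> carrier_vec (nI D)" "wD \<in> carrier_vec (nD D)" "wP \<in> carrier_vec (nP D)"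
    "\<And>i y. i < nsub D \<Longrightarrow> y \<in> closure (subdom D i) \<Longrightarrow> vel_family wI wD wP i y = nodal_sum nodes g y"
    "B_Delta D *\<^sub>v wD = 0\<^sub>v (nL D)"
proof -
  have "\<exists>c. nodal_sum (edge_nodes D e) g = comb c (eprim D e # map snd (edual D e))" if "e \<in> set elist" for e
  proof -
    have "nodal_sum (edge_nodes D e) g \<in> edge_space D e" by (simp add: edge_space_nodal_sum)
    then show ?thesis using edge_basis[of e] that unfolding fun_basis_def set_elist by blast
  qed
  then obtain c where c: "\<And>e. e \<in> set elist \<Longrightarrow> nodal_sum (edge_nodes D e) g = comb (c e) (eprim D e # map snd (edual D e))"
    by metis
  define pe where "pe e = c e $ 0" for e
  define d where "d i e m = c e $ Suc m" for i e m :: nat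
  have edge: "nodal_sum (edge_nodes D e) g y = (if e \<in> set elist then pe e *\<^sub>R eprim D e y else 0)
     + (\<Sum>m<length (edual D e). d i e m *\<^sub>R dual_fun D (e, m) y)" if e: "e < nE" for e i y
  proof (cases "e \<in> set elist")
    case True
    then show ?thesis
      by (simp add: c comb_def sum.lessThan_Suc_shift pe_def d_def dual_fun_def del: sum.lessThan_Suc)
  next
    case False
    then have "edge_nodes D e = {}" using e by (simp add: set_elist)
    then show ?thesis using False no_edual[OF e] by (simp add: nodal_sum_def)
  qed
  obtain wI wD wP where w: "wI \<in> carrier_vec (nI D)" "wD \<in> carrier_vec (nD D)" "wP \<in> carrier_vec (nP D)"
    "\<forall>i<nsub D. vel_family wI wD wP i = coeff_family g d g pe i"
    "\<forall>k<length (dual_idx D). wD $ k = (case dual_idx D ! k of (j, e, m) \<Rightarrow> d j e m)"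
    using vel_family_coefficients_exist by blast
  show thesis
  proof (rule that[OF w(1-3)])
    fix i y assume i: "i < nsub D" and y: "y \<in> closure (subdom D i)"
    have "(\<Sum>e<nE. nodal_sum (edge_nodes D e) g y)
      = (\<Sum>e<nE. if e \<in> set elist then pe e *\<^sub>R eprim D e y else 0) + (\<Sum>e<nE. \<Sum>m<length (edual D e). d i e m *\<^sub>R dual_fun D (e, m) y)"
      unfolding sum.distrib[symmetric] by (intro sum.cong refl edge) simp
    also have "(\<Sum>e<nE. if e \<in> set elist then pe e *\<^sub>R eprim D e y else 0) = (\<Sum>e\<in>set elist. pe e *\<^sub>R eprim D e y)"
      by (rule sum.mono_neutral_cong_right) (auto simp: set_elist)
    also have "(\<Sum>e<nE. \<Sum>m<length (edual D e). d i e m *\<^sub>R dual_fun D (e, m) y) = dual_sum D d i y"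
      unfolding dual_sum_def
      using edge_space_away[OF edual_edge_space _ i _ y]
      by (intro sum.mono_neutral_right) (auto intro!: sum.neutral)
    finally show "vel_family wI wD wP i y = nodal_sum nodes g y"
      unfolding w(4)[rule_format, OF i] coeff_family_def nodal_sum_split by simp
  next
    show "B_Delta D *\<^sub>v wD = 0\<^sub>v (nL D)"
    proof (rule eq_vecI)
      fix r assume "r < dim_vec (0\<^sub>v (nL D))"
      then have r: "r < nL D" by simp
      obtain e m where em: "mult_idx D ! r = (e, m)" by force
      then have "e < nE" using nth_mem[OF r] by (auto simp: set_mult_idx)
      then obtain i j where ij: "edge_subs D e = {i, j}" "i \<noteq> j" "jump_sign D e i = 1" "jump_sign D e j = - 1"
        by (rule edge_subs_pair)
      from B_Delta_mult[OF w(5,2) r em] ij r show "(B_Delta D *\<^sub>v wD) $ r = 0\<^sub>v (nL D) $ r" by (simp add: d_def)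
    qed (use B_Delta_carrier[of D] in auto)
  qed
qed

end

section \<open>Block matrices\<close>

lemma four_block_form:
  fixes A B C E :: rmat
  assumes "A \<in> carrier_mat n1 m1" "B \<in> carrier_mat n1 m2" "C \<in> carrier_mat n2 m1" "E \<in> carrier_mat n2 m2"
    "a \<in> carrier_vec m1" "b \<in> carrier_vec m2" "a' \<in> carrier_vec n1" "b' \<in> carrier_vec n2"
  shows "ip (a' @\<^sub>v b') (four_block_mat A B C E *\<^sub>v (a @\<^sub>v b)) =
    ip a' (A *\<^sub>v a) + ip a' (B *\<^sub>v b) + ip b' (C *\<^sub>v a) + ip b' (E *\<^sub>v b)"
  using assms
  by (simp add: four_block_mat_mult_vec[OF assms(1-6)] scalar_prod_append[of _ n1 _ n2] scalar_prod_add_distrib[of _ n1]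
      scalar_prod_add_distrib[of _ n2])

text \<open>
  Concatenating the lists of functions becomes forming block matrices.
\<close>

definition gram :: "('a \<Rightarrow> 'b \<Rightarrow> real) \<Rightarrow> 'a list \<Rightarrow> 'b list \<Rightarrow> rmat" where
  "gram f xs ys = mat (length xs) (length ys) (\<lambda>(r, c). f (xs ! r) (ys ! c))"

lemma gram_append:
  "gram f (xs @ xs') (ys @ ys') = four_block_mat (gram f xs ys) (gram f xs ys') (gram f xs' ys) (gram f xs' ys')"
  by (rule eq_matI) (auto simp: gram_def nth_append)

lemma gram_zero: "(\<And>x y. x \<in> set xs \<Longrightarrow> y \<in> set ys \<Longrightarrow> f x y = 0) \<Longrightarrow> gram f xs ys = 0\<^sub>m (length xs) (length ys)"
  by (rule eq_matI) (auto simp: gram_def)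

text \<open>
  If functions of different groups do not interact, the matrix is block diagonal with one block for
  each group.
\<close>

lemma gram_concat:
  assumes "distinct is"
    and "\<And>i j x y. i \<in> set is \<Longrightarrow> j \<in> set is \<Longrightarrow> i \<noteq> j \<Longrightarrow> x \<in> set (xs i) \<Longrightarrow> y \<in> set (ys j) \<Longrightarrow> f x y = 0"
  shows "gram f (concat (map xs is)) (concat (map ys is)) = diag_block_mat (map (\<lambda>i. gram f (xs i) (ys i)) is)"
  using assms
proof (induction "is")
  case Nil
  show ?case by (rule eq_matI) (auto simp: gram_def)
next
  case (Cons i "is")
  define X Y where "X = concat (map xs is)" and "Y = concat (map ys is)"
  have IH: "gram f X Y = diag_block_mat (map (\<lambda>i. gram f (xs i) (ys i)) is)"
    unfolding X_def Y_def using Cons.prems by (intro Cons.IH) auto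
  have z1: "gram f (xs i) Y = 0\<^sub>m (length (xs i)) (length Y)"
  proof (rule gram_zero)
    fix x y assume "x \<in> set (xs i)" "y \<in> set Y"
    then obtain j where "j \<in> set is" "y \<in> set (ys j)" by (auto simp: Y_def)
    then show "f x y = 0" using Cons.prems(1) \<open>x \<in> set (xs i)\<close> by (intro Cons.prems(2)[of i j]) auto
  qed
  have z2: "gram f X (ys i) = 0\<^sub>m (length X) (length (ys i))"
  proof (rule gram_zero)
    fix x y assume "x \<in> set X" "y \<in> set (ys i)"
    then obtain j where "j \<in> set is" "x \<in> set (xs j)" by (auto simp: X_def)
    then show "f x y = 0" using Cons.prems(1) \<open>y \<in> set (ys i)\<close> by (intro Cons.prems(2)[of j i]) auto
  qed
  have "gram f (concat (map xs (i # is))) (concat (map ys (i # is))) = gram f (xs i @ X) (ys i @ Y)"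
    by (simp add: X_def Y_def)
  also have "\<dots> = four_block_mat (gram f (xs i) (ys i)) (0\<^sub>m (length (xs i)) (length Y)) (0\<^sub>m (length X) (length (ys i))) (gram f X Y)"
    unfolding gram_append z1 z2 ..
  also have "\<dots> = diag_block_mat (map (\<lambda>i. gram f (xs i) (ys i)) (i # is))"
    unfolding list.map diag_block_mat.simps Let_def IH[symmetric] by (simp add: gram_def)
  finally show ?case .
qed

lemma diag_block_mat_carrier:
  assumes "\<And>i. i \<in> set is \<Longrightarrow> A i \<in> carrier_mat (n i) (m i)"
  shows "diag_block_mat (map A is) \<in> carrier_mat (sum_list (map n is)) (sum_list (map m is))"
  using assms
proof (induction "is")
  case (Cons i "is")
  then have "diag_block_mat (map A is) \<in> carrier_mat (sum_list (map n is)) (sum_list (map m is))" "A i \<in> carrier_mat (n i) (m i)" by auto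
  then show ?case by (auto simp: Let_def)
qed auto

lemma diag_block_mat_mult:
  fixes A B :: "'i \<Rightarrow> rmat"
  assumes "\<And>i. i \<in> set is \<Longrightarrow> A i \<in> carrier_mat (n i) (m i)" "\<And>i. i \<in> set is \<Longrightarrow> B i \<in> carrier_mat (m i) (k i)"
  shows "diag_block_mat (map A is) * diag_block_mat (map B is) = diag_block_mat (map (\<lambda>i. A i * B i) is)"
  using assms
proof (induction "is")
  case (Cons i "is")
  have A: "A i \<in> carrier_mat (n i) (m i)" "diag_block_mat (map A is) \<in> carrier_mat (sum_list (map n is)) (sum_list (map m is))"
    using Cons.prems(1) by (auto intro: diag_block_mat_carrier)
  have B: "B i \<in> carrier_mat (m i) (k i)" "diag_block_mat (map B is) \<in> carrier_mat (sum_list (map m is)) (sum_list (map k is))"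
    using Cons.prems(2) by (auto intro: diag_block_mat_carrier)
  have IH: "diag_block_mat (map A is) * diag_block_mat (map B is) = diag_block_mat (map (\<lambda>i. A i * B i) is)"
    using Cons by auto
  show ?case unfolding list.map diag_block_mat.simps Let_def IH[symmetric]
    using A B by (subst mult_four_block_mat[of _ "n i" "m i" _ "sum_list (map m is)" _ "sum_list (map n is)" _ _ "k i" _ "sum_list (map k is)"]) auto
qed auto

lemma diag_block_mat_minus:
  fixes A B :: "'i \<Rightarrow> rmat"
  assumes "\<And>i. i \<in> set is \<Longrightarrow> A i \<in> carrier_mat (n i) (m i)" "\<And>i. i \<in> set is \<Longrightarrow> B i \<in> carrier_mat (n i) (m i)"
  shows "diag_block_mat (map (\<lambda>i. A i - B i) is) = diag_block_mat (map A is) - diag_block_mat (map B is)"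
  using assms
proof (induction "is")
  case (Cons i "is")
  have A: "A i \<in> carrier_mat (n i) (m i)" "diag_block_mat (map A is) \<in> carrier_mat (sum_list (map n is)) (sum_list (map m is))"
    using Cons.prems(1) by (auto intro: diag_block_mat_carrier)
  have B: "B i \<in> carrier_mat (n i) (m i)" "diag_block_mat (map B is) \<in> carrier_mat (sum_list (map n is)) (sum_list (map m is))"
    using Cons.prems(2) by (auto intro: diag_block_mat_carrier)
  have IH: "diag_block_mat (map (\<lambda>i. A i - B i) is) = diag_block_mat (map A is) - diag_block_mat (map B is)"
    using Cons by auto
  show ?case unfolding list.map diag_block_mat.simps Let_def IH
    using A B by (intro eq_matI) auto
qed auto

text \<open>
  Equations between coefficient vectors are mostly verified weakly, by testing with an arbitrary
  vector, because the tested quantities are integrals.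
\<close>

lemma vec_eq_by_ip:
  fixes u v :: rvec
  assumes "u \<in> carrier_vec n" "v \<in> carrier_vec n" "\<And>x. x \<in> carrier_vec n \<Longrightarrow> ip x u = ip x v"
  shows "u = v"
proof (rule eq_vecI)
  fix i assume "i < dim_vec v"
  then have "i < n" using assms by simp
  then show "u $ i = v $ i" using assms(3)[of "unit_vec n i"] assms(1,2) by simp
qed (use assms in simp)

lemma ip_mult_vec_sum:
  fixes A :: rmat
  assumes "A \<in> carrier_mat n m" "x \<in> carrier_vec n" "y \<in> carrier_vec m"
  shows "ip x (A *\<^sub>v y) = (\<Sum>r<n. \<Sum>c<m. x $ r * (y $ c * index_mat A (r, c)))"
proof -
  have "ip x (A *\<^sub>v y) = (\<Sum>r<n. x $ r * (\<Sum>c<m. index_mat A (r, c) * y $ c))"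
    using assms by (auto simp: scalar_prod_def lessThan_atLeast0 intro!: sum.cong)
  then show ?thesis by (simp add: sum_distrib_left mult.commute mult.left_commute)
qed

lemma symm_ip_transpose:
  fixes A :: rmat
  assumes "A \<in> carrier_mat n m" "x \<in> carrier_vec m" "y \<in> carrier_vec n"
  shows "ip x (transpose_mat A *\<^sub>v y) = ip y (A *\<^sub>v x)"
  using transpose_vec_mult_scalar[OF assms] assms by (subst comm_scalar_prod[of _ m]) auto

lemma asm_a_gram: "asm_a D us vs = gram (\<lambda>u v. \<Sum>i<nsub D. a_int (subdom D i) (u i) (v i)) us vs"
  by (simp add: asm_a_def gram_def)

lemma asm_carrier: "asm_a D us vs \<in> carrier_mat (length us) (length vs)" "asm_b D qs us \<in> carrier_mat (length qs) (length us)"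
  by (simp_all add: asm_a_def asm_b_def)

lemma asm_a_transpose: "transpose_mat (asm_a D us vs) = asm_a D vs us"
  by (rule eq_matI) (auto simp: asm_a_def a_int_sym)

section \<open>Forms of the assembled matrices\<close>

context decomposed_mesh
begin

definition bform :: "(nat \<Rightarrow> point \<Rightarrow> point) \<Rightarrow> (point \<Rightarrow> real) \<Rightarrow> real" where
  "bform u q = (\<Sum>i<nsub D. b_int (subdom D i) (u i) q)"

definition vfam :: "(nat \<Rightarrow> point \<Rightarrow> point) \<Rightarrow> bool" where
  "vfam u \<longleftrightarrow> (\<forall>i. vfun D (u i))"

lemma energy_sym: "energy u v = energy v u"
  by (simp add: energy_def a_int_sym)

lemma energy_add_scaled:
  assumes "vfam u" "vfam v" "vfam w"
  shows "energy (\<lambda>i y. u i y + c *\<^sub>R v i y) w = energy u w + c * energy v w"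
  unfolding energy_def subdom_region using assms
  by (simp add: a_int_add_scaled[OF sub_mesh_tri] vfun_pc1 vfam_def sum.distrib sum_distrib_left)

lemma energy_add:
  assumes "vfam u" "vfam v" "vfam w"
  shows "energy (\<lambda>i y. u i y + v i y) w = energy u w + energy v w"
  using energy_add_scaled[OF assms, of 1] by simp

lemma bform_add_scaled:
  assumes "vfam u" "vfam v" "pwc (mesh D) q"
  shows "bform (\<lambda>i y. u i y + c *\<^sub>R v i y) q = bform u q + c * bform v q"
  unfolding bform_def subdom_region using assms
  by (simp add: b_int_add_scaled[OF sub_mesh_tri] vfun_pc1 vfam_def pwc_subset[OF _ sub_mesh_subset] sum.distrib sum_distrib_left)

lemma bform_add:
  assumes "vfam u" "vfam v" "pwc (mesh D) q"
  shows "bform (\<lambda>i y. u i y + v i y) q = bform u q + bform v q"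
  using bform_add_scaled[OF assms, of 1] by simp

lemma vfam_add: "vfam u \<Longrightarrow> vfam v \<Longrightarrow> vfam (\<lambda>i y. u i y + v i y)"
  by (simp add: vfam_def vfun_add)

lemma vfam_fam: "(\<And>f. f \<in> set fs \<Longrightarrow> vfam f) \<Longrightarrow> vfam (fam c fs)"
  by (simp add: vfam_def vfun_fam)

lemma vfam_lists: "f \<in> set (velI D) \<Longrightarrow> vfam f" "f \<in> set (velD D) \<Longrightarrow> vfam f" "f \<in> set (velP D) \<Longrightarrow> vfam f"
  by (simp_all add: vfam_def vfun_basis)

lemma vfam_fams: "vfam (fam c (velI D))" "vfam (fam c (velD D))" "vfam (fam c (velP D))"
  by (rule vfam_fam[OF vfam_lists(1)] vfam_fam[OF vfam_lists(2)] vfam_fam[OF vfam_lists(3)]; assumption)+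

lemma vfam_vel_family: "vfam (vel_family wI wD wP)"
  by (simp add: vfam_def vfun_vel_family)

lemma form_asm_a:
  assumes us: "\<And>f. f \<in> set us \<Longrightarrow> vfam f" and vs: "\<And>f. f \<in> set vs \<Longrightarrow> vfam f"
    and x: "x \<in> carrier_vec (length us)" and y: "y \<in> carrier_vec (length vs)"
  shows "ip x (asm_a D us vs *\<^sub>v y) = energy (fam x us) (fam y vs)"
proof -
  have pc: "pc1 (sub_mesh D i) ((us ! r) i)" if "r < length us" for r i
    using us[OF nth_mem[OF that]] by (simp add: vfam_def vfun_pc1)
  have pc': "pc1 (sub_mesh D i) ((vs ! r) i)" if "r < length vs" for r i
    using vs[OF nth_mem[OF that]] by (simp add: vfam_def vfun_pc1)
  have pf: "pc1 (sub_mesh D i) (fam y vs i)" for i using vfam_fam[OF vs] by (simp add: vfam_def vfun_pc1)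
  have "a_int (subdom D i) (fam x us i) (fam y vs i)
     = (\<Sum>r<length us. \<Sum>c<length vs. x $ r * (y $ c * a_int (subdom D i) ((us ! r) i) ((vs ! c) i)))" for i
  proof -
    have "a_int (subdom D i) (fam x us i) (fam y vs i) = (\<Sum>r<length us. x $ r * a_int (subdom D i) ((us ! r) i) (fam y vs i))"
      unfolding subdom_region fam_def[of x] by (rule a_int_sum[OF sub_mesh_tri pf pc])
    also have "\<dots> = (\<Sum>r<length us. x $ r * (\<Sum>c<length vs. y $ c * a_int (subdom D i) ((us ! r) i) ((vs ! c) i)))"
    proof (rule sum.cong[OF refl])
      fix r assume "r \<in> {..<length us}"
      then have r: "r < length us" by simp
      have "a_int (subdom D i) ((us ! r) i) (fam y vs i) = a_int (subdom D i) (fam y vs i) ((us ! r) i)" by (rule a_int_sym)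
      also have "\<dots> = (\<Sum>c<length vs. y $ c * a_int (subdom D i) ((vs ! c) i) ((us ! r) i))"
        unfolding subdom_region fam_def by (rule a_int_sum[OF sub_mesh_tri pc[OF r] pc'])
      finally show "x $ r * a_int (subdom D i) ((us ! r) i) (fam y vs i)
         = x $ r * (\<Sum>c<length vs. y $ c * a_int (subdom D i) ((us ! r) i) ((vs ! c) i))" by (simp add: a_int_sym)
    qed
    finally show ?thesis by (simp add: sum_distrib_left)
  qed
  then have "energy (fam x us) (fam y vs) = (\<Sum>i<nsub D. \<Sum>r<length us. \<Sum>c<length vs. x $ r * (y $ c * a_int (subdom D i) ((us ! r) i) ((vs ! c) i)))"
    by (simp add: energy_def)
  also have "\<dots> = (\<Sum>r<length us. \<Sum>c<length vs. \<Sum>i<nsub D. x $ r * (y $ c * a_int (subdom D i) ((us ! r) i) ((vs ! c) i)))"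
    by (subst sum.swap) (intro sum.cong refl sum.swap)
  also have "\<dots> = ip x (asm_a D us vs *\<^sub>v y)"
    unfolding ip_mult_vec_sum[OF asm_carrier(1) x y] by (intro sum.cong refl) (simp add: asm_a_def sum_distrib_left)
  finally show ?thesis by simp
qed

lemma comb_pressure: "comb q qs = (\<lambda>y. \<Sum>k<length qs. q $ k * (qs ! k) y)"
  by (simp add: comb_def)

lemma form_asm_b:
  assumes qs: "\<And>f. f \<in> set qs \<Longrightarrow> pwc (mesh D) f" and vs: "\<And>f. f \<in> set vs \<Longrightarrow> vfam f"
    and x: "x \<in> carrier_vec (length qs)" and y: "y \<in> carrier_vec (length vs)"
  shows "ip x (asm_b D qs vs *\<^sub>v y) = bform (fam y vs) (comb x qs)"
proof -
  have pq: "pwc (sub_mesh D i) (qs ! r)" if "r < length qs" for r i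
    using qs[OF nth_mem[OF that]] pwc_subset[OF _ sub_mesh_subset] by blast
  have pc': "pc1 (sub_mesh D i) ((vs ! r) i)" if "r < length vs" for r i
    using vs[OF nth_mem[OF that]] by (simp add: vfam_def vfun_pc1)
  have pf: "pc1 (sub_mesh D i) (fam y vs i)" for i using vfam_fam[OF vs] by (simp add: vfam_def vfun_pc1)
  have "b_int (subdom D i) (fam y vs i) (comb x qs)
     = (\<Sum>r<length qs. \<Sum>c<length vs. x $ r * (y $ c * b_int (subdom D i) ((vs ! c) i) (qs ! r)))" for i
  proof -
    have "b_int (subdom D i) (fam y vs i) (comb x qs) = (\<Sum>r<length qs. x $ r * b_int (subdom D i) (fam y vs i) (qs ! r))"
      unfolding subdom_region comb_pressure by (rule b_int_sum_right[OF sub_mesh_tri pf pq])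
    also have "\<dots> = (\<Sum>r<length qs. x $ r * (\<Sum>c<length vs. y $ c * b_int (subdom D i) ((vs ! c) i) (qs ! r)))"
    proof (rule sum.cong[OF refl])
      fix r assume "r \<in> {..<length qs}"
      then have r: "r < length qs" by simp
      show "x $ r * b_int (subdom D i) (fam y vs i) (qs ! r)
         = x $ r * (\<Sum>c<length vs. y $ c * b_int (subdom D i) ((vs ! c) i) (qs ! r))"
        unfolding subdom_region fam_def by (subst b_int_sum[OF sub_mesh_tri pq[OF r] pc']) auto
    qed
    finally show ?thesis by (simp add: sum_distrib_left)
  qed
  then have "bform (fam y vs) (comb x qs) = (\<Sum>i<nsub D. \<Sum>r<length qs. \<Sum>c<length vs. x $ r * (y $ c * b_int (subdom D i) ((vs ! c) i) (qs ! r)))"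
    by (simp add: bform_def)
  also have "\<dots> = (\<Sum>r<length qs. \<Sum>c<length vs. \<Sum>i<nsub D. x $ r * (y $ c * b_int (subdom D i) ((vs ! c) i) (qs ! r)))"
    by (subst sum.swap) (intro sum.cong refl sum.swap)
  also have "\<dots> = ip x (asm_b D qs vs *\<^sub>v y)"
    unfolding ip_mult_vec_sum[OF asm_carrier(2) x y] by (intro sum.cong refl) (simp add: asm_b_def sum_distrib_left)
  finally show ?thesis by simp
qed

lemma energy_vel_family:
  assumes "vfam w"
  shows "energy (vel_family wI wD wP) w = energy (fam wI (velI D)) w + energy (fam wD (velD D)) w + energy (fam wP (velP D)) w"
  unfolding vel_family_def[abs_def] using assms by (simp add: energy_add vfam_add vfam_fams)

lemma bform_vel_family:
  assumes "pwc (mesh D) q"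
  shows "bform (vel_family wI wD wP) q = bform (fam wI (velI D)) q + bform (fam wD (velD D)) q + bform (fam wP (velP D)) q"
  unfolding vel_family_def[abs_def] using assms by (simp add: bform_add vfam_add vfam_fams)

lemma pwc_pbasis: "q \<in> set (pbasis D) \<Longrightarrow> pwc (mesh D) q"
proof -
  assume "q \<in> set (pbasis D)"
  then have "\<forall>T\<in>mesh D. \<exists>p. real_polynomial_function p \<and> (\<forall>y\<in>interior T. q y = p y)"
    using pre by (simp add: pressure_ok_def)
  then show ?thesis unfolding pwc_def using real_polynomial_function_continuous by blast
qed

lemma pwc_pI: "q \<in> set (pI D) \<Longrightarrow> pwc (mesh D) q"
  by (auto simp: pI_def intro!: pwc_pbasis)

lemma pwc_comb: "(\<And>f. f \<in> set qs \<Longrightarrow> pwc (mesh D) f) \<Longrightarrow> pwc (mesh D) (comb q qs)"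
  unfolding comb_pressure by (intro pwc_sum pwc_cmult) auto

subsection \<open>The saddle point matrix\<close>

definition full_dim :: nat where "full_dim = (nI D + nQ D) + (nD D + nP D)"

lemma A_tilde_carrier: "A_tilde D \<in> carrier_mat full_dim full_dim"
  unfolding A_tilde_def Let_def full_dim_def by (intro four_block_carrier_mat) (simp_all add: asm_carrier)

text \<open>
  In terms of functions instead of coefficients, \<open>A_tilde\<close> is the form of the Stokes problem on the
  partially assembled space, with the pressures restricted to \<open>Q_I\<close>.
\<close>

lemma A_tilde_form:
  assumes w: "wI \<in> carrier_vec (nI D)" "p \<in> carrier_vec (nQ D)" "wD \<in> carrier_vec (nD D)" "wP \<in> carrier_vec (nP D)"
    and w': "wI' \<in> carrier_vec (nI D)" "p' \<in> carrier_vec (nQ D)" "wD' \<in> carrier_vec (nD D)" "wP' \<in> carrier_vec (nP D)"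
  shows "ip (block_vec wI' p' wD' wP') (A_tilde D *\<^sub>v block_vec wI p wD wP) =
    energy (vel_family wI' wD' wP') (vel_family wI wD wP)
    + bform (vel_family wI' wD' wP') (comb p (pI D)) + bform (vel_family wI wD wP) (comb p' (pI D))"
proof -
  note a = form_asm_a[OF vfam_lists(1) vfam_lists(1)] form_asm_a[OF vfam_lists(1) vfam_lists(2)] form_asm_a[OF vfam_lists(1) vfam_lists(3)]
    form_asm_a[OF vfam_lists(2) vfam_lists(1)] form_asm_a[OF vfam_lists(2) vfam_lists(2)] form_asm_a[OF vfam_lists(2) vfam_lists(3)]
    form_asm_a[OF vfam_lists(3) vfam_lists(1)] form_asm_a[OF vfam_lists(3) vfam_lists(2)] form_asm_a[OF vfam_lists(3) vfam_lists(3)]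
  note b = form_asm_b[OF pwc_pI vfam_lists(1)] form_asm_b[OF pwc_pI vfam_lists(2)] form_asm_b[OF pwc_pI vfam_lists(3)]
  note t = symm_ip_transpose[OF asm_carrier(2)]
  have e: "energy (vel_family wI' wD' wP') (vel_family wI wD wP)
    = energy (fam wI' (velI D)) (fam wI (velI D)) + energy (fam wI' (velI D)) (fam wD (velD D)) + energy (fam wI' (velI D)) (fam wP (velP D))
    + energy (fam wD' (velD D)) (fam wI (velI D)) + energy (fam wD' (velD D)) (fam wD (velD D)) + energy (fam wD' (velD D)) (fam wP (velP D))
    + energy (fam wP' (velP D)) (fam wI (velI D)) + energy (fam wP' (velP D)) (fam wD (velD D)) + energy (fam wP' (velP D)) (fam wP (velP D))"
  proof -
    have "energy f (vel_family wI wD wP) = energy f (fam wI (velI D)) + energy f (fam wD (velD D)) + energy f (fam wP (velP D))"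
      if "vfam f" for f using energy_vel_family[OF that, of wI wD wP] by (simp add: energy_sym)
    then show ?thesis using vfam_fams by (simp add: energy_vel_family[OF vfam_vel_family])
  qed
  have bs: "bform (vel_family wI wD wP) (comb q (pI D)) = bform (fam wI (velI D)) (comb q (pI D))
     + bform (fam wD (velD D)) (comb q (pI D)) + bform (fam wP (velP D)) (comb q (pI D))" for wI wD wP q
    by (rule bform_vel_family[OF pwc_comb[OF pwc_pI]])
  have c1: "four_block_mat (asm_a D (velI D) (velI D)) (transpose_mat (asm_b D (pI D) (velI D))) (asm_b D (pI D) (velI D)) (0\<^sub>m (nQ D) (nQ D))
     \<in> carrier_mat (nI D + nQ D) (nI D + nQ D)"
    by (intro four_block_carrier_mat) (simp_all add: asm_carrier)
  have c2: "four_block_mat (asm_a D (velI D) (velD D)) (asm_a D (velI D) (velP D)) (asm_b D (pI D) (velD D)) (asm_b D (pI D) (velP D))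
     \<in> carrier_mat (nI D + nQ D) (nD D + nP D)"
    by (intro four_block_carrier_mat) (simp_all add: asm_carrier)
  have c3: "four_block_mat (asm_a D (velD D) (velI D)) (transpose_mat (asm_b D (pI D) (velD D))) (asm_a D (velP D) (velI D)) (transpose_mat (asm_b D (pI D) (velP D)))
     \<in> carrier_mat (nD D + nP D) (nI D + nQ D)"
    by (intro four_block_carrier_mat) (simp_all add: asm_carrier)
  have c4: "four_block_mat (asm_a D (velD D) (velD D)) (asm_a D (velD D) (velP D)) (asm_a D (velP D) (velD D)) (asm_a D (velP D) (velP D))
     \<in> carrier_mat (nD D + nP D) (nD D + nP D)"
    by (intro four_block_carrier_mat) (simp_all add: asm_carrier)
  have tc: "transpose_mat (asm_b D (pI D) (velI D)) \<in> carrier_mat (nI D) (nQ D)" "transpose_mat (asm_b D (pI D) (velD D)) \<in> carrier_mat (nD D) (nQ D)"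
    "transpose_mat (asm_b D (pI D) (velP D)) \<in> carrier_mat (nP D) (nQ D)" using asm_carrier(2) by simp_all
  have z: "0\<^sub>m (nQ D) (nQ D) *\<^sub>v p = 0\<^sub>v (nQ D)" using w by (intro eq_vecI) auto
  have v: "wI @\<^sub>v p \<in> carrier_vec (nI D + nQ D)" "wD @\<^sub>v wP \<in> carrier_vec (nD D + nP D)"
    "wI' @\<^sub>v p' \<in> carrier_vec (nI D + nQ D)" "wD' @\<^sub>v wP' \<in> carrier_vec (nD D + nP D)" using w w' by auto
  show ?thesis
    unfolding A_tilde_def Let_def block_vec_def
    unfolding four_block_form[OF c1 c2 c3 c4 v]
      four_block_form[OF asm_carrier(1) tc(1) asm_carrier(2) zero_carrier_mat w(1,2) w'(1,2)]
      four_block_form[OF asm_carrier(1) asm_carrier(1) asm_carrier(2) asm_carrier(2) w(3,4) w'(1,2)]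
      four_block_form[OF asm_carrier(1) tc(2) asm_carrier(1) tc(3) w(1,2) w'(3,4)]
      four_block_form[OF asm_carrier(1) asm_carrier(1) asm_carrier(1) asm_carrier(1) w(3,4) w'(3,4)]
      e bs z
    using w w' by (simp add: a b t)
qed

lemma A_tilde_symm: "symm full_dim (A_tilde D)"
proof -
  have c1: "four_block_mat (asm_a D (velI D) (velI D)) (transpose_mat (asm_b D (pI D) (velI D))) (asm_b D (pI D) (velI D)) (0\<^sub>m (nQ D) (nQ D))
     \<in> carrier_mat (nI D + nQ D) (nI D + nQ D)"
    by (intro four_block_carrier_mat) (simp_all add: asm_carrier)
  have c2: "four_block_mat (asm_a D (velI D) (velD D)) (asm_a D (velI D) (velP D)) (asm_b D (pI D) (velD D)) (asm_b D (pI D) (velP D))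
     \<in> carrier_mat (nI D + nQ D) (nD D + nP D)"
    by (intro four_block_carrier_mat) (simp_all add: asm_carrier)
  have c3: "four_block_mat (asm_a D (velD D) (velI D)) (transpose_mat (asm_b D (pI D) (velD D))) (asm_a D (velP D) (velI D)) (transpose_mat (asm_b D (pI D) (velP D)))
     \<in> carrier_mat (nD D + nP D) (nI D + nQ D)"
    by (intro four_block_carrier_mat) (simp_all add: asm_carrier)
  have c4: "four_block_mat (asm_a D (velD D) (velD D)) (asm_a D (velD D) (velP D)) (asm_a D (velP D) (velD D)) (asm_a D (velP D) (velP D))
     \<in> carrier_mat (nD D + nP D) (nD D + nP D)"
    by (intro four_block_carrier_mat) (simp_all add: asm_carrier)
  have tc: "transpose_mat (asm_b D (pI D) (velI D)) \<in> carrier_mat (nI D) (nQ D)" "transpose_mat (asm_b D (pI D) (velD D)) \<in> carrier_mat (nD D) (nQ D)"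
    "transpose_mat (asm_b D (pI D) (velP D)) \<in> carrier_mat (nP D) (nQ D)" using asm_carrier(2) by simp_all
  have "transpose_mat (A_tilde D) = A_tilde D"
    unfolding A_tilde_def Let_def transpose_four_block_mat[OF c1 c2 c3 c4]
      transpose_four_block_mat[OF asm_carrier(1) tc(1) asm_carrier(2) zero_carrier_mat]
      transpose_four_block_mat[OF asm_carrier(1) asm_carrier(1) asm_carrier(2) asm_carrier(2)]
      transpose_four_block_mat[OF asm_carrier(1) tc(2) asm_carrier(1) tc(3)]
      transpose_four_block_mat[OF asm_carrier(1) asm_carrier(1) asm_carrier(1) asm_carrier(1)]
    by (simp add: asm_a_transpose)
  then show ?thesis using A_tilde_carrier by (simp add: symm_def)
qed

lemma block_vec_carrier:
  "wI \<in> carrier_vec (nI D) \<Longrightarrow> p \<in> carrier_vec (nQ D) \<Longrightarrow> wD \<in> carrier_vec (nD D) \<Longrightarrow> wP \<in> carrier_vec (nP D) \<Longrightarrow>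
   block_vec wI p wD wP \<in> carrier_vec full_dim"
  by (auto simp: block_vec_def full_dim_def)

lemma split_vec:
  fixes v :: rvec
  assumes "v \<in> carrier_vec (n + m)"
  obtains a b where "a \<in> carrier_vec n" "b \<in> carrier_vec m" "v = a @\<^sub>v b"
  using vec_first_last_append[OF assms] vec_first_carrier[of v n] vec_last_carrier[of v m] by metis

lemma block_vec_exhaust:
  assumes "w \<in> carrier_vec full_dim"
  obtains wI p wD wP where "wI \<in> carrier_vec (nI D)" "p \<in> carrier_vec (nQ D)" "wD \<in> carrier_vec (nD D)" "wP \<in> carrier_vec (nP D)"
    "w = block_vec wI p wD wP"
proof -
  obtain a b where ab: "a \<in> carrier_vec (nI D + nQ D)" "b \<in> carrier_vec (nD D + nP D)" "w = a @\<^sub>v b"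
    using assms unfolding full_dim_def by (rule split_vec)
  obtain wI p where a: "wI \<in> carrier_vec (nI D)" "p \<in> carrier_vec (nQ D)" "a = wI @\<^sub>v p" by (rule split_vec[OF ab(1)])
  obtain wD wP where b: "wD \<in> carrier_vec (nD D)" "wP \<in> carrier_vec (nP D)" "b = wD @\<^sub>v wP" by (rule split_vec[OF ab(2)])
  show thesis by (rule that[OF a(1,2) b(1,2)]) (simp add: block_vec_def ab a b)
qed

lemma block_vec_add_scaled:
  assumes "wI \<in> carrier_vec (nI D)" "p \<in> carrier_vec (nQ D)" "wD \<in> carrier_vec (nD D)" "wP \<in> carrier_vec (nP D)"
    "wI' \<in> carrier_vec (nI D)" "p' \<in> carrier_vec (nQ D)" "wD' \<in> carrier_vec (nD D)" "wP' \<in> carrier_vec (nP D)"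
  shows "block_vec wI p wD wP + t \<cdot>\<^sub>v block_vec wI' p' wD' wP'
     = block_vec (wI + t \<cdot>\<^sub>v wI') (p + t \<cdot>\<^sub>v p') (wD + t \<cdot>\<^sub>v wD') (wP + t \<cdot>\<^sub>v wP')"
  using assms by (intro eq_vecI) (auto simp: block_vec_def)

lemma zero_block_vec: "0\<^sub>v full_dim = block_vec (0\<^sub>v (nI D)) (0\<^sub>v (nQ D)) (0\<^sub>v (nD D)) (0\<^sub>v (nP D))"
  by (intro eq_vecI) (auto simp: block_vec_def full_dim_def)

lemma fam_add_scaled:
  assumes "c \<in> carrier_vec (length fs)" "c' \<in> carrier_vec (length fs)"
  shows "fam (c + t \<cdot>\<^sub>v c') fs i y = fam c fs i y + t *\<^sub>R fam c' fs i y"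
  using assms by (simp add: fam_def scaleR_add_left sum.distrib scaleR_sum_right)

lemma vel_family_add_scaled:
  assumes "wI \<in> carrier_vec (nI D)" "wD \<in> carrier_vec (nD D)" "wP \<in> carrier_vec (nP D)"
    "wI' \<in> carrier_vec (nI D)" "wD' \<in> carrier_vec (nD D)" "wP' \<in> carrier_vec (nP D)"
  shows "vel_family (wI + t \<cdot>\<^sub>v wI') (wD + t \<cdot>\<^sub>v wD') (wP + t \<cdot>\<^sub>v wP') = (\<lambda>i y. vel_family wI wD wP i y + t *\<^sub>R vel_family wI' wD' wP' i y)"
  unfolding vel_family_def using assms by (simp add: fam_add_scaled algebra_simps)

lemma vel_family_zero: "vel_family (0\<^sub>v (nI D)) (0\<^sub>v (nD D)) (0\<^sub>v (nP D)) = (\<lambda>i y. 0)"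
  unfolding vel_family_def fam_def by simp

end

section \<open>Discrete harmonic extensions\<close>

definition on_sub :: "nat \<Rightarrow> (point \<Rightarrow> point) \<Rightarrow> nat \<Rightarrow> point \<Rightarrow> point" where
  "on_sub i f = (\<lambda>j. if j = i then f else (\<lambda>_. 0))"

lemma velD_concat: "velD D = concat (map (\<lambda>i. map (on_sub i) (velD_loc D i)) [0..<nsub D])"
  by (simp add: velD_def dual_idx_def map_concat comp_def velD_loc_def on_sub_def case_prod_unfold cong: if_cong)

lemma velI_concat: "velI D = concat (map (\<lambda>i. map (\<lambda>f j. f) (velI_loc D i)) [0..<nsub D])"
  by (simp add: velI_def map_concat comp_def)

context decomposed_mesh
begin

text \<open>
  Only the open subdomains count: an interior basis function is the same function for all subdomain
  numbers, and yet it contributes to the energy of a single subdomain.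
\<close>

definition lives_on :: "nat \<Rightarrow> (nat \<Rightarrow> point \<Rightarrow> point) \<Rightarrow> bool" where
  "lives_on i u \<longleftrightarrow> (\<forall>k<nsub D. k \<noteq> i \<longrightarrow> (\<forall>y\<in>subdom D k. u k y = 0))"

lemma energy_lives_on:
  assumes "lives_on i u" "i < nsub D"
  shows "(\<Sum>k<nsub D. a_int (subdom D k) (u k) (v k)) = a_int (subdom D i) (u i) (v i)"
proof -
  have "(\<Sum>k<nsub D. a_int (subdom D k) (u k) (v k)) = (\<Sum>k\<in>{i}. a_int (subdom D k) (u k) (v k))"
    using assms by (intro sum.mono_neutral_right) (auto simp: lives_on_def intro!: a_int_zero_on open_subdom)
  then show ?thesis by simp
qed

lemma lives_on_on_sub: "lives_on i (on_sub i f)"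
  by (simp add: lives_on_def on_sub_def)

lemma velI_loc_eq: "velI_loc D i = map (nodal_fun D) (node_labels (filter (\<lambda>x. x \<in> subdom D i) (vnodes D)))"
  by (simp add: velI_loc_def nodal_funs_eq)

lemma lives_on_velI_loc:
  assumes "f \<in> set (velI_loc D i)" shows "lives_on i (\<lambda>_. f)"
proof -
  obtain x k where x: "x \<in> nodes" "x \<in> subdom D i" "f = nodal_fun D (x, k)"
    using assms by (auto simp: velI_loc_eq set_node_labels)
  have "f y = 0" if "y \<in> subdom D j" "j \<noteq> i" for y j
  proof -
    have "y \<notin> subdom D i" using that subdom_closure_disjoint[of y j i] closure_subset by blast
    then show ?thesis using shape_interior_support[OF x(1,2)] by (simp add: x(3) nodal_fun_def)
  qed
  then show ?thesis by (auto simp: lives_on_def)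
qed

lemma asm_a_diag:
  assumes xs: "\<And>i u. i < nsub D \<Longrightarrow> u \<in> set (xs i) \<Longrightarrow> lives_on i u"
    and ys: "\<And>i u. i < nsub D \<Longrightarrow> u \<in> set (ys i) \<Longrightarrow> lives_on i u"
  shows "asm_a D (concat (map xs [0..<nsub D])) (concat (map ys [0..<nsub D]))
    = diag_block_mat (map (\<lambda>i. gram (\<lambda>u v. a_int (subdom D i) (u i) (v i)) (xs i) (ys i)) [0..<nsub D])"
proof -
  have "asm_a D (concat (map xs [0..<nsub D])) (concat (map ys [0..<nsub D]))
    = diag_block_mat (map (\<lambda>i. gram (\<lambda>u v. \<Sum>k<nsub D. a_int (subdom D k) (u k) (v k)) (xs i) (ys i)) [0..<nsub D])"
    unfolding asm_a_gram
  proof (rule gram_concat)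
    fix i j u v assume ij: "i \<in> set [0..<nsub D]" "j \<in> set [0..<nsub D]" "i \<noteq> j" "u \<in> set (xs i)" "v \<in> set (ys j)"
    then have u: "lives_on i u" and v: "lives_on j v" using xs ys by auto
    have "a_int (subdom D i) (u i) (v i) = a_int (subdom D i) (v i) (u i)" by (rule a_int_sym)
    also have "\<dots> = 0" using v ij by (intro a_int_zero_on open_subdom) (auto simp: lives_on_def)
    finally show "(\<Sum>k<nsub D. a_int (subdom D k) (u k) (v k)) = 0" using energy_lives_on[OF u, of v] ij by simp
  qed simp
  also have "\<dots> = diag_block_mat (map (\<lambda>i. gram (\<lambda>u v. a_int (subdom D i) (u i) (v i)) (xs i) (ys i)) [0..<nsub D])"
    using xs by (intro arg_cong[of _ _ diag_block_mat] map_cong refl eq_matI) (auto simp: gram_def energy_lives_on)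
  finally show ?thesis .
qed

lemma gram_local:
  "gram (\<lambda>u v. a_int S (u i) (v i)) (map (\<lambda>f j. f) fs) (map (\<lambda>f j. f) gs) = a_mat S fs gs"
  "gram (\<lambda>u v. a_int S (u i) (v i)) (map (\<lambda>f j. f) fs) (map (on_sub i) gs) = a_mat S fs gs"
  "gram (\<lambda>u v. a_int S (u i) (v i)) (map (on_sub i) fs) (map (\<lambda>f j. f) gs) = a_mat S fs gs"
  "gram (\<lambda>u v. a_int S (u i) (v i)) (map (on_sub i) fs) (map (on_sub i) gs) = a_mat S fs gs"
  by (rule eq_matI; auto simp: gram_def a_mat_def on_sub_def)+

text \<open>
  Interior and dual functions live on one subdomain each, so the matrices assembled from them are
  block diagonal and the operations of the separate subdomains can be written as operations with
  global matrices.
\<close>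

lemma asm_a_blocks:
  "asm_a D (velI D) (velI D) = diag_block_mat (map (\<lambda>i. a_mat (subdom D i) (velI_loc D i) (velI_loc D i)) [0..<nsub D])"
  "asm_a D (velI D) (velD D) = diag_block_mat (map (\<lambda>i. a_mat (subdom D i) (velI_loc D i) (velD_loc D i)) [0..<nsub D])"
  "asm_a D (velD D) (velI D) = diag_block_mat (map (\<lambda>i. a_mat (subdom D i) (velD_loc D i) (velI_loc D i)) [0..<nsub D])"
  "asm_a D (velD D) (velD D) = diag_block_mat (map (\<lambda>i. a_mat (subdom D i) (velD_loc D i) (velD_loc D i)) [0..<nsub D])"
proof -
  have I: "lives_on i u" if "u \<in> set (map (\<lambda>f j. f) (velI_loc D i))" for i u using that lives_on_velI_loc by auto
  have E: "lives_on i u" if "u \<in> set (map (on_sub i) (velD_loc D i))" for i u using that lives_on_on_sub by auto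
  show "asm_a D (velI D) (velI D) = diag_block_mat (map (\<lambda>i. a_mat (subdom D i) (velI_loc D i) (velI_loc D i)) [0..<nsub D])"
    unfolding velI_concat using asm_a_diag[of "\<lambda>i. map (\<lambda>f j. f) (velI_loc D i)" "\<lambda>i. map (\<lambda>f j. f) (velI_loc D i)", OF I I]
    by (simp only: gram_local)
  show "asm_a D (velI D) (velD D) = diag_block_mat (map (\<lambda>i. a_mat (subdom D i) (velI_loc D i) (velD_loc D i)) [0..<nsub D])"
    unfolding velI_concat velD_concat using asm_a_diag[of "\<lambda>i. map (\<lambda>f j. f) (velI_loc D i)" "\<lambda>i. map (on_sub i) (velD_loc D i)", OF I E]
    by (simp only: gram_local)
  show "asm_a D (velD D) (velI D) = diag_block_mat (map (\<lambda>i. a_mat (subdom D i) (velD_loc D i) (velI_loc D i)) [0..<nsub D])"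
    unfolding velI_concat velD_concat using asm_a_diag[of "\<lambda>i. map (on_sub i) (velD_loc D i)" "\<lambda>i. map (\<lambda>f j. f) (velI_loc D i)", OF E I]
    by (simp only: gram_local)
  show "asm_a D (velD D) (velD D) = diag_block_mat (map (\<lambda>i. a_mat (subdom D i) (velD_loc D i) (velD_loc D i)) [0..<nsub D])"
    unfolding velD_concat using asm_a_diag[of "\<lambda>i. map (on_sub i) (velD_loc D i)" "\<lambda>i. map (on_sub i) (velD_loc D i)", OF E E]
    by (simp only: gram_local)
qed

text \<open>
  An interior velocity of one subdomain is a special velocity family, so this is another instance of
  the definiteness of the broken energy.
\<close>

lemma local_trivial_kernel:
  assumes i: "i < nsub D"
  shows "trivial_kernel (length (velI_loc D i)) (a_mat (subdom D i) (velI_loc D i) (velI_loc D i))"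
  unfolding trivial_kernel_def
proof (intro conjI ballI impI)
  let ?A = "a_mat (subdom D i) (velI_loc D i) (velI_loc D i)"
  show "?A \<in> carrier_mat (length (velI_loc D i)) (length (velI_loc D i))" by (simp add: a_mat_def)
  fix v assume v: "v \<in> carrier_vec (length (velI_loc D i))" and z: "?A *\<^sub>v v = 0\<^sub>v (length (velI_loc D i))"
  define us where "us = map (\<lambda>f (j :: nat). f) (velI_loc D i)"
  have e: "(\<Sum>k<nsub D. a_int (subdom D k) f g) = a_int (subdom D i) f g" if "f \<in> set (velI_loc D i)" for f g
    using energy_lives_on[OF lives_on_velI_loc[OF that] i, of "\<lambda>_. g"] by simp
  have A: "asm_a D us us = ?A"
    unfolding gram_local(1)[symmetric, where i = i] asm_a_gram us_def
    by (intro eq_matI) (auto simp: gram_def e)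
  define xs where "xs = filter (\<lambda>x. x \<in> subdom D i) (vnodes D)"
  have xs: "distinct xs" "set xs \<subseteq> inodes" using distinct_vnodes i by (auto simp: xs_def inodes_def)
  have loc: "velI_loc D i = map (nodal_fun D) (node_labels xs)" by (simp add: velI_loc_eq xs_def)
  obtain g where g: "comb v (velI_loc D i) = nodal_sum (set xs) g"
    "(\<forall>x\<in>set xs. g x = 0) \<longrightarrow> (\<forall>k<length (node_labels xs). v $ k = 0)"
    unfolding loc using nodal_list_coefficients[OF xs(1), of v] by blast
  define g' where "g' x = (if x \<in> set xs then g x else 0)" for x
  have "nodal_sum inodes g' = nodal_sum (set xs) g"
  proof
    fix y
    have "finite inodes" using inodes_nodes by (rule finite_subset) simp
    then have "nodal_sum inodes g' y = (\<Sum>x\<in>set xs. shape D x y *\<^sub>R g' x)"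
      unfolding nodal_sum_def using xs(2) by (intro sum.mono_neutral_right) (auto simp: g'_def)
    then show "nodal_sum inodes g' y = nodal_sum (set xs) g y" by (simp add: nodal_sum_def g'_def)
  qed
  then have f: "fam v us = coeff_family g' (\<lambda>_ _ _. 0) (\<lambda>_. 0) (\<lambda>_. 0)"
    unfolding us_def fam_map coeff_family_def by (intro ext) (simp add: fam_map g dual_sum_def nodal_sum_def)
  have vf: "vfam u" if u: "u \<in> set us" for u
  proof -
    have "u \<in> set (velI D)" using u i by (auto simp: us_def velI_concat)
    then show ?thesis by (rule vfam_lists(1))
  qed
  have "energy (fam v us) (fam v us) = ip v (?A *\<^sub>v v)"
    using form_asm_a[of us us v v, OF vf vf] v A by (simp add: us_def)
  then have e0: "energy (fam v us) (fam v us) = 0" using z v by simp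
  have "g x = 0" if x: "x \<in> set xs" for x
  proof -
    have "x \<in> closure (subdom D i)" using x closure_subset by (auto simp: xs_def)
    then have "coeff_family g' (\<lambda>_ _ _. 0) (\<lambda>_. 0) (\<lambda>_. 0) i x = 0"
      using energy_zero_imp_vanish[OF e0[unfolded f] i] by simp
    then show ?thesis using coeff_family_inode[of x g' "\<lambda>_ _ _. 0" "\<lambda>_. 0" "\<lambda>_. 0" i] x xs(2) by (auto simp: g'_def)
  qed
  then show "v = 0\<^sub>v (length (velI_loc D i))" using g(2) v by (intro eq_vecI) (auto simp: loc)
qed

text \<open>
  As for \<open>harm_loc\<close>, the discrete harmonic extension is the negative of this matrix.
\<close>

definition harm_ext :: rmat where "harm_ext = diag_block_mat (map (harm_loc D) [0..<nsub D])"

lemma length_velI_sum: "sum_list (map (\<lambda>i. length (velI_loc D i)) [0..<nsub D]) = nI D"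
  by (simp add: velI_concat length_concat comp_def)

lemma length_velD_sum: "sum_list (map (\<lambda>i. length (velD_loc D i)) [0..<nsub D]) = nD D"
  by (simp add: velD_concat length_concat comp_def)

lemma harm_loc_carrier: "i < nsub D \<Longrightarrow> harm_loc D i \<in> carrier_mat (length (velI_loc D i)) (length (velD_loc D i))"
  using inv_mat_props(1)[OF local_trivial_kernel] unfolding harm_loc_def by (auto simp: a_mat_def intro!: mult_carrier_mat)

lemma harm_ext_carrier: "harm_ext \<in> carrier_mat (nI D) (nD D)"
  unfolding harm_ext_def length_velI_sum[symmetric] length_velD_sum[symmetric]
  by (rule diag_block_mat_carrier) (simp add: harm_loc_carrier)

lemma harm_ext_solves: "asm_a D (velI D) (velI D) * harm_ext = asm_a D (velI D) (velD D)"
proof -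
  have "asm_a D (velI D) (velI D) * harm_ext
    = diag_block_mat (map (\<lambda>i. a_mat (subdom D i) (velI_loc D i) (velI_loc D i) * harm_loc D i) [0..<nsub D])"
    unfolding asm_a_blocks(1) harm_ext_def
    by (rule diag_block_mat_mult[where n = "\<lambda>i. length (velI_loc D i)" and m = "\<lambda>i. length (velI_loc D i)" and k = "\<lambda>i. length (velD_loc D i)"])
      (auto simp: harm_loc_carrier a_mat_def)
  also have "\<dots> = asm_a D (velI D) (velD D)"
    unfolding asm_a_blocks(2)
  proof (rule arg_cong[of _ _ diag_block_mat], rule map_cong[OF refl])
    fix i assume "i \<in> set [0..<nsub D]"
    then have i: "i < nsub D" by simp
    let ?A = "a_mat (subdom D i) (velI_loc D i) (velI_loc D i)" and ?C = "a_mat (subdom D i) (velI_loc D i) (velD_loc D i)"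
    note P = inv_mat_props[OF local_trivial_kernel[OF i]]
    have A: "?A \<in> carrier_mat (length (velI_loc D i)) (length (velI_loc D i))" "?C \<in> carrier_mat (length (velI_loc D i)) (length (velD_loc D i))"
      by (simp_all add: a_mat_def)
    have "?A * harm_loc D i = (?A * inv_mat ?A) * ?C"
      unfolding harm_loc_def by (rule assoc_mult_mat[OF A(1) P(1) A(2), symmetric])
    also have "\<dots> = ?C" unfolding P(2) using A(2) by simp
    finally show "?A * harm_loc D i = ?C" .
  qed
  finally show ?thesis .
qed

text \<open>
  By the block structure the direct sum of the local Schur complements is the Schur complement of the
  global blocks.
\<close>

lemma H_Delta_eq: "H_Delta D = asm_a D (velD D) (velD D) - asm_a D (velD D) (velI D) * harm_ext"
proof -
  have m: "asm_a D (velD D) (velI D) * harm_ext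
    = diag_block_mat (map (\<lambda>i. a_mat (subdom D i) (velD_loc D i) (velI_loc D i) * harm_loc D i) [0..<nsub D])"
    unfolding asm_a_blocks(3) harm_ext_def
    by (rule diag_block_mat_mult[where n = "\<lambda>i. length (velD_loc D i)" and m = "\<lambda>i. length (velI_loc D i)" and k = "\<lambda>i. length (velD_loc D i)"])
      (auto simp: harm_loc_carrier a_mat_def)
  show ?thesis unfolding m asm_a_blocks(4) H_Delta_def H_loc_def[abs_def]
    by (rule diag_block_mat_minus[where n = "\<lambda>i. length (velD_loc D i)" and m = "\<lambda>i. length (velD_loc D i)"])
      (auto simp: a_mat_def intro!: mult_carrier_mat[OF _ harm_loc_carrier])
qed

lemma H_Delta_carrier: "H_Delta D \<in> carrier_mat (nD D) (nD D)"
proof -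
  have "asm_a D (velD D) (velI D) * harm_ext \<in> carrier_mat (nD D) (nD D)"
    by (rule mult_carrier_mat[OF asm_carrier(1) harm_ext_carrier])
  then show ?thesis unfolding H_Delta_eq by (rule minus_carrier_mat)
qed

lemma energy_interior_dual:
  assumes a: "a \<in> carrier_vec (nI D)" and v: "v \<in> carrier_vec (nD D)"
  shows "energy (vel_family a v (0\<^sub>v (nP D))) (vel_family a v (0\<^sub>v (nP D)))
    = ip a (asm_a D (velI D) (velI D) *\<^sub>v a) + 2 * ip a (asm_a D (velI D) (velD D) *\<^sub>v v) + ip v (asm_a D (velD D) (velD D) *\<^sub>v v)"
proof -
  have "fam (0\<^sub>v (nP D)) (velP D) = (\<lambda>i y. 0)" by (simp add: fam_def[abs_def])
  then have V: "vel_family a v (0\<^sub>v (nP D)) = (\<lambda>i y. fam a (velI D) i y + fam v (velD D) i y)" by (simp add: vel_family_def[abs_def])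
  have b: "vfam (\<lambda>i y. fam a (velI D) i y + fam v (velD D) i y)" by (intro vfam_add vfam_fams)
  have "energy (vel_family a v (0\<^sub>v (nP D))) (vel_family a v (0\<^sub>v (nP D)))
    = energy (fam a (velI D)) (fam a (velI D)) + 2 * energy (fam a (velI D)) (fam v (velD D)) + energy (fam v (velD D)) (fam v (velD D))"
    unfolding V by (subst energy_add[OF vfam_fams(1,2) b])
      (simp add: energy_add[OF vfam_fams(1,2) vfam_fams(1)] energy_add[OF vfam_fams(1,2) vfam_fams(2)]
        energy_sym[of "fam a (velI D)" "\<lambda>i y. fam a (velI D) i y + fam v (velD D) i y"]
        energy_sym[of "fam v (velD D)" "\<lambda>i y. fam a (velI D) i y + fam v (velD D) i y"]
        energy_sym[of "fam v (velD D)" "fam a (velI D)"])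
  then show ?thesis
    using form_asm_a[OF vfam_lists(1) vfam_lists(1) a a] form_asm_a[OF vfam_lists(1) vfam_lists(2) a v]
      form_asm_a[OF vfam_lists(2) vfam_lists(2) v v] by simp
qed

lemma harm_ext_adjoint:
  assumes v: "v \<in> carrier_vec (nD D)" and x: "x \<in> carrier_vec (nD D)"
  shows "ip x (asm_a D (velD D) (velI D) *\<^sub>v (harm_ext *\<^sub>v v)) = ip (harm_ext *\<^sub>v x) (asm_a D (velI D) (velI D) *\<^sub>v (harm_ext *\<^sub>v v))"
    "asm_a D (velI D) (velI D) *\<^sub>v (harm_ext *\<^sub>v v) = asm_a D (velI D) (velD D) *\<^sub>v v"
proof -
  have kv: "harm_ext *\<^sub>v v \<in> carrier_vec (nI D)" and kx: "harm_ext *\<^sub>v x \<in> carrier_vec (nI D)"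
    using harm_ext_carrier v x by (auto intro!: mult_mat_vec_carrier)
  have eq: "asm_a D (velI D) (velI D) *\<^sub>v (harm_ext *\<^sub>v u) = asm_a D (velI D) (velD D) *\<^sub>v u" if "u \<in> carrier_vec (nD D)" for u
    unfolding harm_ext_solves[symmetric] using assoc_mult_mat_vec[OF asm_carrier(1) harm_ext_carrier that] by simp
  show "asm_a D (velI D) (velI D) *\<^sub>v (harm_ext *\<^sub>v v) = asm_a D (velI D) (velD D) *\<^sub>v v" by (rule eq[OF v])
  have "ip x (asm_a D (velD D) (velI D) *\<^sub>v (harm_ext *\<^sub>v v)) = ip (harm_ext *\<^sub>v v) (asm_a D (velI D) (velD D) *\<^sub>v x)"
    using symm_ip_transpose[OF asm_carrier(1) x kv] by (simp add: asm_a_transpose)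
  also have "\<dots> = ip (harm_ext *\<^sub>v v) (asm_a D (velI D) (velI D) *\<^sub>v (harm_ext *\<^sub>v x))" by (simp add: eq[OF x])
  also have "\<dots> = ip (harm_ext *\<^sub>v x) (asm_a D (velI D) (velI D) *\<^sub>v (harm_ext *\<^sub>v v))"
    using symm_ip_transpose[OF asm_carrier(1) kv kx] by (simp add: asm_a_transpose)
  finally show "ip x (asm_a D (velD D) (velI D) *\<^sub>v (harm_ext *\<^sub>v v)) = ip (harm_ext *\<^sub>v x) (asm_a D (velI D) (velI D) *\<^sub>v (harm_ext *\<^sub>v v))" .
qed

lemma H_Delta_mult:
  assumes v: "v \<in> carrier_vec (nD D)"
  shows "H_Delta D *\<^sub>v v = asm_a D (velD D) (velD D) *\<^sub>v v - asm_a D (velD D) (velI D) *\<^sub>v (harm_ext *\<^sub>v v)"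
proof -
  have c: "asm_a D (velD D) (velI D) * harm_ext \<in> carrier_mat (nD D) (nD D)"
    by (rule mult_carrier_mat[OF asm_carrier(1) harm_ext_carrier])
  have "H_Delta D *\<^sub>v v = asm_a D (velD D) (velD D) *\<^sub>v v - (asm_a D (velD D) (velI D) * harm_ext) *\<^sub>v v"
    unfolding H_Delta_eq by (rule minus_mult_distrib_mat_vec[OF asm_carrier(1) c v])
  then show ?thesis using assoc_mult_mat_vec[OF asm_carrier(1) harm_ext_carrier v] by simp
qed

lemma H_Delta_form:
  assumes v: "v \<in> carrier_vec (nD D)" and x: "x \<in> carrier_vec (nD D)"
  shows "ip x (H_Delta D *\<^sub>v v) = ip x (asm_a D (velD D) (velD D) *\<^sub>v v) - ip (harm_ext *\<^sub>v x) (asm_a D (velI D) (velI D) *\<^sub>v (harm_ext *\<^sub>v v))"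
proof -
  have kv: "harm_ext *\<^sub>v v \<in> carrier_vec (nI D)" using harm_ext_carrier v by (auto intro!: mult_mat_vec_carrier)
  have c: "asm_a D (velD D) (velD D) *\<^sub>v v \<in> carrier_vec (nD D)" "asm_a D (velD D) (velI D) *\<^sub>v (harm_ext *\<^sub>v v) \<in> carrier_vec (nD D)"
    using mult_mat_vec_carrier[OF asm_carrier(1) v] mult_mat_vec_carrier[OF asm_carrier(1) kv] by auto
  show ?thesis unfolding H_Delta_mult[OF v] using scalar_prod_minus_distrib[OF x c] harm_ext_adjoint(1)[OF v x] by simp
qed

lemma H_Delta_symm: "symm (nD D) (H_Delta D)"
proof -
  have "transpose_mat (H_Delta D) = H_Delta D"
  proof (rule eq_matI)
    fix i j assume "i < dim_row (H_Delta D)" "j < dim_col (H_Delta D)"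
    then have ij: "i < nD D" "j < nD D" using H_Delta_carrier by auto
    define x y :: rvec where "x = unit_vec (nD D) i" and "y = unit_vec (nD D) j"
    have xy: "x \<in> carrier_vec (nD D)" "y \<in> carrier_vec (nD D)" by (auto simp: x_def y_def)
    have kx: "harm_ext *\<^sub>v x \<in> carrier_vec (nI D)" "harm_ext *\<^sub>v y \<in> carrier_vec (nI D)" using harm_ext_carrier xy by (auto intro!: mult_mat_vec_carrier)
    have e: "ip x (H_Delta D *\<^sub>v y) = index_mat (H_Delta D) (i, j)" "ip y (H_Delta D *\<^sub>v x) = index_mat (H_Delta D) (j, i)"
      using ij H_Delta_carrier by (auto simp: x_def y_def)
    have "ip x (H_Delta D *\<^sub>v y) = ip y (H_Delta D *\<^sub>v x)"
      unfolding H_Delta_form[OF xy(2,1)] H_Delta_form[OF xy]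
      using symm_ip_transpose[OF asm_carrier(1)[of D "velD D" "velD D"] xy] symm_ip_transpose[OF asm_carrier(1)[of D "velI D" "velI D"] kx]
      by (simp add: asm_a_transpose)
    then show "index_mat (transpose_mat (H_Delta D)) (i, j) = index_mat (H_Delta D) (i, j)"
      using e ij H_Delta_carrier by simp
  qed (use H_Delta_carrier in auto)
  then show ?thesis using H_Delta_carrier by (simp add: symm_def)
qed

text \<open>
  The Schur complement measures the energy of the discrete harmonic extension. All properties of
  \<open>H_Delta\<close> that matter, nonnegativity and definiteness, are inherited from the energy.
\<close>

lemma harmonic_energy:
  assumes v: "v \<in> carrier_vec (nD D)"
  shows "energy (vel_family (- (harm_ext *\<^sub>v v)) v (0\<^sub>v (nP D))) (vel_family (- (harm_ext *\<^sub>v v)) v (0\<^sub>v (nP D))) = ip v (H_Delta D *\<^sub>v v)"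
proof -
  define k where "k = harm_ext *\<^sub>v v"
  have k: "k \<in> carrier_vec (nI D)" using harm_ext_carrier v by (auto simp: k_def intro!: mult_mat_vec_carrier)
  have nk: "- k \<in> carrier_vec (nI D)" using k by simp
  have m: "- k = (-1) \<cdot>\<^sub>v k" using k by (intro eq_vecI) auto
  have Ak: "asm_a D (velI D) (velI D) *\<^sub>v k \<in> carrier_vec (nI D)" by (rule mult_mat_vec_carrier[OF asm_carrier(1) k])
  have "asm_a D (velI D) (velI D) *\<^sub>v (- k) = (-1) \<cdot>\<^sub>v (asm_a D (velI D) (velI D) *\<^sub>v k)"
    unfolding m by (rule mult_mat_vec[OF asm_carrier(1) k])
  then have 1: "ip (- k) (asm_a D (velI D) (velI D) *\<^sub>v (- k)) = ip k (asm_a D (velI D) (velI D) *\<^sub>v k)"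
    unfolding m using k Ak by simp
  have 2: "ip (- k) (asm_a D (velI D) (velD D) *\<^sub>v v) = - ip k (asm_a D (velI D) (velI D) *\<^sub>v k)"
    unfolding m using k Ak harm_ext_adjoint(2)[OF v v] by (simp add: k_def[symmetric])
  show ?thesis
    unfolding k_def[symmetric] energy_interior_dual[OF nk v] 1 2 H_Delta_form[OF v v] by simp
qed

section \<open>Pressures and constraints\<close>

definition JI :: "nat list" where "JI = filter (\<lambda>k. k \<notin> pgam D) [0..<length (pbasis D)]"
definition JG :: "nat list" where "JG = filter (\<lambda>k. k \<in> pgam D) [0..<length (pbasis D)]"

abbreviation "nPB \<equiv> length (pbasis D)"

text \<open>
  With \<open>JI\<close> and \<open>JG\<close> this restricts a vector of pressure coefficients to \<open>Q_I\<close> and \<open>Q_Gamma\<close>. The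
  constraints of both kinds can thus be treated at once, as one vector for the full pressure space,
  which is the space of the inf-sup condition.
\<close>

definition sel :: "nat list \<Rightarrow> rvec \<Rightarrow> rvec" where "sel J r = Matrix.vec (length J) (\<lambda>k. r $ (J ! k))"

lemma pI_JI: "pI D = map ((!) (pbasis D)) JI" and pG_JG: "pG D = map ((!) (pbasis D)) JG"
  by (simp_all add: pI_def pG_def JI_def JG_def)

lemma nQ_JI: "nQ D = length JI" and nG_JG: "nG D = length JG"
  by (simp_all add: pI_JI pG_JG)

lemma sel_carrier: "sel JI r \<in> carrier_vec (nQ D)" "sel JG r \<in> carrier_vec (nG D)"
  by (simp_all add: sel_def nQ_JI nG_JG)

lemma sum_JI_JG:
  fixes G :: "nat \<Rightarrow> 'b :: comm_monoid_add"
  shows "(\<Sum>k<nPB. G k) = (\<Sum>k<length JI. G (JI ! k)) + (\<Sum>k<length JG. G (JG ! k))"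
proof -
  have d: "distinct JI" "distinct JG" by (auto simp: JI_def JG_def)
  have "{..<nPB} = set JI \<union> set JG" "set JI \<inter> set JG = {}" by (auto simp: JI_def JG_def)
  then show ?thesis unfolding sum_nth_distinct[OF d(1)] sum_nth_distinct[OF d(2)] by (simp add: sum.union_disjoint)
qed

lemma sel_ip:
  assumes "q \<in> carrier_vec nPB" "r \<in> carrier_vec nPB"
  shows "ip q r = ip (sel JI q) (sel JI r) + ip (sel JG q) (sel JG r)"
proof -
  have "ip q r = (\<Sum>k<nPB. q $ k * r $ k)" using assms by (simp add: scalar_prod_def lessThan_atLeast0)
  then show ?thesis unfolding sum_JI_JG by (simp add: scalar_prod_def sel_def lessThan_atLeast0)
qed

lemma sel_comb: "comb q (pbasis D) = (\<lambda>y. comb (sel JI q) (pI D) y + comb (sel JG q) (pG D) y)"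
  unfolding comb_pressure sum_JI_JG[of "\<lambda>k. q $ k * (pbasis D ! k) _"] by (simp add: sel_def pI_JI pG_JG)

lemma sel_join:
  assumes "a \<in> carrier_vec (nQ D)" "b \<in> carrier_vec (nG D)"
  shows "\<exists>r\<in>carrier_vec nPB. sel JI r = a \<and> sel JG r = b"
proof -
  have d: "distinct JI" "distinct JG" by (auto simp: JI_def JG_def)
  obtain da where da: "\<forall>k<length JI. a $ k = da (JI ! k)" using labelled_coefficients[OF d(1), of "\<lambda>k. a $ k"] by blast
  obtain db where db: "\<forall>k<length JG. b $ k = db (JG ! k)" using labelled_coefficients[OF d(2), of "\<lambda>k. b $ k"] by blast
  define r where "r = Matrix.vec nPB (\<lambda>k. if k \<in> pgam D then db k else da k)"
  have "JI ! k < nPB \<and> JI ! k \<notin> pgam D" if "k < length JI" for k using nth_mem[OF that] by (auto simp: JI_def)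
  then have "sel JI r = a" using assms da by (intro eq_vecI) (auto simp: sel_def r_def nQ_JI)
  moreover have "JG ! k < nPB \<and> JG ! k \<in> pgam D" if "k < length JG" for k using nth_mem[OF that] by (auto simp: JG_def)
  then have "sel JG r = b" using assms db by (intro eq_vecI) (auto simp: sel_def r_def nG_JG)
  ultimately show ?thesis by (intro bexI[of _ r]) (auto simp: r_def)
qed

text \<open>
  The divergence of a velocity, with negative sign, tested with the functions \<open>qs\<close>.
\<close>

definition div_rows :: "(point \<Rightarrow> real) list \<Rightarrow> rvec \<Rightarrow> rvec \<Rightarrow> rvec \<Rightarrow> rvec" where
  "div_rows qs wI wD wP = asm_b D qs (velI D) *\<^sub>v wI + asm_b D qs (velD D) *\<^sub>v wD + asm_b D qs (velP D) *\<^sub>v wP"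

lemma asm_b_mult_carrier: "w \<in> carrier_vec (length us) \<Longrightarrow> asm_b D qs us *\<^sub>v w \<in> carrier_vec (length qs)"
  by (rule mult_mat_vec_carrier[OF asm_carrier(2)])

lemma div_rows_carrier:
  "wI \<in> carrier_vec (nI D) \<Longrightarrow> wD \<in> carrier_vec (nD D) \<Longrightarrow> wP \<in> carrier_vec (nP D) \<Longrightarrow> div_rows qs wI wD wP \<in> carrier_vec (length qs)"
  unfolding div_rows_def by (intro add_carrier_vec asm_b_mult_carrier)

lemma ip_div_rows:
  assumes qs: "\<And>f. f \<in> set qs \<Longrightarrow> pwc (mesh D) f" and q: "q \<in> carrier_vec (length qs)"
    and w: "wI \<in> carrier_vec (nI D)" "wD \<in> carrier_vec (nD D)" "wP \<in> carrier_vec (nP D)"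
  shows "ip q (div_rows qs wI wD wP) = bform (vel_family wI wD wP) (comb q qs)"
proof -
  note c = asm_b_mult_carrier[OF w(1), of qs] asm_b_mult_carrier[OF w(2), of qs] asm_b_mult_carrier[OF w(3), of qs]
  have "ip q (div_rows qs wI wD wP) = ip q (asm_b D qs (velI D) *\<^sub>v wI) + ip q (asm_b D qs (velD D) *\<^sub>v wD) + ip q (asm_b D qs (velP D) *\<^sub>v wP)"
    unfolding div_rows_def using c q by (simp add: scalar_prod_add_distrib[of _ "length qs"])
  also have "ip q (asm_b D qs (velI D) *\<^sub>v wI) = bform (fam wI (velI D)) (comb q qs)"
    by (rule form_asm_b[OF qs vfam_lists(1) q w(1)])
  also have "ip q (asm_b D qs (velD D) *\<^sub>v wD) = bform (fam wD (velD D)) (comb q qs)"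
    by (rule form_asm_b[OF qs vfam_lists(2) q w(2)])
  also have "ip q (asm_b D qs (velP D) *\<^sub>v wP) = bform (fam wP (velP D)) (comb q qs)"
    by (rule form_asm_b[OF qs vfam_lists(3) q w(3)])
  also have "bform (fam wI (velI D)) (comb q qs) + bform (fam wD (velD D)) (comb q qs) + bform (fam wP (velP D)) (comb q qs)
    = bform (vel_family wI wD wP) (comb q qs)"
    by (rule bform_vel_family[OF pwc_comb[OF qs], symmetric])
  finally show ?thesis .
qed

lemma sel_div_rows:
  assumes w: "wI \<in> carrier_vec (nI D)" "wD \<in> carrier_vec (nD D)" "wP \<in> carrier_vec (nP D)"
  shows "sel JI (div_rows (pbasis D) wI wD wP) = div_rows (pI D) wI wD wP"
    "sel JG (div_rows (pbasis D) wI wD wP) = div_rows (pG D) wI wD wP"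
proof -
  have row: "(asm_b D (map ((!) (pbasis D)) J) us *\<^sub>v w) $ k = (asm_b D (pbasis D) us *\<^sub>v w) $ (J ! k)"
    if "k < length J" "J ! k < nPB" "w \<in> carrier_vec (length us)" for J k us w
    using that by (auto simp: scalar_prod_def asm_b_def intro!: sum.cong)
  have main: "sel J (div_rows (pbasis D) wI wD wP) = div_rows (map ((!) (pbasis D)) J) wI wD wP" if J: "\<forall>k\<in>set J. k < nPB" for J
  proof (rule eq_vecI)
    fix k assume "k < dim_vec (div_rows (map ((!) (pbasis D)) J) wI wD wP)"
    then have k: "k < length J" using div_rows_carrier[OF w, of "map ((!) (pbasis D)) J"] by simp
    then have Jk: "J ! k < nPB" using J by simp
    have dim: "dim_row (asm_b D qs us) = length qs" for qs us by (simp add: asm_b_def)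
    show "sel J (div_rows (pbasis D) wI wD wP) $ k = div_rows (map ((!) (pbasis D)) J) wI wD wP $ k"
      unfolding div_rows_def sel_def using k Jk
      by (simp add: dim row[OF k Jk] w del: index_mult_mat_vec)
  qed (use div_rows_carrier[OF w, of "map ((!) (pbasis D)) J"] in \<open>simp add: sel_def\<close>)
  show "sel JI (div_rows (pbasis D) wI wD wP) = div_rows (pI D) wI wD wP"
    unfolding pI_JI by (rule main) (auto simp: JI_def)
  show "sel JG (div_rows (pbasis D) wI wD wP) = div_rows (pG D) wI wD wP"
    unfolding pG_JG by (rule main) (auto simp: JG_def)
qed

lemma B_C_carrier: "B_C D \<in> carrier_mat (nG D + nL D) full_dim"
proof -
  have "B_C D \<in> carrier_mat ((nG D + nL D) + 0) full_dim"
    unfolding B_C_def full_dim_def by (intro four_block_carrier_mat) (simp_all add: asm_carrier B_Delta_carrier)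
  then show ?thesis by simp
qed

lemma append_vec_dim_0: "b \<in> carrier_vec 0 \<Longrightarrow> a @\<^sub>v b = (a :: rvec)"
  by (rule eq_vecI) auto

lemma B_C_mult:
  assumes w: "wI \<in> carrier_vec (nI D)" "p \<in> carrier_vec (nQ D)" "wD \<in> carrier_vec (nD D)" "wP \<in> carrier_vec (nP D)"
  shows "B_C D *\<^sub>v block_vec wI p wD wP = div_rows (pG D) wI wD wP @\<^sub>v (B_Delta D *\<^sub>v wD)"
proof -
  have c1: "four_block_mat (asm_b D (pG D) (velI D)) (0\<^sub>m (nG D) (nQ D)) (0\<^sub>m (nL D) (nI D)) (0\<^sub>m (nL D) (nQ D)) \<in> carrier_mat (nG D + nL D) (nI D + nQ D)"
    by (intro four_block_carrier_mat) (simp_all add: asm_carrier)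
  have c2: "four_block_mat (asm_b D (pG D) (velD D)) (asm_b D (pG D) (velP D)) (B_Delta D) (0\<^sub>m (nL D) (nP D)) \<in> carrier_mat (nG D + nL D) (nD D + nP D)"
    by (intro four_block_carrier_mat) (simp_all add: asm_carrier)
  have v: "wI @\<^sub>v p \<in> carrier_vec (nI D + nQ D)" "wD @\<^sub>v wP \<in> carrier_vec (nD D + nP D)" using w by auto
  note b = asm_b_mult_carrier[OF w(1), of "pG D"] asm_b_mult_carrier[OF w(3), of "pG D"] asm_b_mult_carrier[OF w(4), of "pG D"]
  have z: "0\<^sub>m (nG D) (nQ D) *\<^sub>v p = 0\<^sub>v (nG D)" "0\<^sub>m (nL D) (nI D) *\<^sub>v wI = 0\<^sub>v (nL D)" "0\<^sub>m (nL D) (nQ D) *\<^sub>v p = 0\<^sub>v (nL D)"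
    "0\<^sub>m (nL D) (nP D) *\<^sub>v wP = 0\<^sub>v (nL D)" using w by (auto intro!: eq_vecI)
  have bd: "B_Delta D *\<^sub>v wD \<in> carrier_vec (nL D)" by (rule mult_mat_vec_carrier[OF B_Delta_carrier w(3)])
  have app: "((x + 0\<^sub>v (nG D)) @\<^sub>v (0\<^sub>v (nL D) + 0\<^sub>v (nL D))) + ((y + z) @\<^sub>v (l + 0\<^sub>v (nL D))) = (x + y + z) @\<^sub>v l"
    if "x \<in> carrier_vec (nG D)" "y \<in> carrier_vec (nG D)" "z \<in> carrier_vec (nG D)" "l \<in> carrier_vec (nL D)"
    for x y z l :: rvec using that by (intro eq_vecI) (auto simp: add.assoc)
  have "B_C D *\<^sub>v block_vec wI p wD wP
    = four_block_mat (asm_b D (pG D) (velI D)) (0\<^sub>m (nG D) (nQ D)) (0\<^sub>m (nL D) (nI D)) (0\<^sub>m (nL D) (nQ D)) *\<^sub>v (wI @\<^sub>v p)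
    + four_block_mat (asm_b D (pG D) (velD D)) (asm_b D (pG D) (velP D)) (B_Delta D) (0\<^sub>m (nL D) (nP D)) *\<^sub>v (wD @\<^sub>v wP)"
    unfolding B_C_def block_vec_def four_block_mat_mult_vec[OF c1 c2 zero_carrier_mat zero_carrier_mat v]
    by (rule append_vec_dim_0, rule add_carrier_vec) (rule mult_mat_vec_carrier[OF zero_carrier_mat] v)+
  also have "\<dots> = ((asm_b D (pG D) (velI D) *\<^sub>v wI + 0\<^sub>v (nG D)) @\<^sub>v (0\<^sub>v (nL D) + 0\<^sub>v (nL D)))
    + ((asm_b D (pG D) (velD D) *\<^sub>v wD + asm_b D (pG D) (velP D) *\<^sub>v wP) @\<^sub>v (B_Delta D *\<^sub>v wD + 0\<^sub>v (nL D)))"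
    unfolding four_block_mat_mult_vec[OF asm_carrier(2) zero_carrier_mat zero_carrier_mat zero_carrier_mat w(1,2)]
      four_block_mat_mult_vec[OF asm_carrier(2) asm_carrier(2) B_Delta_carrier zero_carrier_mat w(3,4)] z ..
  also have "\<dots> = div_rows (pG D) wI wD wP @\<^sub>v (B_Delta D *\<^sub>v wD)"
    unfolding div_rows_def by (rule app[OF b bd])
  finally show ?thesis .
qed

section \<open>The stable mixed element and the saddle point matrix\<close>

abbreviation "Wl \<equiv> nodal_funs D UNIV"
abbreviation "const_fams \<equiv> map (\<lambda>f (i :: nat). f) Wl"

lemma Wl_eq: "Wl = map (nodal_fun D) (node_labels (vnodes D))"
  by (simp add: nodal_funs_eq)

lemma vfun_Wl: "f \<in> set Wl \<Longrightarrow> vfun D f"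
  using vfun_shape by (auto simp: Wl_eq nodal_fun_def set_node_labels split: prod.splits)

lemma vfam_const: "f \<in> set const_fams \<Longrightarrow> vfam f"
  using vfun_Wl by (auto simp: vfam_def)

lemma a_mat_global: "a_mat (domn D) Wl Wl = asm_a D const_fams const_fams"
  by (intro eq_matI) (auto simp: a_mat_def asm_a_def a_int_partition vfun_Wl)

lemma b_mat_global: "b_mat (domn D) (pbasis D) Wl = asm_b D (pbasis D) const_fams"
  by (intro eq_matI) (auto simp: b_mat_def asm_b_def b_int_partition vfun_Wl pwc_pbasis)

lemma fam_const: "fam w const_fams = (\<lambda>_. comb w Wl)"
  by (rule ext) (rule fam_map)

lemma global_form_a:
  assumes "w \<in> carrier_vec (length Wl)"
  shows "ip w (a_mat (domn D) Wl Wl *\<^sub>v w) = energy (\<lambda>_. comb w Wl) (\<lambda>_. comb w Wl)"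
proof -
  have "ip w (asm_a D const_fams const_fams *\<^sub>v w) = energy (fam w const_fams) (fam w const_fams)"
    by (rule form_asm_a) (use assms vfam_const in auto)
  then show ?thesis unfolding a_mat_global fam_const .
qed

lemma global_form_b:
  assumes "q \<in> carrier_vec nPB" "w \<in> carrier_vec (length Wl)"
  shows "ip q (b_mat (domn D) (pbasis D) Wl *\<^sub>v w) = bform (\<lambda>_. comb w Wl) (comb q (pbasis D))"
proof -
  have "ip q (asm_b D (pbasis D) const_fams *\<^sub>v w) = bform (fam w const_fams) (comb q (pbasis D))"
    by (rule form_asm_b) (use assms vfam_const pwc_pbasis in auto)
  then show ?thesis unfolding b_mat_global fam_const .
qed

lemma vfam_comb_Wl: "vfam (\<lambda>_. comb w Wl)"
  by (simp add: vfam_def vfun_comb vfun_Wl)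

lemma energy_cong_closure:
  assumes "\<And>i y. i < nsub D \<Longrightarrow> y \<in> closure (subdom D i) \<Longrightarrow> u i y = u' i y"
  shows "energy u u = energy u' u'" "bform u q = bform u' q"
proof -
  have s: "u i y = u' i y" if "i < nsub D" "y \<in> subdom D i" for i y
    using assms that closure_subset by blast
  then show "energy u u = energy u' u'" unfolding energy_def by (intro sum.cong refl a_int_cong open_subdom) auto
  from s show "bform u q = bform u' q" unfolding bform_def by (intro sum.cong refl b_int_cong open_subdom) auto
qed

text \<open>
  Replacing a velocity by a family that agrees with it on all closed subdomains does not change the
  forms.
\<close>

lemma global_embedding:
  obtains wI wD wP where "wI \<in> carrier_vec (nI D)" "wD \<in> carrier_vec (nD D)" "wP \<in> carrier_vec (nP D)"
    "\<And>i y. i < nsub D \<Longrightarrow> y \<in> closure (subdom D i) \<Longrightarrow> vel_family wI wD wP i y = comb w Wl y"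
    "B_Delta D *\<^sub>v wD = 0\<^sub>v (nL D)"
    "energy (vel_family wI wD wP) (vel_family wI wD wP) = energy (\<lambda>_. comb w Wl) (\<lambda>_. comb w Wl)"
    "\<And>q. bform (vel_family wI wD wP) q = bform (\<lambda>_. comb w Wl) q"
proof -
  obtain g where g: "comb w Wl = nodal_sum nodes g"
    unfolding Wl_eq using nodal_list_coefficients[OF distinct_vnodes, of w] by blast
  show thesis
  proof (rule nodal_embedding[where g = g])
    fix wI wD wP
    assume w: "wI \<in> carrier_vec (nI D)" "wD \<in> carrier_vec (nD D)" "wP \<in> carrier_vec (nP D)"
      and eq: "\<And>i y. i < nsub D \<Longrightarrow> y \<in> closure (subdom D i) \<Longrightarrow> vel_family wI wD wP i y = nodal_sum nodes g y"
      and j: "B_Delta D *\<^sub>v wD = 0\<^sub>v (nL D)"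
    have eq': "vel_family wI wD wP i y = (\<lambda>_. comb w Wl) i y" if "i < nsub D" "y \<in> closure (subdom D i)" for i y
      using eq[OF that] by (simp add: g)
    show thesis
      by (rule that[OF w _ j energy_cong_closure(1)[OF eq'] energy_cong_closure(2)[OF eq']]) (rule eq')
  qed
qed

text \<open>
  The energy of a continuous velocity is that of its image in the partially assembled space, where
  definiteness is known.
\<close>

lemma global_a_pos_def: "pos_def (length Wl) (a_mat (domn D) Wl Wl)"
  unfolding pos_def_def symm_def
proof (intro conjI ballI impI)
  show "a_mat (domn D) Wl Wl \<in> carrier_mat (length Wl) (length Wl)" by (simp add: a_mat_def)
  show "transpose_mat (a_mat (domn D) Wl Wl) = a_mat (domn D) Wl Wl" by (simp add: a_mat_global asm_a_transpose)
  fix v :: rvec assume v: "v \<in> carrier_vec (length Wl)" "v \<noteq> 0\<^sub>v (length Wl)"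
  show "0 < ip v (a_mat (domn D) Wl Wl *\<^sub>v v)"
  proof (rule ccontr)
    assume "\<not> ?thesis"
    then have z: "energy (\<lambda>_. comb v Wl) (\<lambda>_. comb v Wl) = 0"
      using energy_nonneg[of "\<lambda>_. comb v Wl"] unfolding global_form_a[OF v(1)] by simp
    obtain wI wD wP where w: "wI \<in> carrier_vec (nI D)" "wD \<in> carrier_vec (nD D)" "wP \<in> carrier_vec (nP D)"
      and f: "\<And>i y. i < nsub D \<Longrightarrow> y \<in> closure (subdom D i) \<Longrightarrow> vel_family wI wD wP i y = comb v Wl y"
      and e: "energy (vel_family wI wD wP) (vel_family wI wD wP) = energy (\<lambda>_. comb v Wl) (\<lambda>_. comb v Wl)"
      using global_embedding by metis
    have "vel_family wI wD wP = (\<lambda>i y. 0)"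
      using energy_zero_imp_zero[OF w] e z vel_family_zero by simp
    then have v0: "comb v Wl y = 0" if "y \<in> domn D" for y
      using domn_covered[OF that] f by metis
    obtain g where g: "comb v Wl = nodal_sum nodes g" "(\<forall>x\<in>nodes. g x = 0) \<longrightarrow> (\<forall>k<length (node_labels (vnodes D)). v $ k = 0)"
      unfolding Wl_eq using nodal_list_coefficients[OF distinct_vnodes, of v] by blast
    have "g x = 0" if x: "x \<in> nodes" for x
      using v0[OF node_domn[OF x]] nodal_sum_node[of nodes x g] x g(1) by simp
    then have "v = 0\<^sub>v (length Wl)" using g(2) v(1) by (intro eq_vecI) (auto simp: Wl_eq)
    with v(2) show False by simp
  qed
qed

lemma pwc_comb_pbasis: "pwc (mesh D) (comb q (pbasis D))"
  by (rule pwc_comb) (rule pwc_pbasis)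

lemma mass_form:
  assumes q: "q \<in> carrier_vec nPB" and r: "r \<in> carrier_vec nPB"
  shows "ip q (mass_mat D *\<^sub>v r) = (LINT y:domn D|lebesgue. comb q (pbasis D) y * comb r (pbasis D) y)"
proof -
  have pb: "pwc (mesh D) (pbasis D ! k)" if "k < nPB" for k using pwc_pbasis that by simp
  have pr: "pwc (mesh D) (comb r (pbasis D))" by (rule pwc_comb_pbasis)
  have "(LINT y:domn D|lebesgue. comb q (pbasis D) y * comb r (pbasis D) y)
    = (LINT y:domn D|lebesgue. \<Sum>k<nPB. q $ k * ((pbasis D ! k) y * comb r (pbasis D) y))"
    by (simp add: comb_pressure[of q] sum_distrib_right mult.assoc)
  also have "\<dots> = (\<Sum>k<nPB. q $ k * (LINT y:domn D|lebesgue. (pbasis D ! k) y * comb r (pbasis D) y))"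
    unfolding domn_region by (rule pwc_integral_sum[OF mesh_tri]) (intro pwc_mult pb pr)
  also have "\<dots> = (\<Sum>k<nPB. q $ k * (\<Sum>l<nPB. r $ l * (LINT y:domn D|lebesgue. (pbasis D ! k) y * (pbasis D ! l) y)))"
  proof (intro sum.cong refl)
    fix k assume "k \<in> {..<nPB}"
    then have k: "k < nPB" by simp
    have "(LINT y:domn D|lebesgue. (pbasis D ! k) y * comb r (pbasis D) y)
      = (LINT y:domn D|lebesgue. \<Sum>l<nPB. r $ l * ((pbasis D ! k) y * (pbasis D ! l) y))"
      by (simp add: comb_pressure[of r] sum_distrib_left mult.left_commute)
    also have "\<dots> = (\<Sum>l<nPB. r $ l * (LINT y:domn D|lebesgue. (pbasis D ! k) y * (pbasis D ! l) y))"
      unfolding domn_region by (rule pwc_integral_sum[OF mesh_tri]) (intro pwc_mult pb k)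
    finally show "q $ k * (LINT y:domn D|lebesgue. (pbasis D ! k) y * comb r (pbasis D) y)
      = q $ k * (\<Sum>l<nPB. r $ l * (LINT y:domn D|lebesgue. (pbasis D ! k) y * (pbasis D ! l) y))" by simp
  qed
  also have "\<dots> = ip q (mass_mat D *\<^sub>v r)"
  proof -
    have "mass_mat D \<in> carrier_mat nPB nPB" by (simp add: mass_mat_def)
    from ip_mult_vec_sum[OF this q r] show ?thesis by (simp add: mass_mat_def sum_distrib_left)
  qed
  finally show ?thesis by simp
qed

lemma mass_pos_def: "0 < c\<^sub>Z \<Longrightarrow> pos_def nPB (mass_mat D)"
  unfolding pos_def_def symm_def
proof (intro conjI ballI impI)
  assume c: "0 < c\<^sub>Z"
  show "mass_mat D \<in> carrier_mat nPB nPB" by (simp add: mass_mat_def)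
  show "transpose_mat (mass_mat D) = mass_mat D" by (intro eq_matI) (auto simp: mass_mat_def mult.commute)
  fix v :: rvec assume v: "v \<in> carrier_vec nPB" "v \<noteq> 0\<^sub>v nPB"
  have "0 < ip v v" using pos_def_one[of nPB] v by (auto simp: pos_def_def)
  then have "0 < c\<^sub>Z * h\<^sup>2 * ip v v" using c h0 by simp
  also have "\<dots> \<le> ip v (mass_mat D *\<^sub>v v)" using pre v by (simp add: pressure_ok_def)
  finally show "0 < ip v (mass_mat D *\<^sub>v v)" .
qed

lemma mass_bounds:
  assumes "v \<in> carrier_vec nPB"
  shows "c\<^sub>Z * h\<^sup>2 * ip v v \<le> ip v (mass_mat D *\<^sub>v v)" "ip v (mass_mat D *\<^sub>v v) \<le> C\<^sub>Z * h\<^sup>2 * ip v v"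
  using pre assms by (auto simp: pressure_ok_def)

text \<open>
  By the partition of unity, the coefficients of the constant pressure \<open>1\<close>.
\<close>

definition ones :: rvec where "ones = Matrix.vec nPB (\<lambda>_. 1)"

lemma ones_carrier: "ones \<in> carrier_vec nPB" by (simp add: ones_def)

lemma comb_ones: "T \<in> mesh D \<Longrightarrow> y \<in> interior T \<Longrightarrow> comb ones (pbasis D) y = 1"
  using pre by (simp add: comb_pressure ones_def pressure_ok_def)

lemma bform_ones:
  assumes u: "vfam u" shows "bform u (comb ones (pbasis D)) = bform u (\<lambda>_. 1)"
  unfolding bform_def
proof (rule sum.cong[OF refl])
  fix i
  have "(LINT y:subdom D i|lebesgue. trace (jac (u i) y) * comb ones (pbasis D) y) = (LINT y:subdom D i|lebesgue. trace (jac (u i) y) * 1)"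
    unfolding subdom_region
  proof (rule pwc_integral_cong[OF sub_mesh_tri])
    have "vfun D (u i)" using u by (simp add: vfam_def)
    then show "pwc (sub_mesh D i) (\<lambda>y. trace (jac (u i) y) * comb ones (pbasis D) y)"
      by (rule pwc_mult[OF pwc_trace_jac[OF vfun_pc1] pwc_subset[OF pwc_comb_pbasis sub_mesh_subset]])
  qed (auto simp: comb_ones sub_mesh_def)
  then show "b_int (subdom D i) (u i) (comb ones (pbasis D)) = b_int (subdom D i) (u i) (\<lambda>_. 1)"
    unfolding b_int_def by simp
qed

text \<open>
  Orthogonality to the constants in the mass matrix means mean value zero, which links the inf-sup
  condition to its matrix form.
\<close>

lemma mass_ones:
  assumes q: "q \<in> carrier_vec nPB"
  shows "ip (mass_mat D *\<^sub>v ones) q = (LINT y:domn D|lebesgue. comb q (pbasis D) y)"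
proof -
  have "ip (mass_mat D *\<^sub>v ones) q = ip q (mass_mat D *\<^sub>v ones)"
    by (rule comm_scalar_prod[OF mult_mat_vec_carrier[OF _ ones_carrier] q]) (simp add: mass_mat_def)
  also have "\<dots> = (LINT y:domn D|lebesgue. comb q (pbasis D) y * comb ones (pbasis D) y)"
    by (rule mass_form[OF q ones_carrier])
  also have "\<dots> = (LINT y:domn D|lebesgue. comb q (pbasis D) y)"
    unfolding domn_region
    by (rule pwc_integral_cong[OF mesh_tri pwc_mult[OF pwc_comb_pbasis pwc_comb_pbasis]]) (simp add: comb_ones)
  finally show ?thesis .
qed

text \<open>
  The Cauchy-Schwarz inequality for the sum over all subdomains, by way of the discriminant.
\<close>

lemma divergence_bound:
  assumes u: "vfam u" and q: "q \<in> carrier_vec nPB"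
  shows "(bform u (comb q (pbasis D)))\<^sup>2 \<le> 2 * energy u u * ip q (mass_mat D *\<^sub>v q)"
proof (rule quadratic_nonneg_imp_discriminant)
  let ?q = "comb q (pbasis D)"
  have pq: "pwc (mesh D) ?q" by (rule pwc_comb_pbasis)
  have m: "ip q (mass_mat D *\<^sub>v q) = (\<Sum>i<nsub D. LINT y:subdom D i|lebesgue. ?q y * ?q y)"
    unfolding mass_form[OF q q] domn_region subdom_region sub_mesh_def
    by (intro pwc_integral_partition[OF mesh_tri] pwc_mult pq part_less)
  fix t :: real
  have "0 \<le> (\<Sum>i<nsub D. 2 * a_int (subdom D i) (u i) (u i) + 2 * t * b_int (subdom D i) (u i) ?q
    + t\<^sup>2 * (LINT y:subdom D i|lebesgue. ?q y * ?q y))"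
  proof (rule sum_nonneg)
    fix i
    show "0 \<le> 2 * a_int (subdom D i) (u i) (u i) + 2 * t * b_int (subdom D i) (u i) ?q + t\<^sup>2 * (LINT y:subdom D i|lebesgue. ?q y * ?q y)"
      unfolding subdom_region using u
      by (intro divergence_quadratic_nonneg[OF sub_mesh_tri] pwc_subset[OF pq sub_mesh_subset] vfun_pc1) (simp add: vfam_def)
  qed
  also have "\<dots> = 2 * energy u u + 2 * t * bform u ?q + t\<^sup>2 * ip q (mass_mat D *\<^sub>v q)"
    unfolding m energy_def bform_def by (simp add: sum.distrib sum_distrib_left)
  finally show "0 \<le> 2 * energy u u + 2 * t * bform u ?q + t\<^sup>2 * ip q (mass_mat D *\<^sub>v q)" .
next
  show "0 \<le> ip q (mass_mat D *\<^sub>v q)"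
    unfolding mass_form[OF q q] set_lebesgue_integral_def by (intro Bochner_Integration.integral_nonneg) simp
qed

text \<open>
  The weak gradient of a constant pressure vanishes, by the divergence theorem and the zero boundary
  values of the velocities.
\<close>

lemma global_b_ones: "transpose_mat (b_mat (domn D) (pbasis D) Wl) *\<^sub>v ones = 0\<^sub>v (length Wl)"
proof (rule vec_eq_by_ip)
  have bc: "b_mat (domn D) (pbasis D) Wl \<in> carrier_mat nPB (length Wl)" by (simp add: b_mat_def)
  show "transpose_mat (b_mat (domn D) (pbasis D) Wl) *\<^sub>v ones \<in> carrier_vec (length Wl)"
    using bc ones_carrier by (intro mult_mat_vec_carrier[of _ _ nPB]) auto
  fix w :: rvec assume w: "w \<in> carrier_vec (length Wl)"
  have "ip w (transpose_mat (b_mat (domn D) (pbasis D) Wl) *\<^sub>v ones) = bform (\<lambda>_. comb w Wl) (\<lambda>_. 1)"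
    using symm_ip_transpose[OF bc w ones_carrier] global_form_b[OF ones_carrier w] bform_ones[OF vfam_comb_Wl] by simp
  also have "\<dots> = 0"
    unfolding bform_def using b_int_partition[OF vfun_comb[OF vfun_Wl] pwc_const] mean_divergence_domain[OF vfun_comb[OF vfun_Wl]] by simp
  finally show "ip w (transpose_mat (b_mat (domn D) (pbasis D) Wl) *\<^sub>v ones) = ip w (0\<^sub>v (length Wl))" using w by simp
qed simp

abbreviation "Ag \<equiv> a_mat (domn D) Wl Wl"
abbreviation "Bg \<equiv> b_mat (domn D) (pbasis D) Wl"
abbreviation "Z \<equiv> mass_mat D"

lemma Bg_carrier: "Bg \<in> carrier_mat nPB (length Wl)" and Z_carrier: "Z \<in> carrier_mat nPB nPB"
  by (simp_all add: b_mat_def mass_mat_def)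

lemma inf_sup_mean_zero:
  assumes "inf_sup_stable \<beta> D" "q \<in> carrier_vec nPB" "ip (Z *\<^sub>v ones) q = 0"
  shows "\<beta>\<^sup>2 * ip q (Z *\<^sub>v q) \<le> (SUP w\<in>carrier_vec (length Wl). (ip q (Bg *\<^sub>v w))\<^sup>2 / ip w (Ag *\<^sub>v w))"
  using assms mass_ones[OF assms(2)] unfolding inf_sup_stable_def Let_def by simp

lemma global_divergence_bound:
  assumes "q \<in> carrier_vec nPB" "w \<in> carrier_vec (length Wl)"
  shows "(ip q (Bg *\<^sub>v w))\<^sup>2 \<le> 2 * ip w (Ag *\<^sub>v w) * ip q (Z *\<^sub>v q)"
  unfolding global_form_a[OF assms(2)] global_form_b[OF assms] by (rule divergence_bound[OF vfam_comb_Wl assms(1)])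

lemma inf_sup_constant_le_2:
  assumes "0 < c\<^sub>Z" "inf_sup_stable \<beta> D" shows "\<beta>\<^sup>2 \<le> 2"
proof (rule inf_sup_constant_le[OF mass_pos_def[OF assms(1)] _ _ global_a_pos_def inf_sup_mean_zero[OF assms(2)]])
  show "2 \<le> nPB" using pre by (simp add: pressure_ok_def)
  show "Z *\<^sub>v ones \<in> carrier_vec nPB" by (rule mult_mat_vec_carrier[OF Z_carrier ones_carrier])
  show "(ip q (Bg *\<^sub>v w))\<^sup>2 \<le> 2 * ip w (Ag *\<^sub>v w) * ip q (Z *\<^sub>v q)"
    if "q \<in> carrier_vec nPB" "w \<in> carrier_vec (length Wl)" for q w using that by (rule global_divergence_bound)
qed simp_all

lemma ones_nonzero: "ones \<noteq> 0\<^sub>v nPB"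
proof
  assume "ones = 0\<^sub>v nPB"
  then have "ones $ 0 = 0\<^sub>v nPB $ 0" by simp
  moreover have "2 \<le> nPB" using pre by (simp add: pressure_ok_def)
  then have "0 < nPB" by linarith
  ultimately show False by (simp add: ones_def)
qed

text \<open>
  Subtract the multiple of \<open>ones\<close> that makes the mean value zero. The inf-sup condition then leaves no
  room for anything else.
\<close>

lemma pressure_kernel:
  assumes cZ: "0 < c\<^sub>Z" and st: "inf_sup_stable \<beta> D" and q: "q \<in> carrier_vec nPB"
    and z: "\<And>w. w \<in> carrier_vec (length Wl) \<Longrightarrow> ip q (Bg *\<^sub>v w) = 0"
  shows "\<exists>\<alpha>. q = \<alpha> \<cdot>\<^sub>v ones"
proof -
  define k where "k = Z *\<^sub>v ones"
  have k: "k \<in> carrier_vec nPB" unfolding k_def by (rule mult_mat_vec_carrier[OF Z_carrier ones_carrier])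
  have pd: "pos_def nPB Z" by (rule mass_pos_def[OF cZ])
  have "0 < ip ones k" using pd ones_carrier ones_nonzero by (auto simp: pos_def_def k_def)
  then have ke: "ip k ones \<noteq> 0" using comm_scalar_prod[OF k ones_carrier] by simp
  define \<alpha> where "\<alpha> = ip k q / ip k ones"
  define q' where "q' = q + (- \<alpha>) \<cdot>\<^sub>v ones"
  have q': "q' \<in> carrier_vec nPB" using q ones_carrier by (simp add: q'_def)
  have "ip k q' = 0" using k q ones_carrier ke by (simp add: q'_def scalar_prod_add_distrib[of _ nPB] \<alpha>_def)
  have z': "ip q' (Bg *\<^sub>v w) = 0" if w: "w \<in> carrier_vec (length Wl)" for w
  proof -
    have Bw: "Bg *\<^sub>v w \<in> carrier_vec nPB" by (rule mult_mat_vec_carrier[OF Bg_carrier w])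
    have "ip ones (Bg *\<^sub>v w) = ip (transpose_mat Bg *\<^sub>v ones) w"
      using transpose_vec_mult_scalar[OF Bg_carrier w ones_carrier] by simp
    also have "\<dots> = 0" using w by (simp add: global_b_ones)
    finally show ?thesis using z[OF w] q ones_carrier Bw by (simp add: q'_def add_scalar_prod_distrib[of _ nPB])
  qed
  have "\<beta>\<^sup>2 * ip q' (Z *\<^sub>v q') \<le> (SUP w\<in>carrier_vec (length Wl). (ip q' (Bg *\<^sub>v w))\<^sup>2 / ip w (Ag *\<^sub>v w))"
    by (rule inf_sup_mean_zero[OF st q']) (use \<open>ip k q' = 0\<close> in \<open>simp add: k_def\<close>)
  also have "\<dots> \<le> 0"
  proof (rule cSUP_least)
    show "carrier_vec (length Wl) \<noteq> ({} :: rvec set)" using zero_carrier_vec by blast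
  qed (simp add: z')
  finally have "ip q' (Z *\<^sub>v q') \<le> 0" using st by (simp add: inf_sup_stable_def mult_le_0_iff)
  then have "q' = 0\<^sub>v nPB" using pd q' unfolding pos_def_def by (meson not_less)
  have "q = \<alpha> \<cdot>\<^sub>v ones"
  proof (rule eq_vecI)
    fix j assume "j < dim_vec (\<alpha> \<cdot>\<^sub>v ones)"
    then have j: "j < nPB" using ones_carrier by simp
    have "q' $ j = 0" using \<open>q' = 0\<^sub>v nPB\<close> j by simp
    then show "q $ j = (\<alpha> \<cdot>\<^sub>v ones) $ j" using j ones_carrier q by (simp add: q'_def ones_def)
  qed (use q ones_carrier in simp)
  then show ?thesis ..
qed

lemma pgam_index:
  assumes "p_gamma_nonempty D" obtains j where "j < length JG"
proof -
  obtain T where "T \<in> mesh D" using mok by (auto simp: mesh_ok_def)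
  then have n: "part D T < nsub D" by (rule part_less)
  have "pgam D \<noteq> {}" "pgam D \<subseteq> {..<nPB}" using assms n unfolding p_gamma_nonempty_def by auto
  then obtain k where "k \<in> set JG" by (auto simp: JG_def)
  then show thesis using that by (metis in_set_conv_nth)
qed

lemma energy_zero_left: "energy (\<lambda>i y. 0) u = 0" and bform_zero: "bform (\<lambda>i y. 0) q = 0"
  by (simp_all add: energy_def bform_def a_int_zero b_int_zero)

lemma comb_zero: "comb (0\<^sub>v (length fs)) fs = (\<lambda>_. 0)"
  by (simp add: comb_def)

lemma bform_comb_zero: "bform u (comb (0\<^sub>v (length fs)) fs) = 0"
  by (simp add: comb_zero bform_def b_int_zero_right)

text \<open>
  Testing a kernel vector with itself shows that its velocity part has no energy, hence is zero. Its
  pressure is then orthogonal to the divergence of all velocities, in particular of the continuous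
  ones, and must be constant. A constant pressure has the same coefficient everywhere, but the
  coefficients in \<open>Q_Gamma\<close> are zero, and there is at least one.
\<close>

lemma A_tilde_trivial_kernel:
  assumes cZ: "0 < c\<^sub>Z" and st: "inf_sup_stable \<beta> D" and pg: "p_gamma_nonempty D"
  shows "trivial_kernel full_dim (A_tilde D)"
  unfolding trivial_kernel_def
proof (intro conjI ballI impI A_tilde_carrier)
  fix w :: rvec assume wc: "w \<in> carrier_vec full_dim" and Aw: "A_tilde D *\<^sub>v w = 0\<^sub>v full_dim"
  obtain wI p wD wP where w: "wI \<in> carrier_vec (nI D)" "p \<in> carrier_vec (nQ D)" "wD \<in> carrier_vec (nD D)" "wP \<in> carrier_vec (nP D)"
    "w = block_vec wI p wD wP" by (rule block_vec_exhaust[OF wc])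
  let ?V = "vel_family wI wD wP"
  have test: "energy (vel_family zI zD zP) ?V + bform (vel_family zI zD zP) (comb p (pI D)) + bform ?V (comb z (pI D)) = 0"
    if "zI \<in> carrier_vec (nI D)" "z \<in> carrier_vec (nQ D)" "zD \<in> carrier_vec (nD D)" "zP \<in> carrier_vec (nP D)" for zI z zD zP
    using A_tilde_form[OF w(1-4) that] Aw block_vec_carrier[OF that] w(5) by simp
  \<comment> \<open>Test with the pressure alone; what is left of the test with the vector itself is the energy.\<close>
  have "bform ?V (comb p (pI D)) = 0"
    using test[of "0\<^sub>v (nI D)" p "0\<^sub>v (nD D)" "0\<^sub>v (nP D)"] w(2) by (simp add: vel_family_zero energy_zero_left bform_zero)
  then have "energy ?V ?V = 0" using test[OF w(1-4)] by simp
  then have w0: "wI = 0\<^sub>v (nI D)" "wD = 0\<^sub>v (nD D)" "wP = 0\<^sub>v (nP D)" using energy_zero_imp_zero[OF w(1,3,4)] by auto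
  have dual: "bform (vel_family zI zD zP) (comb p (pI D)) = 0"
    if "zI \<in> carrier_vec (nI D)" "zD \<in> carrier_vec (nD D)" "zP \<in> carrier_vec (nP D)" for zI zD zP
    using test[of zI "0\<^sub>v (nQ D)" zD zP] that
    by (simp add: w0 vel_family_zero bform_zero energy_sym[of _ "\<lambda>i y. 0"] energy_zero_left)
  obtain q where q: "q \<in> carrier_vec nPB" "sel JI q = p" "sel JG q = 0\<^sub>v (nG D)"
    using sel_join[OF w(2) zero_carrier_vec] by blast
  have cq: "comb q (pbasis D) = comb p (pI D)"
    unfolding sel_comb q(2,3) comb_zero by simp
  have "ip q (Bg *\<^sub>v v) = 0" if v: "v \<in> carrier_vec (length Wl)" for v
  proof -
    obtain vI vD vP where "vI \<in> carrier_vec (nI D)" "vD \<in> carrier_vec (nD D)" "vP \<in> carrier_vec (nP D)"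
      and b: "\<And>q. bform (vel_family vI vD vP) q = bform (\<lambda>_. comb v Wl) q"
      using global_embedding by metis
    then have "bform (\<lambda>_. comb v Wl) (comb p (pI D)) = 0" using dual b by metis
    then show ?thesis unfolding global_form_b[OF q(1) v] cq .
  qed
  then obtain \<alpha> where \<alpha>: "q = \<alpha> \<cdot>\<^sub>v ones" using pressure_kernel[OF cZ st q(1)] by blast
  obtain j where j: "j < length JG" by (rule pgam_index[OF pg])
  then have Jj: "JG ! j < nPB" using nth_mem[OF j] by (auto simp: JG_def)
  have "sel JG q $ j = 0" using j by (simp add: q(3) nG_JG)
  then have "\<alpha> = 0" using j Jj by (simp add: sel_def \<alpha> ones_def)
  then have "p = 0\<^sub>v (nQ D)"
    unfolding q(2)[symmetric] \<alpha> by (intro eq_vecI) (auto simp: sel_def nQ_JI ones_def JI_def dest!: nth_mem)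
  then show "w = 0\<^sub>v full_dim" unfolding w(5) w0 zero_block_vec by simp
qed

section \<open>The divergence free subspace\<close>

text \<open>
  The space on which \<open>jump_stable\<close> compares energies. On it the indefinite form of \<open>A_tilde\<close> reduces to
  the energy of the velocity.
\<close>

definition div_free :: "rvec set" where
  "div_free = {block_vec wI p wD wP | wI p wD wP. wI \<in> carrier_vec (nI D) \<and> p \<in> carrier_vec (nQ D) \<and>
     wD \<in> carrier_vec (nD D) \<and> wP \<in> carrier_vec (nP D) \<and> div_rows (pI D) wI wD wP = 0\<^sub>v (nQ D)}"

lemma div_freeE:
  assumes "v \<in> div_free"
  obtains wI p wD wP where "wI \<in> carrier_vec (nI D)" "p \<in> carrier_vec (nQ D)" "wD \<in> carrier_vec (nD D)" "wP \<in> carrier_vec (nP D)"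
    "div_rows (pI D) wI wD wP = 0\<^sub>v (nQ D)" "v = block_vec wI p wD wP"
  using assms unfolding div_free_def by blast

lemma div_free_carrier: "div_free \<subseteq> carrier_vec full_dim"
  unfolding div_free_def using block_vec_carrier by blast

lemma div_rows_pI_zero:
  assumes w: "wI \<in> carrier_vec (nI D)" "wD \<in> carrier_vec (nD D)" "wP \<in> carrier_vec (nP D)"
    and z: "\<And>q. q \<in> carrier_vec (nQ D) \<Longrightarrow> bform (vel_family wI wD wP) (comb q (pI D)) = 0"
  shows "div_rows (pI D) wI wD wP = 0\<^sub>v (nQ D)"
proof (rule vec_eq_by_ip[OF div_rows_carrier[OF w]])
  fix q :: rvec assume q: "q \<in> carrier_vec (nQ D)"
  have "ip q (div_rows (pI D) wI wD wP) = bform (vel_family wI wD wP) (comb q (pI D))"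
    by (rule ip_div_rows[OF pwc_pI q w])
  then show "ip q (div_rows (pI D) wI wD wP) = ip q (0\<^sub>v (nQ D))" using z[OF q] q by simp
qed simp

lemma div_free_bform:
  assumes w: "wI \<in> carrier_vec (nI D)" "wD \<in> carrier_vec (nD D)" "wP \<in> carrier_vec (nP D)"
    and z: "div_rows (pI D) wI wD wP = 0\<^sub>v (nQ D)" and q: "q \<in> carrier_vec (nQ D)"
  shows "bform (vel_family wI wD wP) (comb q (pI D)) = 0"
  using ip_div_rows[OF pwc_pI q w] z q by simp

lemma div_free_energy:
  assumes w: "wI \<in> carrier_vec (nI D)" "p \<in> carrier_vec (nQ D)" "wD \<in> carrier_vec (nD D)" "wP \<in> carrier_vec (nP D)"
    and z: "div_rows (pI D) wI wD wP = 0\<^sub>v (nQ D)"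
  shows "ip (block_vec wI p wD wP) (A_tilde D *\<^sub>v block_vec wI p wD wP) = energy (vel_family wI wD wP) (vel_family wI wD wP)"
  using A_tilde_form[OF w w] div_free_bform[OF w(1,3,4) z w(2)] by simp

lemma div_free_add_scaled:
  assumes "u \<in> div_free" "v \<in> div_free" shows "u + t \<cdot>\<^sub>v v \<in> div_free"
proof -
  obtain uI p uD uP where u: "uI \<in> carrier_vec (nI D)" "p \<in> carrier_vec (nQ D)" "uD \<in> carrier_vec (nD D)" "uP \<in> carrier_vec (nP D)"
    "div_rows (pI D) uI uD uP = 0\<^sub>v (nQ D)" "u = block_vec uI p uD uP" by (rule div_freeE[OF assms(1)])
  obtain vI q vD vP where v: "vI \<in> carrier_vec (nI D)" "q \<in> carrier_vec (nQ D)" "vD \<in> carrier_vec (nD D)" "vP \<in> carrier_vec (nP D)"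
    "div_rows (pI D) vI vD vP = 0\<^sub>v (nQ D)" "v = block_vec vI q vD vP" by (rule div_freeE[OF assms(2)])
  have c: "uI + t \<cdot>\<^sub>v vI \<in> carrier_vec (nI D)" "p + t \<cdot>\<^sub>v q \<in> carrier_vec (nQ D)" "uD + t \<cdot>\<^sub>v vD \<in> carrier_vec (nD D)" "uP + t \<cdot>\<^sub>v vP \<in> carrier_vec (nP D)"
    using u v by auto
  have "div_rows (pI D) (uI + t \<cdot>\<^sub>v vI) (uD + t \<cdot>\<^sub>v vD) (uP + t \<cdot>\<^sub>v vP) = 0\<^sub>v (nQ D)"
  proof (rule div_rows_pI_zero[OF c(1,3,4)])
    fix r :: rvec assume r: "r \<in> carrier_vec (nQ D)"
    have "pwc (mesh D) (comb r (pI D))" by (rule pwc_comb[OF pwc_pI])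
    then show "bform (vel_family (uI + t \<cdot>\<^sub>v vI) (uD + t \<cdot>\<^sub>v vD) (uP + t \<cdot>\<^sub>v vP)) (comb r (pI D)) = 0"
      unfolding vel_family_add_scaled[OF u(1,3,4) v(1,3,4)]
      using div_free_bform[OF u(1,3,4,5) r] div_free_bform[OF v(1,3,4,5) r]
      by (simp add: bform_add_scaled vfam_vel_family)
  qed
  then show ?thesis unfolding u(6) v(6) block_vec_add_scaled[OF u(1-4) v(1-4)] div_free_def using c by blast
qed

lemma B_Delta_zero: "B_Delta D *\<^sub>v 0\<^sub>v (nD D) = 0\<^sub>v (nL D)"
  using B_Delta_carrier[of D] by (intro eq_vecI) (auto simp: scalar_prod_def)

text \<open>
  The rows of the constraint matrix do not involve the pressures in \<open>Q_I\<close>, so the right-hand side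
  vanishes in the \<open>Q_I\<close> components of the equation, which state that the velocity is divergence free.
\<close>

lemma solution_div_free:
  assumes w: "w \<in> carrier_vec full_dim" and x: "x \<in> carrier_vec (nG D + nL D)"
    and eq: "A_tilde D *\<^sub>v w = transpose_mat (B_C D) *\<^sub>v x"
  shows "w \<in> div_free"
proof -
  obtain wI p wD wP where v: "wI \<in> carrier_vec (nI D)" "p \<in> carrier_vec (nQ D)" "wD \<in> carrier_vec (nD D)" "wP \<in> carrier_vec (nP D)"
    "w = block_vec wI p wD wP" by (rule block_vec_exhaust[OF w])
  have "div_rows (pI D) wI wD wP = 0\<^sub>v (nQ D)"
  proof (rule div_rows_pI_zero[OF v(1,3,4)])
    fix q :: rvec assume q: "q \<in> carrier_vec (nQ D)"
    \<comment> \<open>A test vector that consists of a pressure in \<open>Q_I\<close> only.\<close>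
    define t where "t = block_vec (0\<^sub>v (nI D)) q (0\<^sub>v (nD D)) (0\<^sub>v (nP D))"
    have t: "t \<in> carrier_vec full_dim" unfolding t_def by (intro block_vec_carrier q zero_carrier_vec)
    have "B_C D *\<^sub>v t = 0\<^sub>v (nG D + nL D)"
    proof -
      have "div_rows (pG D) (0\<^sub>v (nI D)) (0\<^sub>v (nD D)) (0\<^sub>v (nP D)) = 0\<^sub>v (nG D)"
        unfolding div_rows_def by (intro eq_vecI) (simp_all add: asm_b_def scalar_prod_def)
      then show ?thesis unfolding t_def B_C_mult[OF zero_carrier_vec q zero_carrier_vec zero_carrier_vec] B_Delta_zero
        by (intro eq_vecI) auto
    qed
    then have "ip t (A_tilde D *\<^sub>v w) = 0"
      unfolding eq symm_ip_transpose[OF B_C_carrier t x] using x by simp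
    then show "bform (vel_family wI wD wP) (comb q (pI D)) = 0"
      using A_tilde_form[OF v(1-4) zero_carrier_vec q zero_carrier_vec zero_carrier_vec]
      unfolding t_def v(5) by (simp add: vel_family_zero energy_zero_left bform_zero)
  qed
  then show ?thesis unfolding v(5) div_free_def using v(1-4) by blast
qed

section \<open>The Dirichlet preconditioner\<close>

abbreviation "BD \<equiv> B_Delta_D D"

lemma BD_transpose_carrier: "l \<in> carrier_vec (nL D) \<Longrightarrow> transpose_mat BD *\<^sub>v l \<in> carrier_vec (nD D)"
  using B_Delta_D_carrier[of D] by (intro mult_mat_vec_carrier[of _ _ "nL D"]) auto

lemma Dirichlet_block_mult:
  assumes l: "l \<in> carrier_vec (nL D)"
  shows "(BD * H_Delta D * transpose_mat BD) *\<^sub>v l = BD *\<^sub>v (H_Delta D *\<^sub>v (transpose_mat BD *\<^sub>v l))"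
proof -
  have c: "BD * H_Delta D \<in> carrier_mat (nL D) (nD D)" by (rule mult_carrier_mat[OF B_Delta_D_carrier H_Delta_carrier])
  have t: "transpose_mat BD \<in> carrier_mat (nD D) (nL D)" using B_Delta_D_carrier[of D] by simp
  show ?thesis unfolding assoc_mult_mat_vec[OF c t l]
    by (rule assoc_mult_mat_vec[OF B_Delta_D_carrier H_Delta_carrier BD_transpose_carrier[OF l]])
qed

lemma Dirichlet_block_form:
  assumes l: "l \<in> carrier_vec (nL D)" and l': "l' \<in> carrier_vec (nL D)"
  shows "ip l' ((BD * H_Delta D * transpose_mat BD) *\<^sub>v l) = ip (transpose_mat BD *\<^sub>v l') (H_Delta D *\<^sub>v (transpose_mat BD *\<^sub>v l))"
proof -
  have "H_Delta D *\<^sub>v (transpose_mat BD *\<^sub>v l) \<in> carrier_vec (nD D)"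
    by (rule mult_mat_vec_carrier[OF H_Delta_carrier BD_transpose_carrier[OF l]])
  then show ?thesis unfolding Dirichlet_block_mult[OF l]
    using transpose_vec_mult_scalar[OF B_Delta_D_carrier _ l'] by simp
qed

lemma Dirichlet_block_carrier: "BD * H_Delta D * transpose_mat BD \<in> carrier_mat (nL D) (nL D)"
  using B_Delta_D_carrier[of D] H_Delta_carrier by (intro mult_carrier_mat[of _ _ "nD D"]) auto

lemma M_D_inv_carrier: "M_D_inv h D \<in> carrier_mat (nG D + nL D) (nG D + nL D)"
  unfolding M_D_inv_def by (intro four_block_carrier_mat Dirichlet_block_carrier) simp

text \<open>
  By \<open>harmonic_energy\<close> the last term is the energy of the discrete harmonic extension of the scaled
  dual velocity, which is what links the preconditioner to the jump operator.
\<close>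

lemma M_D_inv_form:
  assumes p: "p \<in> carrier_vec (nG D)" "p' \<in> carrier_vec (nG D)" and l: "l \<in> carrier_vec (nL D)" "l' \<in> carrier_vec (nL D)"
  shows "ip (p' @\<^sub>v l') (M_D_inv h D *\<^sub>v (p @\<^sub>v l))
    = 1 / h\<^sup>2 * ip p' p + ip (transpose_mat BD *\<^sub>v l') (H_Delta D *\<^sub>v (transpose_mat BD *\<^sub>v l))"
proof -
  have s: "(1 / h\<^sup>2) \<cdot>\<^sub>m 1\<^sub>m (nG D) \<in> carrier_mat (nG D) (nG D)" by simp
  have z: "0\<^sub>m (nG D) (nL D) *\<^sub>v l = 0\<^sub>v (nG D)" "0\<^sub>m (nL D) (nG D) *\<^sub>v p = 0\<^sub>v (nL D)" using p l by (auto intro!: eq_vecI)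
  have i: "((1 / h\<^sup>2) \<cdot>\<^sub>m 1\<^sub>m (nG D)) *\<^sub>v p = (1 / h\<^sup>2) \<cdot>\<^sub>v p"
    using p by (intro eq_vecI) auto
  show ?thesis
    unfolding M_D_inv_def four_block_form[OF s zero_carrier_mat zero_carrier_mat Dirichlet_block_carrier p(1) l(1) p(2) l(2)]
      z i Dirichlet_block_form[OF l]
    using p l by simp
qed

lemma H_Delta_form_nonneg: "v \<in> carrier_vec (nD D) \<Longrightarrow> 0 \<le> ip v (H_Delta D *\<^sub>v v)"
  using harmonic_energy energy_nonneg by metis

lemma harm_ext_mult_carrier: "v \<in> carrier_vec (nD D) \<Longrightarrow> - (harm_ext *\<^sub>v v) \<in> carrier_vec (nI D)"
  using mult_mat_vec_carrier[OF harm_ext_carrier] by simp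

text \<open>
  The pressure block is a multiple of the identity. If the form of the other block vanishes, the scaled
  dual velocity has a discrete harmonic extension without energy and is zero; as \<open>B_Delta\<close> recovers the
  multiplier from it, the multiplier is zero.
\<close>

lemma M_D_inv_pos_def: "pos_def (nG D + nL D) (M_D_inv h D)"
  unfolding pos_def_def
proof (intro conjI ballI impI)
  show "symm (nG D + nL D) (M_D_inv h D)"
    unfolding symm_def
  proof (intro conjI M_D_inv_carrier)
    have s: "(1 / h\<^sup>2) \<cdot>\<^sub>m 1\<^sub>m (nG D) \<in> carrier_mat (nG D) (nG D)" by simp
    have t: "transpose_mat BD \<in> carrier_mat (nD D) (nL D)" using B_Delta_D_carrier[of D] by simp
    have BH: "BD * H_Delta D \<in> carrier_mat (nL D) (nD D)" by (rule mult_carrier_mat[OF B_Delta_D_carrier H_Delta_carrier])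
    have "transpose_mat (BD * H_Delta D * transpose_mat BD) = BD * (transpose_mat (H_Delta D) * transpose_mat BD)"
      unfolding transpose_mult[OF BH t] transpose_mult[OF B_Delta_D_carrier H_Delta_carrier] by simp
    also have "\<dots> = BD * H_Delta D * transpose_mat BD"
      using H_Delta_symm assoc_mult_mat[OF B_Delta_D_carrier H_Delta_carrier t] by (simp add: symm_def)
    finally have "transpose_mat (BD * H_Delta D * transpose_mat BD) = BD * H_Delta D * transpose_mat BD" .
    moreover have "transpose_mat ((1 / h\<^sup>2) \<cdot>\<^sub>m 1\<^sub>m (nG D)) = (1 / h\<^sup>2) \<cdot>\<^sub>m 1\<^sub>m (nG D)" by (intro eq_matI) auto
    ultimately show "transpose_mat (M_D_inv h D) = M_D_inv h D"
      unfolding M_D_inv_def transpose_four_block_mat[OF s zero_carrier_mat zero_carrier_mat Dirichlet_block_carrier] by simp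
  qed
  fix x :: rvec assume x: "x \<in> carrier_vec (nG D + nL D)" "x \<noteq> 0\<^sub>v (nG D + nL D)"
  obtain p l where pl: "p \<in> carrier_vec (nG D)" "l \<in> carrier_vec (nL D)" "x = p @\<^sub>v l" by (rule split_vec[OF x(1)])
  define v where "v = transpose_mat BD *\<^sub>v l"
  have v: "v \<in> carrier_vec (nD D)" using BD_transpose_carrier[OF pl(2)] by (simp add: v_def)
  have form: "ip x (M_D_inv h D *\<^sub>v x) = 1 / h\<^sup>2 * ip p p + ip v (H_Delta D *\<^sub>v v)"
    unfolding pl(3) v_def by (rule M_D_inv_form[OF pl(1,1,2,2)])
  have nn: "0 \<le> 1 / h\<^sup>2 * ip p p" "0 \<le> ip v (H_Delta D *\<^sub>v v)" using ip_nonneg H_Delta_form_nonneg[OF v] by auto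
  show "0 < ip x (M_D_inv h D *\<^sub>v x)"
  proof (rule ccontr)
    assume "\<not> ?thesis"
    then have z: "1 / h\<^sup>2 * ip p p = 0" "ip v (H_Delta D *\<^sub>v v) = 0" using form nn by linarith+
    have "p = 0\<^sub>v (nG D)"
      using z(1) h0 pos_def_ker[OF pos_def_one pl(1)] pos_def_one[of "nG D"] pl(1) unfolding pos_def_def by force
    moreover have "energy (vel_family (- (harm_ext *\<^sub>v v)) v (0\<^sub>v (nP D))) (vel_family (- (harm_ext *\<^sub>v v)) v (0\<^sub>v (nP D))) = 0"
      using harmonic_energy[OF v] z(2) by simp
    then have "v = 0\<^sub>v (nD D)" using energy_zero_imp_zero[OF harm_ext_mult_carrier[OF v] v zero_carrier_vec] by blast
    then have "l = 0\<^sub>v (nL D)"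
      using B_Delta_right_inverse[OF pl(2)] B_Delta_zero unfolding v_def by simp
    ultimately show False using x(2) pl(3) by (auto intro!: eq_vecI)
  qed
qed

section \<open>The two spectral bounds\<close>

lemma ip_div_rows_pbasis:
  assumes "q \<in> carrier_vec nPB" "wI \<in> carrier_vec (nI D)" "wD \<in> carrier_vec (nD D)" "wP \<in> carrier_vec (nP D)"
  shows "ip q (div_rows (pbasis D) wI wD wP) = bform (vel_family wI wD wP) (comb q (pbasis D))"
  by (rule ip_div_rows[OF _ assms]) (rule pwc_pbasis)

text \<open>
  The inf-sup condition provides a continuous velocity with prescribed divergence, and continuous
  velocities have no jump: the pressure constraints can be changed without changing the others.
\<close>

lemma continuous_correction:
  assumes cZ: "0 < c\<^sub>Z" and st: "inf_sup_stable \<beta> D"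
    and r: "r \<in> carrier_vec nPB" "ip ones r = 0"
    and R: "0 \<le> R" "\<And>q. q \<in> carrier_vec nPB \<Longrightarrow> (ip q r)\<^sup>2 \<le> R * ip q (Z *\<^sub>v q)"
  obtains wI wD wP where "wI \<in> carrier_vec (nI D)" "wD \<in> carrier_vec (nD D)" "wP \<in> carrier_vec (nP D)"
    "div_rows (pbasis D) wI wD wP = r" "B_Delta D *\<^sub>v wD = 0\<^sub>v (nL D)"
    "\<beta>\<^sup>2 * energy (vel_family wI wD wP) (vel_family wI wD wP) \<le> R"
proof -
  have "0 < \<beta>" using st by (simp add: inf_sup_stable_def)
  have "\<exists>w\<in>carrier_vec (length Wl). Bg *\<^sub>v w = r \<and> \<beta>\<^sup>2 * ip w (Ag *\<^sub>v w) \<le> R"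
    by (rule inf_sup_right_inverse[OF global_a_pos_def Bg_carrier mass_pos_def[OF cZ] ones_carrier ones_nonzero global_b_ones
          \<open>0 < \<beta>\<close> inf_sup_mean_zero[OF st] r R])
  then obtain w where w: "w \<in> carrier_vec (length Wl)" "Bg *\<^sub>v w = r" "\<beta>\<^sup>2 * ip w (Ag *\<^sub>v w) \<le> R" by blast
  show thesis
  proof (rule global_embedding[where w = w])
    fix wI wD wP
    assume v: "wI \<in> carrier_vec (nI D)" "wD \<in> carrier_vec (nD D)" "wP \<in> carrier_vec (nP D)"
      and j: "B_Delta D *\<^sub>v wD = 0\<^sub>v (nL D)"
      and e: "energy (vel_family wI wD wP) (vel_family wI wD wP) = energy (\<lambda>_. comb w Wl) (\<lambda>_. comb w Wl)"
      and b: "\<And>q. bform (vel_family wI wD wP) q = bform (\<lambda>_. comb w Wl) q"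
    have "div_rows (pbasis D) wI wD wP = r"
    proof (rule vec_eq_by_ip[OF div_rows_carrier[OF v] r(1)])
      fix q :: rvec assume q: "q \<in> carrier_vec nPB"
      have "ip q (div_rows (pbasis D) wI wD wP) = bform (vel_family wI wD wP) (comb q (pbasis D))"
        by (rule ip_div_rows_pbasis[OF q v])
      also have "\<dots> = ip q (Bg *\<^sub>v w)" unfolding b global_form_b[OF q w(1)] ..
      finally show "ip q (div_rows (pbasis D) wI wD wP) = ip q r" unfolding w(2) .
    qed
    then show thesis using that[OF v _ j] w(3) unfolding e global_form_a[OF w(1)] by blast
  qed
qed

text \<open>
  The pressure part of \<open>B_C v\<close> is bounded by the divergence bound, where the mass matrix turns the
  factor \<open>1 / h\<^sup>2\<close> into \<open>C\<^sub>Z\<close>; the jump part of the preconditioner is the energy of the image of \<open>v\<close> under \<open>P_D2\<close>,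
  which is bounded by the stability of the jump operator.
\<close>

lemma constraint_bound:
  assumes CZ: "0 \<le> C\<^sub>Z" and js: "jump_stable \<phi> D" and v: "v \<in> div_free"
  shows "ip (B_C D *\<^sub>v v) (M_D_inv h D *\<^sub>v (B_C D *\<^sub>v v)) \<le> (2 * C\<^sub>Z + \<phi>) * ip v (A_tilde D *\<^sub>v v)"
proof -
  obtain wI p wD wP where w: "wI \<in> carrier_vec (nI D)" "p \<in> carrier_vec (nQ D)" "wD \<in> carrier_vec (nD D)" "wP \<in> carrier_vec (nP D)"
    "div_rows (pI D) wI wD wP = 0\<^sub>v (nQ D)" "v = block_vec wI p wD wP" by (rule div_freeE[OF v])
  let ?V = "vel_family wI wD wP"
  define E where "E = energy ?V ?V"
  have E0: "0 \<le> E" by (simp add: E_def energy_nonneg)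
  have Ev: "ip v (A_tilde D *\<^sub>v v) = E" unfolding w(6) E_def by (rule div_free_energy[OF w(1-5)])
  define gp where "gp = div_rows (pG D) wI wD wP"
  define gl where "gl = B_Delta D *\<^sub>v wD"
  have gp: "gp \<in> carrier_vec (nG D)" unfolding gp_def by (rule div_rows_carrier[OF w(1,3,4)])
  have gl: "gl \<in> carrier_vec (nL D)" unfolding gl_def by (rule mult_mat_vec_carrier[OF B_Delta_carrier w(3)])
  have Bv: "B_C D *\<^sub>v v = gp @\<^sub>v gl" unfolding w(6) gp_def gl_def by (rule B_C_mult[OF w(1-4)])
  \<comment> \<open>Test the divergence with the pressure whose coefficients are the values to be bounded.\<close>
  obtain q where q: "q \<in> carrier_vec nPB" "sel JI q = 0\<^sub>v (nQ D)" "sel JG q = gp"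
    using sel_join[OF zero_carrier_vec gp] by blast
  have qq: "ip q q = ip gp gp" unfolding sel_ip[OF q(1,1)] q(2,3) by simp
  have "ip q (div_rows (pbasis D) wI wD wP) = ip gp gp"
    unfolding sel_ip[OF q(1) div_rows_carrier[OF w(1,3,4)]] sel_div_rows[OF w(1,3,4)] q(2,3) w(5) gp_def by simp
  then have "(ip gp gp)\<^sup>2 = (bform ?V (comb q (pbasis D)))\<^sup>2"
    using ip_div_rows_pbasis[OF q(1) w(1,3,4)] by simp
  also have "\<dots> \<le> 2 * E * ip q (Z *\<^sub>v q)" unfolding E_def by (rule divergence_bound[OF vfam_vel_family q(1)])
  also have "\<dots> \<le> 2 * E * (C\<^sub>Z * h\<^sup>2 * ip gp gp)"
    using mass_bounds(2)[OF q(1)] E0 unfolding qq by (intro mult_left_mono) auto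
  finally have "(ip gp gp)\<^sup>2 \<le> (2 * C\<^sub>Z * h\<^sup>2) * ip gp gp * E" by (simp add: algebra_simps)
  then have "ip gp gp \<le> 2 * C\<^sub>Z * h\<^sup>2 * E"
    by (rule square_le_mult_imp) (use CZ E0 ip_nonneg in auto)
  then have g1: "1 / h\<^sup>2 * ip gp gp \<le> 2 * C\<^sub>Z * E" using h0 by (simp add: field_simps)
  define d where "d = transpose_mat BD *\<^sub>v gl"
  have d: "d \<in> carrier_vec (nD D)" unfolding d_def by (rule BD_transpose_carrier[OF gl])
  define P where "P = P_D2 D wD"
  have P: "P = block_vec (- (harm_ext *\<^sub>v d)) (0\<^sub>v (nQ D)) d (0\<^sub>v (nP D))"
    by (simp add: P_def P_D2_def Let_def d_def gl_def harm_ext_def)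
  have Pc: "P \<in> carrier_vec full_dim" unfolding P by (intro block_vec_carrier harm_ext_mult_carrier d zero_carrier_vec)
  have vc: "v \<in> carrier_vec full_dim" using v div_free_carrier by blast
  have "ip P (A_tilde D *\<^sub>v P) = energy (vel_family (- (harm_ext *\<^sub>v d)) d (0\<^sub>v (nP D))) (vel_family (- (harm_ext *\<^sub>v d)) d (0\<^sub>v (nP D)))"
    unfolding P A_tilde_form[OF harm_ext_mult_carrier[OF d] zero_carrier_vec d zero_carrier_vec harm_ext_mult_carrier[OF d] zero_carrier_vec d zero_carrier_vec]
    by (simp add: bform_comb_zero)
  then have "ip d (H_Delta D *\<^sub>v d) = ip P (A_tilde D *\<^sub>v P)" using harmonic_energy[OF d] by simp
  also have "\<dots> = ip (A_tilde D *\<^sub>v P) P"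
    by (rule comm_scalar_prod[OF Pc mult_mat_vec_carrier[OF A_tilde_carrier Pc]])
  also have "\<dots> \<le> \<phi> * ip (A_tilde D *\<^sub>v v) v"
    using js w unfolding jump_stable_def P_def div_rows_def by blast
  also have "ip (A_tilde D *\<^sub>v v) v = E"
    using comm_scalar_prod[OF vc mult_mat_vec_carrier[OF A_tilde_carrier vc]] Ev by simp
  finally have g2: "ip d (H_Delta D *\<^sub>v d) \<le> \<phi> * E" .
  show ?thesis unfolding Bv M_D_inv_form[OF gp gp gl gl] Ev d_def[symmetric] using g1 g2 by (simp add: algebra_simps)
qed

text \<open>
  The given constraints are attained with an energy controlled by them, independently of the energy
  of \<open>v\<close>. The jump is produced by the scaled dual velocity and its discrete harmonic extension, whose
  energy \<open>E1\<close> is the jump part of the preconditioner. This disturbs the pressure constraints, and the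
  difference is corrected by a continuous velocity. The correction requires a difference of mean value
  zero, and this is the point of the divergence free boundary condition.
\<close>

lemma constraint_lifting:
  assumes cZ: "0 < c\<^sub>Z" and st: "inf_sup_stable \<beta> D" and fl: "dual_zero_flux D" and v: "v \<in> div_free"
  shows "\<exists>w\<in>div_free. B_C D *\<^sub>v w = B_C D *\<^sub>v v \<and>
    1 / (12 + 4 / c\<^sub>Z) * \<beta>\<^sup>2 * ip w (A_tilde D *\<^sub>v w) \<le> ip (B_C D *\<^sub>v v) (M_D_inv h D *\<^sub>v (B_C D *\<^sub>v v))"
proof -
  obtain wI p wD wP where w: "wI \<in> carrier_vec (nI D)" "p \<in> carrier_vec (nQ D)" "wD \<in> carrier_vec (nD D)" "wP \<in> carrier_vec (nP D)"
    "div_rows (pI D) wI wD wP = 0\<^sub>v (nQ D)" "v = block_vec wI p wD wP" by (rule div_freeE[OF v])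
  define gp where "gp = div_rows (pG D) wI wD wP"
  define gl where "gl = B_Delta D *\<^sub>v wD"
  have gp: "gp \<in> carrier_vec (nG D)" unfolding gp_def by (rule div_rows_carrier[OF w(1,3,4)])
  have gl: "gl \<in> carrier_vec (nL D)" unfolding gl_def by (rule mult_mat_vec_carrier[OF B_Delta_carrier w(3)])
  have Bv: "B_C D *\<^sub>v v = gp @\<^sub>v gl" unfolding w(6) gp_def gl_def by (rule B_C_mult[OF w(1-4)])
  have mean: "ip ones (div_rows (pbasis D) uI uD uP) = 0"
    if u: "uI \<in> carrier_vec (nI D)" "uD \<in> carrier_vec (nD D)" "uP \<in> carrier_vec (nP D)" for uI uD uP
  proof -
    have "ip ones (div_rows (pbasis D) uI uD uP) = bform (vel_family uI uD uP) (comb ones (pbasis D))"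
      by (rule ip_div_rows_pbasis[OF ones_carrier u])
    also have "\<dots> = bform (vel_family uI uD uP) (\<lambda>_. 1)" by (rule bform_ones[OF vfam_vel_family])
    also have "\<dots> = 0" unfolding bform_def by (rule mean_divergence_family[OF fl u])
    finally show ?thesis .
  qed
  \<comment> \<open>The jump is realised by the scaled dual velocity with its discrete harmonic extension.\<close>
  define d where "d = transpose_mat BD *\<^sub>v gl"
  have d: "d \<in> carrier_vec (nD D)" unfolding d_def by (rule BD_transpose_carrier[OF gl])
  define a where "a = - (harm_ext *\<^sub>v d)"
  have a: "a \<in> carrier_vec (nI D)" unfolding a_def by (rule harm_ext_mult_carrier[OF d])
  let ?zP = "0\<^sub>v (nP D) :: rvec"
  let ?V1 = "vel_family a d ?zP"
  define E1 where "E1 = energy ?V1 ?V1"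
  have "E1 = ip d (H_Delta D *\<^sub>v d)" unfolding E1_def a_def by (rule harmonic_energy[OF d])
  moreover have "0 \<le> E1" unfolding E1_def by (rule energy_nonneg)
  ultimately have E1: "E1 = ip d (H_Delta D *\<^sub>v d)" "0 \<le> E1" by auto
  define b1 where "b1 = div_rows (pbasis D) a d ?zP"
  have b1: "b1 \<in> carrier_vec nPB" unfolding b1_def by (rule div_rows_carrier[OF a d zero_carrier_vec])
  \<comment> \<open>What is left of the pressure constraints is corrected by a continuous velocity.\<close>
  define b where "b = div_rows (pbasis D) wI wD wP"
  have b: "b \<in> carrier_vec nPB" unfolding b_def by (rule div_rows_carrier[OF w(1,3,4)])
  have bsel: "sel JI b = 0\<^sub>v (nQ D)" "sel JG b = gp"
    unfolding b_def sel_div_rows[OF w(1,3,4)] w(5) gp_def by simp_all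
  define r where "r = b - b1"
  have r: "r \<in> carrier_vec nPB" unfolding r_def using b b1 by simp
  have ipr: "ip q r = ip q b - ip q b1" if "q \<in> carrier_vec nPB" for q
    unfolding r_def by (rule scalar_prod_minus_distrib[OF that b b1])
  have r1: "ip ones r = 0"
    unfolding ipr[OF ones_carrier] b_def b1_def using mean[OF w(1,3,4)] mean[OF a d zero_carrier_vec] by simp
  define G where "G = ip gp gp"
  have G0: "0 \<le> G" by (simp add: G_def ip_nonneg)
  \<comment> \<open>The defect is a difference: \<open>(x - y)\<^sup>2 \<le> 2 x\<^sup>2 + 2 y\<^sup>2\<close>, with the lower bound for the mass matrix for the
    first term and the divergence bound, with its constant \<open>2\<close>, for the second one.\<close>
  define R where "R = 2 / (c\<^sub>Z * h\<^sup>2) * G + 4 * E1"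
  have cz: "0 < c\<^sub>Z * h\<^sup>2" using cZ h0 by simp
  have R0: "0 \<le> R" unfolding R_def using G0 E1 cz by simp
  have Rq: "(ip q r)\<^sup>2 \<le> R * ip q (Z *\<^sub>v q)" if q: "q \<in> carrier_vec nPB" for q
  proof -
    define m where "m = ip q (Z *\<^sub>v q)"
    have m0: "0 \<le> m" using pos_def_nonneg[OF mass_pos_def[OF cZ] q] by (simp add: m_def)
    have "ip q b = ip (sel JG q) gp" unfolding sel_ip[OF q b] bsel using sel_carrier by simp
    then have "(ip q b)\<^sup>2 \<le> ip (sel JG q) (sel JG q) * G"
      unfolding G_def using Cauchy_Schwarz_ip[OF sel_carrier(2) gp] by simp
    also have "\<dots> \<le> ip q q * G"
      unfolding sel_ip[OF q q] using G0 ip_nonneg by (intro mult_right_mono) auto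
    also have "\<dots> \<le> m / (c\<^sub>Z * h\<^sup>2) * G"
      using mass_bounds(1)[OF q] cz G0 by (intro mult_right_mono) (auto simp: m_def field_simps)
    finally have 1: "(ip q b)\<^sup>2 \<le> m / (c\<^sub>Z * h\<^sup>2) * G" .
    have 2: "(ip q b1)\<^sup>2 \<le> 2 * E1 * m"
      unfolding b1_def E1_def m_def ip_div_rows_pbasis[OF q a d zero_carrier_vec] by (rule divergence_bound[OF vfam_vel_family q])
    have "(ip q r)\<^sup>2 \<le> 2 * (ip q b)\<^sup>2 + 2 * (ip q b1)\<^sup>2"
      unfolding ipr[OF q] using sum_squares_ge_zero[of "ip q b + ip q b1" 0] by (simp add: power2_eq_square algebra_simps)
    also have "\<dots> \<le> 2 * (m / (c\<^sub>Z * h\<^sup>2) * G) + 2 * (2 * E1 * m)" using 1 2 by linarith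
    also have "\<dots> = R * m" by (simp add: R_def algebra_simps)
    finally show ?thesis unfolding m_def .
  qed
  obtain uI uD uP where u: "uI \<in> carrier_vec (nI D)" "uD \<in> carrier_vec (nD D)" "uP \<in> carrier_vec (nP D)"
    "div_rows (pbasis D) uI uD uP = r" "B_Delta D *\<^sub>v uD = 0\<^sub>v (nL D)"
    "\<beta>\<^sup>2 * energy (vel_family uI uD uP) (vel_family uI uD uP) \<le> R"
    by (rule continuous_correction[OF cZ st r r1 R0 Rq])
  let ?V2 = "vel_family uI uD uP"
  define E2 where "E2 = energy ?V2 ?V2"
  have one: "x + 1 \<cdot>\<^sub>v y = x + y" for x y :: rvec by (intro eq_vecI) auto
  define xI xD xP where "xI = a + uI" and "xD = d + uD" and "xP = ?zP + uP"
  have x: "xI \<in> carrier_vec (nI D)" "xD \<in> carrier_vec (nD D)" "xP \<in> carrier_vec (nP D)"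
    using a d u by (auto simp: xI_def xD_def xP_def)
  have V: "vel_family xI xD xP = (\<lambda>i y. ?V1 i y + ?V2 i y)"
    using vel_family_add_scaled[OF a d zero_carrier_vec u(1-3), of 1] by (simp add: one xI_def xD_def xP_def)
  have rows: "div_rows (pbasis D) xI xD xP = b"
  proof (rule vec_eq_by_ip[OF div_rows_carrier[OF x] b])
    fix q :: rvec assume q: "q \<in> carrier_vec nPB"
    have "ip q (div_rows (pbasis D) xI xD xP) = bform (vel_family xI xD xP) (comb q (pbasis D))"
      by (rule ip_div_rows_pbasis[OF q x])
    also have "\<dots> = bform ?V1 (comb q (pbasis D)) + bform ?V2 (comb q (pbasis D))"
      unfolding V by (rule bform_add[OF vfam_vel_family vfam_vel_family pwc_comb_pbasis])
    also have "\<dots> = ip q b1 + ip q r"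
      using ip_div_rows_pbasis[OF q a d zero_carrier_vec] ip_div_rows_pbasis[OF q u(1-3)] by (simp add: b1_def u(4))
    also have "\<dots> = ip q b" unfolding ipr[OF q] by simp
    finally show "ip q (div_rows (pbasis D) xI xD xP) = ip q b" .
  qed
  define x4 where "x4 = block_vec xI (0\<^sub>v (nQ D)) xD xP"
  have xI0: "div_rows (pI D) xI xD xP = 0\<^sub>v (nQ D)" using sel_div_rows(1)[OF x] bsel(1) unfolding rows by simp
  have xG: "div_rows (pG D) xI xD xP = gp" using sel_div_rows(2)[OF x] bsel(2) unfolding rows by simp
  have "x4 \<in> div_free" unfolding x4_def div_free_def using x xI0 zero_carrier_vec[of "nQ D"] by blast
  moreover have "B_Delta D *\<^sub>v xD = B_Delta D *\<^sub>v d + B_Delta D *\<^sub>v uD"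
    unfolding xD_def by (rule mult_add_distrib_mat_vec[OF B_Delta_carrier d u(2)])
  then have "B_Delta D *\<^sub>v xD = gl"
    using B_Delta_right_inverse[OF gl, folded d_def] u(5) gl by simp
  then have "B_C D *\<^sub>v x4 = B_C D *\<^sub>v v"
    unfolding Bv x4_def B_C_mult[OF x(1) zero_carrier_vec x(2,3)] xG by simp
  moreover have "1 / (12 + 4 / c\<^sub>Z) * \<beta>\<^sup>2 * ip x4 (A_tilde D *\<^sub>v x4) \<le> ip (B_C D *\<^sub>v v) (M_D_inv h D *\<^sub>v (B_C D *\<^sub>v v))"
  proof -
    define E where "E = energy (vel_family xI xD xP) (vel_family xI xD xP)"
    have EA: "ip x4 (A_tilde D *\<^sub>v x4) = E"
      unfolding x4_def E_def by (rule div_free_energy[OF x(1) zero_carrier_vec x(2,3) xI0])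
    have N: "ip (B_C D *\<^sub>v v) (M_D_inv h D *\<^sub>v (B_C D *\<^sub>v v)) = 1 / h\<^sup>2 * G + E1"
      unfolding Bv M_D_inv_form[OF gp gp gl gl] d_def[symmetric] E1(1) G_def ..
    have add: "energy (\<lambda>i y. ?V1 i y + t *\<^sub>R ?V2 i y) (\<lambda>i y. ?V1 i y + t *\<^sub>R ?V2 i y) = E1 + 2 * t * energy ?V1 ?V2 + t\<^sup>2 * E2" for t
    proof -
      have vv: "vfam (\<lambda>i y. ?V1 i y + t *\<^sub>R ?V2 i y)"
        using vfam_vel_family by (simp add: vfam_def vfun_add vfun_scale)
      have "energy w (\<lambda>i y. ?V1 i y + t *\<^sub>R ?V2 i y) = energy w ?V1 + t * energy w ?V2" if "vfam w" for w
        using energy_add_scaled[OF vfam_vel_family vfam_vel_family that] by (simp add: energy_sym)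
      then show ?thesis
        unfolding energy_add_scaled[OF vfam_vel_family vfam_vel_family vv] E1_def E2_def
        using vfam_vel_family energy_sym[of ?V2 ?V1] by (simp add: power2_eq_square algebra_simps)
    qed
    \<comment> \<open>The energy of the sum of two velocities is at most twice the sum of their energies, since that of
      the difference is nonnegative.\<close>
    have "0 \<le> E1 - 2 * energy ?V1 ?V2 + E2" using add[of "-1"] energy_nonneg[of "\<lambda>i y. ?V1 i y + (-1) *\<^sub>R ?V2 i y"] by simp
    then have E12: "E \<le> 2 * E1 + 2 * E2" using add[of 1] unfolding E_def V by simp
    have "\<beta>\<^sup>2 * E \<le> \<beta>\<^sup>2 * (2 * E1) + 2 * (\<beta>\<^sup>2 * E2)" using mult_left_mono[OF E12, of "\<beta>\<^sup>2"] by (simp add: algebra_simps)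
    \<comment> \<open>The energy \<open>E1\<close> comes without a factor \<open>1 / \<beta>\<^sup>2\<close>; here \<open>\<beta>\<^sup>2 \<le> 2\<close> is used.\<close>
    also have "\<dots> \<le> 2 * (2 * E1) + 2 * R"
      using u(6) mult_right_mono[OF inf_sup_constant_le_2[OF cZ st], of "2 * E1"] E1(2) unfolding E2_def by linarith
    also have "\<dots> = 12 * E1 + 4 / c\<^sub>Z * (1 / h\<^sup>2 * G)" by (simp add: R_def)
    also have "\<dots> \<le> (12 + 4 / c\<^sub>Z) * E1 + (12 + 4 / c\<^sub>Z) * (1 / h\<^sup>2 * G)"
      using E1(2) G0 cZ by (intro add_mono mult_right_mono) auto
    finally have "\<beta>\<^sup>2 * E \<le> (12 + 4 / c\<^sub>Z) * (1 / h\<^sup>2 * G + E1)" by (simp add: algebra_simps)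
    moreover have "0 < 12 + 4 / c\<^sub>Z" using cZ by (simp add: add_pos_pos)
    ultimately have "\<beta>\<^sup>2 * E / (12 + 4 / c\<^sub>Z) \<le> 1 / h\<^sup>2 * G + E1" by (simp add: pos_divide_le_eq mult.commute)
    then show ?thesis unfolding EA N by simp
  qed
  ultimately show ?thesis by blast
qed

lemma fetidp_bounds:
  assumes cZ: "0 < c\<^sub>Z" and CZ: "0 \<le> C\<^sub>Z" and st: "inf_sup_stable \<beta> D" and pg: "p_gamma_nonempty D"
    and fl: "dual_zero_flux D" and js: "jump_stable \<phi> D" and \<phi>: "0 \<le> \<phi>" and K: "2 * C\<^sub>Z + \<phi> \<le> K"
    and x: "x \<in> mat_range (M_D_inv h D * G_op D)"
  shows "1 / (12 + 4 / c\<^sub>Z) * \<beta>\<^sup>2 * ip (M_D h D *\<^sub>v x) x \<le> ip (G_op D *\<^sub>v x) x"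
    and "ip (G_op D *\<^sub>v x) x \<le> K * ip (M_D h D *\<^sub>v x) x"
proof -
  have c: "0 \<le> 1 / (12 + 4 / c\<^sub>Z) * \<beta>\<^sup>2" and K0: "0 \<le> K" using cZ CZ \<phi> K by simp_all
  have psd: "0 \<le> ip v (A_tilde D *\<^sub>v v)" if "v \<in> div_free" for v
    using that div_free_energy energy_nonneg by (metis div_freeE)
  have upper: "ip (B_C D *\<^sub>v v) (M_D_inv h D *\<^sub>v (B_C D *\<^sub>v v)) \<le> K * ip v (A_tilde D *\<^sub>v v)" if "v \<in> div_free" for v
    using constraint_bound[OF CZ js that] mult_right_mono[OF K psd[OF that]] by linarith
  note bounds = dual_operator_bounds[OF A_tilde_symm A_tilde_trivial_kernel[OF cZ st pg] B_C_carrier M_D_inv_pos_def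
      div_free_carrier div_free_add_scaled psd solution_div_free K0 c upper constraint_lifting[OF cZ st fl]
      x[unfolded G_op_def]]
  show "1 / (12 + 4 / c\<^sub>Z) * \<beta>\<^sup>2 * ip (M_D h D *\<^sub>v x) x \<le> ip (G_op D *\<^sub>v x) x"
    unfolding M_D_def G_op_def by (rule bounds(1))
  show "ip (G_op D *\<^sub>v x) x \<le> K * ip (M_D h D *\<^sub>v x) x"
    unfolding M_D_def G_op_def by (rule bounds(2))
qed

end

theorem theorem2:
  fixes \<sigma> c\<^sub>Z C\<^sub>Z C\<^sub>\<Phi> :: real and \<Phi>\<^sub>2 :: "real \<Rightarrow> real"
  assumes "0 < \<sigma>" and "0 < c\<^sub>Z" and "0 < C\<^sub>Z" and "0 < C\<^sub>\<Phi>"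
    and "\<And>r. \<Phi>\<^sub>2 r = C\<^sub>\<Phi> * (1 + ln r)\<^sup>2"
  shows "\<exists>c>0. \<exists>C>0. \<forall>(D :: dd) (h :: real) (H :: real) (\<beta> :: real).
    fetidp_setting \<sigma> c\<^sub>Z C\<^sub>Z h H D \<longrightarrow>
    inf_sup_stable \<beta> D \<longrightarrow>
    p_gamma_nonempty D \<longrightarrow>
    dual_zero_flux D \<longrightarrow>
    jump_stable (\<Phi>\<^sub>2 (H / h)) D \<longrightarrow>
    (\<forall>x \<in> mat_range (M_D_inv h D * G_op D).
       c * \<beta>\<^sup>2 * scalar_prod (M_D h D *\<^sub>v x) x \<le> scalar_prod (G_op D *\<^sub>v x) x \<and>
       scalar_prod (G_op D *\<^sub>v x) x \<le> C * \<Phi>\<^sub>2 (H / h) * scalar_prod (M_D h D *\<^sub>v x) x)"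
proof (rule exI[of _ "1 / (12 + 4 / c\<^sub>Z)"], rule conjI, goal_cases)
  case 1
  show ?case using assms(2) by (simp add: add_pos_pos)
next
  case 2
  \<comment> \<open>As \<open>h \<le> H\<close>, the logarithm is nonnegative and \<open>C\<^sub>\<Phi>\<close> is a lower bound for \<open>\<Phi>\<^sub>2\<close>. So the pressure part
    \<open>2 C\<^sub>Z\<close> of the upper bound is absorbed into a multiple of \<open>\<Phi>\<^sub>2\<close>.\<close>
  define C where "C = 2 * C\<^sub>Z / C\<^sub>\<Phi> + 1"
  have C0: "0 < C" using assms(3,4) by (simp add: C_def add_pos_pos)
  have main: "1 / (12 + 4 / c\<^sub>Z) * \<beta>\<^sup>2 * ip (M_D h D *\<^sub>v x) x \<le> ip (G_op D *\<^sub>v x) x \<and>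
      ip (G_op D *\<^sub>v x) x \<le> C * \<Phi>\<^sub>2 (H / h) * ip (M_D h D *\<^sub>v x) x"
    if s: "fetidp_setting \<sigma> c\<^sub>Z C\<^sub>Z h H D" and a: "inf_sup_stable \<beta> D" "p_gamma_nonempty D" "dual_zero_flux D"
      "jump_stable (\<Phi>\<^sub>2 (H / h)) D" and x: "x \<in> mat_range (M_D_inv h D * G_op D)" for D h H \<beta> x
  proof -
    interpret decomposed_mesh D \<sigma> c\<^sub>Z C\<^sub>Z h H by (unfold_locales) (rule s)
    have "0 \<le> ln (H / h)" using h0 hH by simp
    then have "1 \<le> (1 + ln (H / h))\<^sup>2" by (simp add: power2_eq_square algebra_simps)
    then have \<Phi>: "C\<^sub>\<Phi> \<le> \<Phi>\<^sub>2 (H / h)" using assms(4) unfolding assms(5) by simp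
    have \<Phi>0: "0 \<le> \<Phi>\<^sub>2 (H / h)" using \<Phi> assms(4) by linarith
    have "2 * C\<^sub>Z = 2 * C\<^sub>Z / C\<^sub>\<Phi> * C\<^sub>\<Phi>" using assms(4) by simp
    also have "\<dots> \<le> 2 * C\<^sub>Z / C\<^sub>\<Phi> * \<Phi>\<^sub>2 (H / h)" using \<Phi> assms(3,4) by (intro mult_left_mono) auto
    finally have le: "2 * C\<^sub>Z + \<Phi>\<^sub>2 (H / h) \<le> C * \<Phi>\<^sub>2 (H / h)" by (simp add: C_def distrib_right)
    show ?thesis using fetidp_bounds[OF assms(2) less_imp_le[OF assms(3)] a \<Phi>0 le x] by blast
  qed
  show ?case by (rule exI[of _ C]) (use C0 main in blast)
qed

end
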